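(* Assume that $\Lambda:\Omega\to M_d(\mathbf{R})$ is bounded, measurable, symmetric and uniformly elliptic, that $f\in L^2(\Omega)$ and that the solution to $-\mathrm{div}(\Lambda\nabla p)=f$ in $\Omega$, $p=0$ on $\partial\Omega$, belongs to $H^1_0(\Omega)$ (weak solution). Let $\theta>0$ be given. Consider a family of polygonal (polytopal) meshes of $\Omega$ such that any cell $K$ is star-shaped with respect to a point $x_K$, and such that every mesh of the family satisfies $$\max\left(\max_{\sigma\in\mathcal E_{\rm int},\ K,L\in\mathcal M_\sigma}\frac{d_{K,\sigma}}{d_{L,\sigma}},\ \max_{K\in\mathcal M,\ \sigma\in\mathcal E_K}\frac{\mathrm{diam}(K)}{d_{K,\sigma}}\right)\le\theta .$$ For each mesh of the family let an HMMF scheme be chosen, with Mimetic matrices $\mathbb M_K$, Hybrid matrices $\mathbb B^H_K$ and Mixed matrices $\mathbb B^M_K$. Then the following three conditions are equivalent: (1) there exist $s_*>0$ and $S_*>0$, independent of the mesh, such that for every cell $K$ and every $V=(V_\sigma)_{\sigma\in\mathcal E_K}$, $$s_*\sum_{\sigma\in\mathcal E_K}|\sigma|d_{K,\sigma}V_\sigma^2\le V^T\mathbb M_KV\le S_*\sum_{\sigma\in\mathcal E_K}|\sigma|d_{K,\sigma}V_\sigma^2;$$ (2) there exist $\bar s_*>0$ and $\bar S_*>0$, independent of the mesh, such that for every cell $K$ and every $V=(V_\sigma)_{\sigma\in\mathcal E_K}$, $$\bar s_*\sum_{\sigma\in\mathcal E_K}\frac{|\sigma|}{d_{K,\sigma}}(L_K(V))_\sigma^2\le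 L_K(V)^T\mathbb B^H_KL_K(V)\le\bar S_*\sum_{\sigma\in\mathcal E_K}\frac{|\sigma|}{d_{K,\sigma}}(L_K(V))_\sigma^2;$$ (3) there exist $\tilde s_*>0$ and $\tilde S_*>0$, independent of the mesh, such that for every cell $K$ and every $V=(V_\sigma)_{\sigma\in\mathcal E_K}$, $$\tilde s_*\sum_{\sigma\in\mathcal E_K}|\sigma|d_{K,\sigma}(T_{K,\sigma}(V))^2\le T_K(V)^T\mathbb B^M_KT_K(V)\le\tilde S_*\sum_{\sigma\in\mathcal E_K}|\sigma|d_{K,\sigma}(T_{K,\sigma}(V))^2.$$ Moreover, if one of the conditions (1), (2) or (3) holds, then the family of corresponding approximate solutions $p$ converges in $L^2(\Omega)$ to the unique solution of $-\mathrm{div}(\Lambda\nabla p)=f$ in $\Omega$, $p=0$ on $\partial\Omega$, as the mesh size tends to $0$.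
   Context: **Setting.** $\Omega\subset\mathbf{R}^d$ ($d\ge1$) is a bounded (polytopal) open set. Uniform ellipticity: there is $\zeta>0$ with $\Lambda(x)\xi\cdot\xi\ge\zeta|\xi|^2$ for a.e. $x$ and all $\xi\in\mathbf{R}^d$. **Mesh.** $\mathcal M$ is a finite partition (up to a null set) of $\Omega$ into open polytopal cells $K$. $\mathcal E_K$ is the set of faces of $K$, each face $\sigma$ being a non-empty relatively open subset of a hyperplane contained in $\partial K$, the faces being disjoint with closures covering $\partial K$. Each face is either contained in $\partial\Omega$ or interior, i.e. common to exactly two cells; $\mathcal E$ is the set of all faces, $\mathcal E_{\rm int}$ the set of interior faces, and $\mathcal M_\sigma$ the set of cells of which $\sigma$ is a face. $|K|,|\sigma|$ are the $d$- and $(d-1)$-dimensional measures; $\mathbf n_{K,\sigma}$ is the unit normal to $\sigma$ outward to $K$; $\bar x_\sigma$ is the center of gravity of $\sigma$; $k_K$ is the number of faces of $K$; $\Lambda_K$ is the mean value of $\Lambda$ on $K$; $x_K\in K$ is the chosen point; $d_{K,\sigma}>0$ is the distance from $x_K$ to the hyperplane containing $\sigma$. The mesh size is $\max_K\mathrm{diam}(K)$. "Independent of the mesh" means: the same constants for all meshes of the family. **Local operators.** For $V=(V_\sigma)_{\sigma\in\mathcal E_K}\in\mathbf{R}^{k_K}$: - $D_KV=\frac1{|K|}\sum_{\sigma\in\mathcal E_K}V_\sigma\mathbf n_{K,\sigma}$ and $(L_K(V))_\sigma=\frac1{|\sigma|}V_\sigma-D_KV\cdot(\bar x_\sigma-x_K)$;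 - $\mathbf v_K(V)\in\mathbf{R}^d$ is given by $|K|\Lambda_K\mathbf v_K(V)=-\sum_{\sigma\in\mathcal E_K}|\sigma|V_\sigma(\bar x_\sigma-x_K)$, $T_{K,\sigma}(V)=V_\sigma+\Lambda_K\mathbf v_K(V)\cdot\mathbf n_{K,\sigma}$, and $T_K(V)=(T_{K,\sigma}(V))_{\sigma\in\mathcal E_K}$. $\mathbb R_K$ is the $k_K\times d$ matrix with rows $|\sigma|(\bar x_\sigma-x_K)^T$, and $\mathbb N_K$ the $k_K\times d$ matrix with rows $(\Lambda_K\mathbf n_{K,\sigma})^T$, $\sigma\in\mathcal E_K$. **HMMF (Hybrid Mimetic Mixed Family) scheme.** It is one scheme which can be written in three equivalent forms (Generalized Mimetic, Generalized Hybrid, Modified Mixed), with the same points $x_K$. In each cell $K$ its parameters are $\mathbb M_K$, $\mathbb B^H_K$, $\mathbb B^M_K$, symmetric positive definite $k_K\times k_K$ matrices such that, for all $V,V'\in\mathbf{R}^{k_K}$, $$V'^T\mathbb M_KV=\frac1{|K|}V'^T\mathbb R_K\Lambda_K^{-1}\mathbb R_K^TV+V'^T\mathbb C_K\mathbb U_K\mathbb C_K^TV,\qquad V'^T\mathbb C_K\mathbb U_K\mathbb C_K^TV=T_K(V')^T\mathbb B^M_KT_K(V),$$ $$V'^T\mathbb M_K^{-1}V=\frac1{|K|}V'^T\mathbb N_K\Lambda_K^{-1}\mathbb N_K^TV+L_K(V')^T\mathbb B^H_KL_K(V),$$ where $\mathbb C_K$ is a $k_K\times(k_K-d)$ matrix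 with $\mathrm{Im}(\mathbb C_K)=(\mathrm{Im}(\mathbb N_K))^\perp$ and $\mathbb U_K$ is a symmetric positive definite $(k_K-d)\times(k_K-d)$ matrix. The approximate solution of the scheme is obtained as follows: find reals $(p_K)_{K\in\mathcal M}$, $(p_\sigma)_{\sigma\in\mathcal E}$ with $p_\sigma=0$ if $\sigma\subset\partial\Omega$, and $(F_{K,\sigma})_{K\in\mathcal M,\sigma\in\mathcal E_K}$ with $F_{K,\sigma}+F_{L,\sigma}=0$ for each interior face $\sigma$ common to $K,L$, such that for all $K\in\mathcal M$: $\sum_{\sigma\in\mathcal E_K}|\sigma|F_{K,\sigma}=\int_Kf$, and for all $G_K=(G_{K,\sigma})_{\sigma\in\mathcal E_K}\in\mathbf{R}^{k_K}$, $G_K^T\mathbb M_KF_K=\sum_{\sigma\in\mathcal E_K}(p_K-p_\sigma)|\sigma|G_{K,\sigma}$, where $F_K=(F_{K,\sigma})_{\sigma\in\mathcal E_K}$. The approximate solution $p$ is identified with the piecewise constant function equal to $p_K$ on $K$. (Equivalently, in the Hybrid form, the relation between $\widetilde p$ and $F$ is $\sum_{\sigma}|\sigma|F_{K,\sigma}(q_K-q_\sigma)=|K|\Lambda_K\nabla_K\widetilde p_K\cdot\nabla_K\widetilde q_K+S_K(\widetilde q_K)^T\mathbb B_K^HS_K(\widetilde p_K)$ for all $\widetilde q_K=(q_K,(q_\sigma)_{\sigma\in\mathcal E_K})$, with $\nabla_K\widetilde p_K=\frac1{|K|}\sum_{\sigma}|\sigma|(p_\sigma-p_K)\mathbf n_{K,\sigma}$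 and $S_{K,\sigma}(\widetilde p_K)=p_\sigma-p_K-\nabla_K\widetilde p_K\cdot(\bar x_\sigma-x_K)$; in the Mixed form it is $|K|\mathbf v_K(F_K)\cdot\Lambda_K\mathbf v_K(G_K)+T_K(G_K)^T\mathbb B^M_KT_K(F_K)=\sum_{\sigma}(p_K-p_\sigma)|\sigma|G_{K,\sigma}$ for all $G_K$.) *)

theory Defs
  imports "HOL-Analysis.Analysis"
begin

section \<open>The Sobolev space of functions vanishing on the boundary, and weak solutions\<close>

definition L2_on :: "(real^'d) set \<Rightarrow> (real^'d \<Rightarrow> 'b::euclidean_space) \<Rightarrow> bool" where
  "L2_on \<Omega> u \<longleftrightarrow> u \<in> borel_measurable (lebesgue_on \<Omega>) \<and>
     integrable (lebesgue_on \<Omega>) (\<lambda>x. (norm (u x))\<^sup>2)"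

definition partial_deriv :: "'d::finite \<Rightarrow> (real^'d \<Rightarrow> real) \<Rightarrow> real^'d \<Rightarrow> real" where
  "partial_deriv i \<phi> x = frechet_derivative \<phi> (at x) (axis i 1)"

definition grad :: "(real^'d \<Rightarrow> real) \<Rightarrow> real^'d \<Rightarrow> real^'d" where
  "grad \<phi> x = (\<chi> i. partial_deriv i \<phi> x)"

primrec C_k :: "nat \<Rightarrow> (real^'d \<Rightarrow> real) \<Rightarrow> bool" where
  "C_k 0 \<phi> \<longleftrightarrow> continuous_on UNIV \<phi>"
| "C_k (Suc k) \<phi> \<longleftrightarrow> \<phi> differentiable_on UNIV \<and> (\<forall>i. C_k k (partial_deriv i \<phi>))"

definition test_function :: "(real^'d) set \<Rightarrow> (real^'d \<Rightarrow> real) \<Rightarrow> bool" where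
  "test_function \<Omega> \<phi> \<longleftrightarrow> (\<forall>k. C_k k \<phi>) \<and>
     compact (closure {x. \<phi> x \<noteq> 0}) \<and> closure {x. \<phi> x \<noteq> 0} \<subseteq> \<Omega>"

definition weak_gradient ::
    "(real^'d) set \<Rightarrow> (real^'d \<Rightarrow> real) \<Rightarrow> (real^'d \<Rightarrow> real^'d) \<Rightarrow> bool" where
  "weak_gradient \<Omega> u g \<longleftrightarrow> (\<forall>\<phi> i. test_function \<Omega> \<phi> \<longrightarrow>
     integral\<^sup>L (lebesgue_on \<Omega>) (\<lambda>x. u x * partial_deriv i \<phi> x) =
     - integral\<^sup>L (lebesgue_on \<Omega>) (\<lambda>x. g x $ i * \<phi> x))"

definition H1 :: "(real^'d) set \<Rightarrow> (real^'d \<Rightarrow> real) \<Rightarrow> (real^'d \<Rightarrow> real^'d) \<Rightarrow> bool" where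
  "H1 \<Omega> u g \<longleftrightarrow> L2_on \<Omega> u \<and> L2_on \<Omega> g \<and> weak_gradient \<Omega> u g"

text \<open>\<open>H1_0 \<Omega> u g\<close>: \<open>u\<close> lies in the closure of the test functions in \<open>H1\<close>, and \<open>g\<close> is its
  weak gradient.\<close>

definition H1_0 :: "(real^'d) set \<Rightarrow> (real^'d \<Rightarrow> real) \<Rightarrow> (real^'d \<Rightarrow> real^'d) \<Rightarrow> bool" where
  "H1_0 \<Omega> u g \<longleftrightarrow> H1 \<Omega> u g \<and>
     (\<exists>\<phi> :: nat \<Rightarrow> real^'d \<Rightarrow> real. (\<forall>n. test_function \<Omega> (\<phi> n)) \<and>
        (\<lambda>n. integral\<^sup>L (lebesgue_on \<Omega>)
               (\<lambda>x. (\<phi> n x - u x)\<^sup>2 + (norm (grad (\<phi> n) x - g x))\<^sup>2)) \<longlonglongrightarrow> 0)"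

text \<open>Weak solutions of \<open>- div (\<Lambda> \<nabla>p) = f\<close> in \<open>\<Omega>\<close>, \<open>p = 0\<close> on the boundary.\<close>

definition weak_solution ::
    "(real^'d) set \<Rightarrow> (real^'d \<Rightarrow> real^'d^'d) \<Rightarrow> (real^'d \<Rightarrow> real) \<Rightarrow> (real^'d \<Rightarrow> real) \<Rightarrow> bool" where
  "weak_solution \<Omega> \<Lambda> f p \<longleftrightarrow> (\<exists>g. H1_0 \<Omega> p g \<and>
     (\<forall>v h. H1_0 \<Omega> v h \<longrightarrow>
        integral\<^sup>L (lebesgue_on \<Omega>) (\<lambda>x. (\<Lambda> x *v g x) \<bullet> h x) =
        integral\<^sup>L (lebesgue_on \<Omega>) (\<lambda>x. f x * v x)))"

section \<open>Polytopal meshes\<close>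

text \<open>Polytopal open sets need be neither convex nor connected.\<close>

definition polytopal_open :: "(real^'d) set \<Rightarrow> bool" where
  "polytopal_open U \<longleftrightarrow>
     (\<exists>P. finite P \<and> (\<forall>S\<in>P. polytope S) \<and> U = interior (\<Union>P))"

text \<open>The \<open>(d-1)\<close>-dimensional Lebesgue measure on a hyperplane \<open>H\<close>: by Fubini, a Borel set
  \<open>A \<subseteq> H\<close> has the same measure as the part of the slab of thickness \<open>1\<close> around \<open>H\<close> which
  projects orthogonally onto \<open>A\<close>. For \<open>d = 1\<close>, \<open>H\<close> is a point, and has measure \<open>1\<close>.\<close>

definition surface_measure :: "(real^'d) set \<Rightarrow> (real^'d) measure" where
  "surface_measure H =
     distr (restrict_space lborel {x. infdist x H \<le> 1/2}) borel (closest_point H)"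

text \<open>A face is a non-empty relatively open subset of a hyperplane, so that this hyperplane is
  its affine hull.\<close>

definition area :: "(real^'d) set \<Rightarrow> real" where
  "area \<sigma> = measure (surface_measure (affine hull \<sigma>)) \<sigma>"

definition barycentre :: "(real^'d) set \<Rightarrow> real^'d" where
  "barycentre \<sigma> = (1 / area \<sigma>) *\<^sub>R (LINT x:\<sigma>|surface_measure (affine hull \<sigma>). x)"

definition vol :: "(real^'d) set \<Rightarrow> real" where
  "vol K = measure lebesgue K"

definition outward_normal :: "(real^'d) set \<Rightarrow> (real^'d) set \<Rightarrow> real^'d" where
  "outward_normal K \<sigma> = (THE n. norm n = 1 \<and> (\<exists>b. \<sigma> \<subseteq> {x. n \<bullet> x = b}) \<and>
     (\<forall>x\<in>\<sigma>. \<forall>\<^sub>F t in at_right 0. x - t *\<^sub>R n \<in> K \<and> x + t *\<^sub>R n \<notin> K))"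

text \<open>A mesh consists of its cells \<open>K\<close>, the set of faces of each cell, and the points \<open>x\<^sub>K\<close>.
  The values of \<open>faces\<close> and \<open>point\<close> outside \<open>cells\<close> are irrelevant.\<close>

record 'a mesh =
  cells :: "'a set set"
  faces :: "'a set \<Rightarrow> 'a set set"
  point :: "'a set \<Rightarrow> 'a"

definition all_faces :: "'a mesh \<Rightarrow> 'a set set" where
  "all_faces m = (\<Union>K\<in>cells m. faces m K)"

definition cells_at :: "'a mesh \<Rightarrow> 'a set \<Rightarrow> 'a set set" where
  "cells_at m \<sigma> = {K \<in> cells m. \<sigma> \<in> faces m K}"

definition interior_faces :: "'a mesh \<Rightarrow> 'a set set" where
  "interior_faces m = {\<sigma> \<in> all_faces m. card (cells_at m \<sigma>) = 2}"

definition dist_face :: "(real^'d) mesh \<Rightarrow> (real^'d) set \<Rightarrow> (real^'d) set \<Rightarrow> real" where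
  "dist_face m K \<sigma> = infdist (point m K) (affine hull \<sigma>)"

text \<open>The last condition says that the relative boundary of a face has measure zero in its
  hyperplane. It is automatic for polytopal faces, but not for arbitrary relatively open sets,
  for which the closures of the faces could cover the boundary of \<open>K\<close> while the faces themselves
  miss a part of it of positive \<open>(d-1)\<close>-dimensional measure.\<close>

definition cell_face :: "(real^'d) set \<Rightarrow> (real^'d) set \<Rightarrow> bool" where
  "cell_face K \<sigma> \<longleftrightarrow> \<sigma> \<noteq> {} \<and>
     (\<exists>a b. a \<noteq> 0 \<and> openin (top_of_set {x. a \<bullet> x = b}) \<sigma>) \<and>
     \<sigma> \<subseteq> frontier K \<and>
     closure \<sigma> - \<sigma> \<in> null_sets (surface_measure (affine hull \<sigma>))"

definition polytopal_mesh :: "(real^'d) set \<Rightarrow> (real^'d) mesh \<Rightarrow> bool" where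
  "polytopal_mesh \<Omega> m \<longleftrightarrow>
     finite (cells m) \<and> disjoint (cells m) \<and>
     \<Union>(cells m) \<subseteq> \<Omega> \<and> negligible (\<Omega> - \<Union>(cells m)) \<and>
     (\<forall>K\<in>cells m. polytopal_open K \<and> point m K \<in> K \<and>
        finite (faces m K) \<and> disjoint (faces m K) \<and>
        frontier K = (\<Union>\<sigma>\<in>faces m K. closure \<sigma>) \<and>
        (\<forall>\<sigma>\<in>faces m K. cell_face K \<sigma> \<and> dist_face m K \<sigma> > 0)) \<and>
     (\<forall>\<sigma>\<in>all_faces m. \<not> \<sigma> \<subseteq> frontier \<Omega> \<longleftrightarrow> \<sigma> \<in> interior_faces m)"

definition star_shaped :: "(real^'d) set \<Rightarrow> real^'d \<Rightarrow> bool" where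
  "star_shaped K x \<longleftrightarrow> x \<in> K \<and> (\<forall>y\<in>K. closed_segment x y \<subseteq> K)"

text \<open>The bound on the maximum is stated elementwise, as there may be no interior face.\<close>

definition regular_mesh :: "real \<Rightarrow> (real^'d) mesh \<Rightarrow> bool" where
  "regular_mesh \<theta> m \<longleftrightarrow>
     (\<forall>\<sigma>\<in>interior_faces m. \<forall>K\<in>cells_at m \<sigma>. \<forall>L\<in>cells_at m \<sigma>.
        dist_face m K \<sigma> / dist_face m L \<sigma> \<le> \<theta>) \<and>
     (\<forall>K\<in>cells m. \<forall>\<sigma>\<in>faces m K. diameter K / dist_face m K \<sigma> \<le> \<theta>)"

definition mesh_size :: "(real^'d) mesh \<Rightarrow> real" where
  "mesh_size m = Max (diameter ` cells m)"

section \<open>Matrices indexed by finite sets\<close>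

text \<open>Vectors of \<open>\<real>\<^bsup>k\<^esup>\<close> for \<open>k = card (faces m K)\<close> are functions on the faces, and matrices are
  functions of two indices; their values outside the index set \<open>I\<close> are irrelevant.
  \<open>bilin I A V' V\<close> is \<open>V'\<^sup>T A V\<close>.\<close>

definition bilin :: "'i set \<Rightarrow> ('i \<Rightarrow> 'i \<Rightarrow> real) \<Rightarrow> ('i \<Rightarrow> real) \<Rightarrow> ('i \<Rightarrow> real) \<Rightarrow> real" where
  "bilin I A V' V = (\<Sum>i\<in>I. \<Sum>j\<in>I. V' i * A i j * V j)"

definition sym_pos_def :: "'i set \<Rightarrow> ('i \<Rightarrow> 'i \<Rightarrow> real) \<Rightarrow> bool" where
  "sym_pos_def I A \<longleftrightarrow> (\<forall>i\<in>I. \<forall>j\<in>I. A i j = A j i) \<and>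
     (\<forall>V. (\<exists>i\<in>I. V i \<noteq> 0) \<longrightarrow> bilin I A V V > 0)"

definition inverse_matrices :: "'i set \<Rightarrow> ('i \<Rightarrow> 'i \<Rightarrow> real) \<Rightarrow> ('i \<Rightarrow> 'i \<Rightarrow> real) \<Rightarrow> bool" where
  "inverse_matrices I A B \<longleftrightarrow> (\<forall>i\<in>I. \<forall>j\<in>I.
     (\<Sum>k\<in>I. A i k * B k j) = (if i = j then 1 else 0) \<and>
     (\<Sum>k\<in>I. B i k * A k j) = (if i = j then 1 else 0))"

section \<open>Local operators\<close>

context
  fixes \<Lambda> :: "real^'d \<Rightarrow> real^'d^'d" and m :: "(real^'d) mesh" and K :: "(real^'d) set"
begin

definition mean_tensor :: "real^'d^'d" where
  "mean_tensor = (1 / vol K) *\<^sub>R (LINT x:K|lebesgue. \<Lambda> x)"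

definition D_op :: "((real^'d) set \<Rightarrow> real) \<Rightarrow> real^'d" where
  "D_op V = (1 / vol K) *\<^sub>R (\<Sum>\<sigma>\<in>faces m K. V \<sigma> *\<^sub>R outward_normal K \<sigma>)"

definition L_op :: "((real^'d) set \<Rightarrow> real) \<Rightarrow> (real^'d) set \<Rightarrow> real" where
  "L_op V \<sigma> = V \<sigma> / area \<sigma> - D_op V \<bullet> (barycentre \<sigma> - point m K)"

definition R_row :: "(real^'d) set \<Rightarrow> real^'d" where
  "R_row \<sigma> = area \<sigma> *\<^sub>R (barycentre \<sigma> - point m K)"

definition N_row :: "(real^'d) set \<Rightarrow> real^'d" where
  "N_row \<sigma> = mean_tensor *v outward_normal K \<sigma>"

definition R_transpose :: "((real^'d) set \<Rightarrow> real) \<Rightarrow> real^'d" where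
  "R_transpose V = (\<Sum>\<sigma>\<in>faces m K. V \<sigma> *\<^sub>R R_row \<sigma>)"

definition N_transpose :: "((real^'d) set \<Rightarrow> real) \<Rightarrow> real^'d" where
  "N_transpose V = (\<Sum>\<sigma>\<in>faces m K. V \<sigma> *\<^sub>R N_row \<sigma>)"

text \<open>The solution of \<open>|K| \<Lambda>\<^sub>K v = - \<Sum>\<sigma>. |\<sigma>| V\<^sub>\<sigma> (x\<^sub>\<sigma> - x\<^sub>K)\<close>.\<close>

definition v_op :: "((real^'d) set \<Rightarrow> real) \<Rightarrow> real^'d" where
  "v_op V = - (1 / vol K) *\<^sub>R (matrix_inv mean_tensor *v
     (\<Sum>\<sigma>\<in>faces m K. (area \<sigma> * V \<sigma>) *\<^sub>R (barycentre \<sigma> - point m K)))"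

definition T_op :: "((real^'d) set \<Rightarrow> real) \<Rightarrow> (real^'d) set \<Rightarrow> real" where
  "T_op V \<sigma> = V \<sigma> + (mean_tensor *v v_op V) \<bullet> outward_normal K \<sigma>"

text \<open>\<open>C\<close> is a matrix with rows indexed by the faces of \<open>K\<close> and columns by
  \<open>0, \<dots>, k - d - 1\<close>, with image the orthogonal complement of the image of the matrix with rows
  \<open>N_row\<close>.\<close>

definition spans_N_complement :: "((real^'d) set \<Rightarrow> nat \<Rightarrow> real) \<Rightarrow> bool" where
  "spans_N_complement C \<longleftrightarrow> (\<forall>V :: (real^'d) set \<Rightarrow> real.
     (\<exists>w :: nat \<Rightarrow> real. \<forall>\<sigma>\<in>faces m K. V \<sigma> = (\<Sum>j<card (faces m K) - CARD('d). C \<sigma> j * w j)) \<longleftrightarrow>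
     (\<forall>\<xi> :: real^'d. (\<Sum>\<sigma>\<in>faces m K. V \<sigma> * (N_row \<sigma> \<bullet> \<xi>)) = 0))"

definition C_transpose :: "((real^'d) set \<Rightarrow> nat \<Rightarrow> real) \<Rightarrow> ((real^'d) set \<Rightarrow> real) \<Rightarrow> nat \<Rightarrow> real" where
  "C_transpose C V j = (\<Sum>\<sigma>\<in>faces m K. C \<sigma> j * V \<sigma>)"

text \<open>Mimetic, Hybrid and Mixed matrices of one and the same scheme in the cell \<open>K\<close>.\<close>

definition hmmf_matrices ::
    "((real^'d) set \<Rightarrow> (real^'d) set \<Rightarrow> real) \<Rightarrow> ((real^'d) set \<Rightarrow> (real^'d) set \<Rightarrow> real) \<Rightarrow>
     ((real^'d) set \<Rightarrow> (real^'d) set \<Rightarrow> real) \<Rightarrow> bool" where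
  "hmmf_matrices M BH BM \<longleftrightarrow>
     sym_pos_def (faces m K) M \<and> sym_pos_def (faces m K) BH \<and> sym_pos_def (faces m K) BM \<and>
     (\<exists>C U W. spans_N_complement C \<and> sym_pos_def {..<card (faces m K) - CARD('d)} U \<and>
        inverse_matrices (faces m K) M W \<and>
        (\<forall>V V'.
           bilin (faces m K) M V' V =
             (1 / vol K) * (R_transpose V' \<bullet> (matrix_inv mean_tensor *v R_transpose V)) +
             bilin {..<card (faces m K) - CARD('d)} U (C_transpose C V') (C_transpose C V) \<and>
           bilin {..<card (faces m K) - CARD('d)} U (C_transpose C V') (C_transpose C V) =
             bilin (faces m K) BM (T_op V') (T_op V) \<and>
           bilin (faces m K) W V' V =
             (1 / vol K) * (N_transpose V' \<bullet> (matrix_inv mean_tensor *v N_transpose V)) +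
             bilin (faces m K) BH (L_op V') (L_op V)))"

end

section \<open>The scheme\<close>

text \<open>\<open>p\<close>, \<open>p'\<close> and \<open>F\<close> are the cell unknowns, the face unknowns and the fluxes; \<open>M K\<close> is the
  Mimetic matrix of the cell \<open>K\<close>.\<close>

definition scheme_solution ::
    "(real^'d) set \<Rightarrow> (real^'d \<Rightarrow> real) \<Rightarrow> (real^'d) mesh \<Rightarrow>
     ((real^'d) set \<Rightarrow> (real^'d) set \<Rightarrow> (real^'d) set \<Rightarrow> real) \<Rightarrow>
     ((real^'d) set \<Rightarrow> real) \<Rightarrow> ((real^'d) set \<Rightarrow> real) \<Rightarrow>
     ((real^'d) set \<Rightarrow> (real^'d) set \<Rightarrow> real) \<Rightarrow> bool" where
  "scheme_solution \<Omega> f m M p p' F \<longleftrightarrow>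
     (\<forall>\<sigma>\<in>all_faces m. \<sigma> \<subseteq> frontier \<Omega> \<longrightarrow> p' \<sigma> = 0) \<and>
     (\<forall>\<sigma>\<in>interior_faces m. \<forall>K\<in>cells_at m \<sigma>. \<forall>L\<in>cells_at m \<sigma>.
        K \<noteq> L \<longrightarrow> F K \<sigma> + F L \<sigma> = 0) \<and>
     (\<forall>K\<in>cells m. (\<Sum>\<sigma>\<in>faces m K. area \<sigma> * F K \<sigma>) = (LINT x:K|lebesgue. f x)) \<and>
     (\<forall>K\<in>cells m. \<forall>G.
        bilin (faces m K) (M K) G (F K) = (\<Sum>\<sigma>\<in>faces m K. (p K - p' \<sigma>) * area \<sigma> * G \<sigma>))"

definition piecewise_constant ::
    "(real^'d) mesh \<Rightarrow> ((real^'d) set \<Rightarrow> real) \<Rightarrow> real^'d \<Rightarrow> real" where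
  "piecewise_constant m p x = (\<Sum>K\<in>cells m. p K * indicator K x)"

definition L2_dist :: "(real^'d) set \<Rightarrow> (real^'d \<Rightarrow> real) \<Rightarrow> (real^'d \<Rightarrow> real) \<Rightarrow> real" where
  "L2_dist \<Omega> u v = sqrt (integral\<^sup>L (lebesgue_on \<Omega>) (\<lambda>x. (u x - v x)\<^sup>2))"

end

theory Submission
  imports Defs
begin

text \<open>
  On a cell, \<open>V\<close> is the sum of a consistent part, which \<open>D_op\<close> (or \<open>R_transpose\<close>) determines, and of the
  part seen by \<open>L_op\<close> (or \<open>T_op\<close>), an operator which is idempotent up to scaling and kills the first
  part. The regularity of the mesh and the divergence theorem on the cell bound both parts by \<open>V\<close> in the
  weighted norms. Hence the bounds for the mixed form are equivalent to those for the mimetic matrix, and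
  the bounds for the hybrid form to those for its inverse; inverting a matrix inverts the weights.

  Convergence needs no compactness argument. The scheme is coercive for a discrete \<open>H\<^sup>1\<close> norm, so the
  distance between its solution and the interpolate of a test function close to the weak solution is
  bounded by interpolation errors and by the defect of the weak equation against discrete functions. To
  estimate this defect, a discrete function is mollified and cut off near the boundary of \<open>\<Omega>\<close>, which
  gives an admissible test function. Its gradient is bounded because a function supported close to
  \<open>\<Omega>\<close> is small on a thin strip along the boundary: the complement of a polytopal set is a finite union
  of closures of convex pieces, and a dilation towards such a piece leaves the support.
\<close>

text \<open>The hub of the equivalences is the two-sided bound for the inverse of the mimetic
  matrix. It links conditions (1) and (2), and it gives coercivity in the cell and face unknowns
  once the fluxes are eliminated. The geometry of a cell is reduced to two identities for face
  normals, the divergence theorem for constant and for linear fields. Cells need not be convex and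
  areas are defined through slabs, so both identities come from cutting the cell into cones with a
  common apex: volume and first moment of a cone are explicit, and moving the apex yields the
  identities. The delicate point of convergence is the order of the choices. The cut-off at distance
  of order \<epsilon> from the boundary has a gradient of size 1/\<epsilon>; the strip estimate
  supplies the compensating factor \<epsilon>. The derivatives of the mollifier blow up with
  \<epsilon>, so the mesh size is restricted last, which keeps the gradient of the mollified
  function below a multiple of the discrete norm that is free of \<epsilon>.\<close>

abbreviation pwc where "pwc \<equiv> piecewise_constant"
abbreviation tfun where "tfun \<equiv> test_function"
abbreviation pd where "pd \<equiv> partial_deriv"
abbreviation leb where "leb \<equiv> lebesgue_on"

section \<open>Surface measure and cones\<close>

lemma closest_point_hyperplane:
  fixes n :: "'a::euclidean_space"
  assumes "norm n = 1"
  shows "closest_point {z. n \<bullet> z = b} x = x - (n \<bullet> x - b) *\<^sub>R n"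
proof (rule closest_point_unique[symmetric])
  show "convex {z. n \<bullet> z = b}" by (rule convex_hyperplane)
  show "closed {z. n \<bullet> z = b}" by (rule closed_hyperplane)
  have nn: "n \<bullet> n = 1" using assms by (simp add: norm_eq_1)
  show "x - (n \<bullet> x - b) *\<^sub>R n \<in> {z. n \<bullet> z = b}"
    by (simp add: inner_diff_right nn)
  show "\<forall>z\<in>{z. n \<bullet> z = b}. dist x (x - (n \<bullet> x - b) *\<^sub>R n) \<le> dist x z"
  proof
    fix z assume z: "z \<in> {z. n \<bullet> z = b}"
    have "\<bar>n \<bullet> (x - z)\<bar> \<le> norm n * norm (x - z)" by (rule Cauchy_Schwarz_ineq2)
    then show "dist x (x - (n \<bullet> x - b) *\<^sub>R n) \<le> dist x z"
      using z assms by (simp add: dist_norm inner_diff_right)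
  qed
qed

lemma infdist_hyperplane:
  fixes n :: "'a::euclidean_space"
  assumes "norm n = 1"
  shows "infdist x {z. n \<bullet> z = b} = \<bar>n \<bullet> x - b\<bar>"
proof -
  have nn: "n \<bullet> n = 1" using assms by (simp add: norm_eq_1)
  have ne: "{z. n \<bullet> z = b} \<noteq> {}"
    using nn by (auto intro!: exI[of _ "b *\<^sub>R n"])
  have "infdist x {z. n \<bullet> z = b} = dist x (closest_point {z. n \<bullet> z = b} x)"
    using ne closed_hyperplane
    by (metis setdist_closest_point infdist_eq_setdist)
  then show ?thesis using assms by (simp add: closest_point_hyperplane dist_norm)
qed

lemma sets_surface_measure [simp, measurable_cong]: "sets (surface_measure H) = sets borel"
  by (simp add: surface_measure_def)

lemma space_surface_measure [simp]: "space (surface_measure H) = UNIV"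
  by (simp add: surface_measure_def)

lemma nn_integral_surface_measure:
  fixes n :: "real^'d"
  assumes n: "norm n = 1" and [measurable]: "F \<in> borel_measurable borel"
  shows "(\<integral>\<^sup>+z. F z \<partial>surface_measure {z. n \<bullet> z = b}) =
    (\<integral>\<^sup>+x. F (x - (n \<bullet> x - b) *\<^sub>R n) * indicator {-1/2..1/2} (n \<bullet> x - b) \<partial>lborel)"
proof -
  have [measurable]: "(\<lambda>x. x - (n \<bullet> x - b) *\<^sub>R n) \<in> borel_measurable borel"
    by (intro borel_measurable_continuous_onI continuous_intros)
  have m: "{x. \<bar>n \<bullet> x - b\<bar> \<le> 1/2} \<in> sets lborel" by measurable
  have "(\<integral>\<^sup>+z. F z \<partial>surface_measure {z. n \<bullet> z = b}) =
     (\<integral>\<^sup>+x. F (x - (n \<bullet> x - b) *\<^sub>R n) \<partial>restrict_space lborel {x. \<bar>n \<bullet> x - b\<bar> \<le> 1/2})"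
    unfolding surface_measure_def infdist_hyperplane[OF n] closest_point_hyperplane[OF n, abs_def]
    by (subst nn_integral_distr) (auto intro!: measurable_restrict_space1)
  also have "\<dots> = (\<integral>\<^sup>+x. F (x - (n \<bullet> x - b) *\<^sub>R n) * indicator {x. \<bar>n \<bullet> x - b\<bar> \<le> 1/2} x \<partial>lborel)"
    using m by (subst nn_integral_restrict_space) auto
  also have "\<dots> = (\<integral>\<^sup>+x. F (x - (n \<bullet> x - b) *\<^sub>R n) * indicator {-1/2..1/2} (n \<bullet> x - b) \<partial>lborel)"
    by (intro nn_integral_cong arg_cong2[where f="(*)"] refl) (auto simp: indicator_def abs_real_def)
  finally show ?thesis .
qed

lemma nn_integral_lborel_translation:
  fixes c :: "'a::euclidean_space"
  assumes [measurable]: "F \<in> borel_measurable borel"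
  shows "(\<integral>\<^sup>+x. F (c + x) \<partial>lborel) = (\<integral>\<^sup>+x. F x \<partial>lborel)"
  by (subst lborel_distr_plus[of c, symmetric], subst nn_integral_distr) auto

lemma nn_integral_lborel_dilation:
  fixes c :: "'a::euclidean_space"
  assumes [measurable]: "F \<in> borel_measurable borel" and "t > 0"
  shows "(\<integral>\<^sup>+x. F x \<partial>lborel) = ennreal (t ^ DIM('a)) * (\<integral>\<^sup>+x. F (c + t *\<^sub>R x) \<partial>lborel)"
  using assms(2)
  by (subst lborel_affine[of t c])
     (auto simp: nn_integral_density nn_integral_distr nn_integral_cmult)

text \<open>Averaging over the translations along \<open>n\<close> turns the set over \<open>B\<close> into the slab of thickness
  \<open>1\<close> times the length of \<open>B\<close>.\<close>

lemma emeasure_lborel_slab: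
  fixes n :: "real^'d"
  assumes n: "norm n = 1" and [measurable]: "A \<in> sets borel" "B \<in> sets borel"
  shows "emeasure lborel {x. n \<bullet> x - b \<in> B \<and> x - (n \<bullet> x - b) *\<^sub>R n \<in> A}
    = emeasure lborel B * emeasure (surface_measure {z. n \<bullet> z = b}) A"
proof -
  have nn: "n \<bullet> n = 1" using n by (simp add: norm_eq_1)
  define h where "h x = n \<bullet> x - b" for x
  define P where "P x = x - h x *\<^sub>R n" for x
  have h[measurable]: "h \<in> borel_measurable borel" unfolding h_def
    by (intro borel_measurable_continuous_onI continuous_intros)
  have P[measurable]: "P \<in> borel_measurable borel" unfolding P_def h_def
    by (intro borel_measurable_continuous_onI continuous_intros)
  have hs: "h (t *\<^sub>R n + x) = h x + t" and Ps: "P (t *\<^sub>R n + x) = P x" for t x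
    by (auto simp: h_def P_def inner_add_right nn algebra_simps)
  let ?I = "{-1/2..1/2::real}"
  let ?m = "emeasure (surface_measure {z. n \<bullet> z = b}) A"
  let ?L = "\<integral>\<^sup>+x. indicator B (h x) * indicator A (P x) \<partial>lborel"
  have m: "?m = (\<integral>\<^sup>+x. indicator A (P x) * indicator ?I (h x) \<partial>lborel)"
    using nn_integral_surface_measure[OF n, of "indicator A" b]
    by (simp add: h_def P_def)
  have "emeasure lborel B * ?m = (\<integral>\<^sup>+z. indicator B z * ?m \<partial>lborel)"
    by (simp add: nn_integral_multc)
  \<comment> \<open>Translating by \<open>- z\<close> times \<open>n\<close> leaves the projection
    \<open>P\<close> fixed and turns the height \<open>h x\<close> into
    \<open>h x - z\<close>.\<close>
  also have "\<dots> = (\<integral>\<^sup>+z. (\<integral>\<^sup>+x. indicator B z * (indicator A (P x) * indicator ?I (h x - z)) \<partial>lborel) \<partial>lborel)"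
  proof (rule nn_integral_cong)
    fix z :: real
    have "?m = (\<integral>\<^sup>+x. indicator A (P (((-z) *\<^sub>R n) + x)) * indicator ?I (h ((-z) *\<^sub>R n + x)) \<partial>lborel)"
      unfolding m by (rule nn_integral_lborel_translation[symmetric]) simp
    then show "indicator B z * ?m = (\<integral>\<^sup>+x. indicator B z * (indicator A (P x) * indicator ?I (h x - z)) \<partial>lborel)"
      unfolding hs Ps by (subst nn_integral_cmult) auto
  qed
  also have "\<dots> = (\<integral>\<^sup>+x. (\<integral>\<^sup>+z. indicator B z * (indicator A (P x) * indicator ?I (h x - z)) \<partial>lborel) \<partial>lborel)"
    by (rule lborel_pair.Fubini') measurable
  \<comment> \<open>Substitution \<open>y = h x - z\<close>; the window for the height now
    constrains \<open>y\<close> alone.\<close>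
  also have "\<dots> = (\<integral>\<^sup>+x. (\<integral>\<^sup>+y. indicator B (h x - y) * (indicator A (P x) * indicator ?I y) \<partial>lborel) \<partial>lborel)"
  proof (rule nn_integral_cong)
    fix x
    show "(\<integral>\<^sup>+z. indicator B z * (indicator A (P x) * indicator ?I (h x - z)) \<partial>lborel) =
      (\<integral>\<^sup>+y. indicator B (h x - y) * (indicator A (P x) * indicator ?I y) \<partial>lborel)"
      by (subst nn_integral_real_affine[where c="-1" and t="h x"]) auto
  qed
  also have "\<dots> = (\<integral>\<^sup>+y. (\<integral>\<^sup>+x. indicator B (h x - y) * (indicator A (P x) * indicator ?I y) \<partial>lborel) \<partial>lborel)"
    by (rule lborel_pair.Fubini') measurable
  \<comment> \<open>Translating back removes \<open>y\<close> from the inner integral, and the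
    window \<open>?I\<close> has length one.\<close>
  also have "\<dots> = (\<integral>\<^sup>+y. indicator ?I y * ?L \<partial>lborel)"
  proof (rule nn_integral_cong)
    fix y :: real
    have "?L = (\<integral>\<^sup>+x. indicator B (h (((-y) *\<^sub>R n) + x)) * indicator A (P ((-y) *\<^sub>R n + x)) \<partial>lborel)"
      by (rule nn_integral_lborel_translation[symmetric]) simp
    then show "(\<integral>\<^sup>+x. indicator B (h x - y) * (indicator A (P x) * indicator ?I y) \<partial>lborel) = indicator ?I y * ?L"
      unfolding hs Ps by (cases "y \<in> ?I") auto
  qed
  also have "\<dots> = ?L" by (subst nn_integral_multc) auto
  also have "?L = (\<integral>\<^sup>+x. indicator {x. h x \<in> B \<and> P x \<in> A} x \<partial>lborel)"
    by (intro nn_integral_cong) (auto simp: indicator_def)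
  also have "\<dots> = emeasure lborel {x. h x \<in> B \<and> P x \<in> A}"
    by (rule nn_integral_indicator) measurable
  finally show ?thesis by (simp add: h_def P_def)
qed

text \<open>The slab of thickness one over \<open>A\<close> has the same measure and lies in a ball
  of radius \<open>R + 1\<close>.\<close>

lemma emeasure_surface_measure_bounded:
  fixes n :: "real^'d"
  assumes n: "norm n = 1" and A[measurable]: "A \<in> sets borel" and bA: "bounded A"
  shows "emeasure (surface_measure {z. n \<bullet> z = b}) A < \<infinity>"
proof -
  let ?S = "{x. n \<bullet> x - b \<in> {0..1} \<and> x - (n \<bullet> x - b) *\<^sub>R n \<in> A}"
  obtain R where R: "\<And>x. x \<in> A ==> norm x \<le> R" using bA unfolding bounded_iff by auto
  have "?S \<subseteq> cball 0 (R + 1)"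
  proof
    fix x assume x: "x \<in> ?S"
    have "norm x \<le> norm (x - (n \<bullet> x - b) *\<^sub>R n) + norm ((n \<bullet> x - b) *\<^sub>R n)"
      by (metis diff_add_cancel norm_triangle_ineq)
    also have "\<dots> \<le> R + 1" using x R n by (intro add_mono) auto
    finally show "x \<in> cball 0 (R + 1)" by simp
  qed
  then have "emeasure lborel ?S \<le> emeasure lborel (cball (0::real^'d) (R + 1))"
    by (intro emeasure_mono) auto
  also have "\<dots> < \<infinity>" by (rule emeasure_lborel_cball_finite)
  finally show ?thesis using emeasure_lborel_slab[OF n A, of "{0..1}" b] by simp
qed

text \<open>Required for the product with \<open>lborel\<close> and for Fubini.\<close>

lemma sigma_finite_surface_measure:
  fixes n :: "real^'d"
  assumes n: "norm n = 1"
  shows "sigma_finite_measure (surface_measure {z. n \<bullet> z = b})"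
proof
  let ?A = "range (\<lambda>k::nat. ball (0::real^'d) (real k))"
  have "\<Union>?A = UNIV"
    by (auto simp: reals_Archimedean2)
  then show "\<exists>A. countable A \<and> A \<subseteq> sets (surface_measure {z. n \<bullet> z = b}) \<and>
     \<Union>A = space (surface_measure {z. n \<bullet> z = b}) \<and>
     (\<forall>a\<in>A. emeasure (surface_measure {z. n \<bullet> z = b}) a \<noteq> \<infinity>)"
    using emeasure_surface_measure_bounded[OF n]
    by (intro exI[of _ ?A]) (auto simp: less_top[symmetric])
qed

text \<open>Rectangles determine both measures, and on a rectangle the identity is
  \<open>emeasure_lborel_slab\<close>.\<close>

lemma lborel_eq_height_projection:
  fixes n :: "real^'d"
  assumes n: "norm n = 1"
  shows "lborel \<Otimes>\<^sub>M surface_measure {z. n \<bullet> z = b} =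
    distr lborel (borel \<Otimes>\<^sub>M borel) (\<lambda>x. (n \<bullet> x - b, x - (n \<bullet> x - b) *\<^sub>R n))"
proof (rule pair_measure_eqI)
  have [measurable]: "(\<lambda>x. x - (n \<bullet> x - b) *\<^sub>R n) \<in> borel_measurable borel"
    by (intro borel_measurable_continuous_onI continuous_intros)
  show "sigma_finite_measure (lborel :: real measure)" by (rule sigma_finite_lborel)
  show "sigma_finite_measure (surface_measure {z. n \<bullet> z = b})" by (rule sigma_finite_surface_measure[OF n])
  show "sets (lborel \<Otimes>\<^sub>M surface_measure {z. n \<bullet> z = b}) =
     sets (distr lborel (borel \<Otimes>\<^sub>M borel) (\<lambda>x. (n \<bullet> x - b, x - (n \<bullet> x - b) *\<^sub>R n)))"
    by (simp cong: sets_pair_measure_cong)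
  fix B A assume "B \<in> sets (lborel::real measure)" "A \<in> sets (surface_measure {z. n \<bullet> z = b})"
  then have [measurable]: "B \<in> sets borel" "A \<in> sets borel" by auto
  show "emeasure lborel B * emeasure (surface_measure {z. n \<bullet> z = b}) A =
    emeasure (distr lborel (borel \<Otimes>\<^sub>M borel) (\<lambda>x. (n \<bullet> x - b, x - (n \<bullet> x - b) *\<^sub>R n))) (B \<times> A)"
    unfolding emeasure_lborel_slab[OF n \<open>A \<in> sets borel\<close> \<open>B \<in> sets borel\<close>, symmetric]
    by (subst emeasure_distr) (auto intro!: arg_cong[where f="emeasure lborel"])
qed

lemma nn_integral_lborel_height_projection:
  fixes n :: "real^'d"
  assumes n: "norm n = 1" and F[measurable]: "F \<in> borel_measurable borel"
  shows "(\<integral>\<^sup>+x. F x \<partial>lborel) = (\<integral>\<^sup>+r. (\<integral>\<^sup>+z. F (z + r *\<^sub>R n) \<partial>surface_measure {z. n \<bullet> z = b}) \<partial>lborel)"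
proof -
  interpret sigma_finite_measure "surface_measure {z. n \<bullet> z = b}"
    by (rule sigma_finite_surface_measure[OF n])
  have [measurable]: "(\<lambda>x. x - (n \<bullet> x - b) *\<^sub>R n) \<in> borel_measurable borel"
    by (intro borel_measurable_continuous_onI continuous_intros)
  have "(\<integral>\<^sup>+r. (\<integral>\<^sup>+z. F (z + r *\<^sub>R n) \<partial>surface_measure {z. n \<bullet> z = b}) \<partial>lborel)
    = (\<integral>\<^sup>+p. (case p of (r, z) => F (z + r *\<^sub>R n)) \<partial>(lborel \<Otimes>\<^sub>M surface_measure {z. n \<bullet> z = b}))"
    by (subst nn_integral_fst[symmetric]) auto
  also have "\<dots> = (\<integral>\<^sup>+x. F x \<partial>lborel)"
    unfolding lborel_eq_height_projection[OF n] by (subst nn_integral_distr) auto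
  finally show ?thesis by simp
qed

text \<open>A dilation by \<open>t\<close> of the whole space contributes \<open>t ^ d\<close> and
  maps the slab of thickness one to the slab of thickness \<open>t\<close>. Dividing by the
  thickness leaves the exponent \<open>d - 1\<close>.\<close>

lemma nn_integral_surface_dilation:
  fixes n :: "real^'d"
  assumes n: "norm n = 1" and F[measurable]: "F \<in> borel_measurable borel" and c: "n \<bullet> c = b" and t: "t > 0"
  shows "(\<integral>\<^sup>+z. F z \<partial>surface_measure {z. n \<bullet> z = b}) =
    ennreal (t ^ (CARD('d) - 1)) * (\<integral>\<^sup>+s. F (c + t *\<^sub>R (s - c)) \<partial>surface_measure {z. n \<bullet> z = b})"
proof -
  have nn: "n \<bullet> n = 1" using n by (simp add: norm_eq_1)
  define h where "h x = n \<bullet> x - b" for x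
  define P where "P x = x - h x *\<^sub>R n" for x
  have h[measurable]: "h \<in> borel_measurable borel" unfolding h_def
    by (intro borel_measurable_continuous_onI continuous_intros)
  have P[measurable]: "P \<in> borel_measurable borel" unfolding P_def h_def
    by (intro borel_measurable_continuous_onI continuous_intros)
  let ?\<mu> = "surface_measure {z. n \<bullet> z = b}"
  interpret \<mu>: sigma_finite_measure ?\<mu> by (rule sigma_finite_surface_measure[OF n])
  have slab: "(\<integral>\<^sup>+x. G (P x) * indicator {-l..l} (h x) \<partial>lborel) = ennreal (2 * l) * (\<integral>\<^sup>+z. G z \<partial>?\<mu>)"
    if l: "l \<ge> 0" and G[measurable]: "G \<in> borel_measurable borel" for l and G :: "real^'d => ennreal"
  proof -
    have "(\<integral>\<^sup>+x. G (P x) * indicator {-l..l} (h x) \<partial>lborel)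
      = (\<integral>\<^sup>+p. (case p of (r, z) => indicator {-l..l} r * G z) \<partial>(lborel \<Otimes>\<^sub>M ?\<mu>))"
      unfolding lborel_eq_height_projection[OF n] P_def h_def
      by (subst nn_integral_distr) (auto simp: ac_simps P_def[unfolded h_def, symmetric] h_def[symmetric])
    also have "\<dots> = (\<integral>\<^sup>+r. indicator {-l..l} r * (\<integral>\<^sup>+z. G z \<partial>?\<mu>) \<partial>lborel)"
      by (subst \<mu>.nn_integral_fst[symmetric]) (auto simp: nn_integral_cmult)
    also have "\<dots> = ennreal (2 * l) * (\<integral>\<^sup>+z. G z \<partial>?\<mu>)"
      using l by (subst nn_integral_multc) auto
    finally show ?thesis .
  qed
  \<comment> \<open>With this shift the affine map is the dilation with centre \<open>c\<close>. It
    multiplies heights by \<open>t\<close> and is compatible with the projection.\<close>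
  define a where "a = (1 - t) *\<^sub>R c"
  have ha: "h (a + t *\<^sub>R x) = t * h x" for x
    using c by (simp add: h_def a_def inner_add_right algebra_simps)
  have Pa: "P (a + t *\<^sub>R x) = c + t *\<^sub>R (P x - c)" for x
    by (simp add: P_def ha) (simp add: a_def algebra_simps)
  have "ennreal t * (\<integral>\<^sup>+z. F z \<partial>?\<mu>) = (\<integral>\<^sup>+x. F (P x) * indicator {-(t/2)..t/2} (h x) \<partial>lborel)"
    using t slab[of "t/2" F] by simp
  also have "\<dots> = ennreal (t ^ CARD('d)) *
     (\<integral>\<^sup>+x. F (c + t *\<^sub>R (P x - c)) * indicator {-(t/2)..t/2} (t * h x) \<partial>lborel)"
    by (subst nn_integral_lborel_dilation[of _ t a]) (auto simp: t ha Pa)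
  also have "(\<integral>\<^sup>+x. F (c + t *\<^sub>R (P x - c)) * indicator {-(t/2)..t/2} (t * h x) \<partial>lborel) =
     (\<integral>\<^sup>+x. F (c + t *\<^sub>R (P x - c)) * indicator {-(1/2)..1/2} (h x) \<partial>lborel)"
  proof -
    have "- (t / 2) \<le> t * r \<and> t * r \<le> t / 2 \<longleftrightarrow> - (1/2) \<le> r \<and> r \<le> 1/2" for r
      using mult_le_cancel_left_pos[OF t, of "-(1/2)" r] mult_le_cancel_left_pos[OF t, of r "1/2"] by simp
    then show ?thesis
      by (intro nn_integral_cong arg_cong2[where f="(*)"] refl) (auto simp: indicator_def)
  qed
  also have "\<dots> = (\<integral>\<^sup>+s. F (c + t *\<^sub>R (s - c)) \<partial>?\<mu>)"
    by (subst slab[of "1/2" "\<lambda>s. F (c + t *\<^sub>R (s - c))"]) auto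
  also have "ennreal (t ^ CARD('d)) = ennreal t * ennreal (t ^ (CARD('d) - 1))"
    using t by (simp add: ennreal_mult'[symmetric] power_eq_if)
  finally show ?thesis
    using t by (simp add: mult.assoc ennreal_mult_cancel_left)
qed

text \<open>The open cone with apex \<open>y\<close> over the part \<open>A\<close> of the
  hyperplane at level \<open>b\<close>, described by the central projection from \<open>y\<close>,
  since measurability is then immediate. The parametrization by \<open>t\<close> and
  \<open>s\<close> is recovered in \<open>cone_param\<close>.\<close>

definition cone :: "real^'d => real => real^'d => (real^'d) set => (real^'d) set" where
  "cone n b y A = {x. n \<bullet> y < n \<bullet> x \<and> n \<bullet> x < b \<and>
     y + ((b - n \<bullet> y) / (n \<bullet> (x - y))) *\<^sub>R (x - y) \<in> A}"

lemma cone_borel [measurable]: "A \<in> sets borel ==> cone n b y A \<in> sets borel"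
proof -
  assume [measurable]: "A \<in> sets borel"
  have [measurable]: "(\<lambda>x. y + ((b - n \<bullet> y) / (n \<bullet> (x - y))) *\<^sub>R (x - y)) \<in> borel_measurable borel"
    by measurable
  show ?thesis unfolding cone_def by measurable
qed

text \<open>Fubini along \<open>n\<close>: the slice at the fraction \<open>t\<close> of the height
  is the base dilated by \<open>t\<close> about the apex, and its area scales with the power
  \<open>d - 1\<close>.\<close>

lemma nn_integral_cone:
  fixes n :: "real^'d"
  assumes n: "norm n = 1" and y: "n \<bullet> y < b"
    and F[measurable]: "F \<in> borel_measurable borel" and A[measurable]: "A \<in> sets borel"
  shows "(\<integral>\<^sup>+x. F x * indicator (cone n b y A) x \<partial>lborel) =
    ennreal (b - n \<bullet> y) * (\<integral>\<^sup>+t. indicator {0<..<1} t * (ennreal (t ^ (CARD('d) - 1)) *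
      (\<integral>\<^sup>+s. F (y + t *\<^sub>R (s - y)) * indicator A s \<partial>surface_measure {z. n \<bullet> z = b})) \<partial>lborel)"
proof -
  have nn: "n \<bullet> n = 1" using n by (simp add: norm_eq_1)
  define \<delta> where "\<delta> = b - n \<bullet> y"
  have \<delta>: "\<delta> > 0" using y by (simp add: \<delta>_def)
  let ?\<mu> = "surface_measure {z. n \<bullet> z = b}"
  interpret \<mu>: sigma_finite_measure ?\<mu> by (rule sigma_finite_surface_measure[OF n])
  let ?G = "\<lambda>x. F x * indicator (cone n b y A) x"
  have G[measurable]: "?G \<in> borel_measurable borel" by measurable
  \<comment> \<open>Heights are parametrized so that \<open>t = 1\<close> is the hyperplane of the
    base and \<open>t = 0\<close> the level of the apex.\<close>
  let ?z = "\<lambda>t z. z + (\<delta> * (t - 1)) *\<^sub>R n"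
  let ?J = "\<lambda>t. \<integral>\<^sup>+s. F (y + t *\<^sub>R (s - y)) * indicator A s \<partial>?\<mu>"
  have AE: "AE z in ?\<mu>. n \<bullet> z = b"
  proof -
    have m: "{z. n \<bullet> z \<noteq> b} \<in> sets borel" by measurable
    have "emeasure ?\<mu> {z. n \<bullet> z \<noteq> b} = 0"
      using nn_integral_surface_measure[OF n, of "indicator {z. n \<bullet> z \<noteq> b}" b] m
      by (simp add: inner_diff_right nn)
    then show ?thesis using m by (intro AE_I[where N="{z. n \<bullet> z \<noteq> b}"]) auto
  qed
  have "(\<integral>\<^sup>+x. ?G x \<partial>lborel) = (\<integral>\<^sup>+r. (\<integral>\<^sup>+z. ?G (z + r *\<^sub>R n) \<partial>?\<mu>) \<partial>lborel)"
    by (rule nn_integral_lborel_height_projection[OF n G])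
  also have "\<dots> = ennreal \<delta> * (\<integral>\<^sup>+t. (\<integral>\<^sup>+z. ?G (?z t z) \<partial>?\<mu>) \<partial>lborel)"
    using \<delta> by (subst nn_integral_real_affine[where c=\<delta> and t="-\<delta>"]) (auto simp: algebra_simps)
  also have "(\<integral>\<^sup>+t. (\<integral>\<^sup>+z. ?G (?z t z) \<partial>?\<mu>) \<partial>lborel) =
      (\<integral>\<^sup>+t. indicator {0<..<1} t * (ennreal (t ^ (CARD('d) - 1)) *
      ?J t) \<partial>lborel)"
  proof (rule nn_integral_cong)
    fix t :: real
    show "(\<integral>\<^sup>+z. ?G (?z t z) \<partial>?\<mu>) = indicator {0<..<1} t * (ennreal (t ^ (CARD('d) - 1)) *
      ?J t)"
    proof (cases "0 < t \<and> t < 1")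
      case False
      have "AE z in ?\<mu>. ?G (?z t z) = 0"
        using AE
      proof eventually_elim
        case (elim z)
        have "n \<bullet> (?z t z) = b + \<delta> * (t - 1)"
          by (simp add: inner_add_right nn elim)
        moreover have "\<not> (n \<bullet> y < b + \<delta> * (t - 1) \<and> b + \<delta> * (t - 1) < b)"
        proof
          assume "n \<bullet> y < b + \<delta> * (t - 1) \<and> b + \<delta> * (t - 1) < b"
          then have "0 < \<delta> * t" "\<delta> * (t - 1) < 0" by (auto simp: \<delta>_def algebra_simps)
          then show False using False \<delta> by (auto simp: zero_less_mult_iff mult_less_0_iff)
        qed
        ultimately show ?case by (auto simp: cone_def indicator_def)
      qed
      then have "(\<integral>\<^sup>+z. ?G (?z t z) \<partial>?\<mu>) = 0"
        by (subst nn_integral_0_iff_AE) auto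
      then show ?thesis using False by (auto simp: indicator_def)
    next
      case True
      \<comment> \<open>The foot of the perpendicular from the apex: dilating about \<open>c\<close>
        inside the hyperplane and then shifting along \<open>n\<close> is the dilation about
        \<open>y\<close>.\<close>
      define c where "c = y + \<delta> *\<^sub>R n"
      have c: "n \<bullet> c = b" by (simp add: c_def inner_add_right nn \<delta>_def)
      have "(\<integral>\<^sup>+z. ?G (?z t z) \<partial>?\<mu>) =
        ennreal (t ^ (CARD('d) - 1)) * (\<integral>\<^sup>+s. ?G (c + t *\<^sub>R (s - c) + (\<delta> * (t - 1)) *\<^sub>R n) \<partial>?\<mu>)"
        using True by (subst nn_integral_surface_dilation[OF n _ c, of _ t]) auto
      also have "(\<integral>\<^sup>+s. ?G (c + t *\<^sub>R (s - c) + (\<delta> * (t - 1)) *\<^sub>R n) \<partial>?\<mu>) =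
         ?J t"
      proof (rule nn_integral_cong_AE)
        show "AE s in ?\<mu>. ?G (c + t *\<^sub>R (s - c) + (\<delta> * (t - 1)) *\<^sub>R n) = F (y + t *\<^sub>R (s - y)) * indicator A s"
          using AE
        proof eventually_elim
          case (elim s)
          have eq: "c + t *\<^sub>R (s - c) + (\<delta> * (t - 1)) *\<^sub>R n = y + t *\<^sub>R (s - y)"
            by (simp add: c_def algebra_simps)
          have "n \<bullet> (s - y) = \<delta>" by (simp add: inner_diff_right elim \<delta>_def)
          moreover have "0 < (1 - t) * \<delta>" using True \<delta> by simp
          then have "n \<bullet> y + t * (b - n \<bullet> y) < b" by (simp add: \<delta>_def algebra_simps)
          ultimately have "y + t *\<^sub>R (s - y) \<in> cone n b y A \<longleftrightarrow> s \<in> A"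
            using True \<delta> y by (simp add: cone_def inner_add_right \<delta>_def)
          then show ?case unfolding eq by (simp add: indicator_def)
        qed
      qed
      finally show ?thesis using True by simp
    qed
  qed
  finally show ?thesis by (simp add: \<delta>_def)
qed


text \<open>Used with \<open>k = d - 1\<close>: \<open>c = 0\<close> gives the volume of a cone, the
  general case its first moment. The affine factor is nonnegative at both ends, hence in between, so
  nothing is lost in \<open>ennreal\<close>.\<close>

lemma nn_integral_power_Ioo:
  fixes a c :: real
  assumes "0 \<le> a" "0 \<le> a + c"
  shows "(\<integral>\<^sup>+t. indicator {0<..<1} t * ennreal (t ^ k * (a + t * c)) \<partial>lborel) =
    ennreal (a / real (Suc k) + c / real (Suc (Suc k)))"
proof -
  have pos: "0 \<le> a + t * c" if "0 \<le> t" "t \<le> 1" for t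
  proof -
    have "a + t * c = (1 - t) * a + t * (a + c)" by (simp add: algebra_simps)
    then show ?thesis using that assms by simp
  qed
  let ?F = "\<lambda>t. a * t ^ Suc k / real (Suc k) + c * t ^ Suc (Suc k) / real (Suc (Suc k))"
  have "(\<integral>\<^sup>+t. indicator {0<..<1} t * ennreal (t ^ k * (a + t * c)) \<partial>lborel) =
     (\<integral>\<^sup>+t. ennreal (t ^ k * (a + t * c)) * indicator {0..1} t \<partial>lborel)"
    using AE_lborel_singleton[of "0::real"] AE_lborel_singleton[of "1::real"]
    by (intro nn_integral_cong_AE, eventually_elim) (auto simp: indicator_def)
  also have "\<dots> = ennreal (?F 1 - ?F 0)"
  proof (rule nn_integral_FTC_Icc)
    fix t :: real assume t: "t \<in> {0..1}"
    have "DERIV ?F t :> a * (real (Suc k) * t ^ k) / real (Suc k) +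
       c * (real (Suc (Suc k)) * t ^ Suc k) / real (Suc (Suc k))"
      by (rule derivative_eq_intros refl | simp)+
    moreover have "a * (real (Suc k) * t ^ k) / real (Suc k) +
       c * (real (Suc (Suc k)) * t ^ Suc k) / real (Suc (Suc k)) = t ^ k * (a + t * c)"
      by (simp add: field_simps del: of_nat_Suc)
    ultimately show "DERIV ?F t :> t ^ k * (a + t * c)" by simp
    show "0 \<le> t ^ k * (a + t * c)" using pos t by simp
  qed auto
  finally show ?thesis by simp
qed

lemma emeasure_cone:
  fixes n :: "real^'d"
  assumes n: "norm n = 1" and y: "n \<bullet> y < b" and A[measurable]: "A \<in> sets borel"
  shows "emeasure lborel (cone n b y A) =
    ennreal ((b - n \<bullet> y) / CARD('d)) * emeasure (surface_measure {z. n \<bullet> z = b}) A"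
proof -
  let ?m = "emeasure (surface_measure {z. n \<bullet> z = b}) A"
  have C: "Suc (CARD('d) - 1) = CARD('d)" by simp
  have "emeasure lborel (cone n b y A) = (\<integral>\<^sup>+x. 1 * indicator (cone n b y A) x \<partial>lborel)"
    by simp
  also have "\<dots> = ennreal (b - n \<bullet> y) * (\<integral>\<^sup>+t. indicator {0<..<1} t * (ennreal (t ^ (CARD('d) - 1)) *
      (\<integral>\<^sup>+s. 1 * indicator A s \<partial>surface_measure {z. n \<bullet> z = b})) \<partial>lborel)"
    by (rule nn_integral_cone[OF n y]) auto
  also have "\<dots> = ennreal (b - n \<bullet> y) * ((\<integral>\<^sup>+t. indicator {0<..<1} t * ennreal (t ^ (CARD('d) - 1) * (1 + t * 0)) \<partial>lborel) * ?m)"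
    by (subst nn_integral_multc[symmetric]) (auto simp: mult.assoc)
  also have "(\<integral>\<^sup>+t. indicator {0<..<1} t * ennreal (t ^ (CARD('d) - 1) * (1 + t * 0)) \<partial>lborel) = ennreal (1 / CARD('d))"
    by (subst nn_integral_power_Ioo) (auto simp: C simp del: of_nat_Suc)
  finally show ?thesis
    using y by (simp add: mult.assoc[symmetric] ennreal_mult'[symmetric])
qed

lemma cone_param:
  assumes "n \<bullet> y < b" "x \<in> cone n b y A" "A \<subseteq> {z. n \<bullet> z = b}"
  obtains t s where "0 < t" "t < 1" "s \<in> A" "x = y + t *\<^sub>R (s - y)"
proof
  let ?t = "n \<bullet> (x - y) / (b - n \<bullet> y)"
  let ?s = "y + ((b - n \<bullet> y) / (n \<bullet> (x - y))) *\<^sub>R (x - y)"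
  have p: "0 < n \<bullet> (x - y)" "n \<bullet> (x - y) < b - n \<bullet> y" and s: "?s \<in> A"
    using assms by (auto simp: cone_def inner_diff_right)
  show "0 < ?t" "?t < 1" using p by auto
  show "?s \<in> A" by fact
  show "x = y + ?t *\<^sub>R (?s - y)" using p by simp
qed

lemma cone_paramI:
  assumes "n \<bullet> y < b" "0 < t" "t < 1" "s \<in> A" "n \<bullet> s = b"
  shows "y + t *\<^sub>R (s - y) \<in> cone n b y A"
proof -
  have "n \<bullet> (s - y) = b - n \<bullet> y" using assms by (simp add: inner_diff_right)
  moreover have "0 < (1 - t) * (b - n \<bullet> y)" using assms(1-3) by simp
  then have "n \<bullet> y + t * (b - n \<bullet> y) < b" by (simp add: algebra_simps)
  moreover have "0 < t * (b - n \<bullet> y)" using assms(1-3) by simp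
  ultimately show ?thesis using assms(1-4) by (simp add: cone_def inner_add_right)
qed

text \<open>Along a ray \<open>e \<bullet> (x - y)\<close> is \<open>t\<close> times its value at
  the base point. This additional power of \<open>t\<close> turns the factor \<open>1 / d\<close> of
  the volume into \<open>1 / (d + 1)\<close>.\<close>

lemma first_moment_cone:
  fixes n :: "real^'d"
  assumes n: "norm n = 1" and y: "n \<bullet> y < b" and A[measurable]: "A \<in> sets borel" and bA: "bounded A"
    and AH: "A \<subseteq> {z. n \<bullet> z = b}"
  shows "(LINT x:cone n b y A|lborel. e \<bullet> (x - y)) =
    (b - n \<bullet> y) / (real CARD('d) + 1) * (LINT s:A|surface_measure {z. n \<bullet> z = b}. e \<bullet> (s - y))"
proof -
  let ?\<mu> = "surface_measure {z. n \<bullet> z = b}"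
  let ?C = "cone n b y A"
  have C: "Suc (CARD('d) - 1) = CARD('d)" by simp
  obtain R where R: "\<And>s. s \<in> A ==> norm (s - y) \<le> R"
    using bounded_translation[OF bA, of "-y"] unfolding bounded_iff by (auto simp: algebra_simps)
  \<comment> \<open>Adding this bound makes the integrand nonnegative, so that
    \<open>nn_integral_cone\<close> applies. Its contribution is \<open>M\<close> times the volume
    of the cone and is subtracted at the end.\<close>
  define M where "M = norm e * \<bar>R\<bar>"
  have M: "\<bar>e \<bullet> (s - y)\<bar> \<le> M" if "s \<in> A" for s
    using Cauchy_Schwarz_ineq2[of e "s - y"] R[OF that] unfolding M_def
    by (meson abs_ge_self mult_left_mono norm_ge_zero order_trans)
  have M0: "M \<ge> 0" by (simp add: M_def)
  let ?j = "\<lambda>t. \<integral>\<^sup>+s. ennreal (M + e \<bullet> (y + t *\<^sub>R (s - y) - y)) * indicator A s \<partial>?\<mu>"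
  have fin: "emeasure ?\<mu> A < \<infinity>" by (rule emeasure_surface_measure_bounded[OF n A bA])
  have finC: "emeasure lborel ?C < \<infinity>" unfolding emeasure_cone[OF n y A]
    using fin by (simp add: ennreal_mult_less_top)
  let ?a = "measure ?\<mu> A"
  have MC: "\<bar>e \<bullet> (x - y)\<bar> \<le> M" if xC: "x \<in> ?C" for x
  proof -
    obtain t s where ts: "0 < t" "t < 1" "s \<in> A" "x = y + t *\<^sub>R (s - y)" using cone_param[OF y xC AH] .
    have "\<bar>e \<bullet> (x - y)\<bar> = t * \<bar>e \<bullet> (s - y)\<bar>" using ts by (simp add: abs_mult)
    also have "\<dots> \<le> 1 * M" using ts M by (intro mult_mono) auto
    finally show ?thesis by simp
  qed
  have intA: "set_integrable ?\<mu> A (\<lambda>s. e \<bullet> (s - y))"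
    unfolding set_integrable_def
    by (rule integrableI_bounded_set[where A=A and B=M])
       (use fin M in \<open>auto intro!: AE_I2 simp: indicator_def\<close>)
  have intA1: "set_integrable ?\<mu> A (\<lambda>s. c)" for c :: real
    unfolding set_integrable_def using fin by (auto simp: integrable_real_indicator)
  have intC: "set_integrable lborel ?C (\<lambda>x. e \<bullet> (x - y))"
    unfolding set_integrable_def
    by (rule integrableI_bounded_set[where A="?C" and B=M])
       (use finC MC in \<open>auto intro!: AE_I2 simp: indicator_def\<close>)
  have intC1: "set_integrable lborel ?C (\<lambda>s. c)" for c :: real
    unfolding set_integrable_def using finC by (auto simp: integrable_real_indicator)
  let ?I = "LINT s:A|?\<mu>. e \<bullet> (s - y)"
  let ?J = "LINT x:?C|lborel. e \<bullet> (x - y)"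
  have c1: "(LINT s:A|?\<mu>. c) = c * ?a" for c by (simp add: set_lebesgue_integral_def)
  have volC: "measure lborel ?C = (b - n \<bullet> y) / CARD('d) * ?a"
    unfolding measure_def emeasure_cone[OF n y A] using y by (simp add: enn2real_mult)
  have inner: "?j t = ennreal (M * ?a + t * ?I)"
    if t: "0 < t" "t < 1" for t
  proof -
    have "?j t =
      (\<integral>\<^sup>+s. ennreal (indicator A s *\<^sub>R (M + t * (e \<bullet> (s - y)))) \<partial>?\<mu>)"
      by (intro nn_integral_cong) (auto simp: indicator_def)
    also have "\<dots> = ennreal (LINT s:A|?\<mu>. M + t * (e \<bullet> (s - y)))"
      unfolding set_lebesgue_integral_def
    proof (rule nn_integral_eq_integral)
      show "integrable ?\<mu> (\<lambda>s. indicator A s *\<^sub>R (M + t * (e \<bullet> (s - y))))"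
        using set_integral_add(1)[OF intA1[of M] set_integrable_mult_right[OF intA, of t]]
        by (simp add: set_integrable_def)
      show "AE s in ?\<mu>. 0 \<le> indicator A s *\<^sub>R (M + t * (e \<bullet> (s - y)))"
      proof (rule AE_I2)
        fix s
        have "s \<in> A ==> - M \<le> t * (e \<bullet> (s - y))"
        proof -
          assume "s \<in> A"
          have "\<bar>t * (e \<bullet> (s - y))\<bar> \<le> 1 * M"
            unfolding abs_mult using M[OF \<open>s \<in> A\<close>] t by (intro mult_mono) auto
          then show ?thesis by simp
        qed
        then show "0 \<le> indicator A s *\<^sub>R (M + t * (e \<bullet> (s - y)))" by (auto simp: indicator_def)
      qed
    qed
    also have "(LINT s:A|?\<mu>. M + t * (e \<bullet> (s - y))) = M * ?a + t * ?I"
      by (subst set_integral_add(2)) (use intA intA1 in \<open>auto simp: c1 \<close>)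
    finally show ?thesis .
  qed
  have absI: "\<bar>?I\<bar> \<le> M * ?a"
  proof -
    have "?I \<le> (LINT s:A|?\<mu>. M)" by (rule set_integral_mono[OF intA intA1]) (use M in force)
    moreover have "(LINT s:A|?\<mu>. - M) \<le> ?I" by (rule set_integral_mono[OF intA1 intA]) (use M in force)
    ultimately show ?thesis by (simp add: c1)
  qed
  have "ennreal (M * measure lborel ?C + ?J) = ennreal (LINT x:?C|lborel. M + e \<bullet> (x - y))"
    by (subst set_integral_add(2)) (use intC intC1 in \<open>auto simp: set_lebesgue_integral_def mult.commute[of M]\<close>)
  also have "\<dots> = (\<integral>\<^sup>+x. ennreal (indicator ?C x *\<^sub>R (M + e \<bullet> (x - y))) \<partial>lborel)"
    unfolding set_lebesgue_integral_def
  proof (rule nn_integral_eq_integral[symmetric])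
    show "integrable lborel (\<lambda>x. indicator ?C x *\<^sub>R (M + e \<bullet> (x - y)))"
      using set_integral_add(1)[OF intC1[of M] intC] by (simp add: set_integrable_def)
    show "AE x in lborel. 0 \<le> indicator ?C x *\<^sub>R (M + e \<bullet> (x - y))"
      using MC by (intro AE_I2) (force simp: indicator_def)
  qed
  also have "\<dots> = (\<integral>\<^sup>+x. ennreal (M + e \<bullet> (x - y)) * indicator ?C x \<partial>lborel)"
    by (intro nn_integral_cong) (auto simp: indicator_def)
  also have "\<dots> = ennreal (b - n \<bullet> y) * (\<integral>\<^sup>+t. indicator {0<..<1} t * (ennreal (t ^ (CARD('d) - 1)) *
      ?j t) \<partial>lborel)"
    by (rule nn_integral_cone[OF n y]) auto
  also have "\<dots> = ennreal (b - n \<bullet> y) *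
      (\<integral>\<^sup>+t. indicator {0<..<1} t * ennreal (t ^ (CARD('d) - 1) * (M * ?a + t * ?I)) \<partial>lborel)"
  proof (rule arg_cong2[where f="(*)", OF refl], rule nn_integral_cong)
    fix t :: real
    show "indicator {0<..<1} t * (ennreal (t ^ (CARD('d) - 1)) *
        ?j t) =
      indicator {0<..<1} t * ennreal (t ^ (CARD('d) - 1) * (M * ?a + t * ?I))"
    proof (cases "0 < t \<and> t < 1")
      case True
      then show ?thesis by (simp only: inner) (simp add: ennreal_mult')
    qed (auto simp: indicator_def)
  qed
  also have "\<dots> = ennreal (b - n \<bullet> y) * ennreal (M * ?a / CARD('d) + ?I / (CARD('d) + 1))"
    using absI M0 by (subst nn_integral_power_Ioo) (auto simp: C simp del: of_nat_Suc)
  also have "\<dots> = ennreal ((b - n \<bullet> y) * (M * ?a / CARD('d) + ?I / (CARD('d) + 1)))"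
    using y by (simp add: ennreal_mult')
  finally have eq: "ennreal (M * measure lborel ?C + ?J) = ennreal ((b - n \<bullet> y) * (M * ?a / CARD('d) + ?I / (CARD('d) + 1)))" .
  have 1: "0 \<le> M * measure lborel ?C + ?J"
  proof -
    have "(LINT x:?C|lborel. - M) \<le> ?J" by (rule set_integral_mono[OF intC1 intC]) (use MC in force)
    then show ?thesis by (simp add: set_lebesgue_integral_def mult.commute[of M])
  qed
  have 2: "0 \<le> (b - n \<bullet> y) * (M * ?a / CARD('d) + ?I / (CARD('d) + 1))"
  proof -
    have "- (M * ?a) / (CARD('d) + 1) \<le> ?I / (CARD('d) + 1)"
      using absI by (intro divide_right_mono) auto
    moreover have "M * ?a / (CARD('d) + 1) \<le> M * ?a / CARD('d)"
      using M0 by (intro divide_left_mono) auto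
    ultimately have "0 \<le> M * ?a / CARD('d) + ?I / (CARD('d) + 1)" by simp
    then show ?thesis using y by simp
  qed
  have "M * measure lborel ?C + ?J = (b - n \<bullet> y) * (M * ?a / CARD('d) + ?I / (CARD('d) + 1))"
    using eq 1 2 by simp
  then show ?thesis unfolding volC by (simp add: algebra_simps)
qed

section \<open>Star-shaped cells\<close>

text \<open>The centre \<open>x\<close> is an argument of its own because it will be moved inside
  the cell in the proof of the divergence theorem.\<close>

definition star_cell :: "(real^'d) set => (real^'d) set set => real^'d => bool" where
  "star_cell K Fs x \<longleftrightarrow> open K \<and> bounded K \<and> finite Fs \<and> disjoint Fs \<and>
     frontier K = (\<Union>E\<in>Fs. closure E) \<and> (\<forall>E\<in>Fs. cell_face K E) \<and>
     star_shaped K x \<and> (\<forall>E\<in>Fs. x \<notin> affine hull E)"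

text \<open>The sign of the normal is fixed by the side of the hyperplane on which \<open>x\<close>
  lies.\<close>

lemma cell_face_hyperplane:
  fixes E :: "(real^'d) set"
  assumes "cell_face K E" "x \<notin> affine hull E"
  obtains n b where "norm n = 1" "affine hull E = {z. n \<bullet> z = b}"
    "openin (top_of_set {z. n \<bullet> z = b}) E" "n \<bullet> x < b"
proof -
  obtain a c where a: "a \<noteq> 0" "openin (top_of_set {z. a \<bullet> z = c}) E" "E \<noteq> {}"
    using assms(1) unfolding cell_face_def by auto
  have aff: "affine hull E = {z. a \<bullet> z = c}"
    using a affine_hull_openin[of "{z. a \<bullet> z = c}" E] affine_hyperplane[of a c]
    by (metis hull_same)
  define s where "s = (if a \<bullet> x < c then 1 / norm a else - 1 / norm a)"
  have s: "s \<noteq> 0" "\<bar>s\<bar> * norm a = 1" using a by (auto simp: s_def)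
  have eq: "{z. (s *\<^sub>R a) \<bullet> z = s * c} = {z. a \<bullet> z = c}" using s by auto
  have "a \<bullet> x \<noteq> c" using assms(2) aff by auto
  then have "(s *\<^sub>R a) \<bullet> x < s * c" using a by (auto simp: s_def divide_strict_right_mono)
  then show ?thesis using that[of "s *\<^sub>R a" "s * c"] s aff a eq by auto
qed

lemma hyperplane_normal_unique:
  fixes n n' :: "'a::real_inner"
  assumes "norm n = 1" "norm n' = 1" "{z. n \<bullet> z = b} \<subseteq> {z. n' \<bullet> z = b'}"
  shows "n' = n \<or> n' = - n"
proof -
  have nn: "n \<bullet> n = 1" "n' \<bullet> n' = 1" using assms by (auto simp: norm_eq_1)
  define v where "v = n' - (n' \<bullet> n) *\<^sub>R n"
  have nv: "n \<bullet> v = 0" by (simp add: v_def inner_diff_right nn inner_commute)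
  have "b *\<^sub>R n \<in> {z. n \<bullet> z = b}" "b *\<^sub>R n + v \<in> {z. n \<bullet> z = b}"
    using nn nv by (auto simp: inner_add_right)
  then have "n' \<bullet> (b *\<^sub>R n) = b'" "n' \<bullet> (b *\<^sub>R n + v) = b'" using assms(3) by blast+
  then have "n' \<bullet> v = 0" by (simp add: inner_add_right)
  then have "v \<bullet> v = 0" using nv by (metis inner_diff_left inner_scaleR_left v_def diff_zero mult_zero_right)
  then have e: "n' = (n' \<bullet> n) *\<^sub>R n" by (simp add: v_def)
  then have "\<bar>n' \<bullet> n\<bar> = 1" using assms by (metis norm_scaleR mult.right_neutral)
  then show ?thesis using e by (metis abs_eq_iff' abs_1 scaleR_one scaleR_minus1_left)
qed

text \<open>The central projection from \<open>x\<close> is continuous on the open half-space above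
  \<open>x\<close>. Hence points close to a point of the face still project into the face.\<close>

lemma radial_cone_open:
  fixes E :: "(real^'d) set"
  assumes "openin (top_of_set {z. n \<bullet> z = b}) E"
  shows "open {z. n \<bullet> x < n \<bullet> z \<and> x + ((b - n \<bullet> x) / (n \<bullet> (z - x))) *\<^sub>R (z - x) \<in> E}"
proof -
  obtain T where T: "open T" "E = {z. n \<bullet> z = b} \<inter> T" using assms by (auto simp: openin_open)
  let ?U = "{z. n \<bullet> x < n \<bullet> z}" and ?g = "\<lambda>z. x + ((b - n \<bullet> x) / (n \<bullet> (z - x))) *\<^sub>R (z - x)"
  have U: "open ?U" by (rule open_halfspace_gt)
  have "continuous_on ?U ?g"
    by (intro continuous_intros) (auto simp: inner_diff_right)
  then have "open (?U \<inter> ?g -` T)" using U T by (simp add: continuous_on_open_vimage Int_commute)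
  moreover have "?U \<inter> ?g -` T = {z. n \<bullet> x < n \<bullet> z \<and> ?g z \<in> E}"
    using T by (auto simp: inner_add_right inner_diff_right)
  ultimately show ?thesis by simp
qed

context
  fixes K :: "(real^'d) set" and Fs and x :: "real^'d"
  assumes sc: "star_cell K Fs x"
begin

section \<open>Rays from the centre of a star-shaped cell\<close>

lemma star_cell_segment:
  assumes "p \<in> K" "0 \<le> t" "t \<le> 1"
  shows "x + t *\<^sub>R (p - x) \<in> K"
proof -
  have "x + t *\<^sub>R (p - x) = (1 - t) *\<^sub>R x + t *\<^sub>R p" by (simp add: algebra_simps)
  then have "x + t *\<^sub>R (p - x) \<in> closed_segment x p" using assms by (auto simp: closed_segment_def)
  then show ?thesis using sc assms unfolding star_cell_def star_shaped_def by blast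
qed

lemma star_cell_in: "x \<in> K" and star_cell_open: "open K"
  using sc unfolding star_cell_def star_shaped_def by auto

lemma star_cell_frontier: "frontier K = (\<Union>E\<in>Fs. closure E)"
  using sc unfolding star_cell_def by metis

lemma star_cell_frontier_notin: "z \<in> frontier K ==> z \<notin> K"
  using star_cell_open by (simp add: frontier_def interior_open)

lemma star_cell_face:
  assumes "E \<in> Fs"
  shows "cell_face K E" "E \<noteq> {}" "E \<subseteq> frontier K" "x \<notin> affine hull E"
proof -
  show f: "cell_face K E" using sc assms unfolding star_cell_def by metis
  then show "E \<noteq> {}" "E \<subseteq> frontier K" unfolding cell_face_def by metis+
  show "x \<notin> affine hull E" using sc assms unfolding star_cell_def by metis
qed

lemma star_cell_closure_face:
  assumes "E \<in> Fs" "z \<in> closure E" "affine hull E = {z. n \<bullet> z = b}"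
  shows "n \<bullet> z = b"
proof -
  have "closure E \<subseteq> {z. n \<bullet> z = b}"
    using assms hull_subset[of E affine] closed_hyperplane by (metis closure_minimal)
  then show ?thesis using assms by auto
qed

text \<open>If such a point were outside \<open>K\<close>, star-shapedness would put the whole
  segment from it to \<open>z\<close> into the frontier. The frontier is covered by finitely many
  closed faces, each in a hyperplane that misses \<open>x\<close> and therefore meets the ray at
  most once; a nondegenerate interval of parameters would be finite.\<close>

lemma star_cell_ray:
  assumes z: "z \<in> frontier K" and t: "0 \<le> t" "t < 1"
  shows "x + t *\<^sub>R (z - x) \<in> K"
proof (rule ccontr)
  assume no: "x + t *\<^sub>R (z - x) \<notin> K"
  have "x + s *\<^sub>R (z - x) \<in> frontier K" if s: "s \<in> {t..1}" for s
  proof -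
    have "(\<lambda>p. x + s *\<^sub>R (p - x)) ` K \<subseteq> K" using s t star_cell_segment by auto
    then have "(\<lambda>p. x + s *\<^sub>R (p - x)) ` closure K \<subseteq> closure K"
      using closure_subset[of K] by (intro image_closure_subset continuous_intros) auto
    then have c: "x + s *\<^sub>R (z - x) \<in> closure K" using z by (auto simp: frontier_def)
    have "x + s *\<^sub>R (z - x) \<notin> K"
    proof
      assume k: "x + s *\<^sub>R (z - x) \<in> K"
      show False
      proof (cases "s = 0")
        case True then show ?thesis using no s t star_cell_in by auto
      next
        case False
        then have "x + (t / s) *\<^sub>R ((x + s *\<^sub>R (z - x)) - x) \<in> K"
          using s t by (intro star_cell_segment k) auto
        then show ?thesis using no False by simp
      qed
    qed
    then show ?thesis using c star_cell_open by (simp add: frontier_def interior_open)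
  qed
  then have "{t..1} \<subseteq> (\<Union>E\<in>Fs. {s. x + s *\<^sub>R (z - x) \<in> closure E})"
    using star_cell_frontier by auto
  moreover have "finite (\<Union>E\<in>Fs. {s. x + s *\<^sub>R (z - x) \<in> closure E})"
  proof (rule finite_UN_I)
    show "finite Fs" using sc by (simp add: star_cell_def)
    fix E assume E: "E \<in> Fs"
    obtain n b where nb: "affine hull E = {z. n \<bullet> z = b}" "n \<bullet> x < b"
      by (rule cell_face_hyperplane[OF star_cell_face(1)[OF E] star_cell_face(4)[OF E]])
    have "{s. x + s *\<^sub>R (z - x) \<in> closure E} \<subseteq> {(b - n \<bullet> x) / (n \<bullet> (z - x))}"
    proof
      fix s assume "s \<in> {s. x + s *\<^sub>R (z - x) \<in> closure E}"
      then have "n \<bullet> (x + s *\<^sub>R (z - x)) = b" using star_cell_closure_face[OF E _ nb(1)] by auto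
      then have e: "s * (n \<bullet> (z - x)) = b - n \<bullet> x" by (simp add: inner_add_right)
      then have "n \<bullet> (z - x) \<noteq> 0" using nb(2) by auto
      then show "s \<in> {(b - n \<bullet> x) / (n \<bullet> (z - x))}" using e by (simp add: field_simps)
    qed
    then show "finite {s. x + s *\<^sub>R (z - x) \<in> closure E}" by (rule finite_subset) simp
  qed
  ultimately have "finite {t..1}" by (rule finite_subset)
  then show False using infinite_Icc[OF t(2)] by contradiction
qed

text \<open>Otherwise \<open>z\<close> would be the point at the fraction \<open>1 / t < 1\<close>
  of a segment from \<open>x\<close> to a point of the closure, hence in \<open>K\<close> by
  star-shapedness or by \<open>star_cell_ray\<close>.\<close>

lemma star_cell_outside:
  assumes z: "z \<in> frontier K" and t: "1 < t"
  shows "x + t *\<^sub>R (z - x) \<notin> closure K"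
proof
  assume c: "x + t *\<^sub>R (z - x) \<in> closure K"
  have "(1 / t) *\<^sub>R (t *\<^sub>R (z - x)) = z - x" using t by simp
  then have e: "x + (1 / t) *\<^sub>R ((x + t *\<^sub>R (z - x)) - x) = z" by (simp only: add_diff_cancel_left') simp
  show False
  proof (cases "x + t *\<^sub>R (z - x) \<in> K")
    case True
    have "x + (1 / t) *\<^sub>R ((x + t *\<^sub>R (z - x)) - x) \<in> K"
      using t by (intro star_cell_segment[OF True]) auto
    then show False using star_cell_frontier_notin[OF z] unfolding e by contradiction
  next
    case False
    then have f: "x + t *\<^sub>R (z - x) \<in> frontier K" using c star_cell_open by (simp add: frontier_def interior_open)
    have "x + (1 / t) *\<^sub>R ((x + t *\<^sub>R (z - x)) - x) \<in> K"
      by (rule star_cell_ray[OF f]) (use t in auto)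
    then show False using star_cell_frontier_notin[OF z] unfolding e by contradiction
  qed
qed

lemma star_cell_frontier_unique:
  assumes "z \<in> frontier K" "x + t *\<^sub>R (z - x) \<in> frontier K" "t \<ge> 0"
  shows "t = 1"
proof -
  have "\<not> t < 1"
    using star_cell_frontier_notin[OF assms(2)] star_cell_ray[OF assms(1,3)] by (rule contrapos_nn)
  moreover have c: "x + t *\<^sub>R (z - x) \<in> closure K" using assms(2) unfolding frontier_def by (rule DiffD1)
  have "\<not> 1 < t"
    by (rule notI, drule star_cell_outside[OF assms(1)]) (rule notE[OF _ c])
  ultimately show ?thesis by simp
qed

text \<open>The ray through \<open>p\<close> leaves \<open>K\<close> exactly at its point in
  \<open>E\<close>, so membership only depends on whether \<open>p\<close> comes before or after the
  hyperplane.\<close>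

lemma star_cell_side:
  assumes E: "E \<in> Fs" and nb: "n \<bullet> x < b" "affine hull E = {z. n \<bullet> z = b}"
    and p: "n \<bullet> x < n \<bullet> p" "x + ((b - n \<bullet> x) / (n \<bullet> (p - x))) *\<^sub>R (p - x) \<in> E"
  shows "p \<in> K \<longleftrightarrow> n \<bullet> p < b"
proof -
  define t where "t = n \<bullet> (p - x) / (b - n \<bullet> x)"
  define s where "s = x + ((b - n \<bullet> x) / (n \<bullet> (p - x))) *\<^sub>R (p - x)"
  have s: "s \<in> frontier K" using p(2) star_cell_face(3)[OF E] by (auto simp: s_def)
  have ps: "p = x + t *\<^sub>R (s - x)" using p(1) nb by (auto simp: t_def s_def inner_diff_right)
  have t: "0 < t" "t < 1 \<longleftrightarrow> n \<bullet> p < b" using p(1) nb by (auto simp: t_def inner_diff_right)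
  consider "t < 1" | "t = 1" | "t > 1" by linarith
  then show ?thesis
  proof cases
    case 1 then show ?thesis using star_cell_ray[OF s, of t] t ps by simp
  next
    case 2 then show ?thesis using ps t star_cell_frontier_notin[OF s] by simp
  next
    case 3 then show ?thesis using star_cell_outside[OF s 3] t ps closure_subset[of K] by auto
  qed
qed

text \<open>Close to a face point the normal line stays among the rays through \<open>E\<close>,
  where \<open>star_cell_side\<close> decides membership. This identifies the vector selected by
  \<open>THE\<close>.\<close>

lemma star_cell_outward_normal:
  assumes E: "E \<in> Fs" and nb: "norm n = 1" "affine hull E = {z. n \<bullet> z = b}"
    "openin (top_of_set {z. n \<bullet> z = b}) E" "n \<bullet> x < b"
  shows "outward_normal K E = n"
    and "z \<in> E ==> \<forall>\<^sub>F t in at_right 0. z - t *\<^sub>R n \<in> K \<and> z + t *\<^sub>R n \<notin> K"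
proof -
  have nn: "n \<bullet> n = 1" using nb by (simp add: norm_eq_1)
  have sH: "E \<subseteq> {z. n \<bullet> z = b}" using nb(2) hull_subset[of E affine] by auto
  let ?Q = "{z. n \<bullet> x < n \<bullet> z \<and> x + ((b - n \<bullet> x) / (n \<bullet> (z - x))) *\<^sub>R (z - x) \<in> E}"
  have ev: "\<forall>\<^sub>F t in at_right 0. z - t *\<^sub>R n \<in> K \<and> z + t *\<^sub>R n \<notin> K" if z: "z \<in> E" for z
  proof -
    have nz: "n \<bullet> z = b" using z sH by auto
    have zQ: "z \<in> ?Q" using z nz nb(4) by (simp add: inner_diff_right)
    have o: "open ?Q" by (rule radial_cone_open[OF nb(3)])
    have "((\<lambda>t. z - t *\<^sub>R n) \<longlongrightarrow> z - 0 *\<^sub>R n) (at_right 0)" "((\<lambda>t. z + t *\<^sub>R n) \<longlongrightarrow> z + 0 *\<^sub>R n) (at_right 0)"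
      by (intro tendsto_intros)+
    then have "\<forall>\<^sub>F t in at_right 0. z - t *\<^sub>R n \<in> ?Q" "\<forall>\<^sub>F t in at_right 0. z + t *\<^sub>R n \<in> ?Q"
      using topological_tendstoD[OF _ o] zQ by fastforce+
    moreover have "\<forall>\<^sub>F t in at_right 0. t > (0::real)" by (simp add: eventually_at_right_less)
    ultimately show ?thesis
    proof eventually_elim
      case (elim t)
      then show ?case
        using star_cell_side[OF E nb(4,2), of "z - t *\<^sub>R n"] star_cell_side[OF E nb(4,2), of "z + t *\<^sub>R n"]
        by (simp add: inner_diff_right inner_add_right nn nz)
    qed
  qed
  show "z \<in> E ==> \<forall>\<^sub>F t in at_right 0. z - t *\<^sub>R n \<in> K \<and> z + t *\<^sub>R n \<notin> K" by (rule ev)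
  show "outward_normal K E = n"
    unfolding outward_normal_def
  proof (rule the_equality)
    show "norm n = 1 \<and> (\<exists>b. E \<subseteq> {x. n \<bullet> x = b}) \<and>
      (\<forall>x\<in>E. \<forall>\<^sub>F t in at_right 0. x - t *\<^sub>R n \<in> K \<and> x + t *\<^sub>R n \<notin> K)"
      using nb(1) sH ev by blast
    fix n' assume n': "norm n' = 1 \<and> (\<exists>b. E \<subseteq> {x. n' \<bullet> x = b}) \<and>
      (\<forall>x\<in>E. \<forall>\<^sub>F t in at_right 0. x - t *\<^sub>R n' \<in> K \<and> x + t *\<^sub>R n' \<notin> K)"
    then obtain b' where b': "E \<subseteq> {x. n' \<bullet> x = b'}" by auto
    then have "{z. n \<bullet> z = b} \<subseteq> {z. n' \<bullet> z = b'}"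
      unfolding nb(2)[symmetric] by (intro hull_minimal affine_hyperplane)
    then have "n' = n \<or> n' = - n" using hyperplane_normal_unique n' nb(1) by blast
    \<comment> \<open>The opposite sign would put \<open>z + t n\<close> both into \<open>K\<close>
      and outside it for small \<open>t\<close>.\<close>
    moreover have "n' \<noteq> - n"
    proof
      assume m: "n' = - n"
      obtain z where z: "z \<in> E" using star_cell_face(2)[OF E] by auto
      then have "\<forall>\<^sub>F t in at_right 0. z + t *\<^sub>R n \<in> K"
        using n' m by (auto elim!: eventually_mono dest!: bspec[where x=z])
      with ev[OF z] have "\<forall>\<^sub>F t in at_right (0::real). False" by eventually_elim simp
      then show False by simp
    qed
    ultimately show "n' = n" by simp
  qed
qed

lemma star_cell_normal:
  assumes "E \<in> Fs"
  obtains b where "norm (outward_normal K E) = 1" "affine hull E = {z. outward_normal K E \<bullet> z = b}"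
    "openin (top_of_set {z. outward_normal K E \<bullet> z = b}) E" "outward_normal K E \<bullet> x < b"
    "\<And>z. z \<in> E ==> \<forall>\<^sub>F t in at_right 0. z - t *\<^sub>R outward_normal K E \<in> K \<and> z + t *\<^sub>R outward_normal K E \<notin> K"
proof -
  obtain n b where nb: "norm n = 1" "affine hull E = {z. n \<bullet> z = b}"
    "openin (top_of_set {z. n \<bullet> z = b}) E" "n \<bullet> x < b"
    by (rule cell_face_hyperplane[OF star_cell_face(1)[OF assms] star_cell_face(4)[OF assms]])
  show ?thesis using that[of b] star_cell_outward_normal[OF assms nb] nb by auto
qed

text \<open>At a frontier point \<open>z\<close> of a segment issued from \<open>y\<close>, both the segment and the ray from \<open>x\<close>
  leave the hyperplanes of all faces around \<open>z\<close> towards the same side, and the ray leaves \<open>K\<close>.\<close>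

lemma star_cell_other_point:
  assumes y: "y \<in> K" and ny: "\<And>E n b. E \<in> Fs ==> affine hull E = {z. n \<bullet> z = b} ==> n \<bullet> x < b ==> n \<bullet> y < b"
  shows "star_cell K Fs y"
proof -
  have "closed_segment y p \<subseteq> K" if p: "p \<in> K" for p
  proof (rule ccontr)
    assume "\<not> closed_segment y p \<subseteq> K"
    then obtain t1 where t1: "0 \<le> t1" "t1 \<le> 1" "(1 - t1) *\<^sub>R y + t1 *\<^sub>R p \<notin> K"
      by (auto simp: closed_segment_def)
    then have t1K: "y + t1 *\<^sub>R (p - y) \<notin> K" by (simp add: algebra_simps)
    define S where "S = {0..1} \<inter> (\<lambda>t. y + t *\<^sub>R (p - y)) -` (- K)"
    have "closed S" unfolding S_def using star_cell_open
      by (intro continuous_closed_preimage continuous_intros) auto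
    moreover have "S \<subseteq> {0..1}" by (auto simp: S_def)
    ultimately have cS: "compact S" by (metis bounded_subset compact_eq_bounded_closed bounded_closed_interval)
    have "S \<noteq> {}" using t1 t1K by (auto simp: S_def)
    \<comment> \<open>The last parameter outside \<open>K\<close>, which exists by compactness:
      behind it the segment runs inside \<open>K\<close> up to \<open>p\<close>.\<close>
    then obtain t0 where t0: "t0 \<in> S" "\<And>t. t \<in> S ==> t \<le> t0"
      using compact_attains_sup[OF cS] by blast
    define z where "z = y + t0 *\<^sub>R (p - y)"
    have zK: "z \<notin> K" using t0 by (auto simp: S_def z_def)
    have t0l: "0 < t0" "t0 < 1"
    proof -
      have "t0 \<noteq> 0" "t0 \<noteq> 1" using zK y p by (auto simp: z_def)
      then show "0 < t0" "t0 < 1" using t0(1) by (auto simp: S_def)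
    qed
    define w where "w = p - y"
    have wK: "z + e *\<^sub>R w \<in> K" if "0 < e" "e < 1 - t0" for e
    proof -
      have "t0 + e \<notin> S" using t0(2)[of "t0 + e"] that by auto
      then show ?thesis using that t0l by (auto simp: S_def z_def w_def algebra_simps)
    qed
    have "z \<in> closure K"
    proof -
      have "((\<lambda>e. z + e *\<^sub>R w) \<longlongrightarrow> z + 0 *\<^sub>R w) (at_right 0)" by (intro tendsto_intros)
      moreover have "\<forall>\<^sub>F e in at_right 0. z + e *\<^sub>R w \<in> closure K"
        using eventually_at_right_real[of 0 "1 - t0"] t0l wK closure_subset[of K]
        by (auto elim!: eventually_mono)
      ultimately show ?thesis using Lim_in_closed_set[OF closed_closure, of "\<lambda>e. z + e *\<^sub>R w"] by auto
    qed
    then have zf: "z \<in> frontier K" using zK star_cell_open by (simp add: frontier_def interior_open)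
    define r where "r = z - x"
    \<comment> \<open>The part of the frontier on faces whose closure misses \<open>z\<close>. A
      small ball around \<open>z\<close> avoids it, so only hyperplanes through \<open>z\<close>
      matter there.\<close>
    define far where "far = (\<Union>E\<in>{E\<in>Fs. z \<notin> closure E}. closure E)"
    have "closed far" unfolding far_def using sc by (intro closed_UN) (auto simp: star_cell_def)
    moreover have "z \<notin> far" by (auto simp: far_def)
    ultimately obtain \<delta> where \<delta>: "\<delta> > 0" "ball z \<delta> \<inter> far = {}"
      by (metis open_Compl ComplI disjoint_eq_subset_Compl openE inf_commute)
    \<comment> \<open>So small that \<open>z + e w\<close> still precedes \<open>p\<close> on the
      segment and that all convex combinations of \<open>z + e r\<close> and \<open>z + e w\<close>
      stay in the ball of radius \<delta>.\<close>
    define e where "e = min ((1 - t0) / 2) (\<delta> / (2 * (norm r + norm w + 1)))"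
    have "0 < norm r + norm w + 1" by (simp add: add_nonneg_pos)
    then have e: "0 < e" using \<delta> t0l unfolding e_def by (simp only: min_less_iff_conj) simp
    have "e \<le> (1 - t0) / 2" unfolding e_def by (rule min.cobounded1)
    then have e1: "e < 1 - t0" using t0l by simp
    have e2: "e * (norm r + norm w) < \<delta>"
    proof -
      have "e * (norm r + norm w) \<le> e * (norm r + norm w + 1)"
        using e by (intro mult_left_mono) auto
      also have "\<dots> \<le> \<delta> / (2 * (norm r + norm w + 1)) * (norm r + norm w + 1)"
        by (intro mult_right_mono) (auto simp: e_def)
      also have "\<dots> = \<delta> / 2" using \<open>0 < norm r + norm w + 1\<close> by (simp add: field_simps)
      also have "\<dots> < \<delta>" using \<delta> by simp
      finally show ?thesis .
    qed
    \<comment> \<open>One end of \<open>?P\<close> lies in \<open>K\<close>, the other outside. By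
      connectedness \<open>?P\<close> would meet the frontier, which is refuted next.\<close>
    let ?P = "closed_segment (z + e *\<^sub>R r) (z + e *\<^sub>R w)"
    have "?P \<inter> frontier K = {}"
    proof (rule ccontr)
      assume "?P \<inter> frontier K \<noteq> {}"
      then obtain u where u: "0 \<le> u" "u \<le> 1" and fr: "(1 - u) *\<^sub>R (z + e *\<^sub>R r) + u *\<^sub>R (z + e *\<^sub>R w) \<in> frontier K"
        by (auto simp: closed_segment_def)
      define q where "q = z + e *\<^sub>R ((1 - u) *\<^sub>R r + u *\<^sub>R w)"
      have "(1 - u) *\<^sub>R (z + e *\<^sub>R r) + u *\<^sub>R (z + e *\<^sub>R w) = q" by (simp add: q_def algebra_simps)
      then obtain E where E: "E \<in> Fs" "q \<in> closure E" using fr sc by (auto simp: star_cell_def)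
      have "norm ((1 - u) *\<^sub>R r + u *\<^sub>R w) \<le> norm r + norm w"
      proof -
        have "norm ((1 - u) *\<^sub>R r + u *\<^sub>R w) \<le> (1 - u) * norm r + u * norm w"
          using u by (metis (no_types, opaque_lifting) norm_triangle_ineq norm_scaleR abs_of_nonneg diff_ge_0_iff_ge)
        also have "\<dots> \<le> 1 * norm r + 1 * norm w" using u by (intro add_mono mult_right_mono) auto
        finally show ?thesis by simp
      qed
      then have "norm (q - z) < \<delta>" using e2 e
        by (simp add: q_def) (smt (verit) mult_left_mono)
      then have "q \<in> ball z \<delta>" by (simp add: dist_norm norm_minus_commute)
      then have zc: "z \<in> closure E" using \<delta> E by (auto simp: far_def)
      obtain n b where nb: "affine hull E = {z. n \<bullet> z = b}" "n \<bullet> x < b"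
        by (rule cell_face_hyperplane[OF star_cell_face(1)[OF E(1)] star_cell_face(4)[OF E(1)]])
      have nz: "n \<bullet> z = b" and nq: "n \<bullet> q = b" using star_cell_closure_face[OF E(1) _ nb(1)] zc E by auto
      \<comment> \<open>Since \<open>z\<close> is reached from \<open>y\<close> in the direction
        \<open>w\<close> and lies on the hyperplane, \<open>w\<close> points strictly upwards; so
        does \<open>r\<close>, as \<open>x\<close> lies below. No combination of them can stay on
        the hyperplane.\<close>
      have "n \<bullet> y < b" by (rule ny[OF E(1) nb])
      then have "t0 * (n \<bullet> w) > 0" using nz by (simp add: z_def w_def inner_add_right)
      then have nw: "n \<bullet> w > 0" using t0l by (simp add: zero_less_mult_iff)
      have nr: "n \<bullet> r > 0" using nz nb by (simp add: r_def inner_diff_right)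
      have "e * ((1 - u) * (n \<bullet> r) + u * (n \<bullet> w)) = 0" using nq nz by (simp add: q_def inner_add_right)
      moreover have "(1 - u) * (n \<bullet> r) + u * (n \<bullet> w) > 0"
        using u nr nw by (cases "u = 0") (auto intro!: add_nonneg_pos)
      ultimately show False using e by simp
    qed
    moreover have "z + e *\<^sub>R w \<in> ?P \<inter> K" using wK e e1 by auto
    moreover have "z + e *\<^sub>R r \<in> ?P - K"
    proof -
      have "x + (1 + e) *\<^sub>R (z - x) \<notin> closure K" using e by (intro star_cell_outside zf) auto
      moreover have "x + (1 + e) *\<^sub>R (z - x) = z + e *\<^sub>R r" by (simp add: r_def algebra_simps)
      ultimately show ?thesis using closure_subset[of K] by auto
    qed
    ultimately show False using connected_Int_frontier[of ?P K] by blast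
  qed
  moreover have "y \<notin> affine hull E" if E: "E \<in> Fs" for E
  proof -
    obtain n b where nb: "affine hull E = {z. n \<bullet> z = b}" "n \<bullet> x < b"
      by (rule cell_face_hyperplane[OF star_cell_face(1)[OF E] star_cell_face(4)[OF E]])
    then show ?thesis using ny[OF E nb] by auto
  qed
  ultimately show ?thesis using sc y unfolding star_cell_def star_shaped_def by metis
qed

end

section \<open>Faces, cone decomposition and the divergence theorem\<close>

lemma star_cell_normal_norm:
  assumes "star_cell K Fs x" "E \<in> Fs"
  shows "norm (outward_normal K E) = 1"
  by (rule star_cell_normal[OF assms])

lemma star_cell_normal_halfspace:
  assumes "star_cell K Fs x" "E \<in> Fs"
  shows "\<exists>b. affine hull E = {z. outward_normal K E \<bullet> z = b} \<and> outward_normal K E \<bullet> x < b"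
  by (rule star_cell_normal[OF assms]) blast

text \<open>The null sets of the surface measure are Borel sets, so \<open>E\<close> is a closed set
  minus a Borel set.\<close>

lemma face_borel_bounded:
  assumes sc: "star_cell K Fs x" and E: "E \<in> Fs"
  shows "E \<in> sets borel" "bounded E" "closure E - E \<in> null_sets (surface_measure (affine hull E))"
proof -
  show 3: "closure E - E \<in> null_sets (surface_measure (affine hull E))"
    using star_cell_face(1)[OF sc E] unfolding cell_face_def by metis
  have "closure E - E \<in> sets borel" using 3 by (auto dest: null_setsD2)
  then have "closure E - (closure E - E) \<in> sets borel" by (rule sets.Diff[OF borel_closed[OF closed_closure]])
  moreover have "closure E - (closure E - E) = E" using closure_subset[of E] by auto
  ultimately show "E \<in> sets borel" by metis
  have "bounded K" using sc unfolding star_cell_def by metis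
  then have "bounded (frontier K)" unfolding frontier_def by (rule bounded_subset[OF bounded_closure Diff_subset])
  then show "bounded E" using star_cell_face(3)[OF sc E] by (rule bounded_subset)
qed

text \<open>The slab over \<open>E\<close> contains a non-empty open set: the preimage of an open
  set under the orthogonal projection, cut by two open half-spaces.\<close>

lemma area_pos:
  fixes n :: "real^'d"
  assumes n: "norm n = 1" and aff: "affine hull E = {z. n \<bullet> z = b}"
    and o: "openin (top_of_set {z. n \<bullet> z = b}) E" and ne: "E \<noteq> {}"
    and [measurable]: "E \<in> sets borel" and b: "bounded E"
  shows "0 < area E"
proof -
  have nn: "n \<bullet> n = 1" using n by (simp add: norm_eq_1)
  obtain T where T: "open T" "E = {z. n \<bullet> z = b} \<inter> T" using o by (auto simp: openin_open)
  obtain s where s: "s \<in> E" using ne by auto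
  let ?P = "\<lambda>x. x - (n \<bullet> x - b) *\<^sub>R n"
  let ?S = "{x. n \<bullet> x - b \<in> {-1/2..1/2} \<and> ?P x \<in> E}"
  let ?U = "{x. n \<bullet> x < b + 1/2} \<inter> {x. b - 1/2 < n \<bullet> x} \<inter> ?P -` T"
  have "open ?U"
    by (intro open_Int open_vimage open_halfspace_lt open_halfspace_gt T continuous_intros)
  moreover have "s \<in> ?U" using s T by auto
  ultimately have "\<not> negligible ?U" "?U \<in> sets borel" using open_not_negligible[of ?U] by auto
  then have "0 < emeasure lborel ?U"
    by (auto simp: negligible_iff_null_sets null_sets_def zero_less_iff_neq_zero)
  also have "emeasure lborel ?U \<le> emeasure lborel ?S"
  proof (rule emeasure_mono)
    show "?U \<subseteq> ?S" using T nn by (auto simp: inner_diff_right)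
    have [measurable]: "?P \<in> borel_measurable borel" by measurable
    show "?S \<in> sets lborel" by measurable
  qed
  also have "\<dots> = emeasure (surface_measure {z. n \<bullet> z = b}) E"
    by (subst emeasure_lborel_slab[OF n]) auto
  finally show ?thesis
    unfolding area_def measure_def aff using emeasure_surface_measure_bounded[OF n _ b, of b]
    by (simp add: enn2real_positive_iff)
qed

text \<open>Turns first moments over a face into values at the barycentre. The bound holds because
  an average is no farther from \<open>y\<close> than the averaged points.\<close>

lemma barycentre_inner:
  fixes n :: "real^'d"
  assumes n: "norm n = 1" and aff: "affine hull E = {z. n \<bullet> z = b}"
    and [measurable]: "E \<in> sets borel" and b: "bounded E" and a: "area E > 0"
  shows "(LINT s:E|surface_measure {z. n \<bullet> z = b}. e \<bullet> (s - y)) = area E * (e \<bullet> (barycentre E - y))"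
    and "(\<And>s. s \<in> E ==> norm (s - y) \<le> D) ==> norm (barycentre E - y) \<le> D"
proof -
  let ?\<mu> = "surface_measure {z. n \<bullet> z = b}"
  have fin: "emeasure ?\<mu> E < \<infinity>" by (rule emeasure_surface_measure_bounded[OF n _ b]) simp
  have ar: "area E = measure ?\<mu> E" by (simp add: area_def aff)
  have int: "set_integrable ?\<mu> E g" if g[measurable]: "g \<in> borel_measurable borel" and "\<And>s. s \<in> E ==> norm (g s) \<le> B"
    for B and g :: "real^'d => real^'d"
    unfolding set_integrable_def
    by (rule integrableI_bounded_set[where A=E and B=B])
       (use fin that in \<open>auto intro!: AE_I2 simp: indicator_def\<close>)
  obtain R where R: "\<And>s. s \<in> E ==> norm s \<le> R" using b unfolding bounded_iff by auto
  have i1: "set_integrable ?\<mu> E (\<lambda>s. s)" by (rule int[OF _ R]) auto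
  have i2: "set_integrable ?\<mu> E (\<lambda>s. c)" for c :: "real^'d" by (rule int[where B="norm c"]) auto
  have I: "(LINT s:E|?\<mu>. s - y) = area E *\<^sub>R (barycentre E - y)"
  proof -
    have "(LINT s:E|?\<mu>. s - y) = (LINT s:E|?\<mu>. s) - (LINT s:E|?\<mu>. y)"
      by (rule set_integral_diff(2)[OF i1 i2])
    also have "(LINT s:E|?\<mu>. y) = area E *\<^sub>R y"
      unfolding ar set_lebesgue_integral_def using fin
      by (subst integral_scaleR_left) (auto simp: integrable_real_indicator)
    also have "(LINT s:E|?\<mu>. s) = area E *\<^sub>R barycentre E"
      using a by (simp add: barycentre_def aff)
    finally show ?thesis by (simp add: scaleR_diff_right)
  qed
  have i3: "set_integrable ?\<mu> E (\<lambda>s. s - y)" by (rule set_integral_diff(1)[OF i1 i2])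
  have "(LINT s:E|?\<mu>. e \<bullet> (s - y)) = e \<bullet> (LINT s:E|?\<mu>. s - y)"
    using i3 unfolding set_lebesgue_integral_def set_integrable_def
    by (subst integral_inner_right[symmetric]) auto
  then show "(LINT s:E|?\<mu>. e \<bullet> (s - y)) = area E * (e \<bullet> (barycentre E - y))" unfolding I by simp
  assume D: "\<And>s. s \<in> E ==> norm (s - y) \<le> D"
  have "area E * norm (barycentre E - y) = norm (LINT s:E|?\<mu>. s - y)" unfolding I using a by simp
  also have "\<dots> \<le> (LINT s:E|?\<mu>. norm (s - y))" by (rule set_integral_norm_bound[OF i3])
  also have "\<dots> \<le> (LINT s:E|?\<mu>. D)"
  proof (rule set_integral_mono[OF set_integrable_norm[OF i3]])
    show "set_integrable ?\<mu> E (\<lambda>s. D)"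
      unfolding set_integrable_def using fin by (auto simp: integrable_real_indicator)
  qed (rule D)
  also have "\<dots> = area E * D" by (simp add: set_lebesgue_integral_def ar)
  finally show "norm (barycentre E - y) \<le> D" using a by simp
qed

text \<open>Two cones sharing a point would give two frontier points on one ray, hence the same
  point in two disjoint faces. Conversely every point of \<open>K\<close> other than
  \<open>x\<close> is prolonged along its ray to the frontier. Rays that end in
  \<open>closure E - E\<close> fill a cone over a null set, of volume zero by
  \<open>emeasure_cone\<close>.\<close>

lemma star_cell_cones:
  fixes K :: "(real^'d) set"
  assumes sc: "star_cell K Fs x"
    and b: "\<And>E. E \<in> Fs ==> affine hull E = {z. outward_normal K E \<bullet> z = b E}"
      "\<And>E. E \<in> Fs ==> outward_normal K E \<bullet> x < b E"
  shows "AE p in lborel. indicator K p = (\<Sum>E\<in>Fs. indicator (cone (outward_normal K E) (b E) x E) p :: real)"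
proof -
  let ?n = "outward_normal K" and ?C = "\<lambda>E. cone (outward_normal K E) (b E) x"
  have fin: "finite Fs" and dj: "disjoint Fs" and bK: "bounded K"
    using sc unfolding star_cell_def by metis+
  have xK: "x \<in> K" and oK: "open K" using star_cell_in[OF sc] star_cell_open[OF sc] .
  have n1: "norm (?n E) = 1" if "E \<in> Fs" for E by (rule star_cell_normal_norm[OF sc that])
  have H: "E \<subseteq> {z. ?n E \<bullet> z = b E}" if "E \<in> Fs" for E using b(1)[OF that] hull_subset[of E affine] by simp
  have CK: "?C E E \<subseteq> K" if "E \<in> Fs" for E
    using star_cell_side[OF sc that b(2)[OF that] b(1)[OF that]] by (auto simp: cone_def)
  have C_eq: "E = \<tau>" if E: "E \<in> Fs" "p \<in> ?C E E" and \<tau>: "\<tau> \<in> Fs" "p \<in> ?C \<tau> \<tau>" for E \<tau> p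
  proof -
    obtain t s where t: "0 < t" "t < 1" "s \<in> E" "p = x + t *\<^sub>R (s - x)"
      by (rule cone_param[OF b(2)[OF E(1)] E(2) H[OF E(1)]])
    obtain t' s' where t': "0 < t'" "t' < 1" "s' \<in> \<tau>" "p = x + t' *\<^sub>R (s' - x)"
      by (rule cone_param[OF b(2)[OF \<tau>(1)] \<tau>(2) H[OF \<tau>(1)]])
    have fr: "s \<in> frontier K" "s' \<in> frontier K"
      using star_cell_face(3)[OF sc] t t' E \<tau> by auto
    have "t *\<^sub>R (s - x) = t' *\<^sub>R (s' - x)" using t t' by simp
    then have "(1 / t') *\<^sub>R (t *\<^sub>R (s - x)) = s' - x" using t' by simp
    then have e: "s' = x + (t / t') *\<^sub>R (s - x)" by simp
    then have "t / t' = 1" using t t' fr by (intro star_cell_frontier_unique[OF sc fr(1)]) auto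
    then have "s' = s" using e by simp
    then show ?thesis using t t' dj E \<tau> by (auto simp: disjoint_def)
  qed
  have cover: "p = x \<or> (\<exists>E\<in>Fs. p \<in> ?C E E) \<or> (\<exists>E\<in>Fs. p \<in> ?C E (closure E - E))" if p: "p \<in> K" for p
  proof (cases "p = x")
    case False
    have "x \<in> interior K" using xK oK by (simp add: interior_open)
    then obtain d where d: "0 < d" "x + d *\<^sub>R (p - x) \<in> frontier K"
      using ray_to_frontier[OF bK, of x "p - x"] False by auto
    have d1: "1 < d"
    proof (rule ccontr)
      assume "\<not> 1 < d"
      then have "x + d *\<^sub>R (p - x) \<in> K" using d by (intro star_cell_segment[OF sc p]) auto
      then show False using d star_cell_frontier_notin[OF sc] by auto
    qed
    define z where "z = x + d *\<^sub>R (p - x)"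
    obtain E where E: "E \<in> Fs" "z \<in> closure E" using d(2) star_cell_frontier[OF sc] by (auto simp: z_def)
    have nz: "?n E \<bullet> z = b E" by (rule star_cell_closure_face[OF sc E b(1)[OF E(1)]])
    have pz: "x + (1 / d) *\<^sub>R (z - x) = p" using d by (simp add: z_def)
    have pA: "p \<in> ?C E A" if "z \<in> A" for A
      using cone_paramI[OF b(2)[OF E(1)] _ _ that nz, of "1 / d"] d1 unfolding pz by simp
    show ?thesis
    proof (cases "z \<in> E")
      case True
      then show ?thesis using pA[OF True] E(1) by (intro disjI2 disjI1 bexI)
    next
      case False
      then have "z \<in> closure E - E" using E(2) by simp
      from pA[OF this] show ?thesis using E(1) by (intro disjI2 bexI)
    qed
  qed simp
  have null: "?C E (closure E - E) \<in> null_sets lborel" if E: "E \<in> Fs" for E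
  proof -
    note fb = face_borel_bounded[OF sc E]
    have m: "closure E - E \<in> sets borel" using fb by auto
    have "emeasure lborel (?C E (closure E - E)) = 0"
      using fb(3) unfolding emeasure_cone[OF n1[OF E] b(2)[OF E] m] b(1)[OF E, symmetric]
      by auto
    then show ?thesis using m by (intro null_setsI) auto
  qed
  have "AE p in lborel. p \<notin> ?C E (closure E - E)" if "E \<in> Fs" for E
    using null[OF that] by (rule AE_not_in)
  then have "AE p in lborel. \<forall>E\<in>Fs. p \<notin> ?C E (closure E - E)" using fin by (simp add: AE_finite_all)
  with AE_lborel_singleton[of x] show ?thesis
  proof eventually_elim
    case (elim p)
    show ?case
    proof (cases "p \<in> K")
      case True
      then obtain E where E: "E \<in> Fs" "p \<in> ?C E E" using cover elim by blast
      have "(\<Sum>\<tau>\<in>Fs. indicator (?C \<tau> \<tau>) p :: real) = (\<Sum>\<tau>\<in>Fs. if \<tau> = E then 1 else 0)"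
        using C_eq E by (intro sum.cong) (auto simp: indicator_def)
      then show ?thesis using True E fin by simp
    next
      case False
      then have "(\<Sum>\<tau>\<in>Fs. indicator (?C \<tau> \<tau>) p :: real) = 0"
        using CK by (intro sum.neutral) (auto simp: indicator_def)
      then show ?thesis using False by simp
    qed
  qed
qed

lemma star_cell_volume_moment:
  fixes K :: "(real^'d) set"
  assumes sc: "star_cell K Fs x"
    and b: "\<And>E. E \<in> Fs ==> affine hull E = {z. outward_normal K E \<bullet> z = b E}"
      "\<And>E. E \<in> Fs ==> outward_normal K E \<bullet> x < b E"
  shows "real CARD('d) * vol K = (\<Sum>E\<in>Fs. area E * (b E - outward_normal K E \<bullet> x))"
    and "(real CARD('d) + 1) * (LINT p:K|lborel. e \<bullet> (p - x)) =
      (\<Sum>E\<in>Fs. area E * (b E - outward_normal K E \<bullet> x) * (e \<bullet> (barycentre E - x)))"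
proof -
  let ?n = "outward_normal K"
  let ?C = "\<lambda>E. cone (outward_normal K E) (b E) x E"
  have AE: "AE p in lborel. indicator K p = (\<Sum>E\<in>Fs. indicator (?C E) p :: real)"
    by (rule star_cell_cones[OF sc b])
  have fin: "finite Fs" and bK: "bounded K" using sc unfolding star_cell_def by metis+
  have oK[measurable]: "K \<in> sets borel" using star_cell_open[OF sc] by simp
  have n1: "norm (?n E) = 1" and o: "openin (top_of_set {z. ?n E \<bullet> z = b E}) E" if E: "E \<in> Fs" for E
  proof -
    obtain b' where b': "norm (?n E) = 1" "affine hull E = {z. ?n E \<bullet> z = b'}"
      "openin (top_of_set {z. ?n E \<bullet> z = b'}) E" by (rule star_cell_normal[OF sc E])
    then show "norm (?n E) = 1" "openin (top_of_set {z. ?n E \<bullet> z = b E}) E" using b(1)[OF E] by auto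
  qed
  note fb = face_borel_bounded[OF sc]
  have [measurable]: "?C E \<in> sets borel" if "E \<in> Fs" for E using fb(1)[OF that] by measurable
  have ap: "area E > 0" if E: "E \<in> Fs" for E
    by (rule area_pos[OF n1[OF E] b(1)[OF E] o[OF E] star_cell_face(2)[OF sc E] fb(1,2)[OF E]])
  have H: "E \<subseteq> {z. ?n E \<bullet> z = b E}" if "E \<in> Fs" for E using b(1)[OF that] hull_subset[of E affine] by simp
  have emC: "emeasure lborel (?C E) = ennreal ((b E - ?n E \<bullet> x) / CARD('d) * area E)" if E: "E \<in> Fs" for E
  proof -
    have "emeasure (surface_measure {z. ?n E \<bullet> z = b E}) E = ennreal (area E)"
      unfolding area_def b(1)[OF E]
      using emeasure_surface_measure_bounded[OF n1[OF E] fb(1,2)[OF E], of "b E"]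
      by (intro emeasure_eq_ennreal_measure) auto
    then show ?thesis
      unfolding emeasure_cone[OF n1[OF E] b(2)[OF E] fb(1)[OF E]]
      using b(2)[OF E] by (simp add: ennreal_mult'[symmetric])
  qed
  have finC: "emeasure lborel (?C E) < \<infinity>" if "E \<in> Fs" for E using emC[OF that] by simp
  have "vol K = measure lborel K" unfolding vol_def by simp
  also have "\<dots> = (LBINT p. indicator K p)" by simp
  also have "\<dots> = (LBINT p. (\<Sum>E\<in>Fs. indicator (?C E) p))"
    by (rule integral_cong_AE) (use AE in auto)
  also have "\<dots> = (\<Sum>E\<in>Fs. measure lborel (?C E))"
    using finC by (subst Bochner_Integration.integral_sum) (auto simp: integrable_real_indicator)
  also have "\<dots> = (\<Sum>E\<in>Fs. (b E - ?n E \<bullet> x) / CARD('d) * area E)"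
    using b(2) ap by (intro sum.cong refl) (simp add: measure_def emC less_imp_le)
  finally show "real CARD('d) * vol K = (\<Sum>E\<in>Fs. area E * (b E - ?n E \<bullet> x))"
    by (simp add: sum_distrib_left) (intro sum.cong, auto)
  obtain R where R: "\<And>p. p \<in> K ==> norm (p - x) \<le> R"
    using bounded_translation[OF bK, of "-x"] unfolding bounded_iff by auto
  have CK: "?C E \<subseteq> K" if "E \<in> Fs" for E
    using star_cell_side[OF sc that b(2)[OF that] b(1)[OF that]] by (auto simp: cone_def)
  have int: "integrable lborel (\<lambda>p. indicator (?C E) p * (e \<bullet> (p - x)))" if E: "E \<in> Fs" for E
  proof (rule integrableI_bounded_set[where A="?C E" and B="norm e * R"])
    show "AE p\<in>?C E in lborel. norm (indicator (?C E) p * (e \<bullet> (p - x))) \<le> norm e * R"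
    proof (intro AE_I2 impI)
      fix p assume "p \<in> ?C E"
      then have "norm (p - x) \<le> R" using CK[OF E] R by auto
      then show "norm (indicator (?C E) p * (e \<bullet> (p - x))) \<le> norm e * R"
        using Cauchy_Schwarz_ineq2[of e "p - x"] mult_left_mono[of "norm (p - x)" R "norm e"]
        by (auto simp: indicator_def abs_mult)
    qed
  qed (use E finC in auto)
  have "(LINT p:K|lborel. e \<bullet> (p - x)) = (LBINT p. (\<Sum>E\<in>Fs. indicator (?C E) p * (e \<bullet> (p - x))))"
    unfolding set_lebesgue_integral_def sum_distrib_right[symmetric]
    by (rule integral_cong_AE) (use AE in \<open>auto elim!: eventually_mono\<close>)
  also have "\<dots> = (\<Sum>E\<in>Fs. LINT p:?C E|lborel. e \<bullet> (p - x))"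
    using int by (subst Bochner_Integration.integral_sum) (auto simp: set_lebesgue_integral_def)
  also have "\<dots> = (\<Sum>E\<in>Fs. (b E - ?n E \<bullet> x) / (real CARD('d) + 1) * (area E * (e \<bullet> (barycentre E - x))))"
    by (intro sum.cong refl, subst first_moment_cone)
       (use n1 b fb H ap in \<open>auto simp: barycentre_inner(1)\<close>)
  finally show "(real CARD('d) + 1) * (LINT p:K|lborel. e \<bullet> (p - x)) =
      (\<Sum>E\<in>Fs. area E * (b E - ?n E \<bullet> x) * (e \<bullet> (barycentre E - x)))"
    by (simp add: sum_distrib_left) (intro sum.cong, auto)
qed

lemma ball_functional_zero:
  assumes "linear g" "\<delta> > 0" and "\<And>\<xi>::'a::real_normed_vector. norm \<xi> < \<delta> ==> g \<xi> = (0::real)"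
  shows "g \<xi> = 0"
proof (cases "\<xi> = 0")
  case True then show ?thesis using linear_0[OF assms(1)] by simp
next
  case False
  define c where "c = \<delta> / (2 * norm \<xi>)"
  have "c > 0" using False assms(2) by (simp add: c_def)
  have "norm (c *\<^sub>R \<xi>) < \<delta>" using False assms(2) by (simp add: c_def)
  then have "g (c *\<^sub>R \<xi>) = 0" by (rule assms(3))
  then show ?thesis using \<open>c > 0\<close> linear_cmul[OF assms(1), of c \<xi>] by simp
qed

text \<open>Both identities come from the fact that the left-hand sides of the cone decompositions do not
  depend on the vertex \<open>y\<close>, which can be moved in a neighbourhood of \<open>x\<close>.\<close>

lemma star_cell_divergence:
  fixes K :: "(real^'d) set"
  assumes sc: "star_cell K Fs x"
  shows "(\<Sum>E\<in>Fs. area E * (outward_normal K E \<bullet> \<xi>)) = 0"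
    and "(\<Sum>E\<in>Fs. area E * (outward_normal K E \<bullet> \<xi>) * (e \<bullet> barycentre E)) = vol K * (e \<bullet> \<xi>)"
proof -
  let ?n = "outward_normal K"
  let ?M = "\<lambda>\<xi>. \<Sum>E\<in>Fs. area E * (?n E \<bullet> \<xi>) * (e \<bullet> barycentre E)"
  have "\<forall>E\<in>Fs. \<exists>b. affine hull E = {z. ?n E \<bullet> z = b} \<and> ?n E \<bullet> x < b"
    using star_cell_normal_halfspace[OF sc] by blast
  then obtain b where b: "\<And>E. E \<in> Fs ==> affine hull E = {z. ?n E \<bullet> z = b E}"
     "\<And>E. E \<in> Fs ==> ?n E \<bullet> x < b E" by metis
  have fin: "finite Fs" using sc unfolding star_cell_def by metis
  have bK: "bounded K" using sc unfolding star_cell_def by metis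
  have n1: "norm (?n E) = 1" if "E \<in> Fs" for E by (rule star_cell_normal_norm[OF sc that])
  let ?L = "\<lambda>x. \<Sum>E\<in>Fs. area E * (b E - ?n E \<bullet> x) * (e \<bullet> (barycentre E - x))"
  obtain \<delta>1 where \<delta>1: "\<delta>1 > 0" "ball x \<delta>1 \<subseteq> K"
    using star_cell_in[OF sc] star_cell_open[OF sc] by (meson openE)
  \<comment> \<open>Within this radius the displaced centre stays in \<open>K\<close> and on the
    inner side of every face.\<close>
  define \<delta> where "\<delta> = Min (insert \<delta>1 ((\<lambda>E. b E - ?n E \<bullet> x) ` Fs))"
  have \<delta>: "\<delta> > 0" "\<delta> \<le> \<delta>1" "\<And>E. E \<in> Fs ==> \<delta> \<le> b E - ?n E \<bullet> x"
    using fin \<delta>1 b(2) by (auto simp: \<delta>_def)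
  have near: "star_cell K Fs (x + \<xi>)" and near2: "\<And>E. E \<in> Fs ==> ?n E \<bullet> (x + \<xi>) < b E" if \<xi>: "norm \<xi> < \<delta>" for \<xi>
  proof -
    show nb: "?n E \<bullet> (x + \<xi>) < b E" if "E \<in> Fs" for E
      using Cauchy_Schwarz_ineq2[of "?n E" \<xi>] n1[OF that] \<xi> \<delta>(3)[OF that] by (simp add: inner_add_right)
    show "star_cell K Fs (x + \<xi>)"
    proof (rule star_cell_other_point[OF sc])
      show "x + \<xi> \<in> K" using \<delta>1 \<delta> \<xi> by (auto simp: subset_iff dist_norm)
      \<comment> \<open>The side condition has to hold for every equation of the hyperplane. If it
        failed for one of them, the segment from \<open>x\<close> to the displaced centre would
        cross the hyperplane, which the equation with the outward normal excludes.\<close>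
      fix E n c assume E: "E \<in> Fs" and aff: "affine hull E = {z. n \<bullet> z = c}" and nx: "n \<bullet> x < c"
      show "n \<bullet> (x + \<xi>) < c"
      proof (rule ccontr)
        assume "\<not> n \<bullet> (x + \<xi>) < c"
        then have ge: "n \<bullet> \<xi> \<ge> c - n \<bullet> x" "n \<bullet> \<xi> > 0" using nx by (auto simp: inner_add_right)
        define t where "t = (c - n \<bullet> x) / (n \<bullet> \<xi>)"
        have t: "0 \<le> t" "t \<le> 1" using ge nx by (auto simp: t_def)
        have "n \<bullet> (x + t *\<^sub>R \<xi>) = c" using ge by (simp add: inner_add_right t_def)
        then have "?n E \<bullet> (x + t *\<^sub>R \<xi>) = b E" using b(1)[OF E] aff by auto
        moreover have "?n E \<bullet> (x + t *\<^sub>R \<xi>) = (1 - t) * (?n E \<bullet> x) + t * (?n E \<bullet> (x + \<xi>))"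
          by (simp add: inner_add_right algebra_simps)
        moreover have "\<dots> < b E"
          using convex_bound_lt[of "?n E \<bullet> x" "b E" "?n E \<bullet> (x + \<xi>)" "1 - t" t] nb[OF E] b(2)[OF E] t by simp
        ultimately show False by simp
      qed
    qed
  qed
  have V: "real CARD('d) * vol K = (\<Sum>E\<in>Fs. area E * (b E - ?n E \<bullet> (x + \<xi>)))" if "norm \<xi> < \<delta>" for \<xi>
    by (rule star_cell_volume_moment(1)[OF near[OF that] b(1) near2[OF that]])
  have M: "(real CARD('d) + 1) * (LINT p:K|lborel. e \<bullet> (p - (x + \<xi>))) =
      ?L (x + \<xi>)" if "norm \<xi> < \<delta>" for \<xi>
    by (rule star_cell_volume_moment(2)[OF near[OF that] b(1) near2[OF that]])
  have lin1: "linear (\<lambda>\<xi>. \<Sum>E\<in>Fs. area E * (?n E \<bullet> \<xi>))"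
    by (rule linearI) (auto simp: inner_add_right sum.distrib sum_distrib_left algebra_simps)
  \<comment> \<open>Difference of the volume identities for the centres \<open>x\<close> and
    \<open>x + \<xi>\<close>, whose left-hand sides agree.\<close>
  have S0: "(\<Sum>E\<in>Fs. area E * (?n E \<bullet> \<xi>)) = 0" for \<xi>
  proof (rule ball_functional_zero[OF lin1 \<delta>(1)])
    fix \<xi> :: "real^'d" assume \<xi>: "norm \<xi> < \<delta>"
    show "(\<Sum>E\<in>Fs. area E * (?n E \<bullet> \<xi>)) = 0"
      using V[OF \<xi>] V[of 0] \<delta>(1)
      by (simp add: inner_add_right diff_add_eq_diff_diff_swap right_diff_distrib distrib_left sum_subtractf sum.distrib)
  qed
  then show "(\<Sum>E\<in>Fs. area E * (?n E \<bullet> \<xi>)) = 0" .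
  have intK: "set_integrable lborel K (\<lambda>p. e \<bullet> (p - x))" "set_integrable lborel K (\<lambda>p. c)" for c :: real
  proof -
    have oK: "K \<in> sets borel" using star_cell_open[OF sc] by simp
    have fK: "emeasure lborel K < \<infinity>" by (rule emeasure_bounded_finite[OF bK])
    obtain R where R: "\<And>p. p \<in> K ==> norm (p - x) \<le> R"
      using bounded_translation[OF bK, of "-x"] unfolding bounded_iff by auto
    show "set_integrable lborel K (\<lambda>p. e \<bullet> (p - x))"
      unfolding set_integrable_def
    proof (rule integrableI_bounded_set[where A="K" and B="norm e * R"])
      show "AE p\<in>K in lborel. norm (indicator K p *\<^sub>R (e \<bullet> (p - x))) \<le> norm e * R"
      proof (intro AE_I2 impI)
        fix p assume "p \<in> K"
        then have "norm (p - x) \<le> R" using R by auto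
        then show "norm (indicator K p *\<^sub>R (e \<bullet> (p - x))) \<le> norm e * R"
          using Cauchy_Schwarz_ineq2[of e "p - x"] mult_left_mono[of "norm (p - x)" R "norm e"]
          by (auto simp: indicator_def abs_mult)
      qed
    qed (use oK fK in auto)
    show "set_integrable lborel K (\<lambda>p. c)"
      unfolding set_integrable_def using oK fK by (auto simp: integrable_real_indicator)
  qed
  have lin2: "linear (\<lambda>\<xi>. ?M \<xi> - vol K * (e \<bullet> \<xi>))"
    by (rule linearI) (auto simp: inner_add_right sum.distrib sum_distrib_left algebra_simps)
  have "?M \<xi> - vol K * (e \<bullet> \<xi>) = 0"
  proof (rule ball_functional_zero[OF lin2 \<delta>(1)])
    fix \<xi> :: "real^'d" assume \<xi>: "norm \<xi> < \<delta>"
    have I: "(LINT p:K|lborel. e \<bullet> (p - (x + \<xi>))) = (LINT p:K|lborel. e \<bullet> (p - x)) - vol K * (e \<bullet> \<xi>)"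
    proof -
      have "(LINT p:K|lborel. e \<bullet> (p - (x + \<xi>))) = (LINT p:K|lborel. e \<bullet> (p - x) - e \<bullet> \<xi>)"
        by (simp add: inner_add_right inner_diff_right algebra_simps)
      also have "\<dots> = (LINT p:K|lborel. e \<bullet> (p - x)) - (LINT p:K|lborel. e \<bullet> \<xi>)"
        by (rule set_integral_diff(2)[OF intK])
      also have "(LINT p:K|lborel. e \<bullet> \<xi>) = vol K * (e \<bullet> \<xi>)"
        using star_cell_open[OF sc] by (simp add: set_lebesgue_integral_def vol_def)
      finally show ?thesis .
    qed
    define I0 where "I0 = (LINT p:K|lborel. e \<bullet> (p - x))"
    have M0: "(real CARD('d) + 1) * I0 = (\<Sum>E\<in>Fs. area E * (b E - ?n E \<bullet> x) * (e \<bullet> (barycentre E - x)))"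
      using M[of 0] \<delta>(1) by (simp add: I0_def)
    have M1: "(real CARD('d) + 1) * (I0 - vol K * (e \<bullet> \<xi>)) =
      ?L (x + \<xi>)"
      using M[OF \<xi>] unfolding I I0_def .
    \<comment> \<open>Expanding at the displaced centre leaves the moment at \<open>x\<close>, the
      sum \<open>?M\<close>, a term killed by \<open>S0\<close> and \<open>d\<close> times the
      volume. Compared with the factor \<open>d + 1\<close> on the other side, exactly one volume
      remains.\<close>
    have "?L (x + \<xi>) =
      (\<Sum>E\<in>Fs. area E * (b E - ?n E \<bullet> x) * (e \<bullet> (barycentre E - x))
         - area E * (?n E \<bullet> \<xi>) * (e \<bullet> barycentre E)
         + (e \<bullet> x) * (area E * (?n E \<bullet> \<xi>))
         - (e \<bullet> \<xi>) * (area E * (b E - ?n E \<bullet> (x + \<xi>))))"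
      by (intro sum.cong refl) (simp add: inner_add_right inner_diff_right algebra_simps)
    also have "\<dots> = (real CARD('d) + 1) * I0 - ?M \<xi>
        - (e \<bullet> \<xi>) * (real CARD('d) * vol K)"
      unfolding sum_subtractf sum.distrib sum_distrib_left[symmetric] V[OF \<xi>, symmetric] S0 M0[symmetric] by simp
    finally show "?M \<xi> - vol K * (e \<bullet> \<xi>) = 0"
      using M1 by (simp add: algebra_simps)
  qed
  then show "?M \<xi> = vol K * (e \<bullet> \<xi>)" by simp
qed

section \<open>Discrete operators and matrices on a cell\<close>

lemma weighted_sum_mult_power2_le:
  fixes a b :: "'a => real"
  assumes "\<And>i. i \<in> I ==> w i > 0"
  shows "(\<Sum>i\<in>I. a i * b i)^2 \<le> (\<Sum>i\<in>I. (a i)^2 / w i) * (\<Sum>i\<in>I. w i * (b i)^2)"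
proof -
  have "(\<Sum>i\<in>I. a i * b i) = (\<Sum>i\<in>I. (a i / sqrt (w i)) * (sqrt (w i) * b i))"
    using assms by (intro sum.cong refl) (auto dest!: assms)
  also have "\<dots>^2 \<le> (\<Sum>i\<in>I. (a i / sqrt (w i))^2) * (\<Sum>i\<in>I. (sqrt (w i) * b i)^2)"
    by (rule Cauchy_Schwarz_ineq_sum)
  also have "(\<Sum>i\<in>I. (a i / sqrt (w i))^2) = (\<Sum>i\<in>I. (a i)^2 / w i)"
    using assms by (intro sum.cong refl) (simp add: power_divide less_imp_le)
  also have "(\<Sum>i\<in>I. (sqrt (w i) * b i)^2) = (\<Sum>i\<in>I. w i * (b i)^2)"
    using assms by (intro sum.cong refl) (simp add: power_mult_distrib less_imp_le)
  finally show ?thesis .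
qed

lemma power2_sum_le: "((x::real) + y)^2 \<le> 2 * x^2 + 2 * y^2"
  using zero_le_power2[of "x - y"] by (simp add: power2_sum power2_diff)

text \<open>Passage between a vector and the part seen by \<open>L_op\<close> or
  \<open>T_op\<close>: \<open>c\<close> is the consistent part and \<open>C\<close> bounds its
  weighted norm.\<close>

lemma weighted_sum_diff_power2_le:
  fixes k x y c :: "'a => real"
  assumes k: "\<And>i. i \<in> I ==> 0 \<le> k i" and x: "\<And>i. i \<in> I ==> x i = y i - c i"
    and C: "(\<Sum>i\<in>I. k i * (c i)^2) \<le> C"
  shows "(\<Sum>i\<in>I. k i * (x i)^2) \<le> 2 * (\<Sum>i\<in>I. k i * (y i)^2) + 2 * C"
    and "(\<Sum>i\<in>I. k i * (y i)^2) \<le> 2 * (\<Sum>i\<in>I. k i * (x i)^2) + 2 * C"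
proof -
  have *: "(\<Sum>i\<in>I. k i * (u i)^2) \<le> 2 * (\<Sum>i\<in>I. k i * (v i)^2) + 2 * C"
    if "\<And>i. i \<in> I ==> (u i)\<^sup>2 \<le> 2 * (v i)^2 + 2 * (c i)^2" for u v
  proof -
    have "(\<Sum>i\<in>I. k i * (u i)^2) \<le> (\<Sum>i\<in>I. k i * (2 * (v i)^2 + 2 * (c i)^2))"
      by (intro sum_mono mult_left_mono k that)
    also have "\<dots> = 2 * (\<Sum>i\<in>I. k i * (v i)^2) + 2 * (\<Sum>i\<in>I. k i * (c i)^2)"
      by (simp add: sum_distrib_left sum.distrib distrib_left mult.left_commute)
    finally show ?thesis using C by linarith
  qed
  show "(\<Sum>i\<in>I. k i * (x i)^2) \<le> 2 * (\<Sum>i\<in>I. k i * (y i)^2) + 2 * C"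
    using power2_sum_le[of "y _" "- c _"] by (intro *) (simp add: x)
  show "(\<Sum>i\<in>I. k i * (y i)^2) \<le> 2 * (\<Sum>i\<in>I. k i * (x i)^2) + 2 * C"
    by (intro *) (metis power2_sum_le x diff_add_cancel)
qed

lemma bilin_add_left: "bilin I A (\<lambda>i. V i + W i) X = bilin I A V X + bilin I A W X"
  and bilin_add_right: "bilin I A X (\<lambda>i. V i + W i) = bilin I A X V + bilin I A X W"
  and bilin_scale_left: "bilin I A (\<lambda>i. c * V i) X = c * bilin I A V X"
  and bilin_scale_right: "bilin I A X (\<lambda>i. c * V i) = c * bilin I A X V"
  by (simp_all add: bilin_def sum.distrib sum_distrib_left sum_distrib_right algebra_simps)

lemma bilin_cong:
  "(\<And>i. i \<in> I ==> V i = V' i) ==> (\<And>i. i \<in> I ==> W i = W' i) ==> bilin I A V W = bilin I A V' W'"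
  by (simp add: bilin_def)

lemma sym_pos_def_bilin:
  assumes "sym_pos_def I A"
  shows "bilin I A V W = bilin I A W V" and "bilin I A V V \<ge> 0"
proof -
  have "bilin I A V W = (\<Sum>j\<in>I. \<Sum>i\<in>I. V i * A i j * W j)"
    unfolding bilin_def by (rule sum.swap)
  also have "\<dots> = bilin I A W V"
    using assms unfolding bilin_def sym_pos_def_def by (intro sum.cong refl) (simp add: mult_ac)
  finally show "bilin I A V W = bilin I A W V" .
  show "bilin I A V V \<ge> 0"
  proof (cases "\<exists>i\<in>I. V i \<noteq> 0")
    case True then show ?thesis using assms by (simp add: sym_pos_def_def less_imp_le)
  next
    case False then show ?thesis by (simp add: bilin_def)
  qed
qed

lemma quadratic_nonneg_discriminant:
  fixes a b c :: real
  assumes "\<And>t. a + 2 * t * b + t^2 * c \<ge> 0" "c \<ge> 0"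
  shows "b^2 \<le> a * c"
proof (cases "c = 0")
  case True
  have "b = 0"
  proof (rule ccontr)
    assume "b \<noteq> 0"
    \<comment> \<open>At this \<open>t\<close> the affine function takes the value
      \<open>-1\<close>.\<close>
    then show False using assms(1)[of "- (a + 1) / (2 * b)"] True by (simp add: field_simps)
  qed
  then show ?thesis using True by simp
next
  case False
  have "0 \<le> a + 2 * (- b / c) * b + (- b / c)^2 * c" by (rule assms)
  also have "\<dots> = a - b^2 / c" using False by (simp add: power2_eq_square)
  finally show ?thesis using False assms(2) by (simp add: field_simps)
qed

lemma bilin_Cauchy_Schwarz:
  assumes sym: "\<And>V W. bilin I A V W = bilin I A W V" and pos: "\<And>V. bilin I A V V \<ge> 0"
  shows "(bilin I A V W)^2 \<le> bilin I A V V * bilin I A W W"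
proof (rule quadratic_nonneg_discriminant)
  fix t
  have "0 \<le> bilin I A (\<lambda>i. V i + t * W i) (\<lambda>i. V i + t * W i)" by (rule pos)
  also have "\<dots> = bilin I A V V + 2 * t * bilin I A V W + t^2 * bilin I A W W"
    using sym[of W V] by (simp add: bilin_add_left bilin_add_right bilin_scale_left bilin_scale_right power2_eq_square)
  finally show "0 \<le> bilin I A V V + 2 * t * bilin I A V W + t^2 * bilin I A W W" .
qed (rule pos)

lemma inverse_matrices_sym: "inverse_matrices I A B ==> inverse_matrices I B A"
  unfolding inverse_matrices_def by auto

text \<open>With \<open>X = B V\<close> the form of \<open>A\<close> at \<open>X\<close> becomes the
  plain pairing with \<open>V\<close>. The fluxes of the scheme are eliminated and recovered in this
  way.\<close>

lemma inverse_matrices_solve: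
  assumes "finite I" "inverse_matrices I A B" "\<And>i. i \<in> I ==> X i = (\<Sum>j\<in>I. B i j * V j)"
  shows "bilin I A Y X = (\<Sum>i\<in>I. Y i * V i)"
proof -
  have "(\<Sum>j\<in>I. A i j * X j) = V i" if "i \<in> I" for i
  proof -
    have "(\<Sum>j\<in>I. A i j * X j) = (\<Sum>j\<in>I. \<Sum>k\<in>I. A i j * B j k * V k)"
      using assms(3) by (intro sum.cong refl) (simp add: sum_distrib_left mult_ac)
    also have "\<dots> = (\<Sum>k\<in>I. (\<Sum>j\<in>I. A i j * B j k) * V k)"
      by (subst sum.swap) (simp add: sum_distrib_right)
    also have "\<dots> = (\<Sum>k\<in>I. if i = k then V k else 0)"
      using assms(2) that by (intro sum.cong refl) (simp add: inverse_matrices_def)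
    also have "\<dots> = V i" using assms(1) that by simp
    finally show ?thesis .
  qed
  then have "(\<Sum>i\<in>I. Y i * (\<Sum>j\<in>I. A i j * X j)) = (\<Sum>i\<in>I. Y i * V i)" by simp
  then show ?thesis unfolding bilin_def by (simp add: sum_distrib_left mult.assoc)
qed

text \<open>For \<open>X = B V\<close> the number \<open>q\<close> is both the form of
  \<open>A\<close> at \<open>X\<close> and the pairing of \<open>V\<close> with \<open>X\<close>.
  The weighted Cauchy-Schwarz inequality and coercivity of \<open>A\<close> bound \<open>q\<close>
  from above; the Cauchy-Schwarz inequality of the form \<open>A\<close>, applied to
  \<open>X\<close> and \<open>Y\<close>, bounds it from below.\<close>

lemma inverse_form_bounds:
  assumes fin: "finite I" and inv: "inverse_matrices I A B"
    and D: "\<And>i. i \<in> I ==> D i > 0"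
    and sym: "\<And>V W. bilin I A V W = bilin I A W V"
    and s: "s > 0" "S > 0"
    and lower: "\<And>V. s * (\<Sum>i\<in>I. D i * (V i)^2) \<le> bilin I A V V"
    and upper: "\<And>V. bilin I A V V \<le> S * (\<Sum>i\<in>I. D i * (V i)^2)"
  shows "(1 / S) * (\<Sum>i\<in>I. (V i)^2 / D i) \<le> bilin I B V V"
    and "bilin I B V V \<le> (1 / s) * (\<Sum>i\<in>I. (V i)^2 / D i)"
proof -
  define X where "X i = (\<Sum>j\<in>I. B i j * V j)" for i
  note sol = inverse_matrices_solve[OF fin inv X_def]
  define w where "w = (\<Sum>i\<in>I. (V i)^2 / D i)"
  define q where "q = bilin I B V V"
  have w0: "w \<ge> 0" unfolding w_def using D by (intro sum_nonneg) (simp add: less_imp_le)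
  have pos: "bilin I A V V \<ge> 0" for V
  proof -
    have "0 \<le> s * (\<Sum>i\<in>I. D i * (V i)^2)" using s D by (intro mult_nonneg_nonneg sum_nonneg) (auto simp: less_imp_le)
    then show ?thesis using lower[of V] by simp
  qed
  have q: "q = (\<Sum>i\<in>I. V i * X i)"
    unfolding q_def bilin_def X_def by (simp add: sum_distrib_left mult_ac)
  have qA: "bilin I A X X = q" unfolding sol q by (simp add: mult.commute)
  have q0: "q \<ge> 0" using pos[of X] qA by simp
  have "q^2 \<le> w * (\<Sum>i\<in>I. D i * (X i)^2)"
    unfolding q w_def by (rule weighted_sum_mult_power2_le[OF D])
  also have "\<dots> \<le> w * (q / s)"
    using lower[of X] s unfolding qA by (intro mult_left_mono w0) (simp add: field_simps)
  finally have "q * q \<le> q * (w / s)" by (simp add: power2_eq_square mult_ac)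
  then have "q \<le> w / s \<or> q = 0" using q0 mult_le_cancel_left_pos[of q q "w / s"] by linarith
  then show "bilin I B V V \<le> (1 / s) * (\<Sum>i\<in>I. (V i)^2 / D i)"
    using w0 s unfolding q_def[symmetric] w_def[symmetric] by auto
  \<comment> \<open>The dual vector of \<open>V\<close>: its norm with weights \<open>D\<close> is
    the norm of \<open>V\<close> with the reciprocal weights.\<close>
  define Y where "Y i = V i / D i" for i
  have wY: "w = bilin I A Y X" unfolding sol w_def Y_def by (simp add: power2_eq_square)
  have DY: "(\<Sum>i\<in>I. D i * (Y i)^2) = w" unfolding w_def Y_def
    using D by (intro sum.cong refl) (fastforce simp: power2_eq_square dest: D)
  have "w^2 \<le> bilin I A Y Y * q" unfolding wY qA[symmetric] by (rule bilin_Cauchy_Schwarz[OF sym pos])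
  also have "\<dots> \<le> (S * w) * q" using upper[of Y] unfolding DY by (intro mult_right_mono q0)
  finally have "w * w \<le> w * (S * q)" by (simp add: power2_eq_square mult_ac)
  then have "w \<le> S * q \<or> w = 0" using w0 mult_le_cancel_left_pos[of w w "S * q"] by linarith
  then show "(1 / S) * (\<Sum>i\<in>I. (V i)^2 / D i) \<le> bilin I B V V"
    using q0 s unfolding q_def[symmetric] w_def[symmetric] by (auto simp: field_simps)
qed

text \<open>The interface between geometry and algebra. The two sums are the divergence theorem for
  constant and for linear fields; \<open>normal_barycentre\<close> expresses that the barycentre
  lies in the hyperplane of its face.\<close>

locale regular_cell =
  fixes \<theta> :: real and m :: "(real^'d) mesh" and K :: "(real^'d) set"
  assumes finite_faces: "finite (faces m K)"
    and vol_pos: "vol K > 0"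
    and area_pos: "\<And>E. E \<in> faces m K ==> area E > 0"
    and dist_pos: "\<And>E. E \<in> faces m K ==> dist_face m K E > 0"
    and norm_normal: "\<And>E. E \<in> faces m K ==> norm (outward_normal K E) = 1"
    and barycentre_le: "\<And>E. E \<in> faces m K ==> norm (barycentre E - point m K) \<le> diameter K"
    and diameter_le: "\<And>E. E \<in> faces m K ==> diameter K \<le> \<theta> * dist_face m K E"
    and normal_barycentre: "\<And>E. E \<in> faces m K ==>
       outward_normal K E \<bullet> (barycentre E - point m K) = dist_face m K E"
    and sum_area_normal: "\<And>\<xi>. (\<Sum>E\<in>faces m K. area E * (outward_normal K E \<bullet> \<xi>)) = 0"
    and sum_area_normal_barycentre: "\<And>\<xi> e. (\<Sum>E\<in>faces m K. area E * (outward_normal K E \<bullet> \<xi>) *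
       (e \<bullet> (barycentre E - point m K))) = vol K * (e \<bullet> \<xi>)"
    and theta_nonneg: "\<theta> \<ge> 0"
begin

abbreviation "F \<equiv> faces m K"
abbreviation "d \<equiv> dist_face m K"
abbreviation "n \<equiv> outward_normal K"
abbreviation "r E \<equiv> barycentre E - point m K"

text \<open>The trace of \<open>sum_area_normal_barycentre\<close>, combined with
  \<open>normal_barycentre\<close>.\<close>

lemma sum_area_dist: "(\<Sum>E\<in>F. area E * d E) = real CARD('d) * vol K"
proof -
  have "(\<Sum>E\<in>F. area E * d E) = (\<Sum>E\<in>F. \<Sum>i\<in>UNIV. area E * (n E \<bullet> axis i 1) * (axis i 1 \<bullet> r E))"
  proof (intro sum.cong refl)
    fix E assume "E \<in> F"
    then have "area E * d E = area E * (\<Sum>i\<in>UNIV. n E $ i * r E $ i)"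
      by (simp add: normal_barycentre[symmetric] inner_vec_def)
    then show "area E * d E = (\<Sum>i\<in>UNIV. area E * (n E \<bullet> axis i 1) * (axis i 1 \<bullet> r E))"
      by (simp add: sum_distrib_left inner_axis inner_axis' mult.assoc)
  qed
  also have "\<dots> = (\<Sum>i\<in>(UNIV::'d set). vol K)"
    by (subst sum.swap) (simp add: sum_area_normal_barycentre inner_axis_axis)
  finally show ?thesis by simp
qed

lemma norm_r_le: "E \<in> F ==> norm (r E) \<le> \<theta> * d E"
  using barycentre_le diameter_le by fastforce

lemma sum_area_r_normal: "(\<Sum>E\<in>F. (area E * (e \<bullet> r E)) *\<^sub>R n E) = vol K *\<^sub>R e"
proof (rule vector_eq_rdot[THEN iffD1], rule allI)
  fix \<xi>
  show "(\<Sum>E\<in>F. (area E * (e \<bullet> r E)) *\<^sub>R n E) \<bullet> \<xi> = (vol K *\<^sub>R e) \<bullet> \<xi>"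
    using sum_area_normal_barycentre[of \<xi> e] by (simp add: inner_sum_left mult_ac)
qed

lemma sum_area_normal_r: "(\<Sum>E\<in>F. (area E * (n E \<bullet> \<xi>)) *\<^sub>R r E) = vol K *\<^sub>R \<xi>"
proof (rule vector_eq_ldot[THEN iffD1], rule allI)
  fix e
  show "e \<bullet> (\<Sum>E\<in>F. (area E * (n E \<bullet> \<xi>)) *\<^sub>R r E) = e \<bullet> (vol K *\<^sub>R \<xi>)"
    using sum_area_normal_barycentre[of \<xi> e] by (simp add: inner_sum_right)
qed

lemma norm_sum_scaleR_power2_le:
  fixes u :: "(real^'d) set => real^'d"
  assumes "\<And>E. E \<in> F ==> norm (u E) \<le> c E" "\<And>E. E \<in> F ==> w E > 0"
  shows "(norm (\<Sum>E\<in>F. V E *\<^sub>R u E))^2 \<le> (\<Sum>E\<in>F. (c E)^2 / w E) * (\<Sum>E\<in>F. w E * (V E)^2)"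
proof -
  have "norm (\<Sum>E\<in>F. V E *\<^sub>R u E) \<le> (\<Sum>E\<in>F. c E * \<bar>V E\<bar>)"
    by (rule order_trans[OF norm_sum sum_mono])
       (simp add: assms(1) mult.commute[of _ "norm _"] mult_right_mono)
  then have "(norm (\<Sum>E\<in>F. V E *\<^sub>R u E))^2 \<le> (\<Sum>E\<in>F. c E * \<bar>V E\<bar>)^2" by (intro power_mono) auto
  also have "\<dots> \<le> (\<Sum>E\<in>F. (c E)^2 / w E) * (\<Sum>E\<in>F. w E * \<bar>V E\<bar>\<^sup>2)"
    by (rule weighted_sum_mult_power2_le[OF assms(2)])
  finally show ?thesis by simp
qed

lemma R_transpose_le:
  "(norm (R_transpose m K V))^2 \<le> \<theta>^2 * CARD('d) * vol K * (\<Sum>E\<in>F. area E * d E * (V E)^2)"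
proof -
  have "(norm (R_transpose m K V))^2 \<le> (\<Sum>E\<in>F. (area E * (\<theta> * d E))^2 / (area E * d E)) * (\<Sum>E\<in>F. area E * d E * (V E)^2)"
    unfolding R_transpose_def
  proof (rule norm_sum_scaleR_power2_le)
    fix E assume "E \<in> F"
    then show "norm (R_row m K E) \<le> area E * (\<theta> * d E)"
      using area_pos[of E] norm_r_le[of E] by (simp add: R_row_def)
  qed (simp add: area_pos dist_pos)
  also have "(\<Sum>E\<in>F. (area E * (\<theta> * d E))^2 / (area E * d E)) = \<theta>^2 * (\<Sum>E\<in>F. area E * d E)"
    unfolding sum_distrib_left
    by (intro sum.cong refl) (use area_pos dist_pos in \<open>fastforce simp: power2_eq_square\<close>)
  finally show ?thesis by (simp add: sum_area_dist mult_ac)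
qed

lemma D_op_le: "(norm (D_op m K V))^2 \<le> CARD('d) / vol K * (\<Sum>E\<in>F. (V E)^2 / (area E * d E))"
proof -
  have "(norm (\<Sum>E\<in>F. V E *\<^sub>R n E))^2 \<le> (\<Sum>E\<in>F. 1^2 / (1 / (area E * d E))) * (\<Sum>E\<in>F. 1 / (area E * d E) * (V E)^2)"
    by (rule norm_sum_scaleR_power2_le) (simp_all add: area_pos dist_pos norm_normal)
  then have "(norm (\<Sum>E\<in>F. V E *\<^sub>R n E))^2 \<le> CARD('d) * vol K * (\<Sum>E\<in>F. (V E)^2 / (area E * d E))"
    by (simp add: sum_area_dist)
  then have "(1 / vol K)^2 * (norm (\<Sum>E\<in>F. V E *\<^sub>R n E))^2 \<le>
     (1 / vol K)^2 * (CARD('d) * vol K * (\<Sum>E\<in>F. (V E)^2 / (area E * d E)))"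
    by (rule mult_left_mono) simp
  also have "\<dots> = CARD('d) / vol K * (\<Sum>E\<in>F. (V E)^2 / (area E * d E))"
    using vol_pos by (simp add: power2_eq_square)
  finally show ?thesis using vol_pos by (simp add: D_op_def power_mult_distrib power_divide)
qed

text \<open>By \<open>sum_area_r_normal\<close> the values \<open>area E * (e \<bullet> r E)\<close>
  have \<open>D_op\<close> equal to \<open>e\<close>, and up to the factor \<open>area E\<close> the
  operator \<open>L_op\<close> subtracts just these values for
  \<open>e = D_op m K V\<close>.\<close>

lemma D_op_L_op: "D_op m K (\<lambda>E. area E * L_op m K V E) = 0"
proof -
  have "(\<Sum>E\<in>F. (area E * L_op m K V E) *\<^sub>R n E) =
     (\<Sum>E\<in>F. V E *\<^sub>R n E) - (\<Sum>E\<in>F. (area E * (D_op m K V \<bullet> r E)) *\<^sub>R n E)"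
    unfolding sum_subtractf[symmetric]
    by (intro sum.cong refl) (use area_pos in \<open>fastforce simp: L_op_def algebra_simps\<close>)
  also have "\<dots> = 0" unfolding sum_area_r_normal using vol_pos by (simp add: D_op_def)
  finally show ?thesis by (simp add: D_op_def)
qed

lemma L_op_idem: "E \<in> F ==> L_op m K (\<lambda>E. area E * L_op m K V E) E = L_op m K V E"
  unfolding L_op_def[of m K "\<lambda>E. area E * L_op m K V E"] D_op_L_op using area_pos[of E] by simp

text \<open>Regularity bounds the length of \<open>r E\<close> by \<theta> times \<open>d E\<close>,
  which turns the weights \<open>area E / d E\<close> into \<open>area E * d E\<close>, whose sum is
  \<open>d\<close> times the volume.\<close>

lemma sum_r_power2_le: "(\<Sum>E\<in>F. area E / d E * (\<xi> \<bullet> r E)^2) \<le> \<theta>^2 * CARD('d) * vol K * (norm \<xi>)^2"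
proof -
  have "(\<Sum>E\<in>F. area E / d E * (\<xi> \<bullet> r E)^2) \<le> (\<Sum>E\<in>F. area E / d E * (norm \<xi> * (\<theta> * d E))^2)"
  proof (intro sum_mono mult_left_mono)
    fix E assume s: "E \<in> F"
    have "\<bar>\<xi> \<bullet> r E\<bar> \<le> norm \<xi> * (\<theta> * d E)"
      by (rule order_trans[OF Cauchy_Schwarz_ineq2]) (intro mult_left_mono norm_r_le s norm_ge_zero)
    then have "\<bar>\<xi> \<bullet> r E\<bar>\<^sup>2 \<le> (norm \<xi> * (\<theta> * d E))^2" by (intro power_mono) auto
    then show "(\<xi> \<bullet> r E)^2 \<le> (norm \<xi> * (\<theta> * d E))^2" by simp
  qed (simp add: area_pos dist_pos less_imp_le)
  also have "\<dots> = (\<Sum>E\<in>F. \<theta>^2 * (norm \<xi>)^2 * (area E * d E))"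
    by (intro sum.cong refl) (use dist_pos in \<open>fastforce simp: power2_eq_square\<close>)
  finally show ?thesis unfolding sum_distrib_left[symmetric] sum_area_dist by (simp add: mult_ac)
qed

lemma L_op_bounds:
  shows "(\<Sum>E\<in>F. area E / d E * (L_op m K V E)^2) \<le>
      2 * (\<Sum>E\<in>F. (V E)^2 / (area E * d E)) + 2 * (\<theta>^2 * CARD('d) * vol K * (norm (D_op m K V))^2)"
    and "(\<Sum>E\<in>F. (V E)^2 / (area E * d E)) \<le>
      2 * (\<Sum>E\<in>F. area E / d E * (L_op m K V E)^2) + 2 * (\<theta>^2 * CARD('d) * vol K * (norm (D_op m K V))^2)"
proof -
  have e: "(\<Sum>E\<in>F. (V E)^2 / (area E * d E)) = (\<Sum>E\<in>F. area E / d E * (V E / area E)^2)"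
    by (intro sum.cong refl) (use area_pos in \<open>fastforce simp: power2_eq_square\<close>)
  note * = weighted_sum_diff_power2_le[OF _ _ sum_r_power2_le, of "L_op m K V" "\<lambda>E. V E / area E" "D_op m K V"]
  show "(\<Sum>E\<in>F. area E / d E * (L_op m K V E)^2) \<le>
      2 * (\<Sum>E\<in>F. (V E)^2 / (area E * d E)) + 2 * (\<theta>^2 * CARD('d) * vol K * (norm (D_op m K V))^2)"
    unfolding e by (rule *) (simp_all add: L_op_def area_pos dist_pos less_imp_le)
  show "(\<Sum>E\<in>F. (V E)^2 / (area E * d E)) \<le>
      2 * (\<Sum>E\<in>F. area E / d E * (L_op m K V E)^2) + 2 * (\<theta>^2 * CARD('d) * vol K * (norm (D_op m K V))^2)"
    unfolding e by (rule *) (simp_all add: L_op_def area_pos dist_pos less_imp_le)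
qed

end

section \<open>Ellipticity on a cell and the families of bounds\<close>

lemma matrix_inv_mult_vec:
  fixes A :: "real^'n^'n"
  assumes "\<And>\<xi>. A *v \<xi> = 0 ==> \<xi> = 0"
  shows "A *v (matrix_inv A *v \<xi>) = \<xi>" and "matrix_inv A *v (A *v \<xi>) = \<xi>"
proof -
  have "invertible A"
    using assms matrix_left_invertible_ker[of A] by (simp add: invertible_left_inverse)
  then have "A ** matrix_inv A = mat 1 \<and> matrix_inv A ** A = mat 1"
    unfolding invertible_def matrix_inv_def by (rule someI_ex)
  then show "A *v (matrix_inv A *v \<xi>) = \<xi>" and "matrix_inv A *v (A *v \<xi>) = \<xi>"
    by (simp_all add: matrix_vector_mul_assoc)
qed

text \<open>The common pattern for the mimetic matrix and for its inverse: \<open>q\<close> is the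
  consistent term and \<rho> its size, \<open>t\<close> the stabilisation and \<open>z\<close> the
  norm that controls it, \<open>w\<close> the full weighted norm. The constants depend only on those
  of the hypotheses.\<close>

lemma split_form_bounds:
  fixes s S a a' b e w z q t \<rho> :: real
  assumes pos: "s > 0" "S > 0" "a > 0" "a' \<ge> 0" "b \<ge> 0" "z \<ge> 0" "\<rho> \<ge> 0"
    and t: "s * z \<le> t" "t \<le> S * z" and q: "a * \<rho> \<le> q" "q \<le> a' * \<rho>" and \<rho>: "\<rho> \<le> e * w"
    and wz: "w \<le> 2 * z + 2 * (b * \<rho>)" "z \<le> 2 * w + 2 * (b * \<rho>)"
  shows "1 / (2 / s + 2 * (b / a)) * w \<le> q + t \<and> q + t \<le> (a' * e + S * (2 + 2 * (b * e))) * w"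
proof
  have 0: "0 \<le> t" "0 \<le> q" using order_trans[OF _ t(1)] order_trans[OF _ q(1)] pos by simp_all
  have c: "0 < 2 / s + 2 * (b / a)" using pos by (intro add_pos_nonneg) auto
  have "z \<le> t / s" "\<rho> \<le> q / a" using t(1) q(1) pos by (simp_all add: field_simps)
  from this(1) mult_left_mono[OF this(2) pos(5)] have "w \<le> 2 * (t / s) + 2 * (b * (q / a))" using wz(1) by linarith
  also have "\<dots> \<le> (2 * (t / s) + 2 * (b * (q / a))) + (2 / s * q + 2 * (b / a) * t)" using pos 0 by simp
  also have "\<dots> = (q + t) * (2 / s + 2 * (b / a))" by (simp add: algebra_simps add_divide_distrib)
  finally show "1 / (2 / s + 2 * (b / a)) * w \<le> q + t" using c by (simp add: pos_divide_le_eq)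
  have "b * \<rho> \<le> b * (e * w)" "a' * \<rho> \<le> a' * (e * w)" using \<rho> pos by (auto intro: mult_left_mono)
  moreover from this have "S * z \<le> S * (2 * w + 2 * (b * (e * w)))" using pos wz by (intro mult_left_mono) auto
  ultimately have "q + t \<le> a' * (e * w) + S * (2 * w + 2 * (b * (e * w)))" using t q by linarith
  then show "q + t \<le> (a' * e + S * (2 + 2 * (b * e))) * w" by (simp add: algebra_simps)
qed

locale elliptic_cell = regular_cell \<theta> m K
  for \<theta> :: real and m :: "(real^'d) mesh" and K :: "(real^'d) set" +
  fixes \<Lambda> :: "real^'d => real^'d^'d" and \<zeta> \<mu> :: real
  assumes zeta_pos: "\<zeta> > 0" and lambda_pos: "\<mu> > 0"
    and mean_sym: "\<And>\<xi> \<eta>. (mean_tensor \<Lambda> K *v \<xi>) \<bullet> \<eta> = \<xi> \<bullet> (mean_tensor \<Lambda> K *v \<eta>)"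
    and mean_coercive: "\<And>\<xi>. \<zeta> * (norm \<xi>)^2 \<le> (mean_tensor \<Lambda> K *v \<xi>) \<bullet> \<xi>"
    and mean_bound: "\<And>\<xi>. norm (mean_tensor \<Lambda> K *v \<xi>) \<le> \<mu> * norm \<xi>"
begin

abbreviation "A \<equiv> mean_tensor \<Lambda> K"
abbreviation "iA \<equiv> matrix_inv (mean_tensor \<Lambda> K)"

lemma mean_ker: "A *v \<xi> = 0 ==> \<xi> = 0"
  using mean_coercive[of \<xi>] zeta_pos by (auto simp: mult_le_0_iff)

lemma mean_inv: "A *v (iA *v \<xi>) = \<xi>" "iA *v (A *v \<xi>) = \<xi>"
  using matrix_inv_mult_vec[of A] mean_ker by blast+

text \<open>With \<open>\<xi> = A \<eta>\<close> the form is that of \<open>A\<close> at \<eta>. The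
  norm of \<xi> is at most \<mu> times that of \<eta>, and coercivity bounds the norm of \<eta> by
  that of \<xi> divided by \<zeta>.\<close>

lemma mean_inv_bounds:
  "\<zeta> / \<mu>^2 * (norm \<xi>)^2 \<le> \<xi> \<bullet> (iA *v \<xi>)" "\<xi> \<bullet> (iA *v \<xi>) \<le> 1 / \<zeta> * (norm \<xi>)^2"
proof -
  define \<eta> where "\<eta> = iA *v \<xi>"
  have e: "\<xi> = A *v \<eta>" by (simp add: \<eta>_def mean_inv)
  have q: "\<xi> \<bullet> (iA *v \<xi>) = (A *v \<eta>) \<bullet> \<eta>" unfolding e mean_inv by simp
  have "(norm \<xi>)^2 \<le> (\<mu> * norm \<eta>)^2" unfolding e using mean_bound[of \<eta>] by (intro power_mono) auto
  then have "\<zeta> / \<mu>^2 * (norm \<xi>)^2 \<le> \<zeta> / \<mu>^2 * (\<mu> * norm \<eta>)^2"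
    using zeta_pos by (intro mult_left_mono) auto
  also have "\<dots> = \<zeta> * (norm \<eta>)^2" using lambda_pos by (simp add: power_mult_distrib)
  also have "\<dots> \<le> \<xi> \<bullet> (iA *v \<xi>)" unfolding q by (rule mean_coercive)
  finally show "\<zeta> / \<mu>^2 * (norm \<xi>)^2 \<le> \<xi> \<bullet> (iA *v \<xi>)" .
  have le: "\<xi> \<bullet> \<eta> \<le> norm \<xi> * norm \<eta>" by (rule norm_cauchy_schwarz)
  have "\<zeta> * (norm \<eta>)^2 \<le> norm \<xi> * norm \<eta>" using mean_coercive[of \<eta>] le e by simp
  then have "norm \<eta> * (\<zeta> * norm \<eta>) \<le> norm \<eta> * norm \<xi>" by (simp add: power2_eq_square mult_ac)
  then have "\<zeta> * norm \<eta> \<le> norm \<xi>"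
    by (cases "norm \<eta> = 0") (auto simp: mult_le_cancel_left)
  then have "norm \<eta> \<le> norm \<xi> / \<zeta>" using zeta_pos by (simp add: field_simps)
  then have "norm \<xi> * norm \<eta> \<le> norm \<xi> * (norm \<xi> / \<zeta>)" by (intro mult_left_mono) auto
  then show "\<xi> \<bullet> (iA *v \<xi>) \<le> 1 / \<zeta> * (norm \<xi>)^2"
    using le unfolding \<eta>_def[symmetric] by (simp add: power2_eq_square)
qed

lemma T_op_eq: "T_op \<Lambda> m K V E = V E - (R_transpose m K V \<bullet> n E) / vol K"
proof -
  have "R_transpose m K V = (\<Sum>E\<in>F. (area E * V E) *\<^sub>R r E)"
    by (simp add: R_transpose_def R_row_def mult.commute)
  then have "A *v v_op \<Lambda> m K V = - (1 / vol K) *\<^sub>R R_transpose m K V"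
    unfolding v_op_def by (simp only: matrix_vector_mult_scaleR mean_inv)
  then show ?thesis by (simp add: T_op_def)
qed

text \<open>\<open>T_op\<close> subtracts the values \<open>n E \<bullet> \<rho> / vol K\<close>
  with \<open>\<rho>\<close> the vector \<open>R_transpose m K V\<close>, and
  \<open>sum_area_normal_r\<close> says that \<open>R_transpose\<close> maps these values back to
  \<rho>.\<close>

lemma R_transpose_T_op: "R_transpose m K (T_op \<Lambda> m K V) = 0"
proof -
  have "R_transpose m K (T_op \<Lambda> m K V) = R_transpose m K V -
      (1 / vol K) *\<^sub>R (\<Sum>E\<in>F. (area E * (n E \<bullet> R_transpose m K V)) *\<^sub>R r E)"
    proof -
    define \<rho> where "\<rho> = R_transpose m K V"
    have "R_transpose m K (T_op \<Lambda> m K V) = (\<Sum>E\<in>F. V E *\<^sub>R R_row m K E - (1 / vol K) *\<^sub>R ((area E * (n E \<bullet> \<rho>)) *\<^sub>R r E))"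
      unfolding R_transpose_def[of m K "T_op \<Lambda> m K V"] T_op_eq \<rho>_def[symmetric]
      by (intro sum.cong refl) (simp add: R_row_def scaleR_diff_left right_diff_distrib inner_commute[of \<rho>] mult.commute)
    then show ?thesis by (simp only: sum_subtractf scaleR_sum_right[symmetric] R_transpose_def[symmetric] \<rho>_def)
  qed
  then show ?thesis unfolding sum_area_normal_r using vol_pos by simp
qed

lemma T_op_idem: "T_op \<Lambda> m K (T_op \<Lambda> m K V) = T_op \<Lambda> m K V"
  by (rule ext) (simp add: T_op_eq[of "T_op \<Lambda> m K V"] R_transpose_T_op)

lemma sum_normal_power2_le:
  "(\<Sum>E\<in>F. area E * d E * ((\<xi> \<bullet> n E) / vol K)^2) \<le> CARD('d) / vol K * (norm \<xi>)^2"
proof -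
  have "(\<Sum>E\<in>F. area E * d E * ((\<xi> \<bullet> n E) / vol K)^2) \<le> (\<Sum>E\<in>F. area E * d E * (norm \<xi> / vol K)^2)"
  proof (intro sum_mono mult_left_mono)
    fix E assume s: "E \<in> F"
    have "\<bar>\<xi> \<bullet> n E\<bar> \<le> norm \<xi>" using Cauchy_Schwarz_ineq2[of \<xi> "n E"] norm_normal[OF s] by simp
    then show "((\<xi> \<bullet> n E) / vol K)^2 \<le> (norm \<xi> / vol K)^2"
      using vol_pos by (intro power2_le_iff_abs_le[THEN iffD2]) (auto simp: abs_mult divide_right_mono)
  qed (simp add: area_pos dist_pos less_imp_le)
  also have "\<dots> = CARD('d) / vol K * (norm \<xi>)^2"
    unfolding sum_distrib_right[symmetric] sum_area_dist using vol_pos by (simp add: power2_eq_square)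
  finally show ?thesis .
qed

lemma T_op_bounds:
  shows "(\<Sum>E\<in>F. area E * d E * (T_op \<Lambda> m K V E)^2) \<le>
      2 * (\<Sum>E\<in>F. area E * d E * (V E)^2) + 2 * (CARD('d) / vol K * (norm (R_transpose m K V))^2)"
    and "(\<Sum>E\<in>F. area E * d E * (V E)^2) \<le>
      2 * (\<Sum>E\<in>F. area E * d E * (T_op \<Lambda> m K V E)^2) + 2 * (CARD('d) / vol K * (norm (R_transpose m K V))^2)"
  by (rule weighted_sum_diff_power2_le[OF _ _ sum_normal_power2_le, of "T_op \<Lambda> m K V" V "R_transpose m K V"];
    simp add: T_op_eq area_pos dist_pos less_imp_le)+

lemma N_transpose_eq: "N_transpose \<Lambda> m K V = vol K *\<^sub>R (A *v D_op m K V)"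
proof -
  have "N_transpose \<Lambda> m K V = A *v (\<Sum>E\<in>F. V E *\<^sub>R n E)"
    by (simp add: N_transpose_def N_row_def linear_sum[OF matrix_vector_mul_linear] matrix_vector_mult_scaleR)
  also have "(\<Sum>E\<in>F. V E *\<^sub>R n E) = vol K *\<^sub>R D_op m K V" using vol_pos by (simp add: D_op_def)
  finally show ?thesis by (simp add: matrix_vector_mult_scaleR)
qed

definition mimetic_bounds :: "_ => real => real => bool" where
  "mimetic_bounds MM s S \<longleftrightarrow> (\<forall>V. s * (\<Sum>E\<in>F. area E * d E * (V E)^2) \<le> bilin F MM V V \<and>
     bilin F MM V V \<le> S * (\<Sum>E\<in>F. area E * d E * (V E)^2))"

text \<open>The intermediate condition between (1) and (2), on the inverse of the mimetic matrix;
  its weights are reciprocal to those of \<open>mimetic_bounds\<close>.\<close>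

definition inverse_bounds :: "_ => real => real => bool" where
  "inverse_bounds W s S \<longleftrightarrow> (\<forall>V. s * (\<Sum>E\<in>F. (V E)^2 / (area E * d E)) \<le> bilin F W V V \<and>
     bilin F W V V \<le> S * (\<Sum>E\<in>F. (V E)^2 / (area E * d E)))"

definition hybrid_bounds :: "_ => real => real => bool" where
  "hybrid_bounds BH s S \<longleftrightarrow> (\<forall>V. s * (\<Sum>E\<in>F. area E / d E * (L_op m K V E)^2)
        \<le> bilin F BH (L_op m K V) (L_op m K V) \<and>
      bilin F BH (L_op m K V) (L_op m K V) \<le> S * (\<Sum>E\<in>F. area E / d E * (L_op m K V E)^2))"

definition mixed_bounds :: "_ => real => real => bool" where
  "mixed_bounds BM s S \<longleftrightarrow> (\<forall>V. s * (\<Sum>E\<in>F. area E * d E * (T_op \<Lambda> m K V E)^2)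
        \<le> bilin F BM (T_op \<Lambda> m K V) (T_op \<Lambda> m K V) \<and>
      bilin F BM (T_op \<Lambda> m K V) (T_op \<Lambda> m K V) \<le> S * (\<Sum>E\<in>F. area E * d E * (T_op \<Lambda> m K V E)^2))"

end

text \<open>In \<open>MM_eq\<close> the stabilisation given by the matrices \<open>C\<close> and
  \<open>U\<close> has been replaced by the equal form of \<open>BM\<close> on \<open>T_op\<close>;
  \<open>W\<close> is the inverse of \<open>MM\<close>.\<close>

locale hmmf_cell = elliptic_cell \<theta> m K \<Lambda> \<zeta> \<mu>
  for \<theta> :: real and m :: "(real^'d) mesh" and K :: "(real^'d) set" and \<Lambda> \<zeta> \<mu> +
  fixes MM BH BM W :: "(real^'d) set => (real^'d) set => real"
  assumes MM_spd: "sym_pos_def F MM" and BH_spd: "sym_pos_def F BH"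
    and inverse: "inverse_matrices F MM W"
    and MM_eq: "\<And>V V'. bilin F MM V' V =
        (1 / vol K) * (R_transpose m K V' \<bullet> (iA *v R_transpose m K V)) +
        bilin F BM (T_op \<Lambda> m K V') (T_op \<Lambda> m K V)"
    and W_eq: "\<And>V V'. bilin F W V' V =
        (1 / vol K) * (N_transpose \<Lambda> m K V' \<bullet> (iA *v N_transpose \<Lambda> m K V)) +
        bilin F BH (L_op m K V') (L_op m K V)"
begin

lemma W_eq': "bilin F W V' V = vol K * ((A *v D_op m K V') \<bullet> D_op m K V) + bilin F BH (L_op m K V') (L_op m K V)"
  unfolding W_eq N_transpose_eq matrix_vector_mult_scaleR mean_inv using vol_pos by simp

lemma W_sym: "bilin F W V' V = bilin F W V V'"
  unfolding W_eq' using mean_sym sym_pos_def_bilin(1)[OF BH_spd] by (simp add: inner_commute)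

text \<open>On vectors \<open>T_op \<Lambda> m K V\<close> the consistent term vanishes and
  \<open>T_op\<close> acts as the identity, so the constants are unchanged.\<close>

lemma mimetic_imp_mixed:
  assumes "mimetic_bounds MM s S"
  shows "mixed_bounds BM s S"
proof -
  have eq: "bilin F MM (T_op \<Lambda> m K V) (T_op \<Lambda> m K V) = bilin F BM (T_op \<Lambda> m K V) (T_op \<Lambda> m K V)" for V
    unfolding MM_eq[of "T_op \<Lambda> m K V"] R_transpose_T_op T_op_idem by simp
  show ?thesis unfolding mixed_bounds_def eq[symmetric]
    by (rule allI, rule spec[OF assms[unfolded mimetic_bounds_def]])
qed

text \<open>\<open>split_form_bounds\<close> with \<rho> the squared norm of
  \<open>R_transpose m K V\<close> divided by the volume: \<open>a\<close> and \<open>a'\<close>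
  come from \<open>mean_inv_bounds\<close>, \<open>b\<close> from \<open>T_op_bounds\<close> and
  \<open>e\<close> from \<open>R_transpose_le\<close>.\<close>

lemma mixed_imp_mimetic:
  assumes "mixed_bounds BM s S" "s > 0" "S > 0"
  shows "mimetic_bounds MM (1 / (2 / s + 2 * (CARD('d) / (\<zeta> / \<mu>^2))))
    (1 / \<zeta> * (\<theta>^2 * CARD('d)) + S * (2 + 2 * (CARD('d) * (\<theta>^2 * CARD('d)))))"
  unfolding mimetic_bounds_def
proof
  fix V
  let ?R = "R_transpose m K V" and ?w = "\<Sum>E\<in>F. area E * d E * (V E)^2"
  let ?z = "\<Sum>E\<in>F. area E * d E * (T_op \<Lambda> m K V E)^2"
  have "0 \<le> ?z" by (intro sum_nonneg mult_nonneg_nonneg) (auto simp: area_pos dist_pos less_imp_le)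
  moreover have "\<zeta> / \<mu>^2 * ((norm ?R)^2 / vol K) \<le> (1 / vol K) * (?R \<bullet> (iA *v ?R))"
    "(1 / vol K) * (?R \<bullet> (iA *v ?R)) \<le> 1 / \<zeta> * ((norm ?R)^2 / vol K)"
    using divide_right_mono[OF mean_inv_bounds(1), of "vol K" ?R] divide_right_mono[OF mean_inv_bounds(2), of "vol K" ?R]
      vol_pos by (simp_all add: mult.commute)
  moreover have "(norm ?R)^2 / vol K \<le> \<theta>^2 * CARD('d) * ?w"
    using R_transpose_le[of V] vol_pos by (simp add: pos_divide_le_eq mult_ac)
  ultimately show "1 / (2 / s + 2 * (CARD('d) / (\<zeta> / \<mu>^2))) * ?w \<le> bilin F MM V V \<and>
    bilin F MM V V \<le> (1 / \<zeta> * (\<theta>^2 * CARD('d)) + S * (2 + 2 * (CARD('d) * (\<theta>^2 * CARD('d))))) * ?w"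
    unfolding MM_eq using assms T_op_bounds[of V] zeta_pos lambda_pos vol_pos
    by (intro split_form_bounds[of s S _ _ _ ?z "(norm ?R)^2 / vol K"]) (simp_all add: mixed_bounds_def)
qed

text \<open>Tested with \<open>area E * L_op m K V E\<close>, on which \<open>D_op\<close> vanishes
  and \<open>L_op\<close> returns \<open>L_op m K V\<close>.\<close>

lemma inverse_imp_hybrid:
  assumes "inverse_bounds W s S"
  shows "hybrid_bounds BH s S"
  unfolding hybrid_bounds_def
proof
  fix V
  let ?V = "\<lambda>E. area E * L_op m K V E"
  have "bilin F W ?V ?V = bilin F BH (L_op m K V) (L_op m K V)"
    unfolding W_eq' D_op_L_op using L_op_idem by (auto intro!: bilin_cong)
  moreover have "(\<Sum>E\<in>F. (?V E)^2 / (area E * d E)) = (\<Sum>E\<in>F. area E / d E * (L_op m K V E)^2)"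
    by (intro sum.cong refl) (use area_pos in \<open>fastforce simp: power2_eq_square\<close>)
  ultimately show "s * (\<Sum>E\<in>F. area E / d E * (L_op m K V E)^2)
        \<le> bilin F BH (L_op m K V) (L_op m K V) \<and>
      bilin F BH (L_op m K V) (L_op m K V) \<le> S * (\<Sum>E\<in>F. area E / d E * (L_op m K V E)^2)"
    using spec[OF assms[unfolded inverse_bounds_def], of ?V] by simp
qed

text \<open>\<open>split_form_bounds\<close> with \<rho> the volume times the squared norm of
  \<open>D_op m K V\<close>; here \<open>a\<close> and \<open>a'\<close> are the ellipticity bounds
  \<zeta> and \<mu> themselves.\<close>

lemma hybrid_imp_inverse:
  assumes "hybrid_bounds BH s S" "s > 0" "S > 0"
  shows "inverse_bounds W (1 / (2 / s + 2 * (\<theta>^2 * CARD('d) / \<zeta>)))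
    (\<mu> * CARD('d) + S * (2 + 2 * (\<theta>^2 * CARD('d) * CARD('d))))"
  unfolding inverse_bounds_def
proof
  fix V
  let ?D = "D_op m K V" and ?w = "\<Sum>E\<in>F. (V E)^2 / (area E * d E)"
  let ?z = "\<Sum>E\<in>F. area E / d E * (L_op m K V E)^2"
  have "0 \<le> ?z" by (intro sum_nonneg mult_nonneg_nonneg) (auto simp: area_pos dist_pos less_imp_le)
  moreover have "\<zeta> * (vol K * (norm ?D)^2) \<le> vol K * ((A *v ?D) \<bullet> ?D)"
    using mult_left_mono[OF mean_coercive, of "vol K" ?D] vol_pos by (simp add: mult_ac)
  moreover have "(A *v ?D) \<bullet> ?D \<le> (\<mu> * norm ?D) * norm ?D"
    by (rule order_trans[OF norm_cauchy_schwarz mult_right_mono[OF mean_bound]]) simp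
  then have "vol K * ((A *v ?D) \<bullet> ?D) \<le> \<mu> * (vol K * (norm ?D)^2)"
    using mult_left_mono[of "(A *v ?D) \<bullet> ?D" _ "vol K"] vol_pos by (simp add: power2_eq_square mult_ac)
  moreover have "vol K * (norm ?D)^2 \<le> CARD('d) * ?w"
    using mult_left_mono[OF D_op_le, of "vol K" V] vol_pos by simp
  ultimately show "1 / (2 / s + 2 * (\<theta>^2 * CARD('d) / \<zeta>)) * ?w \<le> bilin F W V V \<and>
    bilin F W V V \<le> (\<mu> * CARD('d) + S * (2 + 2 * (\<theta>^2 * CARD('d) * CARD('d)))) * ?w"
    unfolding W_eq' using assms L_op_bounds[of V] zeta_pos lambda_pos vol_pos
    by (intro split_form_bounds[of s S _ _ _ ?z]) (simp_all add: hybrid_bounds_def mult.assoc)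
qed

lemma mimetic_imp_inverse:
  assumes "mimetic_bounds MM s S" "s > 0" "S > 0"
  shows "inverse_bounds W (1 / S) (1 / s)"
proof -
  have D: "0 < area E * d E" if "E \<in> F" for E using area_pos[OF that] dist_pos[OF that] by simp
  have lo: "s * (\<Sum>E\<in>F. area E * d E * (V E)^2) \<le> bilin F MM V V"
    and up: "bilin F MM V V \<le> S * (\<Sum>E\<in>F. area E * d E * (V E)^2)" for V
    using spec[OF assms(1)[unfolded mimetic_bounds_def], of V] by (rule conjunct1, rule conjunct2)
  show ?thesis
    unfolding inverse_bounds_def
    by (intro allI conjI inverse_form_bounds[OF finite_faces inverse D sym_pos_def_bilin(1)[OF MM_spd] assms(2,3) lo up])
qed

text \<open>The same inversion with the roles of the two matrices and of the weights
  exchanged.\<close>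

lemma inverse_imp_mimetic:
  assumes "inverse_bounds W s S" "s > 0" "S > 0"
  shows "mimetic_bounds MM (1 / S) (1 / s)"
proof -
  have D: "0 < 1 / (area E * d E)" if "E \<in> F" for E using area_pos[OF that] dist_pos[OF that] by simp
  have e: "(\<Sum>E\<in>F. (V E)^2 / (area E * d E)) = (\<Sum>E\<in>F. 1 / (area E * d E) * (V E)^2)"
    "(\<Sum>E\<in>F. area E * d E * (V E)^2) = (\<Sum>E\<in>F. (V E)^2 / (1 / (area E * d E)))" for V
    by (auto intro!: sum.cong)
  have lo: "s * (\<Sum>E\<in>F. 1 / (area E * d E) * (V E)^2) \<le> bilin F W V V"
    and up: "bilin F W V V \<le> S * (\<Sum>E\<in>F. 1 / (area E * d E) * (V E)^2)" for V
    using spec[OF assms(1)[unfolded inverse_bounds_def e(1)], of V] by (rule conjunct1, rule conjunct2)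
  show ?thesis
    unfolding mimetic_bounds_def e(2)
    by (intro allI conjI inverse_form_bounds[OF finite_faces inverse_matrices_sym[OF inverse] D W_sym assms(2,3) lo up])
qed

end

section \<open>Cells of a regular mesh\<close>

lemma norm_matrix_vector_mult_le: "norm (M *v (x::real^'n)) \<le> norm M * norm x"
  for M :: "real^'n^'m"
proof -
  have "norm (M *v x) \<le> L2_set (\<lambda>i. norm (M $ i) * norm x) UNIV"
    unfolding norm_vec_def[of "M *v x"]
    by (rule L2_set_mono) (simp_all add: matrix_mult_dot Cauchy_Schwarz_ineq2)
  also have "\<dots> = norm M * norm x"
    unfolding norm_vec_def[of M] by (simp add: L2_set_left_distrib)
  finally show ?thesis .
qed

lemma polytopal_open_open: "polytopal_open K ==> open K"
  unfolding polytopal_open_def by auto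

lemma polytopal_mesh_cell:
  assumes "polytopal_mesh \<Omega> m" "K \<in> cells m"
  shows "open K" "K \<subseteq> \<Omega>" "point m K \<in> K" "finite (faces m K)" "disjoint (faces m K)"
    "frontier K = (\<Union>E\<in>faces m K. closure E)"
    and "E \<in> faces m K ==> cell_face K E"
    and "E \<in> faces m K ==> dist_face m K E > 0"
proof -
  have *: "polytopal_open K \<and> point m K \<in> K \<and> finite (faces m K) \<and> disjoint (faces m K) \<and>
        frontier K = (\<Union>E\<in>faces m K. closure E) \<and>
        (\<forall>E\<in>faces m K. cell_face K E \<and> dist_face m K E > 0)"
    using assms unfolding polytopal_mesh_def by (elim conjE) (erule bspec)
  show "open K" by (rule polytopal_open_open[OF conjunct1[OF *]])
  show "K \<subseteq> \<Omega>" using assms unfolding polytopal_mesh_def by auto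
  show "point m K \<in> K" "finite (faces m K)" "disjoint (faces m K)"
    "frontier K = (\<Union>E\<in>faces m K. closure E)" using * by blast+
  show "E \<in> faces m K ==> cell_face K E" "E \<in> faces m K ==> dist_face m K E > 0"
    using * by blast+
qed

lemma mesh_star_cell:
  assumes "polytopal_mesh \<Omega> m" "K \<in> cells m" "bounded \<Omega>" "star_shaped K (point m K)"
  shows "star_cell K (faces m K) (point m K)"
proof -
  note c = polytopal_mesh_cell[OF assms(1,2)]
  have "point m K \<notin> affine hull E" if "E \<in> faces m K" for E
  proof
    assume "point m K \<in> affine hull E"
    then have "dist_face m K E = 0" unfolding dist_face_def by (rule infdist_zero)
    then show False using c(8)[OF that] by simp
  qed
  then show ?thesis
    unfolding star_cell_def using c assms(3,4) bounded_subset[OF assms(3) c(2)] by blast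
qed

lemma vol_open_pos:
  assumes "open K" "K \<noteq> {}" "bounded K"
  shows "vol K > 0"
proof -
  have "\<not> negligible K" using assms by (simp add: open_not_negligible)
  moreover have "K \<in> lmeasurable" using assms lmeasurable_open by blast
  ultimately show ?thesis
    unfolding vol_def using negligible_iff_measure[of K] measure_nonneg[of lebesgue K] by linarith
qed

lemma norm_diff_le_diameter:
  fixes K :: "'a::euclidean_space set"
  assumes "bounded K" "x \<in> closure K" "y \<in> closure K"
  shows "norm (x - y) \<le> diameter K"
  using diameter_bounded_bound[OF bounded_closure[OF assms(1)] assms(2,3)] diameter_closure[OF assms(1)]
  by (simp add: dist_norm)

lemma mesh_face_data:
  assumes mesh: "polytopal_mesh \<Omega> m" "K \<in> cells m" "bounded \<Omega>" "star_shaped K (point m K)"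
    and E: "E \<in> faces m K"
  shows "area E > 0" "norm (outward_normal K E) = 1"
    "outward_normal K E \<bullet> (barycentre E - point m K) = dist_face m K E"
    "(\<And>s. s \<in> E ==> norm (s - y) \<le> D) ==> norm (barycentre E - y) \<le> D"
    "s \<in> E ==> \<forall>\<^sub>F t in at_right 0. s - t *\<^sub>R outward_normal K E \<in> K \<and> s + t *\<^sub>R outward_normal K E \<notin> K"
    "\<exists>b. affine hull E = {z. outward_normal K E \<bullet> z = b}"
proof -
  note sc = mesh_star_cell[OF mesh]
  let ?n = "outward_normal K E"
  obtain b where b: "norm ?n = 1" "affine hull E = {z. ?n \<bullet> z = b}"
    "openin (top_of_set {z. ?n \<bullet> z = b}) E" "?n \<bullet> point m K < b"
    by (rule star_cell_normal[OF sc E])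
  show "norm ?n = 1" by fact
  show "s \<in> E ==> \<forall>\<^sub>F t in at_right 0. s - t *\<^sub>R ?n \<in> K \<and> s + t *\<^sub>R ?n \<notin> K" by (rule star_cell_outward_normal(2)[OF sc E b])
  show "\<exists>b. affine hull E = {z. ?n \<bullet> z = b}" using b(2) by blast
  note fb = face_borel_bounded[OF sc E]
  show ap: "area E > 0" by (rule area_pos[OF b(1,2,3) star_cell_face(2)[OF sc E] fb(1,2)])
  show "(\<And>s. s \<in> E ==> norm (s - y) \<le> D) ==> norm (barycentre E - y) \<le> D"
    by (rule barycentre_inner(2)[OF b(1,2) fb(1,2) ap])
  \<comment> \<open>The barycentre lies in the hyperplane of the face: the constant value
    \<open>b\<close> is integrated over the face.\<close>
  have "area E * (?n \<bullet> (barycentre E - 0)) = (LINT s:E|surface_measure {z. ?n \<bullet> z = b}. ?n \<bullet> (s - 0))"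
    by (rule barycentre_inner(1)[OF b(1,2) fb(1,2) ap, symmetric])
  also have "\<dots> = (LINT s:E|surface_measure {z. ?n \<bullet> z = b}. b)"
    using b(2) hull_subset[of E affine] fb(1) by (intro set_lebesgue_integral_cong) auto
  also have "\<dots> = area E * b" by (simp add: set_lebesgue_integral_def area_def b(2))
  finally have "?n \<bullet> barycentre E = b" using ap by simp
  moreover have "dist_face m K E = b - ?n \<bullet> point m K"
    unfolding dist_face_def b(2) infdist_hyperplane[OF b(1)] using b(4) by simp
  ultimately show "?n \<bullet> (barycentre E - point m K) = dist_face m K E" by (simp add: inner_diff_right)
qed

lemma mesh_regular_cell:
  assumes mesh: "polytopal_mesh \<Omega> m" "K \<in> cells m" "bounded \<Omega>" "star_shaped K (point m K)"
    and reg: "regular_mesh \<theta> m" "\<theta> > 0"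
  shows "regular_cell \<theta> m K"
proof
  note c = polytopal_mesh_cell[OF mesh(1,2)]
  note sc = mesh_star_cell[OF mesh]
  have bK: "bounded K" using c(2) mesh(3) bounded_subset by blast
  show "finite (faces m K)" by (rule c)
  show "vol K > 0" by (rule vol_open_pos) (use c bK in auto)
  show "\<theta> \<ge> 0" using reg by simp
  fix E assume E: "E \<in> faces m K"
  note fd = mesh_face_data[OF mesh E]
  show "area E > 0" "norm (outward_normal K E) = 1"
    "outward_normal K E \<bullet> (barycentre E - point m K) = dist_face m K E" by (rule fd)+
  show "dist_face m K E > 0" by (rule c(8)[OF E])
  then show "diameter K \<le> \<theta> * dist_face m K E"
    using reg(1) mesh(2) E unfolding regular_mesh_def pos_divide_le_eq[OF \<open>dist_face m K E > 0\<close>, symmetric] by blast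
  show "norm (barycentre E - point m K) \<le> diameter K"
  proof (rule fd(4))
    fix s assume "s \<in> E"
    then have "s \<in> closure K" using star_cell_face(3)[OF sc E] by (auto simp: frontier_def)
    then show "norm (s - point m K) \<le> diameter K"
      using c(3) closure_subset[of K] by (intro norm_diff_le_diameter bK) auto
  qed
next
  note c = polytopal_mesh_cell[OF mesh(1,2)]
  note sc = mesh_star_cell[OF mesh]
  fix \<xi> e :: "real^'a"
  show S0: "(\<Sum>E\<in>faces m K. area E * (outward_normal K E \<bullet> \<xi>)) = 0"
    by (rule star_cell_divergence(1)[OF sc])
  have "(\<Sum>E\<in>faces m K. area E * (outward_normal K E \<bullet> \<xi>) * (e \<bullet> (barycentre E - point m K))) =
    (\<Sum>E\<in>faces m K. area E * (outward_normal K E \<bullet> \<xi>) * (e \<bullet> barycentre E)) -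
    (\<Sum>E\<in>faces m K. area E * (outward_normal K E \<bullet> \<xi>)) * (e \<bullet> point m K)"
    by (simp add: inner_diff_right right_diff_distrib sum_subtractf sum_distrib_right)
  also have "\<dots> = vol K * (e \<bullet> \<xi>)" unfolding S0 star_cell_divergence(2)[OF sc] by simp
  finally show "(\<Sum>E\<in>faces m K. area E * (outward_normal K E \<bullet> \<xi>) * (e \<bullet> (barycentre E - point m K))) = vol K * (e \<bullet> \<xi>)" .
qed

text \<open>Two cells with a common face and the same outward normal would overlap near this face.\<close>

lemma common_face_normal:
  assumes mesh: "polytopal_mesh \<Omega> m" "bounded \<Omega>" "\<And>K. K \<in> cells m ==> star_shaped K (point m K)"
    and KL: "K \<in> cells m" "L \<in> cells m" "K \<noteq> L" "E \<in> faces m K" "E \<in> faces m L"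
  shows "outward_normal L E = - outward_normal K E"
proof -
  note fK = mesh_face_data[OF mesh(1) KL(1) mesh(2) mesh(3)[OF KL(1)] KL(4)]
  note fL = mesh_face_data[OF mesh(1) KL(2) mesh(2) mesh(3)[OF KL(2)] KL(5)]
  have "K \<inter> L = {}" using mesh(1) KL unfolding polytopal_mesh_def disjoint_def by auto
  have "E \<noteq> {}" using polytopal_mesh_cell(7)[OF mesh(1) KL(1,4)] unfolding cell_face_def by auto
  then obtain s where s: "s \<in> E" by auto
  have "outward_normal L E = outward_normal K E \<or> outward_normal L E = - outward_normal K E"
    using hyperplane_normal_unique[OF fK(2) fL(2)] fK(6) fL(6) by blast
  moreover have "outward_normal L E \<noteq> outward_normal K E"
  proof
    assume e: "outward_normal L E = outward_normal K E"
    have "\<forall>\<^sub>F t in at_right (0::real). False"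
      using fK(5)[OF s] fL(5)[OF s] unfolding e
      by eventually_elim (use \<open>K \<inter> L = {}\<close> in blast)
    then show False by simp
  qed
  ultimately show ?thesis by blast
qed

locale elliptic_tensor =
  fixes \<Omega> :: "(real^'d) set" and \<Lambda> :: "real^'d => real^'d^'d" and \<zeta> \<mu> :: real
  assumes open_domain: "open \<Omega>" and bounded_domain: "bounded \<Omega>"
    and zeta_pos: "\<zeta> > 0" and mu_pos: "\<mu> > 0"
    and tensor_measurable: "\<Lambda> \<in> borel_measurable (leb \<Omega>)"
    and tensor_bound: "\<And>x. x \<in> \<Omega> ==> norm (\<Lambda> x) \<le> \<mu>"
    and tensor_sym: "\<And>x. x \<in> \<Omega> ==> transpose (\<Lambda> x) = \<Lambda> x"
    and tensor_coercive: "AE x in leb \<Omega>. \<forall>\<xi>. (\<Lambda> x *v \<xi>) \<bullet> \<xi> \<ge> \<zeta> * (norm \<xi>)^2"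
begin

lemma finite_measure_domain: "finite_measure (leb \<Omega>)"
  using open_domain bounded_domain lmeasurable_open by (intro finite_measure_lebesgue_on) blast

lemma tensor_inner_sym: "x \<in> \<Omega> ==> (\<Lambda> x *v \<xi>) \<bullet> \<eta> = \<xi> \<bullet> (\<Lambda> x *v \<eta>)"
  using tensor_sym[of x] by (metis dot_lmul_matrix inner_commute transpose_matrix_vector)

lemma tensor_vec_bound: "x \<in> \<Omega> ==> norm (\<Lambda> x *v \<xi>) \<le> \<mu> * norm \<xi>"
  using norm_matrix_vector_mult_le[of "\<Lambda> x" \<xi>] mult_right_mono[OF tensor_bound, of x "norm \<xi>"] by simp

lemma set_integrable_cell:
  fixes f :: "real^'d => 'b::{banach, second_countable_topology}"
  assumes "K \<subseteq> \<Omega>" "open K"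
  shows "set_integrable lebesgue K f \<longleftrightarrow> integrable (leb K) f"
    "(LINT x:K|lebesgue. f x) = integral\<^sup>L (leb K) f"
proof -
  have K: "K \<inter> space lebesgue \<in> sets lebesgue" using assms(2) by simp
  show "set_integrable lebesgue K f \<longleftrightarrow> integrable (leb K) f"
    unfolding set_integrable_def by (rule integrable_restrict_space[OF K, symmetric])
  show "(LINT x:K|lebesgue. f x) = integral\<^sup>L (leb K) f"
    unfolding set_lebesgue_integral_def by (rule integral_restrict_space[OF K, symmetric])
qed

lemma tensor_integrable:
  assumes K: "K \<subseteq> \<Omega>" "open K"
  shows "integrable (leb K) \<Lambda>"
proof -
  have "\<Lambda> \<in> borel_measurable (leb K)"
    using tensor_measurable K(1) by (rule measurable_restrict_mono)
  moreover have "finite_measure (leb K)"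
    using K bounded_subset[OF bounded_domain K(1)] lmeasurable_open by (intro finite_measure_lebesgue_on) blast
  ultimately show ?thesis
    using K tensor_bound by (intro finite_measure.integrable_const_bound[where B=\<mu>]) (auto intro!: AE_I2)
qed

lemma mean_tensor_inner:
  assumes K: "K \<subseteq> \<Omega>" "open K"
  shows "(mean_tensor \<Lambda> K *v \<xi>) \<bullet> \<eta> = (1 / vol K) * (LINT x|leb K. (\<Lambda> x *v \<xi>) \<bullet> \<eta>)"
    and "integrable (leb K) (\<lambda>x. (\<Lambda> x *v \<xi>) \<bullet> \<eta>)"
proof -
  have bl: "bounded_linear (\<lambda>M::real^'d^'d. (M *v \<xi>) \<bullet> \<eta>)"
    by (rule linear_conv_bounded_linear[THEN iffD1], rule linearI)
       (simp_all add: matrix_vector_mult_add_rdistrib inner_add_left scaleR_matrix_vector_assoc[symmetric])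
  have "(mean_tensor \<Lambda> K *v \<xi>) \<bullet> \<eta> = (1 / vol K) * ((integral\<^sup>L (leb K) \<Lambda> *v \<xi>) \<bullet> \<eta>)"
    unfolding mean_tensor_def set_integrable_cell(2)[OF K] by (simp add: scaleR_matrix_vector_assoc[symmetric])
  also have "(integral\<^sup>L (leb K) \<Lambda> *v \<xi>) \<bullet> \<eta> = (LINT x|leb K. (\<Lambda> x *v \<xi>) \<bullet> \<eta>)"
    by (rule integral_bounded_linear[OF bl tensor_integrable[OF K], symmetric])
  finally show "(mean_tensor \<Lambda> K *v \<xi>) \<bullet> \<eta> = (1 / vol K) * (LINT x|leb K. (\<Lambda> x *v \<xi>) \<bullet> \<eta>)" .
  show "integrable (leb K) (\<lambda>x. (\<Lambda> x *v \<xi>) \<bullet> \<eta>)"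
    by (rule integrable_bounded_linear[OF bl tensor_integrable[OF K]])
qed

text \<open>Symmetry, coercivity and boundedness pass to the mean over the cell with the same
  \<zeta> and \<mu>, so later constants do not depend on the cell.\<close>

lemma mesh_elliptic_cell:
  assumes rc: "regular_cell \<theta> m K" and K: "K \<subseteq> \<Omega>" "open K"
  shows "elliptic_cell \<theta> m K \<Lambda> \<zeta> \<mu>"
proof (intro elliptic_cell.intro rc elliptic_cell_axioms.intro)
  show "\<zeta> > 0" "\<mu> > 0" by (rule zeta_pos mu_pos)+
  have vp: "vol K > 0" using rc unfolding regular_cell_def by blast
  have "K \<inter> space lebesgue \<in> sets lebesgue" using K(2) by simp
  then have mv: "measure (leb K) (space (leb K)) = vol K"
    unfolding vol_def space_lebesgue_on by (rule measure_restrict_space) simp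
  have volK: "(LINT x|leb K. c) = c * vol K" for c :: real
    unfolding lebesgue_integral_const mv by simp
  have fin: "finite_measure (leb K)"
    using K bounded_subset[OF bounded_domain K(1)] lmeasurable_open by (intro finite_measure_lebesgue_on) blast
  fix \<xi> \<eta>
  show "(mean_tensor \<Lambda> K *v \<xi>) \<bullet> \<eta> = \<xi> \<bullet> (mean_tensor \<Lambda> K *v \<eta>)"
  proof -
    have "(LINT x|leb K. (\<Lambda> x *v \<xi>) \<bullet> \<eta>) = (LINT x|leb K. (\<Lambda> x *v \<eta>) \<bullet> \<xi>)"
      using K tensor_inner_sym by (intro Bochner_Integration.integral_cong) (auto simp: inner_commute)
    then show ?thesis unfolding inner_commute[of \<xi>] mean_tensor_inner(1)[OF K] by simp
  qed
  have AE: "AE x in leb K. \<forall>\<xi>. (\<Lambda> x *v \<xi>) \<bullet> \<xi> \<ge> \<zeta> * (norm \<xi>)^2"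
    using tensor_coercive K open_domain by (auto simp: AE_restrict_space_iff)
  have "\<zeta> * (norm \<xi>)^2 * vol K = (LINT x|leb K. \<zeta> * (norm \<xi>)^2)" by (simp only: volK)
  also have "\<dots> \<le> (LINT x|leb K. (\<Lambda> x *v \<xi>) \<bullet> \<xi>)"
    using AE by (intro integral_mono_AE mean_tensor_inner(2)[OF K] finite_measure.integrable_const[OF fin]) auto
  finally show "\<zeta> * (norm \<xi>)^2 \<le> (mean_tensor \<Lambda> K *v \<xi>) \<bullet> \<xi>"
    unfolding mean_tensor_inner(1)[OF K] using vp by (simp add: field_simps)
  have le: "(mean_tensor \<Lambda> K *v \<xi>) \<bullet> \<eta> \<le> \<mu> * norm \<xi> * norm \<eta>" for \<eta>
  proof -
    have "(LINT x|leb K. (\<Lambda> x *v \<xi>) \<bullet> \<eta>) \<le> (LINT x|leb K. \<mu> * norm \<xi> * norm \<eta>)"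
    proof (intro integral_mono mean_tensor_inner(2)[OF K] finite_measure.integrable_const[OF fin])
      fix x assume "x \<in> space (leb K)"
      then have "x \<in> \<Omega>" using K by auto
      have "(\<Lambda> x *v \<xi>) \<bullet> \<eta> \<le> norm (\<Lambda> x *v \<xi>) * norm \<eta>" by (rule norm_cauchy_schwarz)
      also have "\<dots> \<le> \<mu> * norm \<xi> * norm \<eta>" by (intro mult_right_mono tensor_vec_bound \<open>x \<in> \<Omega>\<close>) auto
      finally show "(\<Lambda> x *v \<xi>) \<bullet> \<eta> \<le> \<mu> * norm \<xi> * norm \<eta>" .
    qed
    also have "\<dots> = \<mu> * norm \<xi> * norm \<eta> * vol K" by (rule volK)
    finally show ?thesis unfolding mean_tensor_inner(1)[OF K] using vp by (simp add: field_simps)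
  qed
  show "norm (mean_tensor \<Lambda> K *v \<xi>) \<le> \<mu> * norm \<xi>"
  proof (cases "mean_tensor \<Lambda> K *v \<xi> = 0")
    case False
    \<comment> \<open>The bound \<open>le\<close> is tested with the image of \<xi> itself.\<close>
    have "norm (mean_tensor \<Lambda> K *v \<xi>) * norm (mean_tensor \<Lambda> K *v \<xi>) \<le> \<mu> * norm \<xi> * norm (mean_tensor \<Lambda> K *v \<xi>)"
      using le[of "mean_tensor \<Lambda> K *v \<xi>"] by (simp add: power2_norm_eq_inner[symmetric] power2_eq_square)
    then show ?thesis using False by (simp add: mult_le_cancel_right)
  qed (use mu_pos in simp)
qed

end

lemma hmmf_matrices_cell:
  assumes ec: "elliptic_cell \<theta> m K \<Lambda> \<zeta> \<mu>" and h: "hmmf_matrices \<Lambda> m K MM BH BM"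
  shows "\<exists>W. hmmf_cell \<theta> m K \<Lambda> \<zeta> \<mu> MM BH BM W"
proof -
  obtain C U W where W: "inverse_matrices (faces m K) MM W"
    and eq: "\<And>V V'. bilin (faces m K) MM V' V =
             (1 / vol K) * (R_transpose m K V' \<bullet> (matrix_inv (mean_tensor \<Lambda> K) *v R_transpose m K V)) +
             bilin {..<card (faces m K) - CARD('a)} U (C_transpose m K C V') (C_transpose m K C V) \<and>
           bilin {..<card (faces m K) - CARD('a)} U (C_transpose m K C V') (C_transpose m K C V) =
             bilin (faces m K) BM (T_op \<Lambda> m K V') (T_op \<Lambda> m K V) \<and>
           bilin (faces m K) W V' V =
             (1 / vol K) * (N_transpose \<Lambda> m K V' \<bullet> (matrix_inv (mean_tensor \<Lambda> K) *v N_transpose \<Lambda> m K V)) +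
             bilin (faces m K) BH (L_op m K V') (L_op m K V)"
    using h unfolding hmmf_matrices_def by (elim conjE exE) blast
  have "hmmf_cell \<theta> m K \<Lambda> \<zeta> \<mu> MM BH BM W"
  proof (intro hmmf_cell.intro ec hmmf_cell_axioms.intro W)
    show "sym_pos_def (faces m K) MM" "sym_pos_def (faces m K) BH" using h unfolding hmmf_matrices_def by blast+
  qed (use eq in simp_all)
  then show ?thesis by blast
qed

section \<open>Test functions and convolutions\<close>

lemma pdI:
  "(\<phi> has_derivative f') (at x) ==> pd i \<phi> x = f' (axis i 1)"
  unfolding partial_deriv_def using frechet_derivative_at by metis

lemma C_k_Suc_differentiable: "C_k (Suc k) \<phi> ==> \<phi> differentiable (at x)"
  by (simp add: differentiable_on_def)

lemma C_k_SucD: "C_k (Suc k) \<phi> ==> C_k k \<phi>"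
proof (induction k arbitrary: \<phi>)
  case 0
  then show ?case by (simp add: differentiable_imp_continuous_on)
next
  case (Suc k)
  then have "\<phi> differentiable_on UNIV" "\<And>i. C_k (Suc k) (pd i \<phi>)" by simp_all
  then show ?case using Suc.IH by simp
qed

lemma C_k_continuous: "C_k k \<phi> ==> continuous_on UNIV \<phi>"
  by (cases k) (simp_all add: differentiable_imp_continuous_on)

lemma C_k_const: "C_k k (\<lambda>x. c)"
proof (induction k arbitrary: c)
  case (Suc k)
  have "pd i (\<lambda>x::real^'a. c) = (\<lambda>x. 0)" for i
    by (rule ext, subst pdI[OF has_derivative_const]) simp
  then show ?case using Suc by simp
qed simp

lemma pd_add:
  assumes "\<And>x. f differentiable (at x)" "\<And>x. g differentiable (at x)"
  shows "pd i (\<lambda>x. f x + g x) = (\<lambda>x. pd i f x + pd i g x)"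
proof
  fix x
  show "pd i (\<lambda>x. f x + g x) x = pd i f x + pd i g x"
    unfolding partial_deriv_def[of i f] partial_deriv_def[of i g]
    by (rule pdI) (intro has_derivative_add frechet_derivative_works[THEN iffD1] assms)
qed

lemma pd_mult:
  assumes "\<And>x. f differentiable (at x)" "\<And>x. g differentiable (at x)"
  shows "pd i (\<lambda>x. f x * g x) = (\<lambda>x. f x * pd i g x + pd i f x * g x)"
proof
  fix x
  show "pd i (\<lambda>x. f x * g x) x = f x * pd i g x + pd i f x * g x"
    unfolding partial_deriv_def[of i f] partial_deriv_def[of i g]
    by (rule pdI) (intro has_derivative_mult frechet_derivative_works[THEN iffD1] assms)
qed

lemma C_k_add: "C_k k f ==> C_k k g ==> C_k k (\<lambda>x. f x + g x)"
proof (induction k arbitrary: f g)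
  case (Suc k)
  note d = C_k_Suc_differentiable[OF Suc.prems(1)] C_k_Suc_differentiable[OF Suc.prems(2)]
  show ?case using Suc.IH Suc.prems d by (auto simp: pd_add differentiable_on_def)
qed (simp add: continuous_on_add)

lemma C_k_mult: "C_k k f ==> C_k k g ==> C_k k (\<lambda>x. f x * g x)"
proof (induction k arbitrary: f g)
  case (Suc k)
  note d = C_k_Suc_differentiable[OF Suc.prems(1)] C_k_Suc_differentiable[OF Suc.prems(2)]
  note l = C_k_SucD[OF Suc.prems(1)] C_k_SucD[OF Suc.prems(2)]
  show ?case using Suc.IH Suc.prems d l by (auto simp: pd_mult differentiable_on_def intro!: C_k_add)
qed (simp add: continuous_on_mult)

lemma C_k_prod: "finite I ==> (\<And>i. i \<in> I ==> C_k k (f i)) ==> C_k k (\<lambda>x. \<Prod>i\<in>I. f i x)"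
  by (induction I rule: finite_induct) (auto intro: C_k_const C_k_mult)

text \<open>Up to linear combinations this family is closed under differentiation, so smoothness
  follows by an induction that treats all \<open>k\<close> at once.\<close>

definition flat :: "nat => real => real" where
  "flat k t = (if t > 0 then exp (- 1 / t) / t ^ k else 0)"

lemma flat_tendsto_0: "(flat k \<longlongrightarrow> 0) (at_right 0)"
proof -
  have "((\<lambda>t. inverse t ^ k / exp (inverse t)) \<longlongrightarrow> 0) (at_right (0::real))"
    by (rule filterlim_compose[OF tendsto_power_div_exp_0 filterlim_inverse_at_top_right])
  then show ?thesis
    by (rule Lim_transform_eventually)
       (auto simp: eventually_at_filter flat_def exp_minus field_simps intro!: always_eventually)
qed

lemma flat_has_real_derivative:
  "(flat k has_real_derivative flat (k + 2) t - real k * flat (k + 1) t) (at t)"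
proof -
  consider "t > 0" | "t < 0" | "t = 0" by linarith
  then show ?thesis
  proof cases
    case 1
    have e: "((\<lambda>t. exp (- 1 / t)) has_real_derivative exp (- 1 / t) * (1 / t^2)) (at t)"
      using 1 by (auto intro!: derivative_eq_intros simp: power2_eq_square)
    have i: "(inverse has_real_derivative - (inverse t ^ 2)) (at t)"
      using DERIV_inverse[of t UNIV] 1 by (simp add: numeral_2_eq_2)
    have "((\<lambda>t. exp (- 1 / t) * inverse t ^ k) has_real_derivative
       exp (- 1 / t) * (1 / t^2) * inverse t ^ k + of_nat k * (- (inverse t ^ 2)) * inverse t ^ (k - Suc 0) * exp (- 1 / t)) (at t)"
      by (rule DERIV_mult[OF e, of "\<lambda>t. inverse t ^ k", OF DERIV_cong[OF DERIV_power[OF i]]]) simp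
    moreover have "exp (- 1 / t) * (1 / t^2) * inverse t ^ k + of_nat k * (- (inverse t ^ 2)) * inverse t ^ (k - Suc 0) * exp (- 1 / t)
      = flat (k + 2) t - real k * flat (k + 1) t"
      using 1 by (cases k) (auto simp: flat_def field_simps power2_eq_square)
    ultimately have "((\<lambda>t. exp (- 1 / t) * inverse t ^ k) has_real_derivative flat (k + 2) t - real k * flat (k + 1) t) (at t)"
      by simp
    then show ?thesis
      by (rule has_field_derivative_transform_within_open[where S="{0<..}"])
         (use 1 in \<open>auto simp: flat_def field_simps\<close>)
  next
    case 2
    have "((\<lambda>t. 0) has_real_derivative flat (k + 2) t - real k * flat (k + 1) t) (at t)"
      using 2 by (simp add: flat_def)
    then show ?thesis
      by (rule has_field_derivative_transform_within_open[where S="{..<0}"]) (use 2 in \<open>auto simp: flat_def\<close>)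
  next
    case 3
    \<comment> \<open>At the origin the right difference quotient of \<open>flat k\<close> is
      \<open>flat (k + 1)\<close>, which tends to zero.\<close>
    have r: "((\<lambda>h. flat k h / h) \<longlongrightarrow> 0) (at_right 0)"
      by (rule Lim_transform_eventually[OF flat_tendsto_0[of "k + 1"]])
         (auto simp: eventually_at_filter flat_def intro!: always_eventually)
    have l: "((\<lambda>h. flat k h / h) \<longlongrightarrow> 0) (at_left 0)"
      by (rule Lim_transform_eventually[OF tendsto_const])
         (auto simp: eventually_at_filter flat_def intro!: always_eventually)
    have "((\<lambda>h. flat k h / h) \<longlongrightarrow> 0) (at 0)"
      using l r by (simp add: filterlim_split_at)
    then show ?thesis using 3 by (simp add: DERIV_def flat_def)
  qed
qed

lemma C_k_flat_affine: "C_k n (\<lambda>x::real^'d. flat k (a + c * x $ i))"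
proof (induction n arbitrary: k)
  case 0
  have "continuous_on UNIV (flat k)"
    using flat_has_real_derivative DERIV_isCont by (intro continuous_at_imp_continuous_on) blast
  then show ?case
    by (auto intro!: continuous_intros continuous_on_compose2[where f="\<lambda>x. a + c * x $ i"])
next
  case (Suc n)
  have D: "((\<lambda>x::real^'d. flat k (a + c * x $ i)) has_derivative
     (\<lambda>h. (flat (k + 2) (a + c * x $ i) - real k * flat (k + 1) (a + c * x $ i)) * (c * h $ i))) (at x)" for x
  proof (rule has_derivative_compose[of "\<lambda>x. a + c * x $ i" "\<lambda>h. c * h $ i" x UNIV "flat k"
        "(*) (flat (k + 2) (a + c * x $ i) - real k * flat (k + 1) (a + c * x $ i))"])
    show "((\<lambda>x. a + c * x $ i) has_derivative (\<lambda>h. c * h $ i)) (at x)"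
      by (auto intro!: derivative_eq_intros bounded_linear_imp_has_derivative[OF bounded_linear_vec_nth])
    show "(flat k has_derivative (*) (flat (k + 2) (a + c * x $ i) - real k * flat (k + 1) (a + c * x $ i))) (at (a + c * x $ i))"
      using flat_has_real_derivative[of k "a + c * x $ i"] by (simp add: has_field_derivative_def)
  qed
  have "pd j (\<lambda>x::real^'d. flat k (a + c * x $ i)) =
    (\<lambda>x. (if j = i then c else 0) * (flat (k + 2) (a + c * x $ i) + (- real k) * flat (k + 1) (a + c * x $ i)))" for j
    by (rule ext, subst pdI[OF D]) (auto simp: axis_def)
  moreover have "C_k n (\<lambda>x::real^'d. (if j = i then c else 0) *
      (flat (k + 2) (a + c * x $ i) + (- real k) * flat (k + 1) (a + c * x $ i)))" for j
    by (intro C_k_mult C_k_add C_k_const Suc.IH)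
  ultimately have "C_k n (pd j (\<lambda>x::real^'d. flat k (a + c * x $ i)))" for j
    by (simp only:)
  then show ?case using D by (auto simp: differentiable_on_def differentiable_def)
qed

section \<open>Test functions: supports, bounds and mollifiers\<close>

lemma tfun_C_k: "tfun U \<phi> ==> C_k k \<phi>"
  unfolding test_function_def by blast

lemma tfun_differentiable: "tfun U \<phi> ==> \<phi> differentiable (at x)"
  using C_k_Suc_differentiable[of 0 \<phi>] tfun_C_k by blast

lemma tfun_continuous: "tfun U \<phi> ==> continuous_on S \<phi>"
  using C_k_continuous[of 0 \<phi>] tfun_C_k continuous_on_subset by blast

lemma tfunI:
  assumes "\<And>k. C_k k \<phi>" "compact S" "S \<subseteq> U" "\<And>x. x \<notin> S ==> \<phi> x = 0"
  shows "tfun U \<phi>"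
proof -
  have "closure {x. \<phi> x \<noteq> 0} \<subseteq> S"
    using assms by (intro closure_minimal compact_imp_closed) auto
  moreover from this have "compact (closure {x. \<phi> x \<noteq> 0})"
    using assms(2) by (metis closed_closure compact_Int_closed inf.absorb2)
  ultimately show ?thesis unfolding test_function_def using assms by blast
qed

lemma tfun_support:
  assumes "tfun U \<phi>"
  shows "\<exists>S. compact S \<and> S \<subseteq> U \<and> (\<forall>x. x \<notin> S --> \<phi> x = 0 \<and> (\<forall>i. pd i \<phi> x = 0))"
proof (intro exI conjI allI impI)
  let ?S = "closure {x. \<phi> x \<noteq> 0}"
  show "compact ?S" "?S \<subseteq> U" using assms unfolding test_function_def by blast+
  show z: "\<phi> x = 0" if "x \<notin> ?S" for x
    using that closure_subset[of "{x. \<phi> x \<noteq> 0}"] by blast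
  show "pd i \<phi> x = 0" if x: "x \<notin> ?S" for x i
  proof -
    have "((\<lambda>x. 0) has_derivative (\<lambda>h. 0)) (at x)" by simp
    then have "(\<phi> has_derivative (\<lambda>h. 0)) (at x)"
    proof (rule has_derivative_transform_within_open)
      show "open (- ?S)" "x \<in> - ?S" using x by auto
      show "0 = \<phi> y" if "y \<in> - ?S" for y using z[of y] that by (metis ComplD)
    qed
    then show ?thesis by (simp add: pdI)
  qed
qed

lemma tfun_pd:
  assumes "tfun U \<phi>"
  shows "tfun U (pd i \<phi>)"
proof -
  obtain S where S: "compact S" "S \<subseteq> U" "\<And>x i. x \<notin> S ==> pd i \<phi> x = 0"
    using tfun_support[OF assms] by blast
  have "C_k k (pd i \<phi>)" for k using tfun_C_k[OF assms, of "Suc k"] by simp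
  then show ?thesis using S by (intro tfunI[where S=S]) auto
qed

lemma tfun_mult:
  assumes "tfun U \<phi>" "\<And>k. C_k k \<psi>"
  shows "tfun U (\<lambda>x. \<phi> x * \<psi> x)"
proof -
  obtain S where S: "compact S" "S \<subseteq> U" "\<And>x. x \<notin> S ==> \<phi> x = 0"
    using tfun_support[OF assms(1)] by blast
  show ?thesis using S tfun_C_k[OF assms(1)] assms(2)
    by (intro tfunI[where S=S] C_k_mult) auto
qed

lemma tfun_bounded:
  assumes "tfun U \<phi>"
  obtains B where "B > 0" "\<And>x. \<bar>\<phi> x\<bar> \<le> B"
proof -
  obtain S where S: "compact S" and S0: "\<forall>x. x \<notin> S --> \<phi> x = 0 \<and> (\<forall>i. pd i \<phi> x = 0)"
    using tfun_support[OF assms] by (elim exE conjE)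
  have "bounded (\<phi> ` S)"
    using S tfun_continuous[OF assms] by (intro compact_imp_bounded compact_continuous_image)
  then obtain B where B: "B > 0" "\<And>x. x \<in> S ==> norm (\<phi> x) \<le> B" unfolding bounded_pos by auto
  have "\<bar>\<phi> x\<bar> \<le> B" for x using B spec[OF S0, of x] by (cases "x \<in> S") auto
  then show ?thesis by (rule that[OF B(1)])
qed

lemma tfun_integrable:
  assumes "tfun U \<phi>"
  shows "integrable lborel \<phi>"
proof -
  obtain S where S: "compact S" and S0: "\<forall>x. x \<notin> S --> \<phi> x = 0 \<and> (\<forall>i. pd i \<phi> x = 0)"
    using tfun_support[OF assms] by (elim exE conjE)
  have "integrable lborel (\<lambda>x. indicator S x *\<^sub>R \<phi> x)"
    by (rule borel_integrable_compact[OF S tfun_continuous[OF assms]])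
  moreover have "(\<lambda>x. indicator S x *\<^sub>R \<phi> x) = \<phi>"
    by (rule ext) (use S0 in \<open>auto simp: indicator_def\<close>)
  ultimately show ?thesis by simp
qed

lemma tfun_borel: "tfun U \<phi> ==> \<phi> \<in> borel_measurable borel"
  by (intro borel_measurable_continuous_onI tfun_continuous)

lemma mollifier_exists:
  assumes "\<epsilon> > 0"
  obtains \<kappa> :: "real^'d => real" where "tfun UNIV \<kappa>" "\<And>x. \<kappa> x \<ge> 0"
    "\<And>x. \<kappa> x \<noteq> 0 ==> norm x < \<epsilon>" "integral\<^sup>L lborel \<kappa> = 1"
    "\<And>x. \<kappa> (- x) = \<kappa> x"
proof -
  \<comment> \<open>The cube of half side \<delta> lies in the ball of radius \<epsilon>, by
    comparison with the sum of the absolute coordinates. Each coordinate contributes an even bump,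
    so the product is even.\<close>
  define \<delta> where "\<delta> = \<epsilon> / CARD('d)"
  have \<delta>: "\<delta> > 0" using assms by (simp add: \<delta>_def)
  define g where "g x = (\<Prod>i\<in>(UNIV::'d set). flat 0 (\<delta> + 1 * x $ i) * flat 0 (\<delta> + (-1) * x $ i))" for x :: "real^'d"
  have flat_nonneg: "flat 0 t \<ge> 0" and flat_pos: "flat 0 t > 0 \<longleftrightarrow> t > 0" for t by (auto simp: flat_def)
  have g0: "g x \<ge> 0" for x unfolding g_def by (intro prod_nonneg mult_nonneg_nonneg flat_nonneg ballI)
  have gpos: "g x \<noteq> 0 \<longleftrightarrow> (\<forall>i. \<bar>x $ i\<bar> < \<delta>)" for x
  proof -
    have "g x \<noteq> 0 \<longleftrightarrow> (\<forall>i. flat 0 (\<delta> + x $ i) \<noteq> 0 \<and> flat 0 (\<delta> - x $ i) \<noteq> 0)" by (auto simp: g_def)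
    also have "\<dots> \<longleftrightarrow> (\<forall>i. \<bar>x $ i\<bar> < \<delta>)"
    proof (rule all_cong1)
      show "flat 0 (\<delta> + x $ i) \<noteq> 0 \<and> flat 0 (\<delta> - x $ i) \<noteq> 0 \<longleftrightarrow> \<bar>x $ i\<bar> < \<delta>" for i
        by (simp add: flat_def) linarith
    qed
    finally show ?thesis .
  qed
  have supp: "norm x < \<epsilon>" if "g x \<noteq> 0" for x
  proof -
    have "norm x \<le> (\<Sum>i\<in>UNIV. \<bar>x $ i\<bar>)" by (rule norm_le_l1_cart)
    also have "\<dots> < (\<Sum>i\<in>(UNIV::'d set). \<delta>)" using gpos that by (intro sum_strict_mono) auto
    also have "\<dots> = \<epsilon>" by (simp add: \<delta>_def)
    finally show ?thesis .
  qed
  have Ck: "C_k k g" for k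
    unfolding g_def by (intro C_k_prod C_k_mult C_k_flat_affine) simp
  have tg: "tfun UNIV g"
    by (rule tfunI[where S="cball 0 \<epsilon>"]) (use Ck supp in \<open>fastforce+\<close>)
  define I where "I = integral\<^sup>L lborel g"
  have int: "integrable lborel g" by (rule tfun_integrable[OF tg])
  \<comment> \<open>Otherwise the nonnegative \<open>g\<close> would vanish almost everywhere,
    although it is nonzero on a non-empty open set.\<close>
  have "I \<noteq> 0"
  proof
    assume "I = 0"
    then have "AE x in lborel. g x = 0"
      unfolding I_def using integral_nonneg_eq_0_iff_AE[OF int] g0 by simp
    moreover have "{x. g x \<noteq> 0} \<in> sets borel"
      using tfun_borel[OF tg] by measurable
    ultimately have "{x. g x \<noteq> 0} \<in> null_sets lborel" by (simp add: AE_iff_null_sets)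
    then have "negligible {x. g x \<noteq> 0}" by (simp add: negligible_iff_null_sets null_sets_def)
    moreover have "open {x. g x \<noteq> 0}"
    proof -
      have "open (g -` (- {0}))"
        using tfun_continuous[OF tg] by (intro open_vimage) auto
      then show ?thesis by (simp add: vimage_def)
    qed
    moreover have "(0::real^'d) \<in> {x. g x \<noteq> 0}" using gpos[of 0] \<delta> by simp
    ultimately show False using open_not_negligible by blast
  qed
  moreover have "I \<ge> 0" unfolding I_def by (intro integral_nonneg_AE) (simp add: g0)
  ultimately have I: "I > 0" by simp
  show ?thesis
  proof
    show "tfun UNIV (\<lambda>x. g x * (1 / I))" by (intro tfun_mult tg C_k_const)
    show "g x * (1 / I) \<ge> 0" for x using g0 I by simp
    show "norm x < \<epsilon>" if "g x * (1 / I) \<noteq> 0" for x using supp that by auto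
    show "integral\<^sup>L lborel (\<lambda>x. g x * (1 / I)) = 1" using I by (simp add: I_def)
    show "g (- x) * (1 / I) = g x * (1 / I)" for x by (simp add: g_def mult.commute)
  qed
qed

lemma C_k_component: "C_k k (\<lambda>x::real^'d. x $ i)"
proof (cases k)
  case 0 then show ?thesis by (simp add: continuous_intros)
next
  case (Suc j)
  have D: "((\<lambda>x::real^'d. x $ i) has_derivative (\<lambda>h. h $ i)) (at x)" for x
    by (rule bounded_linear_imp_has_derivative[OF bounded_linear_vec_nth])
  have "pd l (\<lambda>x::real^'d. x $ i) = (\<lambda>x. axis l 1 $ i)" for l
    by (rule ext) (rule pdI[OF D])
  then show ?thesis using Suc D C_k_const by (auto simp: differentiable_on_def differentiable_def)
qed

lemma C_k_polynomial: "real_polynomial_function p ==> C_k k p" for p :: "real^'d => real"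
proof (induction p rule: real_polynomial_function.induct)
  case (linear f)
  have 1: "C_k k (\<lambda>x. \<Sum>i\<in>I. x $ i * f (axis i 1))" if "finite I" for I
    using that by induction (simp_all add: C_k_add C_k_mult C_k_const C_k_component)
  have 2: "f = (\<lambda>x. \<Sum>i\<in>UNIV. x $ i * f (axis i 1))"
  proof
    fix x
    have "f x = f (\<Sum>i\<in>UNIV. x $ i *\<^sub>R axis i 1)" using basis_expansion[of x] by (simp add: scalar_mult_eq_scaleR)
    then show "f x = (\<Sum>i\<in>UNIV. x $ i * f (axis i 1))"
      using bounded_linear.linear[OF linear] by (simp add: linear_sum linear_scale)
  qed
  show ?case by (subst 2) (rule 1[OF finite])
qed (simp_all only: C_k_const C_k_add C_k_mult)

section \<open>Gradients, Lipschitz bounds and first order expansions\<close>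

lemma tfun_has_derivative:
  assumes "\<phi> differentiable (at x)"
  shows "(\<phi> has_derivative (\<lambda>h. grad \<phi> x \<bullet> h)) (at x)"
proof -
  let ?f = "frechet_derivative \<phi> (at x)"
  have f: "(\<phi> has_derivative ?f) (at x)" using assms by (simp add: frechet_derivative_works)
  then have lin: "linear ?f" by (rule has_derivative_linear)
  have "?f h = grad \<phi> x \<bullet> h" for h
  proof -
    have "?f h = ?f (\<Sum>i\<in>UNIV. h $ i *\<^sub>R axis i 1)"
      using basis_expansion[of h] by (simp add: scalar_mult_eq_scaleR)
    also have "\<dots> = (\<Sum>i\<in>UNIV. h $ i * ?f (axis i 1))"
      by (simp add: linear_sum[OF lin] linear_cmul[OF lin])
    finally show ?thesis by (simp add: grad_def inner_vec_def partial_deriv_def mult.commute)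
  qed
  then have "?f = (\<lambda>h. grad \<phi> x \<bullet> h)" by (rule ext)
  then show ?thesis using f by simp
qed

lemma tfun_grad_bounded:
  assumes "tfun U \<phi>"
  obtains B where "B > 0" "\<And>x. norm (grad \<phi> x) \<le> B"
proof -
  have "\<forall>i. \<exists>B>0. \<forall>x. \<bar>pd i \<phi> x\<bar> \<le> B"
  proof
    fix i
    obtain B where "B > 0" "\<And>x. \<bar>pd i \<phi> x\<bar> \<le> B"
      by (rule tfun_bounded[OF tfun_pd[OF assms, of i]]) blast
    then show "\<exists>B>0. \<forall>x. \<bar>pd i \<phi> x\<bar> \<le> B" by blast
  qed
  then obtain B where B: "\<And>i. B i > 0" "\<And>i x. \<bar>pd i \<phi> x\<bar> \<le> B i" by metis
  show ?thesis
  proof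
    show "(\<Sum>i\<in>UNIV. B i) > 0" using B by (intro sum_pos) auto
    fix x
    have "norm (grad \<phi> x) \<le> (\<Sum>i\<in>UNIV. \<bar>grad \<phi> x $ i\<bar>)" by (rule norm_le_l1_cart)
    also have "\<dots> \<le> (\<Sum>i\<in>UNIV. B i)" using B by (intro sum_mono) (simp add: grad_def)
    finally show "norm (grad \<phi> x) \<le> (\<Sum>i\<in>UNIV. B i)" .
  qed
qed

lemma onorm_inner_le: "onorm (\<lambda>h. v \<bullet> h) \<le> norm (v::'a::real_inner)"
  by (rule onorm_bound) (simp_all add: Cauchy_Schwarz_ineq2)

lemma tfun_lipschitz:
  assumes "tfun U \<phi>"
  obtains L where "L > 0" "\<And>x y. \<bar>\<phi> y - \<phi> x\<bar> \<le> L * norm (y - x)"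
proof -
  obtain L where L: "L > 0" "\<And>x. norm (grad \<phi> x) \<le> L" by (rule tfun_grad_bounded[OF assms]) blast
  have "norm (\<phi> y - \<phi> x) \<le> L * norm (y - x)" for x y
  proof (rule differentiable_bound[of UNIV])
    show "(\<phi> has_derivative (\<lambda>h. grad \<phi> z \<bullet> h)) (at z within UNIV)" for z
      using tfun_has_derivative[OF tfun_differentiable[OF assms]] by simp
    show "onorm (\<lambda>h. grad \<phi> z \<bullet> h) \<le> L" for z using onorm_inner_le L(2) order_trans by blast
  qed auto
  then show ?thesis by (intro that[OF L(1)]) simp
qed

text \<open>One constant for the Lipschitz bounds of a function and its gradient and for the
  quadratic Taylor remainder. The gradient \<open>G\<close> is an argument of its own so that the
  notion also covers reflected kernels \<open>\<lambda>y. \<kappa> (x - y)\<close>.\<close>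

definition C11_bound :: "real => (real^'n => real) => (real^'n => real^'n) => bool" where
  "C11_bound C \<phi> G \<longleftrightarrow> C > 0 \<and> (\<forall>x y. \<bar>\<phi> y - \<phi> x\<bar> \<le> C * norm (y - x)) \<and>
    (\<forall>x y. norm (G y - G x) \<le> C * norm (y - x)) \<and>
    (\<forall>x y. \<bar>\<phi> y - \<phi> x - G x \<bullet> (y - x)\<bar> \<le> C * (norm (y - x))^2)"

lemma C11_boundD:
  assumes "C11_bound C \<phi> G"
  shows "C > 0" "\<bar>\<phi> y - \<phi> x\<bar> \<le> C * norm (y - x)" "norm (G y - G x) \<le> C * norm (y - x)"
    "\<bar>\<phi> y - \<phi> x - G x \<bullet> (y - x)\<bar> \<le> C * (norm (y - x))^2"
  using assms by (auto simp: C11_bound_def)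

lemma C11_bound_mono:
  assumes "C11_bound C \<phi> G" "C \<le> C'"
  shows "C11_bound C' \<phi> G"
  unfolding C11_bound_def using C11_boundD(1)[OF assms(1)] assms(2)
  by (intro conjI allI C11_boundD(2-4)[OF assms(1), THEN order_trans] mult_right_mono) auto

lemma C11_bound_reflect:
  assumes "C11_bound C \<phi> G"
  shows "C11_bound C (\<lambda>y. \<phi> (x - y)) (\<lambda>y. - G (x - y))"
  unfolding C11_bound_def
proof (intro conjI allI)
  note C = C11_boundD[OF assms]
  show "C > 0" by (rule C)
  fix y z
  show "\<bar>\<phi> (x - z) - \<phi> (x - y)\<bar> \<le> C * norm (z - y)" using C(2)[of "x - z" "x - y"] by (simp add: norm_minus_commute)
  show "norm (- G (x - z) - - G (x - y)) \<le> C * norm (z - y)" using C(3)[of "x - y" "x - z"] by (simp add: norm_minus_commute)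
  show "\<bar>\<phi> (x - z) - \<phi> (x - y) - - G (x - y) \<bullet> (z - y)\<bar> \<le> C * (norm (z - y))^2"
    using C(4)[of "x - z" "x - y"] by (simp add: norm_minus_commute inner_diff_right)
qed

lemma tfun_C11:
  assumes "tfun U \<phi>"
  obtains C where "C11_bound C \<phi> (grad \<phi>)"
proof -
  obtain L where L: "L > 0" "\<And>x y. \<bar>\<phi> y - \<phi> x\<bar> \<le> L * norm (y - x)" by (rule tfun_lipschitz[OF assms]) blast
  have "\<forall>i. \<exists>L>0. \<forall>x y. \<bar>pd i \<phi> y - pd i \<phi> x\<bar> \<le> L * norm (y - x)"
  proof
    fix i
    obtain L where "L > 0" "\<And>x y. \<bar>pd i \<phi> y - pd i \<phi> x\<bar> \<le> L * norm (y - x)"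
      by (rule tfun_lipschitz[OF tfun_pd[OF assms, of i]]) blast
    then show "\<exists>L>0. \<forall>x y. \<bar>pd i \<phi> y - pd i \<phi> x\<bar> \<le> L * norm (y - x)" by blast
  qed
  then obtain H where H: "\<And>i. H i > 0"
    "\<And>i x y. \<bar>pd i \<phi> y - pd i \<phi> x\<bar> \<le> H i * norm (y - x)" by metis
  define S where "S = (\<Sum>i\<in>UNIV. H i)"
  have S: "S > 0" unfolding S_def using H by (intro sum_pos) auto
  have gl: "norm (grad \<phi> y - grad \<phi> x) \<le> S * norm (y - x)" for x y
  proof -
    have "norm (grad \<phi> y - grad \<phi> x) \<le> (\<Sum>i\<in>UNIV. \<bar>(grad \<phi> y - grad \<phi> x) $ i\<bar>)" by (rule norm_le_l1_cart)
    also have "\<dots> \<le> (\<Sum>i\<in>UNIV. H i * norm (y - x))" using H by (intro sum_mono) (simp add: grad_def)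
    finally show ?thesis by (simp add: S_def sum_distrib_right)
  qed
  have ta: "\<bar>\<phi> y - \<phi> x - grad \<phi> x \<bullet> (y - x)\<bar> \<le> S * (norm (y - x))^2" for x y
  proof -
    \<comment> \<open>Subtracting the linear part leaves a function whose derivative on the segment
      is bounded by \<open>S * norm (y - x)\<close>.\<close>
    let ?g = "\<lambda>z. \<phi> z - grad \<phi> x \<bullet> z"
    have "norm (?g y - ?g x) \<le> (S * norm (y - x)) * norm (y - x)"
    proof (rule differentiable_bound[of "closed_segment x y" ?g "\<lambda>z h. (grad \<phi> z - grad \<phi> x) \<bullet> h"])
      fix z assume z: "z \<in> closed_segment x y"
      show "(?g has_derivative (\<lambda>h. (grad \<phi> z - grad \<phi> x) \<bullet> h)) (at z within closed_segment x y)"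
        unfolding inner_diff_left
        by (intro has_derivative_diff has_derivative_inner_right has_derivative_ident
             has_derivative_at_withinI[OF tfun_has_derivative[OF tfun_differentiable[OF assms]]])
      have "norm (z - x) \<le> norm (y - x)" using segment_bound1[OF z] by simp
      then have "norm (grad \<phi> z - grad \<phi> x) \<le> S * norm (y - x)"
        using S by (intro order_trans[OF gl] mult_left_mono) auto
      then show "onorm (\<lambda>h. (grad \<phi> z - grad \<phi> x) \<bullet> h) \<le> S * norm (y - x)"
        using onorm_inner_le order_trans by blast
    qed auto
    then show ?thesis by (simp add: inner_diff_right power2_eq_square algebra_simps)
  qed
  have "\<bar>\<phi> y - \<phi> x\<bar> \<le> (L + S) * norm (y - x) \<and> norm (grad \<phi> y - grad \<phi> x) \<le> (L + S) * norm (y - x) \<and>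
    \<bar>\<phi> y - \<phi> x - grad \<phi> x \<bullet> (y - x)\<bar> \<le> (L + S) * (norm (y - x))^2" for x y
    using S L(1) by (intro conjI order_trans[OF L(2)] order_trans[OF gl] order_trans[OF ta] mult_right_mono) auto
  then show ?thesis using that[of "L + S"] S L(1) unfolding C11_bound_def by simp
qed

section \<open>Reflections, convolutions and cut-off functions\<close>

lemma nn_integral_lborel_reflect:
  fixes x :: "'a::euclidean_space"
  assumes [measurable]: "f \<in> borel_measurable borel"
  shows "(\<integral>\<^sup>+y. f (x - y) \<partial>lborel) = (\<integral>\<^sup>+y. f y \<partial>lborel)"
  by (subst (2) lborel_affine[of "-1" x]) (auto simp: nn_integral_density nn_integral_distr)

lemma integral_lborel_reflect:
  fixes x :: "'a::euclidean_space" and f :: "'a => real"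
  assumes [measurable]: "f \<in> borel_measurable borel"
  shows "(LBINT y. f (x - y)) = (LBINT y. f y)"
    and "integrable lborel f ==> integrable lborel (\<lambda>y. f (x - y))"
proof -
  have d: "distr lborel borel (\<lambda>y. x - y) = (lborel :: 'a measure)"
  proof (rule measure_eqI)
    fix A assume "A \<in> sets (distr lborel borel (\<lambda>y. x - y))"
    then have [measurable]: "A \<in> sets borel" by simp
    show "emeasure (distr lborel borel (\<lambda>y. x - y)) A = emeasure lborel A"
      using nn_integral_lborel_reflect[of "indicator A" x]
      by (subst emeasure_distr) (auto simp: vimage_def indicator_def[abs_def] simp flip: nn_integral_indicator)
  qed simp
  show "(LBINT y. f (x - y)) = (LBINT y. f y)"
    by (subst (2) d[symmetric], subst integral_distr) auto
  assume "integrable lborel f"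
  then have "integrable (distr lborel borel (\<lambda>y. x - y)) f" by (simp add: d)
  then show "integrable lborel (\<lambda>y. f (x - y))" by (subst (asm) integrable_distr_eq) auto
qed

definition conv :: "('a::euclidean_space => real) => ('a => real) => 'a => real" where
  "conv u \<kappa> x = (LBINT y. u y * \<kappa> (x - y))"

lemma conv_integrable:
  fixes u \<kappa> :: "'a::euclidean_space => real"
  assumes u: "integrable lborel u" and k: "\<kappa> \<in> borel_measurable borel" "\<And>x. \<bar>\<kappa> x\<bar> \<le> B"
  shows "integrable lborel (\<lambda>y. u y * \<kappa> (x - y))"
proof (rule Bochner_Integration.integrable_bound[of _ "\<lambda>y. B * u y"])
  have [measurable]: "u \<in> borel_measurable borel" using borel_measurable_integrable[OF u] by simp
  note k(1)[measurable]
  show "(\<lambda>y. u y * \<kappa> (x - y)) \<in> borel_measurable lborel" by measurable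
  show "AE y in lborel. norm (u y * \<kappa> (x - y)) \<le> norm (B * u y)"
  proof (rule AE_I2)
    fix y
    have "0 \<le> B" using k(2)[of 0] by (meson abs_ge_zero order_trans)
    then show "norm (u y * \<kappa> (x - y)) \<le> norm (B * u y)"
      using mult_right_mono[OF k(2)[of "x - y"], of "\<bar>u y\<bar>"] by (simp add: abs_mult mult.commute)
  qed
qed (use u in simp)

text \<open>The Taylor remainder of the kernel is quadratic with a uniform constant; integrated
  against \<open>u\<close> it remains quadratic in the increment.\<close>

lemma conv_has_derivative:
  fixes u :: "real^'d => real"
  assumes u: "integrable lborel u" and k: "tfun U \<kappa>"
  shows "(conv u \<kappa> has_derivative (\<lambda>h. \<Sum>i\<in>UNIV. conv u (pd i \<kappa>) x * h $ i)) (at x)"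
proof -
  obtain C where C: "C11_bound C \<kappa> (grad \<kappa>)" by (rule tfun_C11[OF k])
  have ti: "integrable lborel (\<lambda>y. u y * f (z - y))" if "tfun U f" for f z
    by (rule tfun_bounded[OF that]) (rule conv_integrable[OF u tfun_borel[OF that]])
  note int = ti[OF k] and inti = ti[OF tfun_pd[OF k]]
  define N where "N = (LBINT y. \<bar>u y\<bar>)"
  have N: "N \<ge> 0" unfolding N_def by simp
  let ?D = "\<lambda>h. \<Sum>i\<in>UNIV. conv u (pd i \<kappa>) x * h $ i"
  have rem: "norm (conv u \<kappa> z - conv u \<kappa> x - ?D (z - x)) \<le> C * N * (norm (z - x))^2" for z
  proof -
    let ?R = "\<lambda>y. u y * (\<kappa> (z - y) - \<kappa> (x - y) - grad \<kappa> (x - y) \<bullet> (z - x))"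
    have Req: "?R = (\<lambda>y. u y * \<kappa> (z - y) - u y * \<kappa> (x - y) - (\<Sum>i\<in>UNIV. u y * pd i \<kappa> (x - y) * (z - x) $ i))"
      by (rule ext) (simp add: inner_vec_def grad_def right_diff_distrib sum_distrib_left mult.assoc)
    have intR: "integrable lborel ?R" unfolding Req using int inti by (intro Bochner_Integration.integrable_diff Bochner_Integration.integrable_sum) auto
    have eq: "conv u \<kappa> z - conv u \<kappa> x - ?D (z - x) = (LBINT y. ?R y)"
      unfolding Req conv_def using int inti
      by (simp add: Bochner_Integration.integral_diff Bochner_Integration.integral_sum)
    have "norm (conv u \<kappa> z - conv u \<kappa> x - ?D (z - x)) \<le> (LBINT y. norm (?R y))"
      unfolding eq by (rule integral_norm_bound)
    also have "\<dots> \<le> (LBINT y. C * (norm (z - x))^2 * \<bar>u y\<bar>)"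
    proof (rule integral_mono)
      show "integrable lborel (\<lambda>y. norm (?R y))" by (rule integrable_norm[OF intR])
      show "integrable lborel (\<lambda>y. C * (norm (z - x))^2 * \<bar>u y\<bar>)"
        by (rule integrable_mult_right[OF integrable_abs[OF u]])
      fix y
      have "\<bar>\<kappa> (z - y) - \<kappa> (x - y) - grad \<kappa> (x - y) \<bullet> (z - x)\<bar> \<le> C * (norm (z - x))^2"
        using C11_boundD(4)[OF C, where x="x - y" and y="z - y"] by simp
      from mult_left_mono[OF this abs_ge_zero[of "u y"]]
      show "norm (?R y) \<le> C * (norm (z - x))^2 * \<bar>u y\<bar>"
        unfolding real_norm_def abs_mult by (simp only: mult.commute[of "\<bar>u y\<bar>"])
    qed
    also have "\<dots> = C * N * (norm (z - x))^2" by (simp add: N_def)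
    finally show ?thesis .
  qed
  show ?thesis
  proof (rule has_derivativeI_sandwich[of 1 _ _ _ _ "\<lambda>z. C * N * norm (z - x)"])
    show "bounded_linear ?D"
      by (intro bounded_linear_sum bounded_linear_const_mult bounded_linear_vec_nth)
    fix z :: "real^'d" assume "z \<noteq> x"
    then show "norm (conv u \<kappa> z - conv u \<kappa> x - ?D (z - x)) / norm (z - x) \<le> C * N * norm (z - x)"
      using rem[of z] by (simp add: pos_divide_le_eq power2_eq_square mult.assoc)
  next
    have "((\<lambda>z. C * N * norm (z - x)) \<longlongrightarrow> C * N * norm (x - x)) (at x)" by (intro tendsto_intros)
    then show "((\<lambda>z. C * N * norm (z - x)) \<longlongrightarrow> 0) (at x)" by simp
  qed simp
qed

lemma pd_conv:
  assumes "integrable lborel u" "tfun U \<kappa>"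
  shows "pd i (conv u \<kappa>) = conv u (pd i \<kappa>)"
proof
  fix x
  show "pd i (conv u \<kappa>) x = conv u (pd i \<kappa>) x"
    by (subst pdI[OF conv_has_derivative[OF assms]]) (simp add: axis_def if_distrib cong: if_cong)
qed

lemma C_k_conv:
  assumes "integrable lborel u" "tfun U \<kappa>"
  shows "C_k k (conv u \<kappa>)"
  using assms(2)
proof (induction k arbitrary: \<kappa>)
  case 0
  then show ?case
    using has_derivative_continuous[OF conv_has_derivative[OF assms(1)]]
    by (auto intro!: continuous_at_imp_continuous_on)
next
  case (Suc k)
  have "conv u \<kappa> differentiable_on UNIV"
    using conv_has_derivative[OF assms(1) Suc.prems] by (auto simp: differentiable_on_def differentiable_def)
  moreover have "C_k k (pd i (conv u \<kappa>))" for i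
    unfolding pd_conv[OF assms(1) Suc.prems] by (rule Suc.IH[OF tfun_pd[OF Suc.prems]])
  ultimately show ?case by simp
qed

lemma conv_nonzeroD:
  assumes "conv u \<kappa> x \<noteq> 0" "\<And>z. \<kappa> z \<noteq> 0 ==> norm z < \<epsilon>"
  shows "\<exists>y. u y \<noteq> 0 \<and> norm (x - y) < \<epsilon>"
proof (rule ccontr)
  assume no: "\<nexists>y. u y \<noteq> 0 \<and> norm (x - y) < \<epsilon>"
  have "u y * \<kappa> (x - y) = 0" for y
  proof (cases "u y = 0")
    case False
    then have "\<not> norm (x - y) < \<epsilon>" using no by blast
    then have "\<kappa> (x - y) = 0" using assms(2)[of "x - y"] by blast
    then show ?thesis by simp
  qed simp
  then have "(\<lambda>y. u y * \<kappa> (x - y)) = (\<lambda>y. 0)" by (rule ext)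
  then have "conv u \<kappa> x = 0" unfolding conv_def by (simp only: Bochner_Integration.integral_zero)
  then show False using assms(1) by contradiction
qed

text \<open>An average with a nonnegative kernel of mass one stays within any bound around
  \<open>c\<close> that holds on the ball seen by the kernel.\<close>

lemma conv_diff_le:
  fixes u :: "real^'d => real"
  assumes u: "integrable lborel u" and k: "tfun U \<kappa>"
    and k0: "\<And>x. \<kappa> x \<ge> 0" "integral\<^sup>L lborel \<kappa> = 1" "\<And>x. \<kappa> x \<noteq> 0 ==> norm x < \<epsilon>"
    and near: "\<And>y. norm (x - y) < \<epsilon> ==> \<bar>u y - c\<bar> \<le> \<eta>"
  shows "\<bar>conv u \<kappa> x - c\<bar> \<le> \<eta>"
proof -
  obtain B where B: "\<And>x. \<bar>\<kappa> x\<bar> \<le> B" by (rule tfun_bounded[OF k]) blast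
  note bk = tfun_borel[OF k]
  have i1: "integrable lborel (\<lambda>y. u y * \<kappa> (x - y))" by (rule conv_integrable[OF u bk B])
  have i2: "integrable lborel (\<lambda>y. \<kappa> (x - y))"
    by (rule integral_lborel_reflect(2)[OF bk tfun_integrable[OF k]])
  have one: "(LBINT y. \<kappa> (x - y)) = 1" using integral_lborel_reflect(1)[OF bk] k0(2) by simp
  have eq: "conv u \<kappa> x - c = (LBINT y. (u y - c) * \<kappa> (x - y))"
    unfolding conv_def left_diff_distrib using i1 i2 one by simp
  have "\<bar>conv u \<kappa> x - c\<bar> \<le> (LBINT y. \<bar>(u y - c) * \<kappa> (x - y)\<bar>)"
    unfolding eq by (rule integral_abs_bound)
  also have "\<dots> \<le> (LBINT y. \<eta> * \<kappa> (x - y))"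
  proof (rule integral_mono)
    show "integrable lborel (\<lambda>y. \<bar>(u y - c) * \<kappa> (x - y)\<bar>)"
      unfolding left_diff_distrib using i1 i2 by auto
    show "integrable lborel (\<lambda>y. \<eta> * \<kappa> (x - y))" using i2 by simp
    fix y
    show "\<bar>(u y - c) * \<kappa> (x - y)\<bar> \<le> \<eta> * \<kappa> (x - y)"
    proof (cases "\<kappa> (x - y) = 0")
      case False
      then have "\<bar>u y - c\<bar> \<le> \<eta>" using near k0(3) by blast
      then show ?thesis using k0(1)[of "x - y"] by (simp add: abs_mult mult_right_mono)
    qed simp
  qed
  also have "\<dots> = \<eta>" using one by simp
  finally show ?thesis .
qed

text \<open>The directional derivative along the gradient itself is the squared norm of the
  gradient.\<close>

lemma grad_le_lipschitz:
  fixes f :: "real^'d => real"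
  assumes d: "f differentiable (at x)" and L: "\<And>y. \<bar>f y - f x\<bar> \<le> L * norm (y - x)"
  shows "norm (grad f x) \<le> L"
proof -
  define g where "g = grad f x"
  have "((\<lambda>t. f (x + t *\<^sub>R g)) has_derivative (\<lambda>t. g \<bullet> (t *\<^sub>R g))) (at 0)"
  proof (rule has_derivative_compose[of "\<lambda>t. x + t *\<^sub>R g" "\<lambda>t. t *\<^sub>R g" 0 UNIV f "\<lambda>k. g \<bullet> k"])
    show "((\<lambda>t. x + t *\<^sub>R g) has_derivative (\<lambda>t. t *\<^sub>R g)) (at 0)" by (auto intro!: derivative_eq_intros)
    show "(f has_derivative (\<bullet>) g) (at (x + 0 *\<^sub>R g))" using tfun_has_derivative[OF d] by (simp add: g_def)
  qed
  then have "((\<lambda>t. f (x + t *\<^sub>R g)) has_real_derivative g \<bullet> g) (at 0)"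
    by (simp add: has_field_derivative_def mult.commute[of "g \<bullet> g"] mult_commute_abs)
  then have "(\<lambda>t. (f (x + t *\<^sub>R g) - f x) / t) \<midarrow>0\<rightarrow> g \<bullet> g" by (simp add: DERIV_def)
  moreover have "\<forall>\<^sub>F t in at 0. (f (x + t *\<^sub>R g) - f x) / t \<le> L * norm g"
  proof (rule always_eventually, rule allI)
    fix t
    have "\<bar>(f (x + t *\<^sub>R g) - f x) / t\<bar> \<le> L * norm g"
    proof (cases "t = 0")
      case True
      have "0 \<le> L * norm (x + g - x)" using L[of "x + g"] by (rule order_trans[OF abs_ge_zero])
      then show ?thesis using True by simp
    next
      case False
      then show ?thesis using L[of "x + t *\<^sub>R g"] by (simp add: abs_divide divide_le_eq mult_ac)
    qed
    then show "(f (x + t *\<^sub>R g) - f x) / t \<le> L * norm g" by (rule abs_le_D1)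
  qed
  ultimately have "g \<bullet> g \<le> L * norm g" by (rule tendsto_upperbound) simp
  then have "norm g * norm g \<le> L * norm g" by (simp add: power2_norm_eq_inner[symmetric] power2_eq_square)
  then show ?thesis using L[of "x + axis undefined 1"] unfolding g_def[symmetric]
    by (cases "g = 0") (auto dest: mult_right_le_imp_le intro: order_trans[OF abs_ge_zero])
qed

lemma grad_locally_constant:
  fixes f :: "real^'d => real"
  assumes "open U" "x \<in> U" "\<And>y. y \<in> U ==> f y = c"
  shows "grad f x = 0"
proof -
  have "(f has_derivative (\<lambda>_. 0)) (at x)"
    by (rule has_derivative_transform_within_open[OF has_derivative_const[of c] assms(1,2)]) (simp add: assms(3))
  then show ?thesis using pdI[of f "\<lambda>_. 0" x] by (simp add: grad_def vec_eq_iff)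
qed

text \<open>The function \<open>l\<close> is zero up to distance 2\<epsilon> from the complement and
  one from distance 3\<epsilon> on. Mollifying at scale \<epsilon> keeps it constant below distance
  \<epsilon> and beyond 4\<epsilon>, and averaging preserves the Lipschitz constant
  1/\<epsilon>.\<close>

lemma cutoff_exists:
  fixes \<Omega> :: "(real^'d) set" and \<kappa> :: "real^'d => real"
  assumes o: "open \<Omega>" and b: "bounded \<Omega>" and \<epsilon>: "\<epsilon> > 0"
    and k: "tfun UNIV \<kappa>" "\<And>x. \<kappa> x \<ge> 0" "integral\<^sup>L lborel \<kappa> = 1" "\<And>x. \<kappa> x \<noteq> 0 ==> norm x < \<epsilon>"
  shows "\<exists>\<rho>. tfun \<Omega> \<rho> \<and> (\<forall>x. 0 \<le> \<rho> x \<and> \<rho> x \<le> 1) \<and> (\<forall>x. norm (grad \<rho> x) \<le> 1 / \<epsilon>) \<and>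
    (\<forall>x. infdist x (- \<Omega>) \<ge> 4 * \<epsilon> --> \<rho> x = 1) \<and>
    (\<forall>x. grad \<rho> x \<noteq> 0 --> x \<in> \<Omega> \<and> infdist x (- \<Omega>) \<le> 4 * \<epsilon>)"
proof -
  define D where "D x = infdist x (- \<Omega>)" for x
  define l where "l x = max 0 (min 1 (D x / \<epsilon> - 2))" for x
  have ne: "- \<Omega> \<noteq> {}" using b not_bounded_UNIV by (metis Compl_empty_eq double_complement)
  have D0: "D x = 0" if "x \<notin> \<Omega>" for x using that by (simp add: D_def)
  have Dl: "\<bar>D x - D y\<bar> \<le> norm (x - y)" for x y
    using infdist_triangle_abs[of x "- \<Omega>" y] by (simp add: D_def dist_norm)
  have Dc: "continuous_on S D" for S unfolding D_def by (intro continuous_intros)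
  have lc: "continuous_on UNIV l" unfolding l_def by (intro continuous_intros Dc) (use \<epsilon> in auto)
  have lb[measurable]: "l \<in> borel_measurable borel" by (rule borel_measurable_continuous_onI[OF lc])
  have l01: "0 \<le> l x" "l x \<le> 1" for x by (auto simp: l_def)
  have l0: "l x = 0" if "x \<notin> \<Omega>" for x using D0[OF that] by (simp add: l_def)
  have ll: "\<bar>l x - l y\<bar> \<le> 1 / \<epsilon> * norm (x - y)" for x y
  proof -
    have "\<bar>l x - l y\<bar> \<le> \<bar>D x / \<epsilon> - D y / \<epsilon>\<bar>" unfolding l_def by (simp add: max_def min_def)
    also have "\<dots> = 1 / \<epsilon> * \<bar>D x - D y\<bar>" using \<epsilon> by (simp add: abs_divide diff_divide_distrib[symmetric])
    also have "\<dots> \<le> 1 / \<epsilon> * norm (x - y)" using \<epsilon> Dl by (intro mult_left_mono) auto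
    finally show ?thesis .
  qed
  have li: "integrable lborel l"
  proof -
    have "integrable lborel (indicator \<Omega> :: _ => real)"
      using o emeasure_bounded_finite[OF b] by (intro integrable_real_indicator) auto
    then show ?thesis
      by (rule Bochner_Integration.integrable_bound) (use l01 l0 in \<open>auto simp: indicator_def abs_of_nonneg\<close>)
  qed
  define \<rho> where "\<rho> = conv l \<kappa>"
  have C: "C_k k \<rho>" for k unfolding \<rho>_def by (rule C_k_conv[OF li k(1)])
  note near = conv_diff_le[OF li k, folded \<rho>_def]
  have \<rho>01: "0 \<le> \<rho> x \<and> \<rho> x \<le> 1" for x
  proof -
    \<comment> \<open>Centred at \<open>1/2\<close>, so that \<open>conv_diff_le\<close> yields both
      bounds at once.\<close>
    have "\<bar>\<rho> x - 1/2\<bar> \<le> 1/2"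
    proof (rule near)
      fix y show "\<bar>l y - 1/2\<bar> \<le> 1/2" using l01[of y] by linarith
    qed
    then show ?thesis by (intro conjI; linarith)
  qed
  have \<rho>1: "\<rho> x = 1" if x: "D x \<ge> 4 * \<epsilon>" for x
  proof -
    have "\<bar>\<rho> x - 1\<bar> \<le> 0"
    proof (rule near)
      fix y assume "norm (x - y) < \<epsilon>"
      then have "D y \<ge> 3 * \<epsilon>" using Dl[of x y] x by linarith
      then show "\<bar>l y - 1\<bar> \<le> 0" using \<epsilon> by (simp add: l_def min_def max_def field_simps)
    qed
    then show ?thesis by simp
  qed
  have \<rho>0: "\<rho> x = 0" if x: "D x < \<epsilon>" for x
  proof -
    have "\<bar>\<rho> x - 0\<bar> \<le> 0"
    proof (rule near)
      fix y assume "norm (x - y) < \<epsilon>"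
      then have "D y \<le> 2 * \<epsilon>" using Dl[of x y] x by linarith
      then show "\<bar>l y - 0\<bar> \<le> 0" using \<epsilon> by (simp add: l_def min_def max_def field_simps)
    qed
    then show ?thesis by simp
  qed
  have kb[measurable]: "\<kappa> \<in> borel_measurable borel" by (rule tfun_borel[OF k(1)])
  obtain B where B: "\<And>x. \<bar>\<kappa> x\<bar> \<le> B" using tfun_bounded[OF k(1)] by blast
  have ki: "integrable lborel \<kappa>" by (rule tfun_integrable[OF k(1)])
  \<comment> \<open>Moving the shift from the kernel to \<open>l\<close> lets the Lipschitz bound of
    \<open>l\<close> pass to \<rho>.\<close>
  have ref: "\<rho> x = (LBINT z. l (x - z) * \<kappa> z)" "integrable lborel (\<lambda>z. l (x - z) * \<kappa> z)" for x
  proof -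
    have m: "(\<lambda>y. l y * \<kappa> (x - y)) \<in> borel_measurable borel" by measurable
    show "\<rho> x = (LBINT z. l (x - z) * \<kappa> z)"
      unfolding \<rho>_def conv_def using integral_lborel_reflect(1)[OF m, of x] by simp
    show "integrable lborel (\<lambda>z. l (x - z) * \<kappa> z)"
      using integral_lborel_reflect(2)[OF m conv_integrable[OF li kb B], of x] by simp
  qed
  have lip: "\<bar>\<rho> y - \<rho> x\<bar> \<le> 1 / \<epsilon> * norm (y - x)" for x y
  proof -
    have e: "\<rho> y - \<rho> x = (LBINT z. l (y - z) * \<kappa> z - l (x - z) * \<kappa> z)"
      unfolding ref(1) by (rule Bochner_Integration.integral_diff[symmetric]) (rule ref(2))+
    have "\<bar>\<rho> y - \<rho> x\<bar> \<le> (LBINT z. \<bar>l (y - z) * \<kappa> z - l (x - z) * \<kappa> z\<bar>)"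
      unfolding e by (rule integral_abs_bound)
    also have "\<dots> \<le> (LBINT z. (1 / \<epsilon> * norm (y - x)) * \<kappa> z)"
    proof (rule integral_mono)
      fix z
      have "\<bar>l (y - z) * \<kappa> z - l (x - z) * \<kappa> z\<bar> = \<bar>l (y - z) - l (x - z)\<bar> * \<kappa> z"
        unfolding left_diff_distrib[symmetric] abs_mult using k(2)[of z] by simp
      also have "\<dots> \<le> (1 / \<epsilon> * norm (y - x)) * \<kappa> z"
        using ll[of "y - z" "x - z"] k(2)[of z] by (intro mult_right_mono) auto
      finally show "\<bar>l (y - z) * \<kappa> z - l (x - z) * \<kappa> z\<bar> \<le> (1 / \<epsilon> * norm (y - x)) * \<kappa> z" .
    qed (use ref(2) ki in auto)
    also have "\<dots> = 1 / \<epsilon> * norm (y - x)" using k(3) by simp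
    finally show ?thesis .
  qed
  show ?thesis
  proof (rule exI[of _ \<rho>], intro conjI[of "tfun \<Omega> \<rho>"] conjI[of "\<forall>x. 0 \<le> \<rho> x \<and> \<rho> x \<le> 1"]
      conjI[of "\<forall>x. norm (grad \<rho> x) \<le> 1 / \<epsilon>"] conjI[of "\<forall>x. _ x --> \<rho> x = 1"] allI impI)
    show "tfun \<Omega> \<rho>"
    proof (rule tfunI[OF C])
      have "closed {x. D x \<ge> \<epsilon>}" by (intro closed_Collect_le Dc continuous_intros)
      then show "compact (closure \<Omega> \<inter> {x. D x \<ge> \<epsilon>})"
        using b by (intro compact_Int_closed) (auto simp: compact_closure)
      show "closure \<Omega> \<inter> {x. D x \<ge> \<epsilon>} \<subseteq> \<Omega>" using D0 \<epsilon> by force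
      fix x assume "x \<notin> closure \<Omega> \<inter> {x. D x \<ge> \<epsilon>}"
      then have "D x < \<epsilon>" using D0[of x] closure_subset[of \<Omega>] \<epsilon> by (cases "x \<in> \<Omega>") auto
      then show "\<rho> x = 0" by (rule \<rho>0)
    qed
    show "norm (grad \<rho> x) \<le> 1 / \<epsilon>" for x
      using C_k_Suc_differentiable[OF C] lip by (intro grad_le_lipschitz)
    show "x \<in> \<Omega> \<and> infdist x (- \<Omega>) \<le> 4 * \<epsilon>" if x: "grad \<rho> x \<noteq> 0" for x
    proof (rule ccontr)
      assume n: "\<not> (x \<in> \<Omega> \<and> infdist x (- \<Omega>) \<le> 4 * \<epsilon>)"
      show False
      proof (cases "x \<in> \<Omega>")
        case True
        have "open {x. D x > 4 * \<epsilon>}" by (intro open_Collect_less Dc continuous_intros)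
        moreover have "x \<in> {x. D x > 4 * \<epsilon>}" using n True by (simp add: D_def)
        ultimately have "grad \<rho> x = 0" by (rule grad_locally_constant[where c = 1]) (auto intro: \<rho>1)
        then show False using x by simp
      next
        case False
        have "open {x. D x < \<epsilon>}" by (intro open_Collect_less Dc continuous_intros)
        moreover have "x \<in> {x. D x < \<epsilon>}" using False D0 \<epsilon> by simp
        ultimately have "grad \<rho> x = 0" by (rule grad_locally_constant[where c = 0]) (auto intro: \<rho>0)
        then show False using x by simp
      qed
    qed
  qed (use \<rho>01 \<rho>1 in \<open>auto simp: D_def\<close>)
qed

section \<open>Square integrable functions and weak solutions\<close>

text \<open>Stated for arbitrary measures, since both \<open>leb \<Omega>\<close> and
  \<open>lborel\<close> occur: convolutions and dilations live on the whole space.\<close>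

definition sq_int :: "'a measure => ('a => real) => bool" where
  "sq_int M u \<longleftrightarrow> u \<in> borel_measurable M \<and> integrable M (\<lambda>x. (u x)^2)"

definition l2 :: "'a measure => ('a => real) => real" where
  "l2 M u = sqrt (\<integral>x. (u x)^2 \<partial>M)"

lemma L2_on_iff_sq_int: "L2_on \<Omega> (f :: real^'d => real) \<longleftrightarrow> sq_int (leb \<Omega>) f"
  by (simp add: L2_on_def sq_int_def)

lemma sq_int_measurable [measurable_dest]: "sq_int M u ==> u \<in> borel_measurable M"
  by (simp add: sq_int_def)

lemma l2_nonneg [simp]: "l2 M u \<ge> 0" by (simp add: l2_def)

lemma l2_power2: "(l2 M u)^2 = (\<integral>x. (u x)^2 \<partial>M)" by (simp add: l2_def)

lemma sq_int_mult:
  assumes u: "sq_int M u" and v: "sq_int M v"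
  shows "integrable M (\<lambda>x. u x * v x)"
proof (rule Bochner_Integration.integrable_bound)
  show "integrable M (\<lambda>x. (u x)^2 + (v x)^2)" using u v by (simp add: sq_int_def)
  show "(\<lambda>x. u x * v x) \<in> borel_measurable M" using u v by (auto simp: sq_int_def)
  have "\<bar>a * b\<bar> \<le> a^2 + b^2" for a b :: real
  proof -
    have "0 \<le> (\<bar>a\<bar> - \<bar>b\<bar>)^2" by simp
    then have "2 * (\<bar>a\<bar> * \<bar>b\<bar>) \<le> a^2 + b^2" by (simp add: power2_diff)
    then show ?thesis unfolding abs_mult using mult_nonneg_nonneg[of "\<bar>a\<bar>" "\<bar>b\<bar>"] by linarith
  qed
  then show "AE x in M. norm (u x * v x) \<le> norm ((u x)^2 + (v x)^2)" by (intro AE_I2) simp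
qed

lemma sq_int_cmult: "sq_int M u ==> sq_int M (\<lambda>x. c * u x)"
  by (auto simp: sq_int_def power_mult_distrib)

lemma sq_int_add:
  assumes "sq_int M u" "sq_int M v"
  shows "sq_int M (\<lambda>x. u x + v x)"
  using assms sq_int_mult[OF assms] by (auto simp: sq_int_def power2_sum mult.assoc)

lemma sq_int_diff:
  assumes "sq_int M u" "sq_int M v"
  shows "sq_int M (\<lambda>x. u x - v x)"
  using sq_int_add[OF assms(1) sq_int_cmult[OF assms(2), of "-1"]] by simp

lemma sq_int_zero: "sq_int M (\<lambda>x. 0)" by (simp add: sq_int_def)

lemma sq_int_mono:
  assumes "sq_int M v" "u \<in> borel_measurable M" "AE x in M. \<bar>u x\<bar> \<le> \<bar>v x\<bar>"
  shows "sq_int M u" "l2 M u \<le> l2 M v"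
proof -
  have le: "AE x in M. (u x)^2 \<le> (v x)^2" using assms(3) by eventually_elim (simp add: abs_le_square_iff)
  have "integrable M (\<lambda>x. (u x)^2)"
    by (rule Bochner_Integration.integrable_bound[where f="\<lambda>x. (v x)^2"])
       (use assms le in \<open>auto simp: sq_int_def\<close>)
  then show s: "sq_int M u" using assms by (simp add: sq_int_def)
  show "l2 M u \<le> l2 M v"
    unfolding l2_def using s assms(1) le by (intro real_sqrt_le_mono integral_mono_AE) (auto simp: sq_int_def)
qed

lemma sq_int_bounded:
  assumes "finite_measure M" "u \<in> borel_measurable M" "AE x in M. \<bar>u x\<bar> \<le> c" "c \<ge> 0"
  shows "sq_int M u" "l2 M u \<le> c * sqrt (measure M (space M))"
proof -
  have "integrable M (\<lambda>x. c^2)" using assms(1) by (rule finite_measure.integrable_const)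
  then have c: "sq_int M (\<lambda>x. c)" by (simp add: sq_int_def)
  have ae: "AE x in M. \<bar>u x\<bar> \<le> \<bar>c\<bar>" using assms(3,4) by simp
  show "sq_int M u" by (rule sq_int_mono(1)[OF c assms(2) ae])
  have "l2 M u \<le> l2 M (\<lambda>x. c)" by (rule sq_int_mono(2)[OF c assms(2) ae])
  also have "l2 M (\<lambda>x. c) = c * sqrt (measure M (space M))"
    using assms(4) by (simp add: l2_def real_sqrt_mult)
  finally show "l2 M u \<le> c * sqrt (measure M (space M))" .
qed

lemma l2_Cauchy_Schwarz:
  assumes u: "sq_int M u" and v: "sq_int M v"
  shows "\<bar>\<integral>x. u x * v x \<partial>M\<bar> \<le> l2 M u * l2 M v"
proof -
  have "(\<integral>x. u x * v x \<partial>M)^2 \<le> (\<integral>x. (u x)^2 \<partial>M) * (\<integral>x. (v x)^2 \<partial>M)"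
  proof (rule quadratic_nonneg_discriminant)
    fix t
    have "0 \<le> (\<integral>x. (u x + t * v x)^2 \<partial>M)" by simp
    also have "\<dots> = (\<integral>x. (u x)^2 + 2 * t * (u x * v x) + t^2 * (v x)^2 \<partial>M)"
      by (intro Bochner_Integration.integral_cong refl) (simp add: power2_sum power_mult_distrib mult_ac)
    also have "\<dots> = (\<integral>x. (u x)^2 \<partial>M) + 2 * t * (\<integral>x. u x * v x \<partial>M) + t^2 * (\<integral>x. (v x)^2 \<partial>M)"
      using u v sq_int_mult[OF u v] by (simp add: sq_int_def)
    finally show "0 \<le> (\<integral>x. (u x)^2 \<partial>M) + 2 * t * (\<integral>x. u x * v x \<partial>M) + t^2 * (\<integral>x. (v x)^2 \<partial>M)" .
  qed simp
  then show ?thesis unfolding l2_def real_sqrt_mult[symmetric]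
    by (metis real_sqrt_abs real_sqrt_le_mono)
qed

lemma l2_triangle:
  assumes u: "sq_int M u" and v: "sq_int M v"
  shows "l2 M (\<lambda>x. u x + v x) \<le> l2 M u + l2 M v"
proof (rule power2_le_imp_le)
  have "(l2 M (\<lambda>x. u x + v x))^2 = (\<integral>x. (u x)^2 + 2 * (u x * v x) + (v x)^2 \<partial>M)"
    unfolding l2_power2 by (intro Bochner_Integration.integral_cong refl) (simp add: power2_sum)
  also have "\<dots> = (l2 M u)^2 + 2 * (\<integral>x. u x * v x \<partial>M) + (l2 M v)^2"
    using u v sq_int_mult[OF u v] unfolding l2_power2 by (simp add: sq_int_def)
  also have "\<dots> \<le> (l2 M u)^2 + 2 * (l2 M u * l2 M v) + (l2 M v)^2"
    using l2_Cauchy_Schwarz[OF u v] by simp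
  also have "\<dots> = (l2 M u + l2 M v)^2" by (simp add: power2_sum)
  finally show "(l2 M (\<lambda>x. u x + v x))^2 \<le> (l2 M u + l2 M v)^2" .
qed simp

lemma l2_cmult: "l2 M (\<lambda>x. c * u x) = \<bar>c\<bar> * l2 M u"
  by (simp add: l2_def power_mult_distrib real_sqrt_mult)

lemma l2_minus_commute: "l2 M (\<lambda>x. u x - v x) = l2 M (\<lambda>x. v x - u x)"
  by (simp add: l2_def power2_commute)

lemma l2_triangle_diff:
  assumes u: "sq_int M u" and v: "sq_int M v" and w: "sq_int M w"
  shows "l2 M (\<lambda>x. u x - w x) \<le> l2 M (\<lambda>x. u x - v x) + l2 M (\<lambda>x. v x - w x)"
  using l2_triangle[OF sq_int_diff[OF u v] sq_int_diff[OF v w]] by simp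

lemma l2_diff_le:
  assumes u: "sq_int M u" and v: "sq_int M v"
  shows "l2 M (\<lambda>x. u x - v x) \<le> l2 M u + l2 M v"
  using l2_triangle[OF u sq_int_cmult[OF v, of "-1"]] l2_cmult[of M "-1" v] by simp

lemma l2_tendsto_0:
  assumes m: "\<And>n. g n \<in> borel_measurable M" "g' \<in> borel_measurable M"
    and w: "integrable M w" and lim: "AE x in M. (\<lambda>n. g n x) \<longlonglongrightarrow> g' x"
    and bound: "\<And>n. AE x in M. (g n x - g' x)^2 \<le> w x"
  shows "(\<lambda>n. l2 M (\<lambda>x. g n x - g' x)) \<longlonglongrightarrow> 0"
proof -
  have "(\<lambda>n. \<integral>x. (g n x - g' x)^2 \<partial>M) \<longlonglongrightarrow> (\<integral>x. 0 \<partial>M)"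
  proof (rule integral_dominated_convergence[where w=w])
    show "AE x in M. (\<lambda>n. (g n x - g' x)^2) \<longlonglongrightarrow> 0"
      using lim
    proof eventually_elim
      case (elim x)
      then have "(\<lambda>n. (g n x - g' x)^2) \<longlonglongrightarrow> (g' x - g' x)\<^sup>2" by (intro tendsto_intros)
      then show ?case by simp
    qed
    show "AE x in M. norm ((g n x - g' x)^2) \<le> w x" for n using bound[of n] by simp
  qed (use m w in auto)
  then have "(\<lambda>n. sqrt (\<integral>x. (g n x - g' x)^2 \<partial>M)) \<longlonglongrightarrow> sqrt 0"
    by (intro tendsto_real_sqrt) simp
  then show ?thesis by (simp add: l2_def)
qed

lemma lebesgue_on_borel: "u \<in> borel_measurable borel ==> u \<in> borel_measurable (leb S)"
  for u :: "real^'d => real"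
  by (intro measurable_restrict_space1 measurable_completion) simp

lemma lebesgue_on_finite: "open \<Omega> ==> bounded \<Omega> ==> finite_measure (leb (\<Omega>::(real^'d) set))"
  using lmeasurable_open by (intro finite_measure_lebesgue_on) blast

text \<open>The approximants are polynomials times cut-offs, where the polynomials are uniformly close to
  continuous functions converging almost everywhere to a truncation of \<open>f\<close>.\<close>

lemma tfun_dense:
  fixes \<Omega> :: "(real^'d) set"
  assumes o: "open \<Omega>" and b: "bounded \<Omega>" and f: "sq_int (leb \<Omega>) f" and \<eta>: "\<eta> > 0"
  obtains \<phi> where "tfun \<Omega> \<phi>" "l2 (leb \<Omega>) (\<lambda>x. f x - \<phi> x) < \<eta>"
proof -
  let ?M = "leb \<Omega>"
  have fin: "finite_measure ?M" by (rule lebesgue_on_finite[OF o b])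
  have \<Omega>m: "\<Omega> \<in> sets lebesgue" using o by simp
  define clip where "clip c x = max (- c) (min c x)" for c x :: real
  have clipm[measurable]: "clip c \<in> borel_measurable borel" for c unfolding clip_def by measurable
  have clipc: "continuous_on UNIV (clip c)" for c unfolding clip_def by (intro continuous_intros)
  have fm[measurable]: "f \<in> borel_measurable ?M" using f by (simp add: sq_int_def)
  have "(\<lambda>n. l2 ?M (\<lambda>x. clip (real n) (f x) - f x)) \<longlonglongrightarrow> 0"
  proof (rule l2_tendsto_0[where w="\<lambda>x. (f x)^2"])
    show "AE x in ?M. (\<lambda>n. clip (real n) (f x)) \<longlonglongrightarrow> f x"
    proof (rule AE_I2)
      fix x
      have "\<forall>\<^sub>F n in sequentially. \<bar>f x\<bar> \<le> real n"
        using filterlim_real_sequentially by (simp add: filterlim_at_top)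
      then have "\<forall>\<^sub>F n in sequentially. clip (real n) (f x) = f x"
        by eventually_elim (auto simp: clip_def)
      then show "(\<lambda>n. clip (real n) (f x)) \<longlonglongrightarrow> f x" by (rule tendsto_eventually)
    qed
    show "AE x in ?M. (clip (real n) (f x) - f x)^2 \<le> (f x)^2" for n
      by (rule AE_I2, rule abs_le_square_iff[THEN iffD1]) (auto simp: clip_def)
  qed (use f in \<open>auto simp: sq_int_def\<close>)
  then have "\<forall>\<^sub>F n in sequentially. l2 ?M (\<lambda>x. clip (real n) (f x) - f x) < \<eta> / 2"
    using \<eta> by (intro order_tendstoD(2)[where a="\<eta>/2"]) auto
  then obtain N where N: "l2 ?M (\<lambda>x. clip (real N) (f x) - f x) < \<eta> / 2"
    by (auto simp: eventually_sequentially)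
  define fN where "fN x = clip (real N) (f x)" for x
  have fNm[measurable]: "fN \<in> borel_measurable ?M" unfolding fN_def by measurable
  have fNb: "\<bar>fN x\<bar> \<le> real N" for x by (simp add: fN_def clip_def)
  have fN: "sq_int ?M fN" by (rule sq_int_bounded[OF fin fNm, where c="real N"]) (use fNb in auto)
  have "fN measurable_on \<Omega>" using measurable_on_iff_borel_measurable[OF \<Omega>m] fNm by blast
  \<comment> \<open>A measurable function is an almost everywhere limit of continuous functions on
    the whole space; these are truncated at level \<open>N\<close> again below.\<close>
  then obtain Z g where Z: "negligible Z" and gc: "\<And>n. continuous_on UNIV (g n)"
    and gl: "\<And>x. x \<notin> Z ==> (\<lambda>n. g n x) \<longlonglongrightarrow> (if x \<in> \<Omega> then fN x else 0)"
    unfolding measurable_on_def by blast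
  \<comment> \<open>One null sequence serves both as the scale of the cut-off and as the accuracy of
    the polynomial.\<close>
  define e where "e n = 1 / real (Suc n)" for n
  have e: "e n > 0" "e n \<le> 1" for n by (auto simp: e_def)
  have e0: "e \<longlonglongrightarrow> 0" unfolding e_def by (rule lim_1_over_n[THEN LIMSEQ_Suc])
  have "\<exists>\<phi>. tfun \<Omega> \<phi> \<and> (\<forall>x\<in>\<Omega>. \<bar>\<phi> x\<bar> \<le> real N + 1) \<and>
    (\<forall>x\<in>\<Omega>. infdist x (- \<Omega>) \<ge> 4 * e n --> \<bar>\<phi> x - clip (real N) (g n x)\<bar> \<le> e n)" for n
  proof -
    obtain \<kappa> :: "real^'d => real" where \<kappa>: "tfun UNIV \<kappa>" "\<And>x. \<kappa> x \<ge> 0" "integral\<^sup>L lborel \<kappa> = 1"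
      "\<And>x. \<kappa> x \<noteq> 0 ==> norm x < e n" by (rule mollifier_exists[OF e(1)]) blast
    obtain \<rho> where \<rho>: "tfun \<Omega> \<rho>" "\<And>x. 0 \<le> \<rho> x \<and> \<rho> x \<le> 1" "\<And>x. infdist x (- \<Omega>) \<ge> 4 * e n ==> \<rho> x = 1"
      using cutoff_exists[OF o b e(1) \<kappa>] by blast
    have "continuous_on (closure \<Omega>) (\<lambda>x. clip (real N) (g n x))"
      by (intro continuous_on_compose2[OF clipc] continuous_on_subset[OF gc]) auto
    then obtain p where p: "real_polynomial_function p" "\<And>x. x \<in> closure \<Omega> ==> \<bar>clip (real N) (g n x) - p x\<bar> < e n"
      using Stone_Weierstrass_real_polynomial_function[of "closure \<Omega>" _ "e n"] b e(1)[of n] by (auto simp: compact_closure)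
    have 1: "\<bar>clip (real N) (g n x) - p x\<bar> < e n" if "x \<in> \<Omega>" for x using p(2) that closure_subset by blast
    have "\<bar>\<rho> x * p x\<bar> \<le> real N + 1" if "x \<in> \<Omega>" for x
    proof -
      have "\<bar>clip (real N) (g n x)\<bar> \<le> real N" by (simp add: clip_def)
      then have "\<bar>p x\<bar> \<le> real N + 1" using 1[OF that] e(2)[of n] by linarith
      then have "\<bar>\<rho> x\<bar> * \<bar>p x\<bar> \<le> 1 * (real N + 1)" using \<rho>(2)[of x] by (intro mult_mono) auto
      then show ?thesis by (simp add: abs_mult)
    qed
    moreover have "\<bar>\<rho> x * p x - clip (real N) (g n x)\<bar> \<le> e n" if "x \<in> \<Omega>" "infdist x (- \<Omega>) \<ge> 4 * e n" for x
      using \<rho>(3)[OF that(2)] 1[OF that(1)] by simp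
    ultimately show ?thesis using tfun_mult[OF \<rho>(1) C_k_polynomial[OF p(1)]] by (intro exI[of _ "\<lambda>x. \<rho> x * p x"]) blast
  qed
  then obtain \<phi> where \<phi>: "\<And>n. tfun \<Omega> (\<phi> n)" "\<And>n x. x \<in> \<Omega> ==> \<bar>\<phi> n x\<bar> \<le> real N + 1"
    and \<phi>g: "\<And>n x. x \<in> \<Omega> ==> infdist x (- \<Omega>) \<ge> 4 * e n ==> \<bar>\<phi> n x - clip (real N) (g n x)\<bar> \<le> e n" by metis
  have \<phi>m: "\<phi> n \<in> borel_measurable ?M" for n by (rule lebesgue_on_borel[OF tfun_borel[OF \<phi>(1)]])
  have "(\<lambda>n. l2 ?M (\<lambda>x. \<phi> n x - fN x)) \<longlonglongrightarrow> 0"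
  proof (rule l2_tendsto_0[where w="\<lambda>x. (2 * real N + 1)^2", OF \<phi>m fNm])
    show "integrable ?M (\<lambda>x. (2 * real N + 1)^2)" by (rule finite_measure.integrable_const[OF fin])
    show "AE x in ?M. (\<phi> n x - fN x)^2 \<le> (2 * real N + 1)^2" for n
    proof (rule AE_I2)
      fix x assume "x \<in> space ?M"
      then have "\<bar>\<phi> n x - fN x\<bar> \<le> \<bar>2 * real N + 1\<bar>" using \<phi>(2)[of x n] fNb[of x] by simp
      then show "(\<phi> n x - fN x)^2 \<le> (2 * real N + 1)^2" by (simp only: abs_le_square_iff)
    qed
    have "AE x in ?M. x \<notin> Z"
      using Z \<Omega>m by (simp add: AE_restrict_space_iff negligible_iff_null_sets AE_not_in eventually_mono[OF AE_not_in])
    then show "AE x in ?M. (\<lambda>n. \<phi> n x) \<longlonglongrightarrow> fN x"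
    proof (rule AE_mp, intro AE_I2 impI)
      fix x assume x: "x \<in> space ?M" "x \<notin> Z"
      then have "(\<lambda>n. g n x) \<longlonglongrightarrow> fN x" using gl[of x] by simp
      then have l: "(\<lambda>n. clip (real N) (g n x)) \<longlonglongrightarrow> clip (real N) (fN x)"
        by (rule continuous_on_tendsto_compose[OF clipc]) auto
      \<comment> \<open>At a fixed point of the open set the cut-off is eventually one, so the
        approximants converge there.\<close>
      have "infdist x (- \<Omega>) > 0" using x o b not_bounded_UNIV
        by (metis ComplD Compl_empty_eq boolean_algebra_class.boolean_algebra.double_compl closed_Compl in_closed_iff_infdist_zero infdist_nonneg less_eq_real_def space_lebesgue_on)
      then have "\<forall>\<^sub>F n in sequentially. e n < infdist x (- \<Omega>) / 4" using e0 by (intro order_tendstoD) auto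
      then have "\<forall>\<^sub>F n in sequentially. norm (\<phi> n x - clip (real N) (g n x)) \<le> e n"
        by eventually_elim (use \<phi>g x in auto)
      then have "(\<lambda>n. (\<phi> n x - clip (real N) (g n x)) + clip (real N) (g n x)) \<longlonglongrightarrow> 0 + clip (real N) (fN x)"
        by (intro tendsto_add l Lim_null_comparison[OF _ e0])
      then show "(\<lambda>n. \<phi> n x) \<longlonglongrightarrow> fN x" by (simp add: fN_def clip_def)
    qed
  qed
  then have "\<forall>\<^sub>F n in sequentially. l2 ?M (\<lambda>x. \<phi> n x - fN x) < \<eta> / 2"
    using \<eta> by (intro order_tendstoD(2)[where a="\<eta>/2"]) auto
  then obtain n where n: "l2 ?M (\<lambda>x. \<phi> n x - fN x) < \<eta> / 2" by (auto simp: eventually_sequentially)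
  have \<phi>s: "sq_int ?M (\<phi> n)" by (rule sq_int_bounded[OF fin \<phi>m, where c="real N + 1"]) (use \<phi>(2) in auto)
  have "l2 ?M (\<lambda>x. f x - \<phi> n x) \<le> l2 ?M (\<lambda>x. f x - fN x) + l2 ?M (\<lambda>x. fN x - \<phi> n x)"
    by (rule l2_triangle_diff[OF f fN \<phi>s])
  then have "l2 ?M (\<lambda>x. f x - \<phi> n x) < \<eta>"
    using N n unfolding fN_def[symmetric] l2_minus_commute[of ?M f] l2_minus_commute[of ?M fN "\<phi> n"] by simp
  then show ?thesis using that \<phi>(1) by blast
qed

section \<open>Integration by parts and the energy space\<close>

lemma integral_lebesgue_on_eq:
  fixes g :: "real^'d => real"
  assumes o: "open \<Omega>" and g: "g \<in> borel_measurable borel" and z: "\<And>x. x \<notin> \<Omega> ==> g x = 0"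
  shows "integral\<^sup>L (leb \<Omega>) g = integral\<^sup>L lborel g"
    and "integrable (leb \<Omega>) g \<longleftrightarrow> integrable lborel g"
proof -
  have K: "\<Omega> \<inter> space lebesgue \<in> sets lebesgue" using o by simp
  have e: "(\<lambda>x. indicator \<Omega> x *\<^sub>R g x) = g" by (rule ext) (use z in \<open>auto simp: indicator_def\<close>)
  show "integral\<^sup>L (leb \<Omega>) g = integral\<^sup>L lborel g"
    unfolding integral_restrict_space[OF K] e by (rule integral_completion) (use g in simp)
  show "integrable (leb \<Omega>) g \<longleftrightarrow> integrable lborel g"
    unfolding integrable_restrict_space[OF K] e by (rule integrable_completion) (use g in simp)
qed

text \<open>The convolution of \<open>\<phi>\<close> with the indicator function of a large ball is constant near \<open>0\<close>.\<close>

lemma integral_pd_zero: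
  fixes \<phi> :: "real^'d => real"
  assumes t: "tfun U \<phi>"
  shows "integral\<^sup>L lborel (pd i \<phi>) = 0"
proof -
  obtain S where S: "compact S" and S0: "\<forall>x. x \<notin> S --> \<phi> x = 0 \<and> (\<forall>i. pd i \<phi> x = 0)"
    using tfun_support[OF t] by (elim exE conjE)
  obtain R where R: "\<And>x. x \<in> S ==> norm x \<le> R" using compact_imp_bounded[OF S] unfolding bounded_iff by blast
  let ?u = "indicator (cball 0 (R + 1)) :: real^'d => real"
  have u: "integrable lborel ?u" by (intro integrable_real_indicator emeasure_bounded_finite) auto
  have c: "conv ?u f x = integral\<^sup>L lborel f"
    if "tfun U f" "\<And>x. x \<notin> S ==> f x = 0" "x \<in> ball 0 1" for f x
  proof -
    have "(\<lambda>y. ?u y * f (x - y)) = (\<lambda>y. f (x - y))"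
    proof (rule ext)
      fix y show "?u y * f (x - y) = f (x - y)"
    proof (cases "x - y \<in> S")
      case True
      then have "norm y \<le> R + 1" using R[OF True] norm_triangle_sub[of y x] that(3) by (simp add: norm_minus_commute)
      then show ?thesis by simp
    qed (simp add: that(2))
    qed
    then show ?thesis unfolding conv_def using integral_lborel_reflect(1)[OF tfun_borel[OF that(1)], of x] by simp
  qed
  have "grad (conv ?u \<phi>) 0 = 0"
    by (rule grad_locally_constant[where U = "ball 0 1"]) (use c[OF t] S0 in auto)
  then have "conv ?u (pd i \<phi>) 0 = 0" unfolding pd_conv[OF u t, symmetric] by (simp add: grad_def vec_eq_iff)
  then show ?thesis using c[OF tfun_pd[OF t], of i 0] S0 by simp
qed

text \<open>The product has compact support because \<phi> has. \<psi> is an arbitrary smooth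
  function, so that coordinate functions may be inserted.\<close>

lemma integral_by_parts:
  assumes \<phi>: "tfun U \<phi>" and \<psi>: "\<And>k. C_k k \<psi>"
  shows "(LBINT x. \<phi> x * pd i \<psi> x) = - (LBINT x. pd i \<phi> x * \<psi> x)"
proof -
  have t: "tfun U (\<lambda>x. \<phi> x * \<psi> x)" by (rule tfun_mult[OF \<phi> \<psi>])
  have \<psi>i: "C_k k (pd i \<psi>)" for k using \<psi>[of "Suc k"] by simp
  have d\<psi>: "\<psi> differentiable (at x)" for x using C_k_Suc_differentiable[OF \<psi>] .
  have i1: "integrable lborel (\<lambda>x. \<phi> x * pd i \<psi> x)"
    by (rule tfun_integrable[OF tfun_mult[OF \<phi> \<psi>i]])
  have i2: "integrable lborel (\<lambda>x. pd i \<phi> x * \<psi> x)"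
    by (rule tfun_integrable[OF tfun_mult[OF tfun_pd[OF \<phi>] \<psi>]])
  have "(LBINT x. \<phi> x * pd i \<psi> x + pd i \<phi> x * \<psi> x) = 0"
    using integral_pd_zero[OF t, of i]
    unfolding pd_mult[OF tfun_differentiable[OF \<phi>] d\<psi>] .
  then show ?thesis using i1 i2 by simp
qed

lemma tfun_outside: "tfun \<Omega> \<phi> ==> x \<notin> \<Omega> ==> \<phi> x = 0"
  using tfun_support[of \<Omega> \<phi>] by blast

lemma weak_gradient_tfun:
  assumes o: "open \<Omega>" and \<phi>: "tfun \<Omega> \<phi>"
  shows "weak_gradient \<Omega> \<phi> (grad \<phi>)"
  unfolding weak_gradient_def
proof (intro allI impI)
  fix \<psi> i assume \<psi>: "tfun \<Omega> \<psi>"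
  note b = tfun_borel[OF \<phi>] tfun_borel[OF \<psi>]
    tfun_borel[OF tfun_pd[OF \<phi>]] tfun_borel[OF tfun_pd[OF \<psi>]]
  have "integral\<^sup>L (leb \<Omega>) (\<lambda>x. \<phi> x * pd i \<psi> x) = (LBINT x. \<phi> x * pd i \<psi> x)"
    by (rule integral_lebesgue_on_eq[OF o]) (use b tfun_outside[OF \<phi>] in auto)
  also have "\<dots> = - (LBINT x. pd i \<phi> x * \<psi> x)"
    by (rule integral_by_parts[OF \<phi> tfun_C_k[OF \<psi>]])
  also have "(LBINT x. pd i \<phi> x * \<psi> x) = integral\<^sup>L (leb \<Omega>) (\<lambda>x. pd i \<phi> x * \<psi> x)"
    by (rule integral_lebesgue_on_eq[OF o, symmetric]) (use b tfun_outside[OF \<psi>] in auto)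
  finally show "integral\<^sup>L (leb \<Omega>) (\<lambda>x. \<phi> x * pd i \<psi> x) =
     - integral\<^sup>L (leb \<Omega>) (\<lambda>x. grad \<phi> x $ i * \<psi> x)" by (simp add: grad_def)
qed

lemma grad_borel:
  assumes "tfun U \<phi>"
  shows "grad \<phi> \<in> borel_measurable borel"
proof (rule borel_measurable_continuous_onI)
  show "continuous_on UNIV (grad \<phi>)"
    unfolding grad_def
    by (rule continuous_on_vec_lambda) (rule tfun_continuous[OF tfun_pd[OF assms]])
qed

lemma L2_on_vec:
  fixes g :: "real^'d => real^'d"
  assumes "L2_on \<Omega> g"
  shows "sq_int (leb \<Omega>) (\<lambda>x. norm (g x))" "sq_int (leb \<Omega>) (\<lambda>x. g x $ i)"
    "l2 (leb \<Omega>) (\<lambda>x. g x $ i) \<le> l2 (leb \<Omega>) (\<lambda>x. norm (g x))"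
proof -
  have m[measurable]: "g \<in> borel_measurable (leb \<Omega>)" using assms by (simp add: L2_on_def)
  show n: "sq_int (leb \<Omega>) (\<lambda>x. norm (g x))" using assms by (simp add: L2_on_def sq_int_def)
  have mi: "(\<lambda>x. g x $ i) \<in> borel_measurable (leb \<Omega>)"
    by (rule measurable_compose[OF m]) (intro borel_measurable_continuous_onI continuous_intros)
  have ae: "AE x in leb \<Omega>. \<bar>g x $ i\<bar> \<le> \<bar>norm (g x)\<bar>"
    using component_le_norm_cart by (intro AE_I2) auto
  show "sq_int (leb \<Omega>) (\<lambda>x. g x $ i)" "l2 (leb \<Omega>) (\<lambda>x. g x $ i) \<le> l2 (leb \<Omega>) (\<lambda>x. norm (g x))"
    by (rule sq_int_mono[OF n mi ae])+
qed

lemma L2_on_vec_diff: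
  fixes g h :: "real^'d => real^'d"
  assumes "L2_on \<Omega> g" "L2_on \<Omega> h"
  shows "L2_on \<Omega> (\<lambda>x. g x - h x)"
    "l2 (leb \<Omega>) (\<lambda>x. norm (g x - h x)) \<le> l2 (leb \<Omega>) (\<lambda>x. norm (g x)) + l2 (leb \<Omega>) (\<lambda>x. norm (h x))"
proof -
  have m: "g \<in> borel_measurable (leb \<Omega>)" "h \<in> borel_measurable (leb \<Omega>)" using assms by (simp_all add: L2_on_def)
  have md: "(\<lambda>x. g x - h x) \<in> borel_measurable (leb \<Omega>)" by (rule borel_measurable_diff[OF m])
  have s: "sq_int (leb \<Omega>) (\<lambda>x. norm (g x) + norm (h x))"
    by (intro sq_int_add L2_on_vec assms)
  have ae: "AE x in leb \<Omega>. \<bar>norm (g x - h x)\<bar> \<le> \<bar>norm (g x) + norm (h x)\<bar>"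
    using norm_triangle_ineq4 by (intro AE_I2) simp
  have mn: "(\<lambda>x. norm (g x - h x)) \<in> borel_measurable (leb \<Omega>)" by (rule measurable_compose[OF md borel_measurable_norm])
  note mono = sq_int_mono[OF s mn ae]
  show "L2_on \<Omega> (\<lambda>x. g x - h x)" using md mono(1) by (simp add: L2_on_def sq_int_def)
  show "l2 (leb \<Omega>) (\<lambda>x. norm (g x - h x)) \<le> l2 (leb \<Omega>) (\<lambda>x. norm (g x)) + l2 (leb \<Omega>) (\<lambda>x. norm (h x))"
    using mono(2) l2_triangle[OF L2_on_vec(1)[OF assms(1)] L2_on_vec(1)[OF assms(2)]] by simp
qed

lemma tfun_sq_int:
  fixes \<phi> :: "real^'d => real"
  assumes "open \<Omega>" "bounded \<Omega>" "tfun U \<phi>"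
  shows "sq_int (leb \<Omega>) \<phi>" "L2_on \<Omega> (grad \<phi>)"
proof -
  note fin = lebesgue_on_finite[OF assms(1,2)]
  obtain B where B: "B > 0" "\<And>x. \<bar>\<phi> x\<bar> \<le> B" by (rule tfun_bounded[OF assms(3)]) blast
  show "sq_int (leb \<Omega>) \<phi>"
    by (rule sq_int_bounded[OF fin lebesgue_on_borel[OF tfun_borel[OF assms(3)]], where c=B]) (use B in auto)
  obtain G where G: "G > 0" "\<And>x. norm (grad \<phi> x) \<le> G" by (rule tfun_grad_bounded[OF assms(3)]) blast
  have m: "grad \<phi> \<in> borel_measurable (leb \<Omega>)"
    using grad_borel[OF assms(3)] by (intro measurable_restrict_space1 measurable_completion) simp
  have "sq_int (leb \<Omega>) (\<lambda>x. norm (grad \<phi> x))"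
    by (rule sq_int_bounded[OF fin measurable_compose[OF m borel_measurable_norm], where c=G]) (use G in auto)
  then show "L2_on \<Omega> (grad \<phi>)" using m by (simp add: L2_on_def sq_int_def)
qed

lemma H1_0_tfun:
  assumes "open \<Omega>" "bounded \<Omega>" "tfun \<Omega> \<phi>"
  shows "H1_0 \<Omega> \<phi> (grad \<phi>)"
  unfolding H1_0_def H1_def
  using tfun_sq_int[OF assms] weak_gradient_tfun[OF assms(1,3)] assms(3)
  by (auto simp: L2_on_iff_sq_int intro!: exI[of _ "\<lambda>_. \<phi>"])

lemma H1_0_sq_int:
  assumes "H1_0 \<Omega> u g"
  shows "sq_int (leb \<Omega>) u" "L2_on \<Omega> g"
  using assms unfolding H1_0_def H1_def by (simp_all add: L2_on_iff_sq_int)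

lemma H1_0_approx:
  assumes o: "open \<Omega>" "bounded \<Omega>" and u: "H1_0 \<Omega> u g" and \<eta>: "\<eta> > 0"
  obtains \<phi> where "tfun \<Omega> \<phi>" "l2 (leb \<Omega>) (\<lambda>x. \<phi> x - u x) < \<eta>"
    "l2 (leb \<Omega>) (\<lambda>x. norm (grad \<phi> x - g x)) < \<eta>"
proof -
  let ?M = "leb \<Omega>"
  obtain \<phi> :: "nat => real^'a => real" where \<phi>: "\<And>n. tfun \<Omega> (\<phi> n)"
    and lim: "(\<lambda>n. integral\<^sup>L ?M (\<lambda>x. (\<phi> n x - u x)^2 + (norm (grad (\<phi> n) x - g x))^2)) \<longlonglongrightarrow> 0"
    using u unfolding H1_0_def by blast
  have "\<forall>\<^sub>F n in sequentially. integral\<^sup>L ?M (\<lambda>x. (\<phi> n x - u x)^2 + (norm (grad (\<phi> n) x - g x))^2) < \<eta>^2"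
    using order_tendstoD(2)[OF lim] \<eta> by simp
  then obtain n where n: "integral\<^sup>L ?M (\<lambda>x. (\<phi> n x - u x)^2 + (norm (grad (\<phi> n) x - g x))^2) < \<eta>^2"
    by (auto simp: eventually_sequentially)
  note t = tfun_sq_int[OF o \<phi>[of n]]
  have s1: "sq_int ?M (\<lambda>x. \<phi> n x - u x)" by (rule sq_int_diff[OF t(1) H1_0_sq_int(1)[OF u]])
  have s2: "sq_int ?M (\<lambda>x. norm (grad (\<phi> n) x - g x))"
    by (rule L2_on_vec(1)[OF L2_on_vec_diff(1)[OF t(2) H1_0_sq_int(2)[OF u]]])
  have "(l2 ?M (\<lambda>x. \<phi> n x - u x))^2 + (l2 ?M (\<lambda>x. norm (grad (\<phi> n) x - g x)))^2 < \<eta>^2"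
    unfolding l2_power2 using n s1 s2 by (simp add: sq_int_def)
  then have "(l2 ?M (\<lambda>x. \<phi> n x - u x))^2 < \<eta>^2" "(l2 ?M (\<lambda>x. norm (grad (\<phi> n) x - g x)))^2 < \<eta>^2"
    using zero_le_power2[of "l2 ?M (\<lambda>x. \<phi> n x - u x)"] zero_le_power2[of "l2 ?M (\<lambda>x. norm (grad (\<phi> n) x - g x))"]
    by linarith+
  then have "l2 ?M (\<lambda>x. \<phi> n x - u x) < \<eta>" "l2 ?M (\<lambda>x. norm (grad (\<phi> n) x - g x)) < \<eta>"
    using \<eta> by (auto intro: power_less_imp_less_base[where n=2])
  then show ?thesis by (rule that[OF \<phi>[of n]])
qed

lemma tfun_diff:
  assumes "tfun \<Omega> \<phi>" "tfun \<Omega> \<psi>"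
  shows "tfun \<Omega> (\<lambda>x. \<phi> x - \<psi> x)" "grad (\<lambda>x. \<phi> x - \<psi> x) x = grad \<phi> x - grad \<psi> x"
proof -
  have m: "tfun \<Omega> (\<lambda>x. \<psi> x * (-1))" by (rule tfun_mult[OF assms(2) C_k_const])
  obtain S where S: "compact S" "S \<subseteq> \<Omega>" "\<And>x. x \<notin> S ==> \<phi> x = 0" using tfun_support[OF assms(1)] by blast
  obtain T where T: "compact T" "T \<subseteq> \<Omega>" "\<And>x. x \<notin> T ==> \<psi> x = 0" using tfun_support[OF assms(2)] by blast
  have "tfun \<Omega> (\<lambda>x. \<phi> x + \<psi> x * (-1))"
    by (rule tfunI[where S="S \<union> T"])
       (use S T C_k_add[OF tfun_C_k[OF assms(1)] tfun_C_k[OF m]] in auto)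
  then show "tfun \<Omega> (\<lambda>x. \<phi> x - \<psi> x)" by simp
  have "((\<lambda>x. \<phi> x - \<psi> x) has_derivative (\<lambda>h. grad \<phi> x \<bullet> h - grad \<psi> x \<bullet> h)) (at x)"
    by (intro has_derivative_diff tfun_has_derivative tfun_differentiable[OF assms(1)]
         tfun_differentiable[OF assms(2)])
  then show "grad (\<lambda>x. \<phi> x - \<psi> x) x = grad \<phi> x - grad \<psi> x"
    by (simp add: vec_eq_iff grad_def pdI inner_axis)
qed

lemma pd_component: "pd i (\<lambda>x::real^'d. x $ i) = (\<lambda>x. 1)"
  by (rule ext, subst pdI[OF bounded_linear_imp_has_derivative[OF bounded_linear_vec_nth]]) (simp add: axis_def)

text \<open>The square of \<phi> is integrated by parts against the derivative one of a coordinate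
  function, which is bounded by \<open>R\<close>; the factor 2 comes from differentiating the
  square.\<close>

lemma Poincare_tfun:
  fixes \<Omega> :: "(real^'d) set"
  assumes o: "open \<Omega>" "bounded \<Omega>" and R: "\<And>x. x \<in> \<Omega> ==> norm x \<le> R" "R \<ge> 0" and \<phi>: "tfun \<Omega> \<phi>"
  shows "l2 (leb \<Omega>) \<phi> \<le> 2 * R * l2 (leb \<Omega>) (\<lambda>x. norm (grad \<phi> x))"
proof -
  let ?M = "leb \<Omega>"
  fix i :: 'd
  note fin = lebesgue_on_finite[OF o]
  note s = tfun_sq_int[OF o \<phi>]
  note si = L2_on_vec(2,3)[OF s(2), of i]
  have sx: "sq_int ?M (\<lambda>x. x $ i * \<phi> x)" "l2 ?M (\<lambda>x. x $ i * \<phi> x) \<le> R * l2 ?M \<phi>"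
  proof -
    have m: "(\<lambda>x. x $ i * \<phi> x) \<in> borel_measurable ?M"
      by (intro lebesgue_on_borel borel_measurable_times tfun_borel[OF \<phi>] borel_measurable_continuous_onI continuous_intros)
    have ae: "AE x in ?M. \<bar>x $ i * \<phi> x\<bar> \<le> \<bar>R * \<phi> x\<bar>"
    proof (rule AE_I2)
      fix x assume "x \<in> space ?M"
      then have "\<bar>x $ i\<bar> \<le> R" using R(1)[of x] component_le_norm_cart[of x i] by simp
      then show "\<bar>x $ i * \<phi> x\<bar> \<le> \<bar>R * \<phi> x\<bar>" using R(2) by (simp add: abs_mult mult_right_mono)
    qed
    note mono = sq_int_mono[OF sq_int_cmult[OF s(1)] m ae]
    show "sq_int ?M (\<lambda>x. x $ i * \<phi> x)" by (rule mono)
    show "l2 ?M (\<lambda>x. x $ i * \<phi> x) \<le> R * l2 ?M \<phi>" using mono(2) l2_cmult[of ?M R \<phi>] R(2) by simp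
  qed
  have tp: "tfun \<Omega> (\<lambda>x. \<phi> x * \<phi> x)" by (rule tfun_mult[OF \<phi> tfun_C_k[OF \<phi>]])
  have pdm: "pd i (\<lambda>x. \<phi> x * \<phi> x) = (\<lambda>x. \<phi> x * pd i \<phi> x + pd i \<phi> x * \<phi> x)"
    by (intro pd_mult tfun_differentiable[OF \<phi>])
  have "(LBINT x. \<phi> x * \<phi> x * 1) = - (LBINT x. (\<phi> x * pd i \<phi> x + pd i \<phi> x * \<phi> x) * x $ i)"
    using integral_by_parts[OF tp C_k_component, of i i] unfolding pdm pd_component .
  also have "(LBINT x. (\<phi> x * pd i \<phi> x + pd i \<phi> x * \<phi> x) * x $ i) =
     (LBINT x. 2 * (x $ i * \<phi> x * grad \<phi> x $ i))"
    by (intro Bochner_Integration.integral_cong refl) (simp add: grad_def algebra_simps)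
  also have "\<dots> = (\<integral>x. 2 * (x $ i * \<phi> x * grad \<phi> x $ i) \<partial>?M)"
  proof (rule integral_lebesgue_on_eq(1)[OF o(1), symmetric])
    have "(\<lambda>x. pd i \<phi> x) \<in> borel_measurable borel"
      by (rule tfun_borel[OF tfun_pd[OF \<phi>]])
    then show "(\<lambda>x. 2 * (x $ i * \<phi> x * grad \<phi> x $ i)) \<in> borel_measurable borel"
      unfolding grad_def using tfun_borel[OF \<phi>]
      by (auto intro!: borel_measurable_times borel_measurable_continuous_onI continuous_intros)
  qed (simp add: tfun_outside[OF \<phi>])
  also have "\<dots> = 2 * (\<integral>x. x $ i * \<phi> x * grad \<phi> x $ i \<partial>?M)" by simp
  finally have e: "(LBINT x. \<phi> x * \<phi> x * 1) = - (2 * (\<integral>x. x $ i * \<phi> x * grad \<phi> x $ i \<partial>?M))" .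
  have "(l2 ?M \<phi>)^2 = (LBINT x. \<phi> x * \<phi> x * 1)"
    unfolding l2_power2 unfolding power2_eq_square mult_1_right
    using tfun_borel[OF tp] tfun_outside[OF \<phi>] by (intro integral_lebesgue_on_eq(1)[OF o(1)]) auto
  also have "\<dots> \<le> 2 * \<bar>\<integral>x. x $ i * \<phi> x * grad \<phi> x $ i \<partial>?M\<bar>" unfolding e by linarith
  also have "\<bar>\<integral>x. x $ i * \<phi> x * grad \<phi> x $ i \<partial>?M\<bar> \<le> l2 ?M (\<lambda>x. x $ i * \<phi> x) * l2 ?M (\<lambda>x. grad \<phi> x $ i)"
    by (rule l2_Cauchy_Schwarz[OF sx(1) si(1)])
  also have "\<dots> \<le> (R * l2 ?M \<phi>) * l2 ?M (\<lambda>x. norm (grad \<phi> x))"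
    by (intro mult_mono sx si) (simp_all add: R)
  finally have "l2 ?M \<phi> * l2 ?M \<phi> \<le> l2 ?M \<phi> * (2 * R * l2 ?M (\<lambda>x. norm (grad \<phi> x)))"
    by (simp add: power2_eq_square mult_ac)
  then show ?thesis
    using mult_le_cancel_left_pos[of "l2 ?M \<phi>"] R(2) l2_nonneg[of ?M \<phi>]
    by (cases "l2 ?M \<phi> = 0") auto
qed

context elliptic_tensor
begin

lemma tensor_form:
  fixes g h :: "real^'d => real^'d"
  assumes g: "L2_on \<Omega> g" and h: "L2_on \<Omega> h"
  shows "integrable (leb \<Omega>) (\<lambda>x. (\<Lambda> x *v g x) \<bullet> h x)"
    and "\<bar>LINT x|leb \<Omega>. (\<Lambda> x *v g x) \<bullet> h x\<bar> \<le>
      \<mu> * (l2 (leb \<Omega>) (\<lambda>x. norm (g x)) * l2 (leb \<Omega>) (\<lambda>x. norm (h x)))"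
    and "L2_on \<Omega> (\<lambda>x. \<Lambda> x *v g x)"
proof -
  let ?M = "leb \<Omega>"
  have gm[measurable]: "(\<lambda>x. g x $ i) \<in> borel_measurable ?M" and hm[measurable]: "(\<lambda>x. h x $ i) \<in> borel_measurable ?M" for i
    using L2_on_vec(2)[OF g] L2_on_vec(2)[OF h] by (auto simp: sq_int_def)
  have Lm[measurable]: "(\<lambda>x. \<Lambda> x $ i $ j) \<in> borel_measurable ?M" for i j
    by (rule measurable_compose[OF tensor_measurable]) (intro borel_measurable_continuous_onI continuous_intros)
  have comp: "(\<lambda>x. (\<Lambda> x *v g x) $ i) \<in> borel_measurable ?M" for i
    unfolding matrix_vector_mult_def vec_lambda_beta by measurable
  have vm: "(\<lambda>x. \<Lambda> x *v g x) \<in> borel_measurable ?M"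
  proof (subst borel_measurable_euclidean_space, intro ballI)
    fix b :: "real^'d" assume "b \<in> Basis"
    then obtain i where "b = axis i 1" by (auto simp: Basis_vec_def)
    then show "(\<lambda>x. (\<Lambda> x *v g x) \<bullet> b) \<in> borel_measurable ?M" using comp[of i] by (simp add: inner_axis)
  qed
  have m: "(\<lambda>x. (\<Lambda> x *v g x) \<bullet> h x) \<in> borel_measurable ?M"
    unfolding inner_vec_def using comp hm by measurable
  note ng = L2_on_vec(1)[OF g] and nh = L2_on_vec(1)[OF h]
  have le: "AE x in ?M. norm ((\<Lambda> x *v g x) \<bullet> h x) \<le> norm (\<mu> * (norm (g x) * norm (h x)))"
  proof (rule AE_I2)
    fix x assume "x \<in> space ?M"
    then have x: "x \<in> \<Omega>" by simp
    have "\<bar>(\<Lambda> x *v g x) \<bullet> h x\<bar> \<le> norm (\<Lambda> x *v g x) * norm (h x)" by (rule Cauchy_Schwarz_ineq2)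
    also have "\<dots> \<le> (\<mu> * norm (g x)) * norm (h x)" by (intro mult_right_mono tensor_vec_bound x) simp
    finally show "norm ((\<Lambda> x *v g x) \<bullet> h x) \<le> norm (\<mu> * (norm (g x) * norm (h x)))"
      using mu_pos by (simp add: mult.assoc)
  qed
  have ib: "integrable ?M (\<lambda>x. \<mu> * (norm (g x) * norm (h x)))" using sq_int_mult[OF ng nh] by simp
  show i: "integrable ?M (\<lambda>x. (\<Lambda> x *v g x) \<bullet> h x)"
    by (rule Bochner_Integration.integrable_bound[OF ib m le])
  have "\<bar>LINT x|?M. (\<Lambda> x *v g x) \<bullet> h x\<bar> \<le> (LINT x|?M. \<bar>(\<Lambda> x *v g x) \<bullet> h x\<bar>)" by (rule integral_abs_bound)
  also have "\<dots> \<le> (LINT x|?M. \<mu> * (norm (g x) * norm (h x)))"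
    using le mu_pos by (intro integral_mono_AE ib integrable_abs i) (auto elim!: eventually_mono)
  also have "\<dots> = \<mu> * (LINT x|?M. norm (g x) * norm (h x))" by simp
  also have "\<dots> \<le> \<mu> * (l2 ?M (\<lambda>x. norm (g x)) * l2 ?M (\<lambda>x. norm (h x)))"
    using l2_Cauchy_Schwarz[OF ng nh] mu_pos by (intro mult_left_mono) auto
  finally show "\<bar>LINT x|?M. (\<Lambda> x *v g x) \<bullet> h x\<bar> \<le> \<mu> * (l2 ?M (\<lambda>x. norm (g x)) * l2 ?M (\<lambda>x. norm (h x)))" .
  have "sq_int ?M (\<lambda>x. norm (\<Lambda> x *v g x))"
  proof (rule sq_int_mono(1)[OF sq_int_cmult[OF ng, of \<mu>]])
    show "(\<lambda>x. norm (\<Lambda> x *v g x)) \<in> borel_measurable ?M" by (rule measurable_compose[OF vm borel_measurable_norm])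
    show "AE x in ?M. \<bar>norm (\<Lambda> x *v g x)\<bar> \<le> \<bar>\<mu> * norm (g x)\<bar>"
      using tensor_vec_bound mu_pos by (intro AE_I2) auto
  qed
  then show "L2_on \<Omega> (\<lambda>x. \<Lambda> x *v g x)" using vm by (simp add: L2_on_def sq_int_def)
qed

text \<open>The difference of two solutions is approximated in \<open>H\<^sup>1\<close> by a test function, which is admissible
  in both equations.\<close>

lemma weak_solution_unique:
  assumes p: "weak_solution \<Omega> \<Lambda> f p" and q: "weak_solution \<Omega> \<Lambda> f q"
  shows "AE x in leb \<Omega>. q x = p x"
proof -
  let ?M = "leb \<Omega>"
  note o = open_domain bounded_domain
  obtain g where g: "H1_0 \<Omega> p g" and pg: "\<And>v h. H1_0 \<Omega> v h ==> (LINT x|?M. (\<Lambda> x *v g x) \<bullet> h x) = (LINT x|?M. f x * v x)"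
    using p unfolding weak_solution_def by blast
  obtain k where k: "H1_0 \<Omega> q k" and qk: "\<And>v h. H1_0 \<Omega> v h ==> (LINT x|?M. (\<Lambda> x *v k x) \<bullet> h x) = (LINT x|?M. f x * v x)"
    using q unfolding weak_solution_def by blast
  define d where "d x = q x - p x" for x
  define r where "r x = k x - g x" for x
  note L = H1_0_sq_int(2)[OF g] H1_0_sq_int(2)[OF k] L2_on_vec_diff(1)[OF H1_0_sq_int(2)[OF k] H1_0_sq_int(2)[OF g], folded r_def]
  have d: "sq_int ?M d" unfolding d_def by (intro sq_int_diff H1_0_sq_int(1)[OF g] H1_0_sq_int(1)[OF k])
  have orth: "(LINT x|?M. (\<Lambda> x *v r x) \<bullet> grad \<phi> x) = 0" if "tfun \<Omega> \<phi>" for \<phi>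
  proof -
    note \<phi> = H1_0_tfun[OF o that]
    have "(LINT x|?M. (\<Lambda> x *v r x) \<bullet> grad \<phi> x) = (LINT x|?M. (\<Lambda> x *v k x) \<bullet> grad \<phi> x - (\<Lambda> x *v g x) \<bullet> grad \<phi> x)"
      by (simp add: r_def matrix_vector_mult_diff_distrib inner_diff_left)
    also have "\<dots> = 0"
      unfolding Bochner_Integration.integral_diff[OF tensor_form(1)[OF L(2) H1_0_sq_int(2)[OF \<phi>]] tensor_form(1)[OF L(1) H1_0_sq_int(2)[OF \<phi>]]]
        pg[OF \<phi>] qk[OF \<phi>] by simp
    finally show ?thesis .
  qed
  obtain R where R: "\<And>x. x \<in> \<Omega> ==> norm x \<le> R" "R \<ge> 0"
    using bounded_domain unfolding bounded_pos by (metis less_imp_le)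
  \<comment> \<open>The summand one accounts for replacing \<open>d\<close> by the test function
    \<open>w\<close>; \<open>2 * R\<close> is the Poincare constant and
    \<open>1 + \<mu> / \<zeta>\<close> bounds the gradient of \<open>w\<close> in units of
    \<eta>.\<close>
  define c where "c = 1 + 2 * R * (1 + \<mu> / \<zeta>)"
  have c: "c > 0" unfolding c_def using R(2) mu_pos zeta_pos by (intro add_pos_nonneg) auto
  have main: "l2 ?M d \<le> c * \<eta>" if \<eta>: "\<eta> > 0" for \<eta>
  proof -
    have \<eta>2: "\<eta> / 2 > 0" using \<eta> by simp
    obtain \<phi> where \<phi>: "tfun \<Omega> \<phi>" "l2 ?M (\<lambda>x. \<phi> x - q x) < \<eta> / 2"
      "l2 ?M (\<lambda>x. norm (grad \<phi> x - k x)) < \<eta> / 2" by (rule H1_0_approx[OF o k \<eta>2])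
    obtain \<psi> where \<psi>: "tfun \<Omega> \<psi>" "l2 ?M (\<lambda>x. \<psi> x - p x) < \<eta> / 2"
      "l2 ?M (\<lambda>x. norm (grad \<psi> x - g x)) < \<eta> / 2" by (rule H1_0_approx[OF o g \<eta>2])
    define w where "w = (\<lambda>x. \<phi> x - \<psi> x)"
    note w = tfun_diff[OF \<phi>(1) \<psi>(1), folded w_def]
    note s = tfun_sq_int[OF o \<phi>(1)] tfun_sq_int[OF o \<psi>(1)] tfun_sq_int[OF o w(1)]
    have "l2 ?M (\<lambda>x. (\<phi> x - q x) - (\<psi> x - p x)) \<le> l2 ?M (\<lambda>x. \<phi> x - q x) + l2 ?M (\<lambda>x. \<psi> x - p x)"
      by (intro l2_diff_le sq_int_diff s H1_0_sq_int(1)[OF g] H1_0_sq_int(1)[OF k])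
    then have dw: "l2 ?M (\<lambda>x. w x - d x) \<le> \<eta>" using \<phi>(2) \<psi>(2) by (simp add: w_def d_def algebra_simps)
    have "l2 ?M (\<lambda>x. norm ((grad \<phi> x - k x) - (grad \<psi> x - g x))) \<le>
      l2 ?M (\<lambda>x. norm (grad \<phi> x - k x)) + l2 ?M (\<lambda>x. norm (grad \<psi> x - g x))"
      by (intro L2_on_vec_diff s L)
    then have rw: "l2 ?M (\<lambda>x. norm (grad w x - r x)) \<le> \<eta>" using \<phi>(3) \<psi>(3) by (simp add: w(2) r_def algebra_simps)
    define N where "N = l2 ?M (\<lambda>x. norm (r x))"
    note e = L2_on_vec_diff(1)[OF s(6) L(3)]
    \<comment> \<open>By coercivity and orthogonality to the gradient of \<open>w\<close>, the
      energy of \<open>r\<close> is controlled by its distance to that gradient.\<close>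
    have "\<zeta> * N^2 = (LINT x|?M. \<zeta> * (norm (r x))^2)" unfolding N_def l2_power2 by simp
    also have "\<dots> \<le> (LINT x|?M. (\<Lambda> x *v r x) \<bullet> r x)"
      using tensor_coercive L2_on_vec(1)[OF L(3)]
      by (intro integral_mono_AE tensor_form(1) L) (auto simp: sq_int_def elim!: eventually_mono)
    also have "\<dots> = (LINT x|?M. (\<Lambda> x *v r x) \<bullet> grad w x) - (LINT x|?M. (\<Lambda> x *v r x) \<bullet> (grad w x - r x))"
      using tensor_form(1)[OF L(3) s(6)] tensor_form(1)[OF L(3) L(3)] by (simp add: inner_diff_right)
    also have "\<dots> \<le> \<mu> * (N * l2 ?M (\<lambda>x. norm (grad w x - r x)))"
      using tensor_form(2)[OF L(3) e] orth[OF w(1)] unfolding N_def by linarith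
    also have "\<dots> \<le> \<mu> * (N * \<eta>)" using mu_pos rw unfolding N_def by (intro mult_left_mono) auto
    finally have "\<zeta> * N * N \<le> \<mu> * \<eta> * N" by (simp add: power2_eq_square mult_ac)
    then have "N \<le> \<mu> / \<zeta> * \<eta>" using zeta_pos mu_pos \<eta> l2_nonneg[of ?M "\<lambda>x. norm (r x)"]
      unfolding N_def[symmetric] by (cases "N = 0") (auto simp: field_simps dest: mult_right_le_imp_le)
    moreover have "l2 ?M (\<lambda>x. norm ((grad w x - r x) - (0 - r x))) \<le> l2 ?M (\<lambda>x. norm (grad w x - r x)) + l2 ?M (\<lambda>x. norm (0 - r x))"
      using L(3) by (intro L2_on_vec_diff(2)[OF e]) (simp add: L2_on_def)
    ultimately have "l2 ?M (\<lambda>x. norm (grad w x)) \<le> (1 + \<mu> / \<zeta>) * \<eta>" using rw by (simp add: N_def algebra_simps)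
    then have "2 * R * l2 ?M (\<lambda>x. norm (grad w x)) \<le> 2 * R * ((1 + \<mu> / \<zeta>) * \<eta>)" using R(2) by (intro mult_left_mono) auto
    moreover have "l2 ?M (\<lambda>x. d x - 0) \<le> l2 ?M (\<lambda>x. d x - w x) + l2 ?M (\<lambda>x. w x - 0)"
      by (rule l2_triangle_diff[OF d s(5) sq_int_zero])
    ultimately show ?thesis using Poincare_tfun[OF o R w(1)] dw
      unfolding c_def by (simp add: l2_minus_commute[of ?M d] algebra_simps)
  qed
  have "l2 ?M d \<le> 0 + \<eta>" if "\<eta> > 0" for \<eta> using main[of "\<eta> / c"] c that by simp
  then have "l2 ?M d \<le> 0" by (rule field_le_epsilon)
  then have "(l2 ?M d)^2 = 0" using l2_nonneg[of ?M d] by simp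
  then have "AE x in ?M. (d x)^2 = 0"
    unfolding l2_power2 using d integral_nonneg_eq_0_iff_AE[of ?M "\<lambda>x. (d x)^2"] by (simp add: sq_int_def)
  then show ?thesis by (simp add: d_def)
qed

end

text \<open>Jensen's inequality for the probability density
  \<open>\<lambda>y. \<kappa> (x - y)\<close>, then Tonelli. The bound \<open>B\<close> makes the
  integrable \<open>u\<close> square integrable.\<close>

lemma conv_l2:
  fixes u :: "real^'d => real"
  assumes u: "integrable lborel u" "u \<in> borel_measurable borel" "\<And>x. \<bar>u x\<bar> \<le> B"
    and k: "tfun UNIV \<kappa>" "\<And>x. \<kappa> x \<ge> 0" "integral\<^sup>L lborel \<kappa> = 1"
  shows "sq_int lborel u" "sq_int lborel (conv u \<kappa>)" "l2 lborel (conv u \<kappa>) \<le> l2 lborel u"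
proof -
  note bk[measurable] = tfun_borel[OF k(1)] and bu[measurable] = u(2)
  have B0: "0 \<le> B" using u(3)[of 0] by (meson abs_ge_zero order_trans)
  have iu2: "integrable lborel (\<lambda>y. (u y)^2)"
  proof (rule Bochner_Integration.integrable_bound[of _ "\<lambda>y. B * u y"])
    show "AE x in lborel. norm ((u x)^2) \<le> norm (B * u x)"
    proof (rule AE_I2)
      fix x show "norm ((u x)^2) \<le> norm (B * u x)"
        using mult_right_mono[OF u(3)[of x] abs_ge_zero[of "u x"]] B0 by (simp add: power2_eq_square abs_mult)
    qed
  qed (use u in auto)
  then show su: "sq_int lborel u" using u(2) by (simp add: sq_int_def)
  obtain Bk where Bk: "\<And>x. \<bar>\<kappa> x\<bar> \<le> Bk" by (rule tfun_bounded[OF k(1)]) blast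
  have i1: "integrable lborel (\<lambda>y. u y * \<kappa> (x - y))" for x by (rule conv_integrable[OF u(1) bk Bk])
  have i2: "integrable lborel (\<lambda>y. (u y)^2 * \<kappa> (x - y))" for x by (rule conv_integrable[OF iu2 bk Bk])
  have i3: "integrable lborel (\<lambda>y. \<kappa> (x - y))" and one: "(LBINT y. \<kappa> (x - y)) = 1" for x
    using integral_lborel_reflect[OF bk] tfun_integrable[OF k(1)] k(3) by auto
  have jensen: "(conv u \<kappa> x)^2 \<le> (LBINT y. (u y)^2 * \<kappa> (x - y))" for x
  proof -
    \<comment> \<open>Jensen's inequality is the nonnegativity of the variance about this
      mean.\<close>
    define c where "c = conv u \<kappa> x"
    have "0 \<le> (LBINT y. (u y - c)^2 * \<kappa> (x - y))" using k(2) by (intro integral_nonneg_AE AE_I2) simp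
    also have "\<dots> = (LBINT y. (u y)^2 * \<kappa> (x - y) - 2 * c * (u y * \<kappa> (x - y)) + c^2 * \<kappa> (x - y))"
      by (intro Bochner_Integration.integral_cong refl) (simp add: power2_diff algebra_simps)
    also have "\<dots> = (LBINT y. (u y)^2 * \<kappa> (x - y)) - 2 * c * c + c^2 * 1"
      using i1[of x] i2[of x] i3[of x] unfolding one[of x, symmetric] c_def conv_def by simp
    finally show ?thesis unfolding c_def[symmetric] by (simp add: power2_eq_square)
  qed
  have cm: "conv u \<kappa> \<in> borel_measurable borel"
    by (rule borel_measurable_continuous_onI[OF C_k_continuous[OF C_k_conv[OF u(1) k(1)]]])
  have "(\<integral>\<^sup>+x. ennreal ((conv u \<kappa> x)^2) \<partial>lborel) \<le> (\<integral>\<^sup>+x. (\<integral>\<^sup>+y. ennreal ((u y)^2) * ennreal (\<kappa> (x - y)) \<partial>lborel) \<partial>lborel)"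
  proof (rule nn_integral_mono)
    fix x
    have "(\<integral>\<^sup>+y. ennreal ((u y)^2) * ennreal (\<kappa> (x - y)) \<partial>lborel) = (\<integral>\<^sup>+y. ennreal ((u y)^2 * \<kappa> (x - y)) \<partial>lborel)"
      by (intro nn_integral_cong) (simp add: ennreal_mult'[symmetric] k(2))
    also have "\<dots> = ennreal (LBINT y. (u y)^2 * \<kappa> (x - y))"
      using k(2) by (intro nn_integral_eq_integral i2) simp
    finally show "ennreal ((conv u \<kappa> x)^2) \<le> (\<integral>\<^sup>+y. ennreal ((u y)^2) * ennreal (\<kappa> (x - y)) \<partial>lborel)"
      using jensen[of x] by (simp add: ennreal_leI)
  qed
  also have "\<dots> = (\<integral>\<^sup>+y. (\<integral>\<^sup>+x. ennreal ((u y)^2) * ennreal (\<kappa> (x - y)) \<partial>lborel) \<partial>lborel)"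
    by (rule lborel_pair.Fubini') measurable
  also have "\<dots> = (\<integral>\<^sup>+y. ennreal ((u y)^2) \<partial>lborel)"
  proof (rule nn_integral_cong)
    fix y
    have "(\<integral>\<^sup>+x. ennreal (\<kappa> (x - y)) \<partial>lborel) = (\<integral>\<^sup>+x. ennreal (\<kappa> x) \<partial>lborel)"
      using nn_integral_lborel_translation[of "\<lambda>x. ennreal (\<kappa> x)" "-y"] by simp
    also have "\<dots> = 1" using nn_integral_eq_integral[OF tfun_integrable[OF k(1)]] k by simp
    finally show "(\<integral>\<^sup>+x. ennreal ((u y)^2) * ennreal (\<kappa> (x - y)) \<partial>lborel) = ennreal ((u y)^2)"
      by (subst nn_integral_cmult) auto
  qed
  also have "\<dots> = ennreal (LBINT y. (u y)^2)" by (rule nn_integral_eq_integral[OF iu2]) simp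
  finally have le: "(\<integral>\<^sup>+x. ennreal ((conv u \<kappa> x)^2) \<partial>lborel) \<le> ennreal (LBINT y. (u y)^2)" .
  then have ic: "integrable lborel (\<lambda>x. (conv u \<kappa> x)^2)"
    using cm by (intro integrableI_nonneg) (auto simp: less_top[symmetric] top_unique intro: le_less_trans)
  then show "sq_int lborel (conv u \<kappa>)" using cm by (simp add: sq_int_def)
  have "ennreal (LBINT x. (conv u \<kappa> x)^2) \<le> ennreal (LBINT y. (u y)^2)"
    using le nn_integral_eq_integral[OF ic] by simp
  then have "(LBINT x. (conv u \<kappa> x)^2) \<le> (LBINT y. (u y)^2)" by (simp add: ennreal_le_iff)
  then show "l2 lborel (conv u \<kappa>) \<le> l2 lborel u" by (simp add: l2_def)
qed

section \<open>Strips along a polytopal boundary\<close>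

text \<open>Fundamental theorem of calculus and the Cauchy-Schwarz inequality against the indicator
  of the interval.\<close>

lemma power2_integral_le:
  fixes f :: "real => real"
  assumes t: "0 \<le> t" and F: "\<And>s. s \<in> {0..t} ==> (F has_real_derivative f s) (at s within {0..t})"
    and f: "continuous_on {0..t} f"
  shows "(F t - F 0)^2 \<le> t * (LBINT s. (f s)^2 * indicator {0..t} s)"
    and "integrable lborel (\<lambda>s. (f s)^2 * indicator {0..t} s)"
proof -
  have hb: "has_bochner_integral lborel (\<lambda>s. f s * indicator {0..t} s) (F t - F 0)"
    using has_bochner_integral_FTC_Icc[OF t _ f, of F] F
    by (simp add: has_real_derivative_iff_has_vector_derivative mult.commute)
  have c2: "continuous_on {0..t} (\<lambda>s. (f s)^2)" using f by (intro continuous_intros)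
  have "integrable lborel (\<lambda>s. indicator {0..t} s *\<^sub>R (f s)\<^sup>2)"
    by (rule borel_integrable_compact[OF compact_Icc c2])
  then show i2: "integrable lborel (\<lambda>s. (f s)^2 * indicator {0..t} s)" by (simp add: mult.commute)
  let ?u = "\<lambda>s. f s * indicator {0..t} s" and ?v = "indicator {0..t} :: real => real"
  have u2: "(\<lambda>s. (?u s)^2) = (\<lambda>s. (f s)^2 * indicator {0..t} s)" and v2: "(\<lambda>s. (?v s)^2) = ?v"
    and uv: "(\<lambda>s. ?u s * ?v s) = ?u"
    by (auto simp: indicator_def)
  have um: "?u \<in> borel_measurable lborel" using borel_measurable_has_bochner_integral[OF hb] by simp
  have su: "sq_int lborel ?u" unfolding sq_int_def u2 using um i2 by simp
  have sv: "sq_int lborel ?v" unfolding sq_int_def v2 using t by (auto intro!: integrable_real_indicator)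
  have lv: "l2 lborel ?v = sqrt t" unfolding l2_def v2 using t by simp
  have e: "F t - F 0 = (LBINT s. ?u s * ?v s)" unfolding uv using has_bochner_integral_integral_eq[OF hb] by simp
  have "\<bar>F t - F 0\<bar> \<le> l2 lborel ?u * sqrt t"
    unfolding e lv[symmetric] by (rule l2_Cauchy_Schwarz[OF su sv])
  then have "\<bar>F t - F 0\<bar>\<^sup>2 \<le> (l2 lborel ?u * sqrt t)^2" by (intro power_mono) auto
  also have "\<dots> = (l2 lborel ?u)^2 * (sqrt t)^2" by (rule power_mult_distrib)
  also have "\<dots> = t * (LBINT s. (f s)^2 * indicator {0..t} s)"
    unfolding l2_power2 u2 using t by simp
  finally show "(F t - F 0)^2 \<le> t * (LBINT s. (f s)^2 * indicator {0..t} s)" by simp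
qed

text \<open>The increment is the integral of the derivative along the segment towards
  \<open>c\<close>. One factor \<open>t\<close> comes from the Cauchy-Schwarz inequality, the other
  from the length of the parameter interval; undoing the dilation inside the gradient costs at most
  the power of two.\<close>

lemma dilation_difference:
  fixes w :: "real^'d => real"
  assumes w: "tfun UNIV w" and t: "0 \<le> t" "t \<le> 1/2" and A[measurable]: "A \<in> sets borel"
    and R: "\<And>x. x \<in> A ==> norm (c - x) \<le> R" "0 \<le> R"
  shows "(\<integral>\<^sup>+x. ennreal ((w (x + t *\<^sub>R (c - x)) - w x)^2) * indicator A x \<partial>lborel) \<le>
    ennreal (t^2 * R^2 * 2 ^ CARD('d)) * (\<integral>\<^sup>+x. ennreal ((norm (grad w x))^2) \<partial>lborel)"
proof -
  let ?T = "\<lambda>s x. x + s *\<^sub>R (c - x)"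
  define G where "G x = ennreal ((norm (grad w x))^2)" for x
  let ?g = "\<integral>\<^sup>+x. G x \<partial>lborel"
  let ?J = "\<lambda>s. \<integral>\<^sup>+x. G (?T s x) \<partial>lborel"
  let ?h = "\<lambda>s x. ennreal (t * R^2) * (G (?T s x) * indicator {0..t} s)"
  have [measurable]: "grad w \<in> borel_measurable borel" by (rule grad_borel[OF w])
  have G[measurable]: "G \<in> borel_measurable borel" unfolding G_def by measurable
  have gc: "continuous_on UNIV (grad w)"
    unfolding grad_def by (rule continuous_on_vec_lambda) (rule tfun_continuous[OF tfun_pd[OF w]])
  have pt: "ennreal ((w (?T t x) - w x)^2) * indicator A x \<le>
     (\<integral>\<^sup>+s. ?h s x \<partial>lborel)" for x
  proof (cases "x \<in> A")
    case True
    let ?f = "\<lambda>s. grad w (?T s x) \<bullet> (c - x)"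
    have fc: "continuous_on {0..t} ?f"
      by (intro continuous_intros continuous_on_compose2[OF gc]) auto
    have D: "((\<lambda>s. w (?T s x)) has_real_derivative ?f s) (at s within {0..t})" for s
    proof -
      have "((\<lambda>s. w (?T s x)) has_derivative (\<lambda>h. grad w (?T s x) \<bullet> (h *\<^sub>R (c - x)))) (at s within {0..t})"
      proof (rule has_derivative_compose[of "\<lambda>s. ?T s x" "\<lambda>h. h *\<^sub>R (c - x)" s _ w "\<lambda>k. grad w (?T s x) \<bullet> k"])
        show "((\<lambda>s. ?T s x) has_derivative (\<lambda>h. h *\<^sub>R (c - x))) (at s within {0..t})"
          by (auto intro!: derivative_eq_intros)
        show "(w has_derivative (\<bullet>) (grad w (?T s x))) (at (?T s x))"
          by (rule tfun_has_derivative[OF tfun_differentiable[OF w]])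
      qed
      then show ?thesis by (simp add: has_field_derivative_def mult.commute[of "?f s"] mult_commute_abs)
    qed
    note le = power2_integral_le[OF t(1) D fc]
    have sq: "(?f s)^2 \<le> R^2 * (norm (grad w (?T s x)))^2" for s
    proof -
      have "\<bar>?f s\<bar> \<le> norm (grad w (?T s x)) * norm (c - x)" by (rule Cauchy_Schwarz_ineq2)
      also have "\<dots> \<le> norm (grad w (?T s x)) * R" by (intro mult_left_mono R(1) True norm_ge_zero)
      finally have "\<bar>?f s\<bar>\<^sup>2 \<le> (norm (grad w (?T s x)) * R)^2" by (intro power_mono) auto
      then show ?thesis by (simp add: power_mult_distrib mult.commute)
    qed
    have "ennreal ((w (?T t x) - w x)^2) \<le> ennreal (t * (LBINT s. (?f s)^2 * indicator {0..t} s))"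
      using le(1) by (intro ennreal_leI) simp
    also have "\<dots> = ennreal t * (\<integral>\<^sup>+s. ennreal ((?f s)^2 * indicator {0..t} s) \<partial>lborel)"
      using t(1) nn_integral_eq_integral[OF le(2)] by (simp add: ennreal_mult')
    also have "\<dots> = (\<integral>\<^sup>+s. ennreal t * ennreal ((?f s)^2 * indicator {0..t} s) \<partial>lborel)"
      using borel_measurable_integrable[OF le(2)] by (intro nn_integral_cmult[symmetric]) simp
    also have "\<dots> \<le> (\<integral>\<^sup>+s. ?h s x \<partial>lborel)"
    proof (rule nn_integral_mono)
      fix s
      have "ennreal ((?f s)^2) \<le> ennreal (R^2) * G (?T s x)"
        unfolding G_def using sq[of s] by (simp add: ennreal_mult'[symmetric] ennreal_leI)
      then have "ennreal t * ennreal ((?f s)^2) \<le> ennreal t * (ennreal (R^2) * G (?T s x))"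
        by (rule mult_left_mono) simp
      then show "ennreal t * ennreal ((?f s)^2 * indicator {0..t} s) \<le> ?h s x"
        using t(1) by (auto simp: indicator_def ennreal_mult' mult.assoc)
    qed
    finally show ?thesis using True by simp
  qed simp
  have "(\<integral>\<^sup>+x. ennreal ((w (?T t x) - w x)^2) * indicator A x \<partial>lborel) \<le>
    (\<integral>\<^sup>+x. (\<integral>\<^sup>+s. ?h s x \<partial>lborel) \<partial>lborel)"
    by (rule nn_integral_mono) (rule pt)
  also have "\<dots> = (\<integral>\<^sup>+s. (\<integral>\<^sup>+x. ?h s x \<partial>lborel) \<partial>lborel)"
    by (rule lborel_pair.Fubini') measurable
  also have "\<dots> \<le> (\<integral>\<^sup>+s. ennreal (t * R^2) * (ennreal (2 ^ CARD('d)) * ?g) * indicator {0..t} s \<partial>lborel)"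
  proof (rule nn_integral_mono)
    fix s
    show "(\<integral>\<^sup>+x. ?h s x \<partial>lborel) \<le>
      ennreal (t * R^2) * (ennreal (2 ^ CARD('d)) * ?g) * indicator {0..t} s"
    proof (cases "s \<in> {0..t}")
      case True
      then have s: "0 \<le> s" "s \<le> 1/2" "1 - s > 0" using t by auto
      have T: "?T s x = s *\<^sub>R c + (1 - s) *\<^sub>R x" for x by (simp add: algebra_simps)
      have d: "?g = ennreal ((1 - s) ^ CARD('d)) * ?J s"
        unfolding T using nn_integral_lborel_dilation[OF G s(3), of "s *\<^sub>R c"] by simp
      \<comment> \<open>The Jacobian of the dilation with ratio \<open>1 - s\<close> is at least the
        \<open>d\<close>-th power of one half.\<close>
      have "1 \<le> (2 * (1 - s)) ^ CARD('d)" using s by (intro one_le_power) auto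
      then have "1 \<le> 2 ^ CARD('d) * (1 - s) ^ CARD('d)" unfolding power_mult_distrib .
      then have one: "(1::ennreal) \<le> ennreal (2 ^ CARD('d)) * ennreal ((1 - s) ^ CARD('d))"
        using s by (simp add: ennreal_mult'[symmetric])
      have "?J s = 1 * ?J s" by simp
      also have "\<dots> \<le> (ennreal (2 ^ CARD('d)) * ennreal ((1 - s) ^ CARD('d))) * ?J s"
        by (rule mult_right_mono[OF one]) simp
      also have "\<dots> = ennreal (2 ^ CARD('d)) * ?g" unfolding d by (simp add: mult.assoc)
      finally have le: "?J s \<le> ennreal (2 ^ CARD('d)) * ?g" .
      have "(\<integral>\<^sup>+x. ?h s x \<partial>lborel) = ennreal (t * R^2) * ?J s"
        using True by (simp add: nn_integral_cmult)
      also have "\<dots> \<le> ennreal (t * R^2) * (ennreal (2 ^ CARD('d)) * ?g)"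
        by (rule mult_left_mono[OF le]) simp
      finally show ?thesis using True by simp
    qed simp
  qed
  also have "\<dots> = ennreal (t * R^2) * (ennreal (2 ^ CARD('d)) * ?g) * ennreal t"
    using t(1) by (subst nn_integral_cmult_indicator) auto
  also have "\<dots> = (ennreal (t * R^2) * ennreal (2 ^ CARD('d)) * ennreal t) * ?g"
    by (simp only: mult_ac)
  also have "ennreal (t * R^2) * ennreal (2 ^ CARD('d)) * ennreal t = ennreal (t^2 * R^2 * 2 ^ CARD('d))"
  proof -
    have "t^2 * R^2 * 2 ^ CARD('d) = t * R^2 * 2 ^ CARD('d) * t" by (simp add: power2_eq_square)
    then show ?thesis using t(1) by (simp only: ennreal_mult zero_le_mult_iff zero_le_power2 zero_le_numeral zero_le_power simp_thms mult_nonneg_nonneg)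
  qed
  finally show ?thesis unfolding G_def .
qed

text \<open>A polytope is a finite intersection of closed half-spaces; the complements of these are
  the pieces.\<close>

lemma polytope_complement_pieces:
  fixes S :: "'a::euclidean_space set"
  assumes "polytope S"
  shows "\<exists>\<G>. finite \<G> \<and> (\<forall>V\<in>\<G>. open V \<and> convex V) \<and> - S = \<Union>\<G>"
proof -
  obtain F where F: "finite F" "S = \<Inter>F" "\<And>h. h \<in> F ==> \<exists>a b. a \<noteq> 0 \<and> h = {x. a \<bullet> x \<le> b}"
    using polytope_imp_polyhedron[OF assms] unfolding polyhedron_def by blast
  have "open (- h) \<and> convex (- h)" if "h \<in> F" for h
  proof -
    from F(3)[OF that] obtain a b where "h = {x. a \<bullet> x \<le> b}" by auto
    then have "- h = {x. a \<bullet> x > b}" by auto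
    then show ?thesis by (simp add: open_halfspace_gt convex_halfspace_gt)
  qed
  then show ?thesis using F by (intro exI[of _ "uminus ` F"]) auto
qed

text \<open>The complement of a union is an intersection of finite unions. Distributing it produces
  pairwise intersections, which are again open and convex.\<close>

lemma Union_polytopes_complement_pieces:
  fixes P :: "'a::euclidean_space set set"
  assumes "finite P" "\<And>S. S \<in> P ==> polytope S"
  shows "\<exists>\<G>. finite \<G> \<and> (\<forall>V\<in>\<G>. open V \<and> convex V) \<and> - \<Union>P = \<Union>\<G>"
  using assms
proof (induction P rule: finite_induct)
  case empty
  show ?case by (intro exI[of _ "{UNIV}"]) auto
next
  case (insert S P)
  obtain \<G> where G: "finite \<G>" "\<forall>V\<in>\<G>. open V \<and> convex V" "- \<Union>P = \<Union>\<G>" using insert by auto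
  obtain \<H> where H: "finite \<H>" "\<forall>V\<in>\<H>. open V \<and> convex V" "- S = \<Union>\<H>"
    using polytope_complement_pieces[of S] insert.prems by auto
  let ?I = "(\<lambda>(V, W). V \<inter> W) ` (\<G> \<times> \<H>)"
  have "finite ?I" using G H by simp
  moreover have "\<forall>V\<in>?I. open V \<and> convex V" using G H by (auto intro: convex_Int)
  moreover have "- \<Union>(insert S P) = \<Union>?I"
  proof -
    have "- \<Union>(insert S P) = \<Union>\<G> \<inter> \<Union>\<H>" using G(3) H(3) by auto
    also have "\<dots> = \<Union>?I" by auto
    finally show ?thesis .
  qed
  ultimately show ?case by blast
qed

text \<open>The complement of an interior is the closure of the complement, so every boundary point
  is a limit of points of the open pieces.\<close>

lemma polytopal_open_complement:
  assumes "polytopal_open \<Omega>"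
  shows "\<exists>\<G>. finite \<G> \<and> (\<forall>V\<in>\<G>. open V \<and> convex V \<and> V \<noteq> {} \<and> V \<inter> \<Omega> = {}) \<and> - \<Omega> = closure (\<Union>\<G>)"
proof -
  obtain P where P: "finite P" "\<And>S. S \<in> P ==> polytope S" "\<Omega> = interior (\<Union>P)"
    using assms unfolding polytopal_open_def by blast
  obtain \<G> where G: "finite \<G>" "\<forall>V\<in>\<G>. open V \<and> convex V" "- \<Union>P = \<Union>\<G>"
    using Union_polytopes_complement_pieces[OF P(1,2)] by blast
  have c: "- \<Omega> = closure (\<Union>\<G>)" unfolding P(3) G(3)[symmetric] by (simp add: closure_complement)
  have "\<Union>(\<G> - {{}}) = \<Union>\<G>" by auto
  moreover have "V \<inter> \<Omega> = {}" if "V \<in> \<G>" for V using that c closure_subset[of "\<Union>\<G>"] by blast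
  ultimately show ?thesis using G c by (intro exI[of _ "\<G> - {{}}"]) auto
qed

text \<open>The dilation towards a ball in a convex piece of the complement maps the strip near this
  piece to points where \<open>w\<close> vanishes.\<close>

lemma boundary_strip:
  fixes \<Omega> :: "(real^'d) set"
  assumes po: "polytopal_open \<Omega>" and b: "bounded \<Omega>"
  obtains C \<epsilon>0 where "C > 0" "\<epsilon>0 > 0"
    "\<And>\<epsilon> w. 0 < \<epsilon> ==> \<epsilon> \<le> \<epsilon>0 ==> tfun UNIV w ==> (\<And>x. w x \<noteq> 0 ==> \<exists>y\<in>\<Omega>. norm (x - y) < \<epsilon>) ==>
      l2 lborel (\<lambda>x. indicator {x \<in> \<Omega>. infdist x (- \<Omega>) \<le> 4 * \<epsilon>} x * w x) \<le> C * \<epsilon> * l2 lborel (\<lambda>x. norm (grad w x))"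
proof -
  have o: "open \<Omega>" by (rule polytopal_open_open[OF po])
  obtain \<G> where G: "finite \<G>" "\<And>V. V \<in> \<G> ==> open V" "\<And>V. V \<in> \<G> ==> convex V" "\<And>V. V \<in> \<G> ==> V \<noteq> {}"
    "\<And>V. V \<in> \<G> ==> V \<inter> \<Omega> = {}" and cG: "- \<Omega> = closure (\<Union>\<G>)"
    using polytopal_open_complement[OF po] by blast
  have "\<exists>c r. r > 0 \<and> ball c r \<subseteq> V" if "V \<in> \<G>" for V
    using G(2,4)[OF that] by (metis all_not_in_conv open_contains_ball)
  then obtain c r where cr: "\<And>V. V \<in> \<G> ==> r V > 0" "\<And>V. V \<in> \<G> ==> ball (c V) (r V) \<subseteq> V" by metis
  \<comment> \<open>A common radius for one ball in each of the finitely many pieces.\<close>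
  define \<rho> where "\<rho> = Min (insert 1 (r ` \<G>))"
  have \<rho>: "\<rho> > 0" "\<And>V. V \<in> \<G> ==> \<rho> \<le> r V" using G(1) cr(1) by (auto simp: \<rho>_def)
  have bV: "ball (c V) \<rho> \<subseteq> V" if "V \<in> \<G>" for V using cr(2)[OF that] \<rho>(2)[OF that] by (auto simp: subset_iff)
  obtain R0 where R0: "R0 > 0" "\<And>x. x \<in> \<Omega> ==> norm x \<le> R0" using b unfolding bounded_pos by blast
  define R where "R = R0 + (\<Sum>V\<in>\<G>. norm (c V))"
  have Rp: "R > 0" unfolding R_def using R0 by (intro add_pos_nonneg sum_nonneg) auto
  have R: "norm (c V - x) \<le> R" if "V \<in> \<G>" "x \<in> \<Omega>" for V x
  proof -
    have "norm (c V - x) \<le> norm (c V) + norm x" by (rule norm_triangle_ineq4)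
    moreover have "norm (c V) \<le> (\<Sum>V\<in>\<G>. norm (c V))" using that(1) G(1) by (intro member_le_sum) auto
    ultimately show ?thesis using R0(2)[OF that(2)] by (simp add: R_def)
  qed
  have ne: "- \<Omega> \<noteq> {}" using b not_bounded_UNIV by (metis Compl_empty_eq double_complement)
  \<comment> \<open>The coefficient of \<open>dilation_difference\<close> at
    \<open>t = 6 * \<epsilon> / \<rho>\<close>, summed over the pieces and with \<epsilon> taken
    out; the summand one keeps it positive.\<close>
  define C where "C = sqrt (real (card \<G>) * (36 / \<rho>^2 * R^2 * 2 ^ CARD('d))) + 1"
  show ?thesis
  proof (rule that[of C "\<rho> / 12"])
    show "C > 0" unfolding C_def by (intro add_nonneg_pos) simp_all
    show "\<rho> / 12 > 0" using \<rho> by simp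
    fix \<epsilon> :: real and w :: "real^'d => real"
    assume \<epsilon>: "0 < \<epsilon>" "\<epsilon> \<le> \<rho> / 12" and w: "tfun UNIV w"
      and supp: "\<And>x. w x \<noteq> 0 ==> \<exists>y\<in>\<Omega>. norm (x - y) < \<epsilon>"
    \<comment> \<open>The displacement \<open>t * \<rho>\<close> absorbs 6\<epsilon>: the width
      4\<epsilon> of the strip, \<epsilon> for reaching a point of a piece, and \<epsilon> by which
      the support may exceed the domain. The bound on \<epsilon> gives
      \<open>t \<le> 1/2\<close>.\<close>
    define t where "t = 6 * \<epsilon> / \<rho>"
    have t: "0 < t" "t \<le> 1/2" using \<epsilon> \<rho> by (auto simp: t_def field_simps)
    let ?S = "{x \<in> \<Omega>. infdist x (- \<Omega>) \<le> 4 * \<epsilon>}"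
    let ?T = "\<lambda>V x. x + t *\<^sub>R (c V - x)"
    have key: "\<exists>V\<in>\<G>. w (?T V x) = 0" if x: "x \<in> ?S" for x
    proof -
      have "closed (- \<Omega>)" using o by (rule closed_Compl)
      then obtain y where y: "y \<in> - \<Omega>" "infdist x (- \<Omega>) = dist x y" using infdist_attains_inf ne by blast
      then obtain y' where y': "y' \<in> \<Union>\<G>" "dist y' y < \<epsilon>" unfolding cG using \<epsilon>(1) closure_approachable by blast
      then obtain V where V: "V \<in> \<G>" "y' \<in> V" by blast
      have "dist x y' \<le> dist x y + dist y y'" by (rule dist_triangle)
      then have xy: "norm (x - y') < 5 * \<epsilon>" using y'(2) y(2) x by (simp add: dist_norm norm_minus_commute)
      have "w (?T V x) = 0"
      proof (rule ccontr)
        assume "w (?T V x) \<noteq> 0"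
        then obtain z where z: "z \<in> \<Omega>" "norm (?T V x - z) < \<epsilon>" using supp by blast
        \<comment> \<open>Solves \<open>z = (1 - t) y' + t c'\<close>. The estimates place
          \<open>c'\<close> within \<rho> of the centre, hence in \<open>V\<close>; by convexity
          \<open>z\<close> would then lie in \<open>V\<close>, which is disjoint from the
          domain.\<close>
        define c' where "c' = c V + (1 / t) *\<^sub>R (z - ?T V x + (1 - t) *\<^sub>R (x - y'))"
        have e: "z = (1 - t) *\<^sub>R y' + t *\<^sub>R c'"
          using t by (simp add: c'_def algebra_simps)
        have "norm (z - ?T V x + (1 - t) *\<^sub>R (x - y')) \<le> norm (z - ?T V x) + norm ((1 - t) *\<^sub>R (x - y'))"
          by (rule norm_triangle_ineq)
        also have "norm ((1 - t) *\<^sub>R (x - y')) \<le> 1 * norm (x - y')"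
          unfolding norm_scaleR using t by (intro mult_right_mono) auto
        finally have "norm (z - ?T V x + (1 - t) *\<^sub>R (x - y')) < 6 * \<epsilon>"
          using z(2) xy by (simp add: norm_minus_commute)
        then have "(1 / t) * norm (z - ?T V x + (1 - t) *\<^sub>R (x - y')) < (1 / t) * (6 * \<epsilon>)"
          using t by (intro mult_strict_left_mono) auto
        also have "(1 / t) * (6 * \<epsilon>) = \<rho>" using \<epsilon> \<rho> by (simp add: t_def)
        finally have "norm (c' - c V) < \<rho>" using t by (simp add: c'_def)
        then have "c' \<in> V" using bV[OF V(1)] by (auto simp: dist_norm norm_minus_commute)
        then have "z \<in> V" unfolding e using G(3)[OF V(1)] V(2) t by (intro convexD) auto
        then show False using G(5)[OF V(1)] z(1) by blast
      qed
      then show ?thesis using V(1) by blast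
    qed
    have gm[measurable]: "grad w \<in> borel_measurable borel" by (rule grad_borel[OF w])
    have wm[measurable]: "w \<in> borel_measurable borel" by (rule tfun_borel[OF w])
    have \<Omega>m[measurable]: "\<Omega> \<in> sets borel" using o by simp
    have Sm[measurable]: "?S \<in> sets borel"
    proof -
      have "?S = \<Omega> \<inter> {x. infdist x (- \<Omega>) \<le> 4 * \<epsilon>}" by auto
      moreover have "closed {x. infdist x (- \<Omega>) \<le> 4 * \<epsilon>}" by (intro closed_Collect_le continuous_intros)
      ultimately show ?thesis by simp
    qed
    define K where "K = t^2 * R^2 * 2 ^ CARD('d)"
    have K0: "K \<ge> 0" by (simp add: K_def)
    define N where "N = (\<integral>\<^sup>+x. ennreal ((norm (grad w x))^2) \<partial>lborel)"
    have "(\<integral>\<^sup>+x. ennreal ((indicator ?S x * w x)^2) \<partial>lborel) \<le>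
      (\<integral>\<^sup>+x. (\<Sum>V\<in>\<G>. ennreal ((w (?T V x) - w x)^2) * indicator \<Omega> x) \<partial>lborel)"
    proof (rule nn_integral_mono)
      fix x
      show "ennreal ((indicator ?S x * w x)^2) \<le> (\<Sum>V\<in>\<G>. ennreal ((w (?T V x) - w x)^2) * indicator \<Omega> x)"
      proof (cases "x \<in> ?S")
        case True
        then obtain V where V: "V \<in> \<G>" "w (?T V x) = 0" using key by blast
        \<comment> \<open>As \<open>w\<close> vanishes at the dilated point, its value at
          \<open>x\<close> is an increment along the dilation.\<close>
        then have "ennreal ((indicator ?S x * w x)^2) = ennreal ((w (?T V x) - w x)^2) * indicator \<Omega> x" using True by simp
        also have "\<dots> \<le> (\<Sum>V\<in>\<G>. ennreal ((w (?T V x) - w x)^2) * indicator \<Omega> x)"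
          by (rule member_le_sum[OF V(1) _ G(1)]) simp
        finally show ?thesis .
      qed simp
    qed
    also have "\<dots> = (\<Sum>V\<in>\<G>. \<integral>\<^sup>+x. ennreal ((w (?T V x) - w x)^2) * indicator \<Omega> x \<partial>lborel)"
      by (rule nn_integral_sum) measurable
    also have "\<dots> \<le> (\<Sum>V\<in>\<G>. ennreal K * N)"
      unfolding K_def N_def using t R Rp by (intro sum_mono dilation_difference[OF w]) auto
    also have "\<dots> = ennreal (real (card \<G>) * K) * N"
      using K0 by (simp add: ennreal_mult' ennreal_of_nat_eq_real_of_nat mult.assoc)
    finally have le: "(\<integral>\<^sup>+x. ennreal ((indicator ?S x * w x)^2) \<partial>lborel) \<le> ennreal (real (card \<G>) * K) * N" .
    have ig: "integrable lborel (\<lambda>x. (norm (grad w x))^2)"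
    proof -
      have e: "(\<lambda>x. (norm (grad w x))^2) = (\<lambda>x. \<Sum>i\<in>UNIV. pd i w x * pd i w x)"
        by (rule ext) (simp add: power2_norm_eq_inner inner_vec_def grad_def)
      have "integrable lborel (\<lambda>x. pd i w x * pd i w x)" for i
        using tfun_pd[OF w] by (intro tfun_integrable[of UNIV] tfun_mult tfun_C_k)
      then show ?thesis unfolding e by simp
    qed
    have N: "N = ennreal (LBINT x. (norm (grad w x))^2)"
      unfolding N_def by (rule nn_integral_eq_integral[OF ig]) simp
    have iS: "integrable lborel (\<lambda>x. (indicator ?S x * w x)^2)"
      using le unfolding N by (intro integrableI_nonneg) (auto simp: ennreal_mult'[symmetric] K0 intro: le_less_trans)
    have "ennreal (LBINT x. (indicator ?S x * w x)^2) \<le> ennreal (real (card \<G>) * K * (LBINT x. (norm (grad w x))^2))"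
      using le nn_integral_eq_integral[OF iS] K0 unfolding N by (simp add: ennreal_mult'[symmetric])
    then have "(LBINT x. (indicator ?S x * w x)^2) \<le> real (card \<G>) * K * (LBINT x. (norm (grad w x))^2)"
      using K0 by (subst (asm) ennreal_le_iff) auto
    then have "l2 lborel (\<lambda>x. indicator ?S x * w x) \<le> sqrt (real (card \<G>) * K) * l2 lborel (\<lambda>x. norm (grad w x))"
      unfolding l2_def real_sqrt_mult[symmetric] by (rule real_sqrt_le_mono)
    also have "real (card \<G>) * K = real (card \<G>) * (36 / \<rho>^2 * R^2 * 2 ^ CARD('d)) * \<epsilon>^2"
      by (simp add: K_def t_def power_divide power_mult_distrib)
    also have "sqrt (real (card \<G>) * (36 / \<rho>^2 * R^2 * 2 ^ CARD('d)) * \<epsilon>^2) \<le> C * \<epsilon>"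
      unfolding real_sqrt_mult[of _ "\<epsilon>^2"] C_def using \<epsilon> by (simp add: algebra_simps)
    finally show "l2 lborel (\<lambda>x. indicator ?S x * w x) \<le> C * \<epsilon> * l2 lborel (\<lambda>x. norm (grad w x))"
      by (simp add: mult_right_mono)
  qed
qed

section \<open>Discrete functions on a mesh\<close>

text \<open>The discrete gradient of the hybrid form, written through \<open>D_op\<close>.\<close>

definition dgrad :: "(real^'d) mesh => ((real^'d) set => real) => ((real^'d) set => real) => (real^'d) set => real^'d" where
  "dgrad m v v' K = D_op m K (\<lambda>E. area E * (v' E - v K))"

text \<open>The discrete counterpart of the \<open>H^1_0\<close> norm for cell values
  \<open>v\<close> and face values \<open>v'\<close>.\<close>

definition dnorm :: "(real^'d) mesh => ((real^'d) set => real) => ((real^'d) set => real) => real" where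
  "dnorm m v v' = sqrt (\<Sum>K\<in>cells m. \<Sum>E\<in>faces m K. area E / dist_face m K E * (v' E - v K)^2)"

text \<open>\<open>h\<close> is any nonnegative bound for the diameters; \<open>mesh_size\<close>
  itself is a maximum over a set of cells that may be empty.\<close>

locale star_mesh =
  fixes \<Omega> :: "(real^'d) set" and R \<theta> h :: real and m :: "(real^'d) mesh"
  assumes open_domain: "open \<Omega>" and radius: "\<And>x. x \<in> \<Omega> ==> norm x \<le> R" and radius_pos: "R > 0"
    and mesh: "polytopal_mesh \<Omega> m"
    and star: "\<And>K. K \<in> cells m ==> star_shaped K (point m K)"
    and regular: "regular_mesh \<theta> m" and theta_pos: "\<theta> > 0"
    and diameter_le_size: "\<And>K. K \<in> cells m ==> diameter K \<le> h" and size_nonneg: "h \<ge> 0"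
begin

section \<open>Integrals of piecewise constant functions\<close>

lemma bounded_domain: "bounded \<Omega>"
  using radius unfolding bounded_iff by blast

lemma finite_cells: "finite (cells m)" and disjoint_cells: "disjoint (cells m)"
  and negligible_rest: "negligible (\<Omega> - \<Union>(cells m))"
  using mesh unfolding polytopal_mesh_def by auto

lemma cell:
  assumes "K \<in> cells m"
  shows "regular_cell \<theta> m K" "open K" "K \<subseteq> \<Omega>" "point m K \<in> K" "finite (faces m K)" "bounded K" "K \<in> sets borel"
    "vol K > 0"
proof -
  show rc: "regular_cell \<theta> m K" by (rule mesh_regular_cell[OF mesh assms bounded_domain star[OF assms] regular theta_pos])
  show "open K" "K \<subseteq> \<Omega>" "point m K \<in> K" "finite (faces m K)"
    using polytopal_mesh_cell[OF mesh assms] by auto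
  then show "bounded K" "K \<in> sets borel" using bounded_domain bounded_subset by auto
  show "vol K > 0" using regular_cell.vol_pos[OF rc] .
qed

lemma pwc_cell:
  assumes "K \<in> cells m" "x \<in> K"
  shows "pwc m p x = p K"
proof -
  have "pwc m p x = (\<Sum>L\<in>cells m. if L = K then p K else 0)"
    unfolding piecewise_constant_def
  proof (rule sum.cong[OF refl])
    fix L assume L: "L \<in> cells m"
    have "x \<notin> L" if "L \<noteq> K" using disjointD[OF disjoint_cells L assms(1) that] assms(2) by blast
    then show "p L * indicator L x = (if L = K then p K else 0)" using assms(2) by auto
  qed
  then show ?thesis using assms(1) finite_cells by simp
qed

lemma pwc_outside: "x \<notin> \<Omega> ==> pwc m p x = 0"
  unfolding piecewise_constant_def using cell(3) by (intro sum.neutral) (auto simp: indicator_def)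

lemma pwc_borel [measurable]: "pwc m p \<in> borel_measurable borel"
  unfolding piecewise_constant_def
  using cell(7) by (intro borel_measurable_sum borel_measurable_times borel_measurable_const borel_measurable_indicator)

lemma pwc_bounded: "\<bar>pwc m p x\<bar> \<le> (\<Sum>K\<in>cells m. \<bar>p K\<bar>)"
  unfolding piecewise_constant_def
  by (rule order_trans[OF sum_abs]) (auto intro!: sum_mono simp: abs_mult indicator_def)

lemma pwc_integrable: "integrable lborel (pwc m p)"
proof -
  have "integrable lborel (indicator K :: _ => real)" if "K \<in> cells m" for K
    using cell[OF that] by (intro integrable_real_indicator emeasure_bounded_finite) auto
  then show ?thesis unfolding piecewise_constant_def
    by (intro Bochner_Integration.integrable_sum integrable_mult_right) auto
qed

lemma AE_cells: "AE x in leb \<Omega>. \<exists>K\<in>cells m. x \<in> K"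
proof -
  have "AE x in lebesgue. x \<notin> \<Omega> - \<Union>(cells m)"
    using negligible_rest by (intro AE_not_in) (simp add: negligible_iff_null_sets)
  then show ?thesis using open_domain by (subst AE_restrict_space_iff) auto
qed

lemma integral_indicator_cell:
  fixes g :: "real^'d => real"
  assumes K: "K \<in> cells m"
  shows "(LINT x|leb \<Omega>. indicator K x * g x) = integral\<^sup>L (leb K) g"
    and "integrable (leb \<Omega>) g ==> integrable (leb \<Omega>) (\<lambda>x. indicator K x * g x)"
    and "integrable (leb \<Omega>) g ==> integrable (leb K) g"
proof -
  have e: "(\<lambda>x. indicator \<Omega> x *\<^sub>R (indicator K x * g x)) = (\<lambda>x. indicator K x *\<^sub>R g x)"
    using cell(3)[OF K] by (intro ext) (auto simp: indicator_def)
  have sets: "\<Omega> \<inter> space lebesgue \<in> sets lebesgue" "K \<inter> space lebesgue \<in> sets lebesgue"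
    using open_domain cell(2)[OF K] by auto
  show "(LINT x|leb \<Omega>. indicator K x * g x) = integral\<^sup>L (leb K) g"
    unfolding integral_restrict_space[OF sets(1)] integral_restrict_space[OF sets(2)] e ..
  assume g: "integrable (leb \<Omega>) g"
  have "(indicator K :: _ => real) \<in> borel_measurable (leb \<Omega>)"
    by (rule lebesgue_on_borel) (use cell(7)[OF K] in simp)
  then have "(\<lambda>x. indicator K x * g x) \<in> borel_measurable (leb \<Omega>)"
    using g by (intro borel_measurable_times) auto
  then show 1: "integrable (leb \<Omega>) (\<lambda>x. indicator K x * g x)"
    by (rule Bochner_Integration.integrable_bound[OF g]) (auto simp: indicator_def)
  show "integrable (leb K) g"
    using 1 unfolding integrable_restrict_space[OF sets(1)] integrable_restrict_space[OF sets(2)] e .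
qed

lemma integral_cells:
  fixes g :: "real^'d => real"
  assumes g: "integrable (leb \<Omega>) g"
  shows "(LINT x|leb \<Omega>. pwc m p x * g x) = (\<Sum>K\<in>cells m. p K * integral\<^sup>L (leb K) g)"
    and "integrable (leb \<Omega>) (\<lambda>x. pwc m p x * g x)"
    and "integral\<^sup>L (leb \<Omega>) g = (\<Sum>K\<in>cells m. integral\<^sup>L (leb K) g)"
proof -
  have e: "pwc m p x * g x = (\<Sum>K\<in>cells m. p K * (indicator K x * g x))" for x p
    unfolding piecewise_constant_def sum_distrib_right by (simp add: mult.assoc)
  have i: "integrable (leb \<Omega>) (\<lambda>x. p K * (indicator K x * g x))" if "K \<in> cells m" for K p
    using integral_indicator_cell(2)[OF that g] by simp
  show *: "(LINT x|leb \<Omega>. pwc m p x * g x) = (\<Sum>K\<in>cells m. p K * integral\<^sup>L (leb K) g)" for p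
    unfolding e using i integral_indicator_cell(1) by (subst Bochner_Integration.integral_sum) auto
  show "integrable (leb \<Omega>) (\<lambda>x. pwc m p x * g x)"
    unfolding e using i by (rule Bochner_Integration.integrable_sum)
  have "AE x in leb \<Omega>. g x = pwc m (\<lambda>_. 1) x * g x"
    using AE_cells by eventually_elim (auto simp: pwc_cell)
  then have "integral\<^sup>L (leb \<Omega>) g = (LINT x|leb \<Omega>. pwc m (\<lambda>_. 1) x * g x)"
    using g by (intro integral_cong_AE) (auto intro!: borel_measurable_times lebesgue_on_borel[OF pwc_borel])
  then show "integral\<^sup>L (leb \<Omega>) g = (\<Sum>K\<in>cells m. integral\<^sup>L (leb K) g)" using *[of "\<lambda>_. 1"] by simp
qed

lemma measure_cell: "K \<in> cells m ==> measure (leb K) (space (leb K)) = vol K"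
  using cell(2) by (simp add: vol_def measure_restrict_space)

lemma sum_vol: "(\<Sum>K\<in>cells m. vol K) = vol \<Omega>"
proof -
  interpret finite_measure "leb \<Omega>" using lebesgue_on_finite open_domain bounded_domain by blast
  have "(LINT x|leb \<Omega>. 1::real) = (\<Sum>K\<in>cells m. (LINT x|leb K. 1))"
    by (rule integral_cells(3)) simp
  then show ?thesis using measure_cell open_domain by (simp add: vol_def measure_restrict_space)
qed

lemma pwc_l2:
  shows "sq_int (leb \<Omega>) (pwc m p)"
    and "(l2 (leb \<Omega>) (pwc m p))^2 = (\<Sum>K\<in>cells m. vol K * (p K)^2)"
    and "l2 lborel (pwc m p) = l2 (leb \<Omega>) (pwc m p)"
proof -
  have fm: "finite_measure (leb \<Omega>)" using lebesgue_on_finite open_domain bounded_domain by blast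
  show sq: "sq_int (leb \<Omega>) (pwc m p)"
    by (rule sq_int_bounded[OF fm lebesgue_on_borel[OF pwc_borel], where c = "\<Sum>K\<in>cells m. \<bar>p K\<bar>"])
       (auto intro: pwc_bounded sum_nonneg)
  have i: "integrable (leb \<Omega>) (\<lambda>x. (pwc m p x)^2)" using sq by (simp add: sq_int_def)
  have "(l2 (leb \<Omega>) (pwc m p))^2 = (\<Sum>K\<in>cells m. (LINT x|leb K. (pwc m p x)^2))"
    unfolding l2_power2 by (rule integral_cells(3)[OF i])
  also have "\<dots> = (\<Sum>K\<in>cells m. (LINT x|leb K. (p K)^2))"
    by (intro sum.cong refl Bochner_Integration.integral_cong) (auto simp: pwc_cell)
  also have "\<dots> = (\<Sum>K\<in>cells m. vol K * (p K)^2)" using measure_cell by (intro sum.cong refl) simp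
  finally show "(l2 (leb \<Omega>) (pwc m p))^2 = (\<Sum>K\<in>cells m. vol K * (p K)^2)" .
  show "l2 lborel (pwc m p) = l2 (leb \<Omega>) (pwc m p)"
    unfolding l2_def using integral_lebesgue_on_eq(1)[OF open_domain, of "\<lambda>x. (pwc m p x)^2"]
    by (simp add: pwc_outside)
qed

lemma sum_vol_abs_le: "(\<Sum>K\<in>cells m. vol K * \<bar>p K\<bar>) \<le> sqrt (vol \<Omega>) * l2 (leb \<Omega>) (pwc m p)"
proof -
  have "(\<Sum>K\<in>cells m. vol K * \<bar>p K\<bar>)^2 \<le> (\<Sum>K\<in>cells m. (vol K)^2 / vol K) * (\<Sum>K\<in>cells m. vol K * \<bar>p K\<bar>\<^sup>2)"
    by (rule weighted_sum_mult_power2_le) (rule cell(8))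
  also have "(\<Sum>K\<in>cells m. (vol K)^2 / vol K) = vol \<Omega>"
    unfolding sum_vol[symmetric] using cell(8) by (intro sum.cong) (auto simp: power2_eq_square)
  finally have "(\<Sum>K\<in>cells m. vol K * \<bar>p K\<bar>)^2 \<le> (sqrt (vol \<Omega>) * l2 (leb \<Omega>) (pwc m p))^2"
    unfolding power_mult_distrib pwc_l2(2) by (simp add: vol_def)
  then show ?thesis by (rule power2_le_imp_le) (simp add: vol_def)
qed

text \<open>Summation is reordered by faces. A boundary face carries the value zero, and an interior
  face is met from exactly two cells with opposite contributions.\<close>

lemma sum_faces_cancel:
  assumes bz: "\<And>E. E \<in> all_faces m ==> E \<subseteq> frontier \<Omega> ==> v' E = (0::real)"
    and X: "\<And>E K L. E \<in> interior_faces m ==> K \<in> cells_at m E ==> L \<in> cells_at m E ==> K \<noteq> L ==> X K E + X L E = 0"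
  shows "(\<Sum>K\<in>cells m. \<Sum>E\<in>faces m K. v' E * X K E) = 0"
proof -
  have fa: "finite (all_faces m)" unfolding all_faces_def using finite_cells cell(5) by blast
  have "(\<Sum>K\<in>cells m. \<Sum>E\<in>faces m K. v' E * X K E) =
    (\<Sum>K\<in>cells m. \<Sum>E | E \<in> all_faces m \<and> E \<in> faces m K. v' E * X K E)"
    by (intro sum.cong refl) (auto simp: all_faces_def)
  also have "\<dots> = (\<Sum>E\<in>all_faces m. \<Sum>K | K \<in> cells m \<and> E \<in> faces m K. v' E * X K E)"
    by (rule sum.swap_restrict[OF finite_cells fa])
  also have "\<dots> = 0"
  proof (rule sum.neutral, rule ballI)
    fix E assume s: "E \<in> all_faces m"
    show "(\<Sum>K | K \<in> cells m \<and> E \<in> faces m K. v' E * X K E) = 0"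
    proof (cases "E \<subseteq> frontier \<Omega>")
      case True
      then show ?thesis using bz[OF s] by simp
    next
      case False
      then have i: "E \<in> interior_faces m" using mesh s unfolding polytopal_mesh_def by blast
      then have "card (cells_at m E) = 2" unfolding interior_faces_def by blast
      then obtain K L where KL: "cells_at m E = {K, L}" "K \<noteq> L" unfolding card_2_iff by blast
      then have "X K E + X L E = 0" using X[OF i] by blast
      moreover have "{K \<in> cells m. E \<in> faces m K} = {K, L}" using KL(1) unfolding cells_at_def .
      ultimately show ?thesis using KL(2) by (simp add: distrib_left[symmetric])
    qed
  qed
  finally show ?thesis .
qed

lemma cells_at_normal:
  assumes "K \<in> cells_at m E" "L \<in> cells_at m E" "K \<noteq> L"
  shows "outward_normal L E = - outward_normal K E"
  using assms common_face_normal[OF mesh bounded_domain star, of K L E] unfolding cells_at_def by blast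

lemma sum_faces_normal:
  assumes bz: "\<And>E. E \<in> all_faces m ==> E \<subseteq> frontier \<Omega> ==> v' E = (0::real)"
  shows "(\<Sum>K\<in>cells m. \<Sum>E\<in>faces m K. v' E * (c E * outward_normal K E $ i)) = 0"
proof (rule sum_faces_cancel[where X = "\<lambda>K E. c E * outward_normal K E $ i"])
  fix E K L assume "K \<in> cells_at m E" "L \<in> cells_at m E" "K \<noteq> L"
  then show "c E * outward_normal K E $ i + c E * outward_normal L E $ i = 0"
    by (subst cells_at_normal[of K E L]) auto
qed (rule bz)

section \<open>The discrete norm and the discrete Poincare inequality\<close>

lemma sum_area_dist: "(\<Sum>K\<in>cells m. \<Sum>E\<in>faces m K. area E * dist_face m K E * c K) = CARD('d) * (\<Sum>K\<in>cells m. vol K * c K)"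
proof -
  have "(\<Sum>E\<in>faces m K. area E * dist_face m K E * c K) = CARD('d) * (vol K * c K)" if "K \<in> cells m" for K
    unfolding sum_distrib_right[symmetric] regular_cell.sum_area_dist[OF cell(1)[OF that]] by simp
  then show ?thesis by (simp add: sum_distrib_left)
qed

lemma dnorm_nonneg: "dnorm m v v' \<ge> 0"
  and dnorm_power2: "(dnorm m v v')^2 = (\<Sum>K\<in>cells m. \<Sum>E\<in>faces m K. area E / dist_face m K E * (v' E - v K)^2)"
proof -
  have "0 \<le> (\<Sum>K\<in>cells m. \<Sum>E\<in>faces m K. area E / dist_face m K E * (v' E - v K)^2)"
    by (intro sum_nonneg mult_nonneg_nonneg divide_nonneg_nonneg)
       (auto intro: less_imp_le regular_cell.area_pos[OF cell(1)] regular_cell.dist_pos[OF cell(1)])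
  then show "dnorm m v v' \<ge> 0"
    "(dnorm m v v')^2 = (\<Sum>K\<in>cells m. \<Sum>E\<in>faces m K. area E / dist_face m K E * (v' E - v K)^2)"
    by (auto simp: dnorm_def)
qed

lemma sum_area_jump_le:
  "(\<Sum>K\<in>cells m. \<Sum>E\<in>faces m K. area E * (\<bar>v' E - v K\<bar> * \<bar>c K\<bar>)) \<le>
    sqrt (CARD('d)) * l2 (leb \<Omega>) (pwc m c) * dnorm m v v'"
proof -
  let ?S = "Sigma (cells m) (faces m)"
  have f: "\<forall>K\<in>cells m. finite (faces m K)" using cell(5) by blast
  have w: "0 < area E / dist_face m K E" if "K \<in> cells m" "E \<in> faces m K" for K E
    using regular_cell.area_pos[OF cell(1)] regular_cell.dist_pos[OF cell(1)] that by simp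
  have "(\<Sum>(K, E)\<in>?S. (area E * \<bar>c K\<bar>) * \<bar>v' E - v K\<bar>)^2 \<le>
     (\<Sum>(K, E)\<in>?S. (area E * \<bar>c K\<bar>)^2 / (area E / dist_face m K E)) *
     (\<Sum>(K, E)\<in>?S. area E / dist_face m K E * \<bar>v' E - v K\<bar>\<^sup>2)"
    using weighted_sum_mult_power2_le[of ?S "\<lambda>(K, E). area E / dist_face m K E" "\<lambda>(K, E). area E * \<bar>c K\<bar>"
      "\<lambda>(K, E). \<bar>v' E - v K\<bar>"] w by (force simp: split_beta)
  also have "(\<Sum>(K, E)\<in>?S. area E / dist_face m K E * \<bar>v' E - v K\<bar>\<^sup>2) = (dnorm m v v')^2"
    unfolding dnorm_power2 using sum.Sigma[OF finite_cells f, symmetric] by simp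
  also have "(\<Sum>(K, E)\<in>?S. (area E * \<bar>c K\<bar>)^2 / (area E / dist_face m K E)) =
     (\<Sum>(K, E)\<in>?S. area E * dist_face m K E * (c K)^2)"
    using w by (intro sum.cong refl) (auto simp: power2_eq_square field_simps)
  also have "\<dots> = CARD('d) * (l2 (leb \<Omega>) (pwc m c))^2"
    unfolding pwc_l2(2) sum_area_dist[symmetric] using sum.Sigma[OF finite_cells f, symmetric] by simp
  also have "CARD('d) * (l2 (leb \<Omega>) (pwc m c))^2 * (dnorm m v v')^2 =
     (sqrt (CARD('d)) * l2 (leb \<Omega>) (pwc m c) * dnorm m v v')^2"
    by (simp add: power_mult_distrib)
  finally have "(\<Sum>(K, E)\<in>?S. (area E * \<bar>c K\<bar>) * \<bar>v' E - v K\<bar>) \<le> sqrt (CARD('d)) * l2 (leb \<Omega>) (pwc m c) * dnorm m v v'"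
    by (rule power2_le_imp_le) (simp add: dnorm_nonneg)
  then show ?thesis unfolding sum.Sigma[OF finite_cells f] by (simp add: mult_ac)
qed

lemma dgrad_l2:
  shows "(\<Sum>K\<in>cells m. vol K * (norm (dgrad m v v' K))^2) \<le> CARD('d) * (dnorm m v v')^2"
    and "l2 (leb \<Omega>) (pwc m (\<lambda>K. norm (dgrad m v v' K))) \<le> sqrt (CARD('d)) * dnorm m v v'"
    and "l2 (leb \<Omega>) (pwc m (\<lambda>K. dgrad m v v' K $ i)) \<le> sqrt (CARD('d)) * dnorm m v v'"
proof -
  have "vol K * (norm (dgrad m v v' K))^2 \<le> CARD('d) * (\<Sum>E\<in>faces m K. area E / dist_face m K E * (v' E - v K)^2)"
    if K: "K \<in> cells m" for K
  proof -
    interpret regular_cell \<theta> m K by (rule cell(1)[OF K])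
    have "vol K * (norm (dgrad m v v' K))^2 \<le>
      vol K * (CARD('d) / vol K * (\<Sum>E\<in>faces m K. (area E * (v' E - v K))^2 / (area E * dist_face m K E)))"
      unfolding dgrad_def using vol_pos by (intro mult_left_mono D_op_le) simp
    also have "(\<Sum>E\<in>faces m K. (area E * (v' E - v K))^2 / (area E * dist_face m K E)) =
      (\<Sum>E\<in>faces m K. area E / dist_face m K E * (v' E - v K)^2)"
      using area_pos dist_pos by (intro sum.cong refl) (force simp: power2_eq_square)
    finally show ?thesis using vol_pos by simp
  qed
  then show 1: "(\<Sum>K\<in>cells m. vol K * (norm (dgrad m v v' K))^2) \<le> CARD('d) * (dnorm m v v')^2"
    unfolding dnorm_power2 sum_distrib_left[of "real CARD('d)"] by (intro sum_mono) auto
  have *: "l2 (leb \<Omega>) (pwc m c) \<le> sqrt (CARD('d)) * dnorm m v v'"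
    if c: "\<And>K. \<bar>c K\<bar> \<le> norm (dgrad m v v' K)" for c
  proof (rule power2_le_imp_le)
    have "(l2 (leb \<Omega>) (pwc m c))^2 \<le> (\<Sum>K\<in>cells m. vol K * (norm (dgrad m v v' K))^2)"
      unfolding pwc_l2(2) using c
      by (intro sum_mono mult_left_mono) (auto simp: vol_def abs_le_square_iff[symmetric])
    then show "(l2 (leb \<Omega>) (pwc m c))^2 \<le> (sqrt (CARD('d)) * dnorm m v v')^2"
      using 1 by (simp add: power_mult_distrib)
  qed (simp add: dnorm_nonneg)
  show "l2 (leb \<Omega>) (pwc m (\<lambda>K. norm (dgrad m v v' K))) \<le> sqrt (CARD('d)) * dnorm m v v'"
    by (rule *) simp
  show "l2 (leb \<Omega>) (pwc m (\<lambda>K. dgrad m v v' K $ i)) \<le> sqrt (CARD('d)) * dnorm m v v'"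
    by (rule *) (rule component_le_norm_cart)
qed

end

context star_mesh
begin

lemma face:
  assumes K: "K \<in> cells m" and E: "E \<in> faces m K"
  shows "area E > 0" "dist_face m K E > 0" "norm (barycentre E) \<le> R" "dist_face m K E \<le> 2 * R"
    "norm (barycentre E - point m K) \<le> h" "(norm (barycentre E - point m K))^2 \<le> h * \<theta> * dist_face m K E"
    "norm (outward_normal K E) = 1" "\<bar>outward_normal K E $ i\<bar> \<le> 1"
proof -
  interpret regular_cell \<theta> m K by (rule cell(1)[OF K])
  note fd = mesh_face_data[OF mesh K bounded_domain star[OF K] E]
  show "area E > 0" "dist_face m K E > 0" "norm (outward_normal K E) = 1" using area_pos dist_pos norm_normal E by auto
  then show "\<bar>outward_normal K E $ i\<bar> \<le> 1" using component_le_norm_cart[of "outward_normal K E" i] by simp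
  have cl: "norm x \<le> R" if "x \<in> closure \<Omega>" for x
  proof -
    have "closure \<Omega> \<subseteq> cball 0 R" by (rule closure_minimal) (use radius in auto)
    then show ?thesis using that by auto
  qed
  have "E \<subseteq> closure \<Omega>"
    using polytopal_mesh_cell(7)[OF mesh K E] closure_mono[OF cell(3)[OF K]] unfolding cell_face_def frontier_def by blast
  then have "norm (barycentre E - 0) \<le> R" using cl by (intro fd(4)) auto
  then show 1: "norm (barycentre E) \<le> R" by simp
  have "dist_face m K E \<le> norm (outward_normal K E) * norm (barycentre E - point m K)"
    using fd(3) norm_cauchy_schwarz by metis
  also have "\<dots> \<le> norm (barycentre E) + norm (point m K)"
    using fd(2) norm_triangle_ineq4 by simp
  finally show "dist_face m K E \<le> 2 * R" using 1 radius[of "point m K"] cell(3,4)[OF K] by auto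
  have a: "norm (barycentre E - point m K) \<le> diameter K" by (rule barycentre_le[OF E])
  then show b: "norm (barycentre E - point m K) \<le> h" using diameter_le_size[OF K] by simp
  \<comment> \<open>One factor is bounded by \<open>h\<close>, the other by regularity, so that the
    remaining weight \<open>area E * dist_face m K E\<close> sums to a multiple of the
    volume.\<close>
  have "norm (barycentre E - point m K) * norm (barycentre E - point m K) \<le> h * (\<theta> * dist_face m K E)"
    using b a diameter_le[OF E] size_nonneg by (intro mult_mono) auto
  then show "(norm (barycentre E - point m K))^2 \<le> h * \<theta> * dist_face m K E" by (simp add: power2_eq_square)
qed

text \<open>The divergence theorem for the field \<open>x\<^sub>i e\<^sub>i\<close> on each cell.\<close>

lemma discrete_Poincare:
  assumes bz: "\<And>E. E \<in> all_faces m ==> E \<subseteq> frontier \<Omega> ==> v' E = (0::real)"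
  shows "l2 (leb \<Omega>) (pwc m v) \<le> 2 * R * sqrt (real CARD('d) + 1) * dnorm m v v'"
proof -
  define P where "P = l2 (leb \<Omega>) (pwc m v)"
  define N where "N = dnorm m v v'"
  obtain i :: 'd where True by blast
  let ?n = "\<lambda>K E. outward_normal K E $ i" and ?b = "\<lambda>E. barycentre E $ i"
  have vol: "vol K * (v K)^2 = (\<Sum>E\<in>faces m K. area E * ?n K E * ?b E * (v K)^2)" if K: "K \<in> cells m" for K
  proof -
    interpret regular_cell \<theta> m K by (rule cell(1)[OF K])
    have "(\<Sum>E\<in>faces m K. area E * ?n K E * (?b E - point m K $ i)) = vol K"
      using sum_area_normal_barycentre[of "axis i 1" "axis i 1"] by (simp add: inner_axis inner_axis' )
    moreover have "(\<Sum>E\<in>faces m K. area E * ?n K E) = 0"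
      using sum_area_normal[of "axis i 1"] by (simp add: inner_axis)
    ultimately have "(\<Sum>E\<in>faces m K. area E * ?n K E * ?b E) = vol K"
      by (simp add: right_diff_distrib sum_subtractf sum_distrib_right[symmetric])
    then show ?thesis by (simp add: sum_distrib_right[symmetric])
  qed
  \<comment> \<open>These terms cancel between neighbouring cells. Subtracting them turns the
    squares of cell values into differences with squares of face values, which contain the jump as a
    factor.\<close>
  have zero: "(\<Sum>K\<in>cells m. \<Sum>E\<in>faces m K. (v' E)^2 * ((area E * ?b E) * ?n K E)) = 0"
    by (rule sum_faces_normal) (simp add: bz)
  have "P^2 = (\<Sum>K\<in>cells m. \<Sum>E\<in>faces m K. area E * ?n K E * ?b E * (v K)^2)"
    unfolding P_def pwc_l2(2) using vol by (intro sum.cong) auto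
  also have "\<dots> = (\<Sum>K\<in>cells m. \<Sum>E\<in>faces m K. area E * ?n K E * ?b E * (v K)^2 - (v' E)^2 * ((area E * ?b E) * ?n K E))"
    by (simp add: sum_subtractf zero)
  also have "\<dots> \<le> (\<Sum>K\<in>cells m. \<Sum>E\<in>faces m K. 2 * R^2 * (area E / dist_face m K E * (v' E - v K)^2) +
      2 * R * (area E * (\<bar>v' E - v K\<bar> * \<bar>v K\<bar>)))"
  proof (intro sum_mono)
    fix K E assume K: "K \<in> cells m" "E \<in> faces m K"
    note f = face[OF K]
    define \<delta> where "\<delta> = v' E - v K"
    have "\<bar>?n K E * ?b E\<bar> \<le> 1 * R" unfolding abs_mult
      using f(3) f(8)[of i] component_le_norm_cart[of "barycentre E" i] by (intro mult_mono) auto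
    then have nb: "\<bar>?n K E * ?b E\<bar> \<le> R" by simp
    have "(v K)^2 - (v' E)^2 = - \<delta> * (\<delta> + 2 * v K)" unfolding \<delta>_def by (simp add: power2_eq_square algebra_simps)
    then have dd: "\<bar>(v K)\<^sup>2 - (v' E)^2\<bar> \<le> \<bar>\<delta>\<bar> * (\<bar>\<delta>\<bar> + 2 * \<bar>v K\<bar>)" unfolding abs_mult abs_minus_cancel
      by (simp add: abs_mult mult_left_mono)
    have "area E * ?n K E * ?b E * (v K)^2 - (v' E)^2 * ((area E * ?b E) * ?n K E) =
      area E * ((?n K E * ?b E) * ((v K)^2 - (v' E)^2))" by (simp add: algebra_simps)
    also have "\<dots> \<le> area E * (R * (\<bar>\<delta>\<bar> * (\<bar>\<delta>\<bar> + 2 * \<bar>v K\<bar>)))"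
    proof (rule mult_left_mono)
      show "(?n K E * ?b E) * ((v K)^2 - (v' E)^2) \<le> R * (\<bar>\<delta>\<bar> * (\<bar>\<delta>\<bar> + 2 * \<bar>v K\<bar>))"
        using mult_mono[OF nb dd] radius_pos abs_ge_self[of "(?n K E * ?b E) * ((v K)^2 - (v' E)^2)"] by (simp add: abs_mult)
    qed (use f in simp)
    also have "\<dots> = R * (area E * \<delta>^2) + 2 * R * (area E * (\<bar>\<delta>\<bar> * \<bar>v K\<bar>))"
      by (simp add: algebra_simps power2_eq_square)
    also have "area E * \<delta>^2 = dist_face m K E * (area E / dist_face m K E * \<delta>^2)" using f(2) by simp
    also have "R * (dist_face m K E * (area E / dist_face m K E * \<delta>^2)) \<le> R * (2 * R * (area E / dist_face m K E * \<delta>^2))"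
      using f radius_pos by (intro mult_left_mono mult_right_mono) auto
    finally show "area E * ?n K E * ?b E * (v K)^2 - (v' E)^2 * ((area E * ?b E) * ?n K E) \<le>
      2 * R^2 * (area E / dist_face m K E * (v' E - v K)^2) + 2 * R * (area E * (\<bar>v' E - v K\<bar> * \<bar>v K\<bar>))"
      unfolding \<delta>_def by (simp add: power2_eq_square mult_ac)
  qed
  also have "\<dots> = 2 * R^2 * N^2 + 2 * R * (\<Sum>K\<in>cells m. \<Sum>E\<in>faces m K. area E * (\<bar>v' E - v K\<bar> * \<bar>v K\<bar>))"
    unfolding N_def dnorm_power2 by (simp add: sum.distrib sum_distrib_left)
  also have "\<dots> \<le> 2 * R^2 * N^2 + 2 * R * (sqrt (CARD('d)) * P * N)"
    unfolding N_def P_def using radius_pos by (intro add_left_mono mult_left_mono sum_area_jump_le) auto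
  finally have 1: "P^2 \<le> 2 * R^2 * N^2 + 2 * R * (sqrt (CARD('d)) * P * N)" .
  \<comment> \<open>Completing the square absorbs the mixed term in \<open>P\<close> and
    \<open>N\<close>.\<close>
  have "0 \<le> (P - 2 * R * sqrt (CARD('d)) * N)^2" by simp
  also have "\<dots> = P^2 - 4 * R * (sqrt (CARD('d)) * P * N) + 4 * R^2 * CARD('d) * N^2"
    unfolding power2_diff by (simp add: power_mult_distrib)
  finally have "P^2 \<le> 4 * R^2 * N^2 + 4 * R^2 * CARD('d) * N^2" using 1 by linarith
  also have "\<dots> = (2 * R * sqrt (real CARD('d) + 1) * N)^2" by (simp add: power_mult_distrib algebra_simps)
  finally show ?thesis unfolding P_def[symmetric] N_def[symmetric]
    by (rule power2_le_imp_le) (use radius_pos dnorm_nonneg N_def in simp)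
qed

lemma lipschitz_integrable:
  fixes \<phi> :: "real^'d => real"
  assumes \<phi>: "\<phi> \<in> borel_measurable borel" and L: "\<And>x y. \<bar>\<phi> y - \<phi> x\<bar> \<le> C * norm (y - x)" and C: "C \<ge> 0"
  shows "integrable (leb \<Omega>) \<phi>"
    and "K \<in> cells m ==> \<bar>integral\<^sup>L (leb K) \<phi> - vol K * \<phi> (point m K)\<bar> \<le> C * h * vol K"
proof -
  interpret finite_measure "leb \<Omega>" using lebesgue_on_finite open_domain bounded_domain by blast
  have "\<bar>\<phi> x\<bar> \<le> \<bar>\<phi> 0\<bar> + C * R" if "x \<in> \<Omega>" for x
    using L[of x 0] mult_left_mono[OF radius[OF that] C] by simp
  then show i: "integrable (leb \<Omega>) \<phi>"
    by (intro integrable_const_bound[where B = "\<bar>\<phi> 0\<bar> + C * R"] lebesgue_on_borel \<phi>) auto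
  assume K: "K \<in> cells m"
  interpret K: finite_measure "leb K" using lebesgue_on_finite cell(2,6)[OF K] by blast
  have iK: "integrable (leb K) \<phi>" by (rule integral_indicator_cell(3)[OF K i])
  have "integral\<^sup>L (leb K) \<phi> - vol K * \<phi> (point m K) = (LINT x|leb K. \<phi> x - \<phi> (point m K))"
    using iK measure_cell[OF K] by simp
  also have "\<bar>\<dots>\<bar> \<le> (LINT x|leb K. \<bar>\<phi> x - \<phi> (point m K)\<bar>)" by (rule integral_abs_bound)
  also have "\<dots> \<le> (LINT x|leb K. C * h)"
  proof (rule integral_mono)
    fix x assume "x \<in> space (leb K)"
    then have "norm (x - point m K) \<le> diameter K"
      using closure_subset cell[OF K] by (intro norm_diff_le_diameter) auto
    then have "C * norm (x - point m K) \<le> C * h" using diameter_le_size[OF K] C by (intro mult_left_mono) auto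
    then show "\<bar>\<phi> x - \<phi> (point m K)\<bar> \<le> C * h" using L[of x "point m K"] by simp
  qed (use iK in auto)
  also have "\<dots> = C * h * vol K" using measure_cell[OF K] by simp
  finally show "\<bar>integral\<^sup>L (leb K) \<phi> - vol K * \<phi> (point m K)\<bar> \<le> C * h * vol K" .
qed

text \<open>Each of the two jump errors \<open>e1\<close> and \<open>e2\<close> in
  \<open>conformity\<close> contributes the root of the dimension; the third error contributes
  \<open>1 + \<theta> * d\<close> times the discrete Poincare constant.\<close>

definition conformity_const :: real where
  "conformity_const = sqrt (vol \<Omega>) * (2 * sqrt (CARD('d)) + (1 + \<theta> * CARD('d)) * (2 * R * sqrt (real CARD('d) + 1)))"

text \<open>Discrete integration by parts. The error \<open>e1\<close> replaces \<phi> by its value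
  at the cell point, \<open>e2\<close> moves that value to the barycentres, \<open>e3\<close>
  compares the mean of \<open>G\<close> with the flux of \<phi> through the faces. The rest is a sum
  over faces in which \<phi> has the same value from both sides, so it cancels.\<close>

lemma conformity:
  fixes \<phi> :: "real^'d => real" and G :: "real^'d => real^'d"
  assumes bz: "\<And>E. E \<in> all_faces m ==> E \<subseteq> frontier \<Omega> ==> v' E = (0::real)"
    and \<phi>: "\<phi> \<in> borel_measurable borel" and G: "(\<lambda>x. G x $ i) \<in> borel_measurable borel" and C11: "C11_bound C \<phi> G"
  shows "\<bar>(LINT x|leb \<Omega>. pwc m (\<lambda>K. dgrad m v v' K $ i) x * \<phi> x) +
    (LINT x|leb \<Omega>. pwc m v x * G x $ i)\<bar> \<le> C * h * conformity_const * dnorm m v v'"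
proof -
  note C = less_imp_le[OF C11_boundD(1)[OF C11]] and L = C11_boundD(2,3)[OF C11] and T = C11_boundD(4)[OF C11]
  define N where "N = dnorm m v v'"
  let ?S = "\<lambda>K. \<Sum>E\<in>faces m K. area E * (\<bar>v' E - v K\<bar> * \<bar>1\<bar>)"
  let ?n = "\<lambda>K E. outward_normal K E $ i" and ?x = "point m" and ?b = barycentre
  have Li: "\<bar>G y $ i - G x $ i\<bar> \<le> C * norm (y - x)" for x y
    using component_le_norm_cart[of "G y - G x" i] L(2)[of y x] by simp
  note mean_\<phi> = lipschitz_integrable[OF \<phi> L(1) C] and mean_G = lipschitz_integrable[OF G Li C]
  let ?I = "\<lambda>K f. integral\<^sup>L (leb K) f"
  have zero: "(\<Sum>K\<in>cells m. \<Sum>E\<in>faces m K. v' E * ((area E * \<phi> (?b E)) * ?n K E)) = 0"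
    by (rule sum_faces_normal) (rule bz)
  define e1 where "e1 K = dgrad m v v' K $ i * (?I K \<phi> - vol K * \<phi> (?x K))" for K
  define e2 where "e2 K = (\<Sum>E\<in>faces m K. area E * (v' E - v K) * ?n K E * (\<phi> (?x K) - \<phi> (?b E)))" for K
  define e3 where "e3 K = v K * (?I K (\<lambda>x. G x $ i) - (\<Sum>E\<in>faces m K. area E * ?n K E * \<phi> (?b E)))" for K
  have dec: "dgrad m v v' K $ i * ?I K \<phi> + v K * ?I K (\<lambda>x. G x $ i) =
    e1 K + e2 K + e3 K + (\<Sum>E\<in>faces m K. v' E * ((area E * \<phi> (?b E)) * ?n K E))" if K: "K \<in> cells m" for K
  proof -
    have "vol K * dgrad m v v' K $ i = (\<Sum>E\<in>faces m K. area E * (v' E - v K) * ?n K E)"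
      using cell(8)[OF K] by (simp add: dgrad_def D_op_def)
    then have "dgrad m v v' K $ i * (vol K * \<phi> (?x K)) = (\<Sum>E\<in>faces m K. area E * (v' E - v K) * ?n K E) * \<phi> (?x K)"
      by (metis mult.assoc mult.commute)
    then have "dgrad m v v' K $ i * (vol K * \<phi> (?x K)) = (\<Sum>E\<in>faces m K. area E * (v' E - v K) * ?n K E * \<phi> (?x K))"
      unfolding sum_distrib_right .
    then show ?thesis unfolding e1_def e2_def e3_def
      by (simp add: algebra_simps sum_subtractf sum.distrib sum_distrib_left)
  qed
  have E1: "\<bar>e1 K\<bar> \<le> C * h * ?S K" if K: "K \<in> cells m" for K
  proof -
    have "vol K * dgrad m v v' K $ i = (\<Sum>E\<in>faces m K. area E * (v' E - v K) * ?n K E)"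
      using cell(8)[OF K] by (simp add: dgrad_def D_op_def)
    then have "\<bar>vol K * dgrad m v v' K $ i\<bar> \<le> (\<Sum>E\<in>faces m K. \<bar>area E * (v' E - v K) * ?n K E\<bar>)"
      using sum_abs[of "\<lambda>E. area E * (v' E - v K) * ?n K E" "faces m K"] by simp
    also have "\<dots> \<le> ?S K"
    proof (rule sum_mono)
      fix E assume s: "E \<in> faces m K"
      have "\<bar>area E * (v' E - v K) * ?n K E\<bar> \<le> \<bar>area E * (v' E - v K)\<bar> * 1"
        unfolding abs_mult[of _ "?n K E"] by (intro mult_left_mono face(8)[OF K s]) simp
      then show "\<bar>area E * (v' E - v K) * ?n K E\<bar> \<le> area E * (\<bar>v' E - v K\<bar> * \<bar>1\<bar>)"
        using face(1)[OF K s] by (simp add: abs_mult)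
    qed
    finally have le: "vol K * \<bar>dgrad m v v' K $ i\<bar> \<le> ?S K"
      using cell(8)[OF K] by (simp add: abs_mult)
    have "\<bar>e1 K\<bar> \<le> \<bar>dgrad m v v' K $ i\<bar> * (C * h * vol K)"
      unfolding e1_def abs_mult by (intro mult_left_mono mean_\<phi>(2)[OF K]) simp
    also have "\<dots> = C * h * (vol K * \<bar>dgrad m v v' K $ i\<bar>)" by simp
    also have "\<dots> \<le> C * h * ?S K"
      using C size_nonneg by (intro mult_left_mono le) simp
    finally show ?thesis .
  qed
  have E2: "\<bar>e2 K\<bar> \<le> C * h * ?S K" if K: "K \<in> cells m" for K
  proof -
    have "\<bar>e2 K\<bar> \<le> (\<Sum>E\<in>faces m K. \<bar>area E * (v' E - v K) * ?n K E * (\<phi> (?x K) - \<phi> (?b E))\<bar>)"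
      unfolding e2_def by (rule sum_abs)
    also have "\<dots> \<le> (\<Sum>E\<in>faces m K. C * h * (area E * (\<bar>v' E - v K\<bar> * \<bar>1\<bar>)))"
    proof (rule sum_mono)
      fix E assume s: "E \<in> faces m K"
      have "\<bar>\<phi> (?x K) - \<phi> (?b E)\<bar> \<le> C * norm (?b E - ?x K)" using L(1)[of "?x K" "?b E"] by (simp add: norm_minus_commute)
      also have "\<dots> \<le> C * h" by (intro mult_left_mono face(5)[OF K s] C)
      finally have a: "\<bar>\<phi> (?x K) - \<phi> (?b E)\<bar> \<le> C * h" .
      have "\<bar>?n K E\<bar> * \<bar>\<phi> (?x K) - \<phi> (?b E)\<bar> \<le> 1 * (C * h)" by (intro mult_mono face(8)[OF K s] a) auto
      then have "area E * \<bar>v' E - v K\<bar> * (\<bar>?n K E\<bar> * \<bar>\<phi> (?x K) - \<phi> (?b E)\<bar>) \<le> area E * \<bar>v' E - v K\<bar> * (1 * (C * h))"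
        using face(1)[OF K s] by (intro mult_left_mono) auto
      then show "\<bar>area E * (v' E - v K) * ?n K E * (\<phi> (?x K) - \<phi> (?b E))\<bar> \<le> C * h * (area E * (\<bar>v' E - v K\<bar> * \<bar>1\<bar>))"
        using face(1)[OF K s] by (simp add: abs_mult mult_ac)
    qed
    finally show ?thesis by (simp add: sum_distrib_left)
  qed
  have E3: "\<bar>e3 K\<bar> \<le> C * h * (1 + \<theta> * CARD('d)) * (vol K * \<bar>v K\<bar>)" if K: "K \<in> cells m" for K
  proof -
    interpret regular_cell \<theta> m K by (rule cell(1)[OF K])
    let ?r = "\<lambda>E. ?b E - ?x K"
    have z1: "(\<Sum>E\<in>faces m K. area E * ?n K E) = 0" using sum_area_normal[of "axis i 1"] by (simp add: inner_axis)
    have z2: "(\<Sum>E\<in>faces m K. area E * ?n K E * (G (?x K) \<bullet> ?r E)) = vol K * G (?x K) $ i"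
      using sum_area_normal_barycentre[of "axis i 1" "G (?x K)"] by (simp add: inner_axis)
    \<comment> \<open>The divergence theorem removes the constant term of the Taylor expansion and
      evaluates the linear term exactly; only the quadratic remainder is left.\<close>
    have "(\<Sum>E\<in>faces m K. area E * ?n K E * \<phi> (?b E)) - vol K * G (?x K) $ i =
      (\<Sum>E\<in>faces m K. area E * ?n K E * (\<phi> (?b E) - \<phi> (?x K) - G (?x K) \<bullet> ?r E))"
      unfolding z2[symmetric] right_diff_distrib sum_subtractf sum_distrib_right[symmetric] z1 by simp
    moreover have "\<bar>\<Sum>E\<in>faces m K. area E * ?n K E * (\<phi> (?b E) - \<phi> (?x K) - G (?x K) \<bullet> ?r E)\<bar> \<le>
      (\<Sum>E\<in>faces m K. C * h * \<theta> * (area E * dist_face m K E))"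
    proof (rule order_trans[OF sum_abs sum_mono])
      fix E assume s: "E \<in> faces m K"
      have "\<bar>\<phi> (?b E) - \<phi> (?x K) - G (?x K) \<bullet> ?r E\<bar> \<le> C * (norm (?r E))^2" by (rule T)
      also have "\<dots> \<le> C * (h * \<theta> * dist_face m K E)" by (intro mult_left_mono face(6)[OF K s] C)
      finally have "\<bar>?n K E\<bar> * \<bar>\<phi> (?b E) - \<phi> (?x K) - G (?x K) \<bullet> ?r E\<bar> \<le> 1 * (C * (h * \<theta> * dist_face m K E))"
        by (intro mult_mono face(8)[OF K s]) auto
      then have "area E * (\<bar>?n K E\<bar> * \<bar>\<phi> (?b E) - \<phi> (?x K) - G (?x K) \<bullet> ?r E\<bar>) \<le> area E * (1 * (C * (h * \<theta> * dist_face m K E)))"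
        using face(1)[OF K s] by (intro mult_left_mono) auto
      then show "\<bar>area E * ?n K E * (\<phi> (?b E) - \<phi> (?x K) - G (?x K) \<bullet> ?r E)\<bar> \<le> C * h * \<theta> * (area E * dist_face m K E)"
        using face(1)[OF K s] by (simp add: abs_mult mult_ac)
    qed
    moreover have "(\<Sum>E\<in>faces m K. C * h * \<theta> * (area E * dist_face m K E)) = C * h * \<theta> * CARD('d) * vol K"
      unfolding sum_distrib_left[symmetric] sum_area_dist by simp
    moreover have "\<bar>?I K (\<lambda>x. G x $ i) - vol K * G (?x K) $ i\<bar> \<le> C * h * vol K" by (rule mean_G(2)[OF K])
    ultimately have "\<bar>?I K (\<lambda>x. G x $ i) - (\<Sum>E\<in>faces m K. area E * ?n K E * \<phi> (?b E))\<bar> \<le>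
      C * h * vol K + C * h * \<theta> * CARD('d) * vol K" by linarith
    also have "\<dots> = C * h * (1 + \<theta> * CARD('d)) * vol K" by (simp add: algebra_simps)
    finally have "\<bar>v K\<bar> * \<bar>?I K (\<lambda>x. G x $ i) - (\<Sum>E\<in>faces m K. area E * ?n K E * \<phi> (?b E))\<bar> \<le>
      \<bar>v K\<bar> * (C * h * (1 + \<theta> * CARD('d)) * vol K)" by (intro mult_left_mono) auto
    then show ?thesis unfolding e3_def abs_mult by (simp add: mult_ac)
  qed
  have l1: "l2 (leb \<Omega>) (pwc m (\<lambda>_. 1)) = sqrt (vol \<Omega>)"
    using pwc_l2(2)[of "\<lambda>_. 1"] sum_vol by (simp add: real_sqrt_unique)
  have J: "(\<Sum>K\<in>cells m. ?S K) \<le> sqrt (CARD('d)) * sqrt (vol \<Omega>) * N"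
    using sum_area_jump_le[of v' v "\<lambda>_. 1"] unfolding l1 N_def by simp
  have P: "l2 (leb \<Omega>) (pwc m v) \<le> 2 * R * sqrt (real CARD('d) + 1) * N"
    unfolding N_def by (rule discrete_Poincare) (rule bz)
  have "(LINT x|leb \<Omega>. pwc m (\<lambda>K. dgrad m v v' K $ i) x * \<phi> x) +
    (LINT x|leb \<Omega>. pwc m v x * G x $ i) = (\<Sum>K\<in>cells m. e1 K + e2 K + e3 K)"
    unfolding integral_cells(1)[OF mean_\<phi>(1)] integral_cells(1)[OF mean_G(1)] sum.distrib[symmetric]
    using dec zero by (simp add: sum.distrib)
  also have "\<bar>\<Sum>K\<in>cells m. e1 K + e2 K + e3 K\<bar> \<le> (\<Sum>K\<in>cells m. \<bar>e1 K\<bar> + \<bar>e2 K\<bar> + \<bar>e3 K\<bar>)"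
    by (rule order_trans[OF sum_abs]) (intro sum_mono, linarith)
  also have "\<dots> \<le> (\<Sum>K\<in>cells m. 2 * (C * h) * ?S K +
      C * h * (1 + \<theta> * CARD('d)) * (vol K * \<bar>v K\<bar>))"
  proof (rule sum_mono)
    fix K assume K: "K \<in> cells m"
    show "\<bar>e1 K\<bar> + \<bar>e2 K\<bar> + \<bar>e3 K\<bar> \<le> 2 * (C * h) * ?S K +
      C * h * (1 + \<theta> * CARD('d)) * (vol K * \<bar>v K\<bar>)"
      using E1[OF K] E2[OF K] E3[OF K] by linarith
  qed
  also have "\<dots> = 2 * (C * h) * (\<Sum>K\<in>cells m. ?S K) +
      C * h * (1 + \<theta> * CARD('d)) * (\<Sum>K\<in>cells m. vol K * \<bar>v K\<bar>)"
    unfolding sum.distrib sum_distrib_left ..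
  also have "\<dots> \<le> 2 * (C * h) * (sqrt (CARD('d)) * sqrt (vol \<Omega>) * N) +
      C * h * (1 + \<theta> * CARD('d)) * (sqrt (vol \<Omega>) * (2 * R * sqrt (real CARD('d) + 1) * N))"
    using C size_nonneg theta_pos P
    by (intro add_mono mult_left_mono J order_trans[OF sum_vol_abs_le]) (auto simp: vol_def)
  also have "\<dots> = C * h * conformity_const * N" unfolding conformity_const_def by (simp add: algebra_simps)
  finally show ?thesis unfolding N_def .
qed

end

section \<open>Limit conformity\<close>

text \<open>Fubini: \<open>\<integral> \<psi> (u - u * \<kappa>) = \<integral> u (\<psi> - \<psi> * \<kappa>)\<close> for an even kernel \<open>\<kappa>\<close>.\<close>

lemma integral_conv_defect:
  fixes u \<psi> :: "real^'d => real"
  assumes u: "integrable lborel u" "u \<in> borel_measurable borel" and \<psi>: "tfun U \<psi>"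
    and k: "tfun UNIV \<kappa>" "\<And>x. \<kappa> x \<ge> 0" "integral\<^sup>L lborel \<kappa> = 1" "\<And>x. \<kappa> x \<noteq> 0 ==> norm x < \<epsilon>"
      "\<And>x. \<kappa> (- x) = \<kappa> x"
    and L: "\<And>x y. \<bar>\<psi> y - \<psi> x\<bar> \<le> L * norm (y - x)" "L \<ge> 0"
  shows "\<bar>(LBINT x. \<psi> x * u x) - (LBINT x. \<psi> x * conv u \<kappa> x)\<bar> \<le> L * \<epsilon> * (LBINT x. \<bar>u x\<bar>)"
proof -
  note kb[measurable] = tfun_borel[OF k(1)] and pb[measurable] = tfun_borel[OF \<psi>] and u(2)[measurable]
  obtain B where B: "B > 0" "\<And>x. \<bar>\<kappa> x\<bar> \<le> B" using tfun_bounded[OF k(1)] by blast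
  obtain B' where B': "\<And>x. \<bar>\<psi> x\<bar> \<le> B'" using tfun_bounded[OF \<psi>] by blast
  have pi: "integrable lborel \<psi>" by (rule tfun_integrable[OF \<psi>])
  have pu: "integrable lborel (\<lambda>x. \<psi> x * u x)"
    using u(1) by (intro Bochner_Integration.integrable_bound[of _ "\<lambda>x. B' * u x" "\<lambda>x. \<psi> x * u x"])
      (auto simp: abs_mult intro!: mult_right_mono order_trans[OF B' abs_ge_self])
  \<comment> \<open>Absolute integrability for Fubini: the kernel is bounded by \<open>B\<close>,
    while \<psi> and \<open>u\<close> are integrable.\<close>
  have prod: "integrable (lborel \<Otimes>\<^sub>M lborel) (case_prod (\<lambda>x y. \<psi> x * (u y * \<kappa> (x - y))))"
  proof (rule lborel_pair.Fubini_integrable)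
    show "case_prod (\<lambda>x y. \<psi> x * (u y * \<kappa> (x - y))) \<in> borel_measurable (lborel \<Otimes>\<^sub>M lborel)" by measurable
    have uk: "integrable lborel (\<lambda>y. u y * \<kappa> (x - y))" for x by (rule conv_integrable[OF u(1) kb B(2)])
    then show "AE x in lborel. integrable lborel (\<lambda>y. case (x, y) of (x, y) => \<psi> x * (u y * \<kappa> (x - y)))" by simp
    have le: "(LBINT y. norm (\<psi> x * (u y * \<kappa> (x - y)))) \<le> B * (LBINT y. \<bar>u y\<bar>) * \<bar>\<psi> x\<bar>" for x
    proof -
      have "(LBINT y. norm (\<psi> x * (u y * \<kappa> (x - y)))) \<le> (LBINT y. (B * \<bar>\<psi> x\<bar>) * \<bar>u y\<bar>)"
      proof (rule integral_mono)
        fix y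
        have "\<bar>\<psi> x\<bar> * (\<bar>u y\<bar> * \<bar>\<kappa> (x - y)\<bar>) \<le> \<bar>\<psi> x\<bar> * (\<bar>u y\<bar> * B)" by (intro mult_left_mono B) auto
        then show "norm (\<psi> x * (u y * \<kappa> (x - y))) \<le> (B * \<bar>\<psi> x\<bar>) * \<bar>u y\<bar>" by (simp add: abs_mult mult_ac)
      qed (use uk u(1) in auto)
      then show ?thesis by (simp add: mult_ac)
    qed
    have nn: "0 \<le> (LBINT y. norm (\<psi> x * (u y * \<kappa> (x - y))))" for x by simp
    show "integrable lborel (\<lambda>x. \<integral>y. norm (case (x, y) of (x, y) => \<psi> x * (u y * \<kappa> (x - y))) \<partial>lborel)"
      unfolding case_prod_conv
      by (rule Bochner_Integration.integrable_bound[of _ "\<lambda>x. B * (LBINT y. \<bar>u y\<bar>) * \<bar>\<psi> x\<bar>"], use pi in simp, measurable)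
         (intro AE_I2, simp only: real_norm_def abs_of_nonneg[OF nn[unfolded real_norm_def]] order_trans[OF le[unfolded real_norm_def] abs_ge_self])
  qed
  have ev: "\<kappa> (x - y) = \<kappa> (y - x)" for x y using k(5)[of "y - x"] by simp
  have conv: "(LBINT x. \<psi> x * (u y * \<kappa> (x - y))) = u y * conv \<psi> \<kappa> y" for y
    unfolding conv_def ev[of _ y] mult.left_commute[of "\<psi> _"] by simp
  have fub: "(LBINT x. \<psi> x * conv u \<kappa> x) = (LBINT y. u y * conv \<psi> \<kappa> y)"
    using lborel_pair.Fubini_integral[OF prod] unfolding conv by (simp add: conv_def)
  have iu: "integrable lborel (\<lambda>y. u y * conv \<psi> \<kappa> y)" using lborel_pair.integrable_snd[OF prod] unfolding conv .
  have near: "\<bar>conv \<psi> \<kappa> y - \<psi> y\<bar> \<le> L * \<epsilon>" for y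
  proof (rule conv_diff_le[OF pi k(1-4)])
    fix x assume "norm (y - x) < \<epsilon>"
    then have "L * norm (x - y) \<le> L * \<epsilon>" using L(2) by (intro mult_left_mono) (auto simp: norm_minus_commute)
    then show "\<bar>\<psi> x - \<psi> y\<bar> \<le> L * \<epsilon>" using L(1)[of x y] by linarith
  qed
  have e: "(LBINT x. \<psi> x * u x) - (LBINT x. \<psi> x * conv u \<kappa> x) = (LBINT y. \<psi> y * u y - u y * conv \<psi> \<kappa> y)"
    unfolding fub by (rule Bochner_Integration.integral_diff[symmetric]) (fact pu, fact iu)
  have "\<bar>(LBINT x. \<psi> x * u x) - (LBINT x. \<psi> x * conv u \<kappa> x)\<bar> \<le> (LBINT y. \<bar>\<psi> y * u y - u y * conv \<psi> \<kappa> y\<bar>)"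
    unfolding e by (rule integral_abs_bound)
  also have "\<dots> \<le> (LBINT y. (L * \<epsilon>) * \<bar>u y\<bar>)"
  proof (rule integral_mono)
    fix y
    have "\<bar>\<psi> y * u y - u y * conv \<psi> \<kappa> y\<bar> = \<bar>conv \<psi> \<kappa> y - \<psi> y\<bar> * \<bar>u y\<bar>"
      unfolding abs_mult[symmetric] by (simp add: algebra_simps abs_minus_commute)
    then show "\<bar>\<psi> y * u y - u y * conv \<psi> \<kappa> y\<bar> \<le> (L * \<epsilon>) * \<bar>u y\<bar>" by (simp add: mult_right_mono near)
  qed (use pu iu u(1) in auto)
  finally show ?thesis by simp
qed

lemma conv_tfun:
  fixes u :: "real^'d => real"
  assumes u: "integrable lborel u" "\<And>x. u x \<noteq> 0 ==> norm x \<le> R"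
    and k: "tfun UNIV \<kappa>" "\<And>x. \<kappa> x \<noteq> 0 ==> norm x < \<epsilon>"
  shows "tfun UNIV (conv u \<kappa>)"
proof (rule tfunI[OF C_k_conv[OF u(1) k(1)]])
  show "compact (cball 0 (R + \<epsilon>) :: (real^'d) set)" by simp
  fix x :: "real^'d" assume x: "x \<notin> cball 0 (R + \<epsilon>)"
  show "conv u \<kappa> x = 0"
  proof (rule ccontr)
    assume "conv u \<kappa> x \<noteq> 0"
    then obtain y where "u y \<noteq> 0" "norm (x - y) < \<epsilon>" using conv_nonzeroD[OF _ k(2)] by blast
    then have "norm x \<le> R + \<epsilon>" using u(2)[of y] norm_triangle_sub[of x y] by linarith
    then show False using x by simp
  qed
qed simp

context star_mesh
begin

text \<open>\<open>conformity\<close> applied to the reflected kernel centred at \<open>x\<close>: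
  differentiating the mollified function nearly amounts to mollifying the discrete gradient,
  uniformly in \<open>x\<close>.\<close>

lemma conv_derivative_defect:
  fixes \<kappa> :: "real^'d => real"
  assumes bz: "\<And>E. E \<in> all_faces m ==> E \<subseteq> frontier \<Omega> ==> v' E = (0::real)"
    and k: "tfun UNIV \<kappa>" and C: "C11_bound C \<kappa> (grad \<kappa>)"
  shows "\<bar>pd i (conv (pwc m v) \<kappa>) x - conv (pwc m (\<lambda>K. dgrad m v v' K $ i)) \<kappa> x\<bar> \<le>
    C * h * conformity_const * dnorm m v v'"
proof -
  let ?\<phi> = "\<lambda>y. \<kappa> (x - y)" and ?G = "\<lambda>y. - grad \<kappa> (x - y)"
  have kb[measurable]: "\<kappa> \<in> borel_measurable borel" by (rule tfun_borel[OF k])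
  have pb[measurable]: "pd i \<kappa> \<in> borel_measurable borel"
    by (rule tfun_borel[OF tfun_pd[OF k]])
  have G: "?G y $ i = - pd i \<kappa> (x - y)" for y by (simp add: grad_def)
  have 1: "(LINT y|leb \<Omega>. pwc m p y * f (x - y)) = conv (pwc m p) f x"
    if "f \<in> borel_measurable borel" for p f
    unfolding conv_def using that
    by (intro integral_lebesgue_on_eq(1)[OF open_domain]) (auto simp: pwc_outside)
  have 2: "(LINT y|leb \<Omega>. pwc m v y * ?G y $ i) = - conv (pwc m v) (pd i \<kappa>) x"
    unfolding G 1[OF pb, symmetric] by simp
  have "\<bar>(LINT y|leb \<Omega>. pwc m (\<lambda>K. dgrad m v v' K $ i) y * ?\<phi> y) +
    (LINT y|leb \<Omega>. pwc m v y * ?G y $ i)\<bar> \<le> C * h * conformity_const * dnorm m v v'"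
  proof (rule conformity)
    show "C11_bound C ?\<phi> ?G" by (rule C11_bound_reflect[OF C])
    show "(\<lambda>y. ?G y $ i) \<in> borel_measurable borel" unfolding G by measurable
  qed (use bz in auto)
  then show ?thesis unfolding 1[OF kb] 2 pd_conv[OF pwc_integrable k] by (simp add: abs_minus_commute)
qed

text \<open>Turns a discrete function into an admissible test function \<open>w\<close> without
  increasing its norm. In the product rule the gradient of the cut-off is at most 1/\<epsilon> and
  lives on the boundary strip, where \<open>c\<close> is of order \<epsilon> times its gradient; so
  \<epsilon> survives only in the constant \<open>C\<close> of the kernel, which is multiplied by
  \<open>h\<close>.\<close>

lemma reconstruction:
  fixes \<kappa> \<rho> :: "real^'d => real" and v v' :: "(real^'d) set => real"
  defines "u \<equiv> pwc m v"
  defines "c \<equiv> conv u \<kappa>"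
  defines "w \<equiv> (\<lambda>x. \<rho> x * c x)"
  assumes bz: "\<And>E. E \<in> all_faces m ==> E \<subseteq> frontier \<Omega> ==> v' E = 0"
    and \<epsilon>: "0 < \<epsilon>" "\<epsilon> \<le> 1"
    and k: "tfun UNIV \<kappa>" "\<And>x. \<kappa> x \<ge> 0" "integral\<^sup>L lborel \<kappa> = 1" "\<And>x. \<kappa> x \<noteq> 0 ==> norm x < \<epsilon>"
    and C: "C11_bound C \<kappa> (grad \<kappa>)"
    and \<rho>: "tfun \<Omega> \<rho>" "\<And>x. 0 \<le> \<rho> x" "\<And>x. \<rho> x \<le> 1" "\<And>x. norm (grad \<rho> x) \<le> 1 / \<epsilon>"
    "\<And>x. grad \<rho> x \<noteq> 0 ==> x \<in> \<Omega> \<and> infdist x (- \<Omega>) \<le> 4 * \<epsilon>"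
    and Cs: "Cs \<ge> 0" "l2 lborel (\<lambda>x. indicator {x \<in> \<Omega>. infdist x (- \<Omega>) \<le> 4 * \<epsilon>} x * c x) \<le> Cs * \<epsilon> * l2 lborel (\<lambda>x. norm (grad c x))"
  shows "tfun \<Omega> w" "l2 (leb \<Omega>) w \<le> l2 (leb \<Omega>) u"
    and "l2 (leb \<Omega>) (pd i w) \<le>
      (1 + Cs) * (CARD('d) * (sqrt (CARD('d)) + C * h * conformity_const * sqrt (measure lborel (cball 0 (R + 1) :: (real^'d) set)))) * dnorm m v v'"
proof -
  define N where "N = dnorm m v v'"
  let ?B = "cball 0 (R + 1) :: (real^'d) set"
  note ui = pwc_integrable[of v, folded u_def] and ub = pwc_borel[of v, folded u_def]
  have Ck: "C_k k c" for k unfolding c_def by (rule C_k_conv[OF ui k(1)])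
  have u0: "norm x \<le> R" if "u x \<noteq> 0" for x
    using that radius pwc_outside unfolding u_def by blast
  have ct: "tfun UNIV c" unfolding c_def by (rule conv_tfun[OF ui u0 k(1,4)])
  show wt: "tfun \<Omega> w" unfolding w_def by (rule tfun_mult[OF \<rho>(1) Ck])
  have sq_tf: "sq_int lborel \<phi>" if "tfun U \<phi>" for \<phi> :: "real^'d => real" and U
    unfolding sq_int_def power2_eq_square
    using tfun_borel[OF that] tfun_integrable[OF tfun_mult[OF that tfun_C_k[OF that]]] by simp
  have l2_tf: "l2 (leb \<Omega>) \<phi> = l2 lborel \<phi>" if "tfun \<Omega> \<phi>" for \<phi>
    unfolding l2_def using tfun_borel[OF that]
    by (subst integral_lebesgue_on_eq(1)[OF open_domain]) (auto simp: tfun_outside[OF that])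
  have "l2 lborel w \<le> l2 lborel c"
  proof (rule sq_int_mono(2)[OF sq_tf[OF ct]])
    show "w \<in> borel_measurable lborel" using tfun_borel[OF wt] by simp
    have "\<bar>w x\<bar> \<le> \<bar>c x\<bar>" for x
      unfolding w_def abs_mult using mult_right_mono[of "\<bar>\<rho> x\<bar>" 1 "\<bar>c x\<bar>"] \<rho>(2,3)[of x] by simp
    then show "AE x in lborel. \<bar>w x\<bar> \<le> \<bar>c x\<bar>" by simp
  qed
  also have "\<dots> \<le> l2 lborel u"
    unfolding c_def using pwc_bounded[of v] unfolding u_def[symmetric] by (rule conv_l2(3)[OF ui ub _ k(1,2,3)])
  finally show "l2 (leb \<Omega>) w \<le> l2 (leb \<Omega>) u"
    unfolding l2_tf[OF wt] u_def pwc_l2(3) .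
  define V where "V = sqrt (measure lborel ?B)"
  have D: "sq_int lborel (pd j c)" "l2 lborel (pd j c) \<le> sqrt (CARD('d)) * N + C * h * conformity_const * N * V" for j
  proof -
    let ?g = "pwc m (\<lambda>K. dgrad m v v' K $ j)"
    note gi = pwc_integrable[of "\<lambda>K. dgrad m v v' K $ j"]
      and gb = pwc_borel[of "\<lambda>K. dgrad m v v' K $ j"]
    show s1: "sq_int lborel (pd j c)" by (rule sq_tf[OF tfun_pd[OF ct]])
    have s2: "sq_int lborel (conv ?g \<kappa>)" and le2: "l2 lborel (conv ?g \<kappa>) \<le> l2 lborel ?g"
      using conv_l2(2,3)[OF gi gb pwc_bounded k(1,2,3)] by auto
    define A where "A = C * h * conformity_const * N"
    have le: "\<bar>pd j c x - conv ?g \<kappa> x\<bar> \<le> A" for x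
      unfolding A_def N_def c_def u_def by (rule conv_derivative_defect[OF bz k(1) C])
    have A0: "0 \<le> A" using le[of 0] by (rule order_trans[OF abs_ge_zero])
    \<comment> \<open>Both functions vanish outside the ball of radius \<open>R + 1\<close> because
      \<epsilon> is at most one; thus the uniform bound \<open>A\<close> becomes a bound in mean
      square with the factor \<open>V\<close>.\<close>
    have zero: "pd j c x - conv ?g \<kappa> x = 0" if x: "x \<notin> ?B" for x
    proof -
      have ball: "False" if "norm (x - y) < \<epsilon>" "norm y \<le> R" for y
        using that \<epsilon> x norm_triangle_sub[of x y] by simp
      have "conv ?g \<kappa> x = 0"
      proof (rule ccontr)
        assume "conv ?g \<kappa> x \<noteq> 0"
        then obtain y where "?g y \<noteq> 0" "norm (x - y) < \<epsilon>" using conv_nonzeroD[OF _ k(4)] by blast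
        then show False using ball radius pwc_outside by blast
      qed
      moreover have "conv u (pd j \<kappa>) x = 0"
      proof (rule ccontr)
        assume n: "conv u (pd j \<kappa>) x \<noteq> 0"
        have "norm z \<le> \<epsilon>" if "pd j \<kappa> z \<noteq> 0" for z
        proof (rule ccontr)
          assume z: "\<not> norm z \<le> \<epsilon>"
          have "open {z :: real^'d. \<epsilon> < norm z}" by (intro open_Collect_less continuous_intros)
          then have "grad \<kappa> z = 0" by (rule grad_locally_constant[where c = 0]) (use z k(4) in force)+
          then show False using that by (simp add: grad_def vec_eq_iff)
        qed
        then have "norm z < norm x - R" if "pd j \<kappa> z \<noteq> 0" for z using that x \<epsilon> by fastforce
        then obtain y where y: "u y \<noteq> 0" "norm (x - y) < norm x - R" using conv_nonzeroD[OF n] by blast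
        then show False using u0[OF y(1)] norm_triangle_sub[of x y] by linarith
      qed
      ultimately show ?thesis unfolding c_def pd_conv[OF ui k(1)] by simp
    qed
    have sB: "sq_int lborel (\<lambda>x. A * indicator ?B x)" and lB: "l2 lborel (\<lambda>x. A * indicator ?B x) = A * V"
    proof -
      have sqi: "(\<lambda>x. (indicator ?B x :: real)^2) = indicator ?B" by (auto simp: indicator_def)
      have fin: "emeasure lborel ?B < \<infinity>" by (rule emeasure_bounded_finite) simp
      then have "sq_int lborel (indicator ?B)"
        unfolding sq_int_def sqi by (auto intro!: integrable_real_indicator borel_measurable_indicator borel_closed)
      then show "sq_int lborel (\<lambda>x. A * indicator ?B x)" by (rule sq_int_cmult)
      show "l2 lborel (\<lambda>x. A * indicator ?B x) = A * V"
        unfolding l2_cmult V_def using A0 unfolding l2_def sqi by simp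
    qed
    have "l2 lborel (pd j c) = l2 lborel (\<lambda>x. conv ?g \<kappa> x + (pd j c x - conv ?g \<kappa> x))" by simp
    also have "\<dots> \<le> l2 lborel (conv ?g \<kappa>) + l2 lborel (\<lambda>x. pd j c x - conv ?g \<kappa> x)"
      by (rule l2_triangle[OF s2 sq_int_diff[OF s1 s2]])
    also have "l2 lborel (\<lambda>x. pd j c x - conv ?g \<kappa> x) \<le> l2 lborel (\<lambda>x. A * indicator ?B x)"
    proof (rule sq_int_mono(2)[OF sB])
      show "(\<lambda>x. pd j c x - conv ?g \<kappa> x) \<in> borel_measurable lborel"
        using sq_int_diff[OF s1 s2] by (rule sq_int_measurable)
      have "\<bar>pd j c x - conv ?g \<kappa> x\<bar> \<le> \<bar>A * indicator ?B x\<bar>" for x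
        using le[of x] zero[of x] A0 by (cases "x \<in> ?B") auto
      then show "AE x in lborel. \<bar>pd j c x - conv ?g \<kappa> x\<bar> \<le> \<bar>A * indicator ?B x\<bar>" by simp
    qed
    also have "l2 lborel (conv ?g \<kappa>) \<le> sqrt (CARD('d)) * N"
      using le2 dgrad_l2(3)[of v v' j] unfolding pwc_l2(3) N_def by simp
    finally show "l2 lborel (pd j c) \<le> sqrt (CARD('d)) * N + C * h * conformity_const * N * V"
      unfolding lB by (simp add: A_def)
  qed
  have sg: "sq_int lborel (\<lambda>x. norm (grad c x))"
  and lg: "l2 lborel (\<lambda>x. norm (grad c x)) \<le> CARD('d) * (sqrt (CARD('d)) + C * h * conformity_const * V) * N"
  proof -
    \<comment> \<open>The norm of the gradient is at most the sum of the absolute partial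
      derivatives, whence the factor \<open>CARD('d)\<close>.\<close>
    have sum: "sq_int lborel (\<lambda>x. \<Sum>j\<in>J. \<bar>pd j c x\<bar>) \<and>
      l2 lborel (\<lambda>x. \<Sum>j\<in>J. \<bar>pd j c x\<bar>) \<le> card J * (sqrt (CARD('d)) * N + C * h * conformity_const * N * V)"
      if "finite J" for J using that
    proof induction
      case empty show ?case by (simp add: sq_int_zero l2_def)
    next
      case (insert j J)
      have a: "sq_int lborel (\<lambda>x. \<bar>pd j c x\<bar>)" and la: "l2 lborel (\<lambda>x. \<bar>pd j c x\<bar>) = l2 lborel (pd j c)"
        using D(1)[of j] by (auto simp: sq_int_def l2_def)
      have "sq_int lborel (\<lambda>x. \<bar>pd j c x\<bar> + (\<Sum>j\<in>J. \<bar>pd j c x\<bar>))"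
        by (rule sq_int_add[OF a]) (use insert in blast)
      moreover have "l2 lborel (\<lambda>x. \<bar>pd j c x\<bar> + (\<Sum>j\<in>J. \<bar>pd j c x\<bar>)) \<le>
        l2 lborel (\<lambda>x. \<bar>pd j c x\<bar>) + l2 lborel (\<lambda>x. \<Sum>j\<in>J. \<bar>pd j c x\<bar>)"
        by (rule l2_triangle[OF a]) (use insert in blast)
      ultimately show ?case using insert D(2)[of j] la by (simp add: algebra_simps)
    qed
    have m: "(\<lambda>x. norm (grad c x)) \<in> borel_measurable lborel"
      using grad_borel[OF ct] by simp
    have le: "AE x in lborel. \<bar>norm (grad c x)\<bar> \<le> \<bar>\<Sum>j\<in>UNIV. \<bar>pd j c x\<bar>\<bar>"
    proof (rule AE_I2)
      fix x
      have "norm (grad c x) \<le> (\<Sum>j\<in>UNIV. \<bar>grad c x $ j\<bar>)" by (rule norm_le_l1_cart)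
      then show "\<bar>norm (grad c x)\<bar> \<le> \<bar>\<Sum>j\<in>UNIV. \<bar>pd j c x\<bar>\<bar>" by (simp add: grad_def)
    qed
    show "sq_int lborel (\<lambda>x. norm (grad c x))"
      by (rule sq_int_mono(1)[OF _ m le]) (use sum in simp)
    have "l2 lborel (\<lambda>x. norm (grad c x)) \<le> l2 lborel (\<lambda>x. \<Sum>j\<in>UNIV. \<bar>pd j c x\<bar>)"
      by (rule sq_int_mono(2)[OF _ m le]) (use sum in simp)
    also have "\<dots> \<le> CARD('d) * (sqrt (CARD('d)) * N + C * h * conformity_const * N * V)" using sum[of UNIV] by simp
    finally show "l2 lborel (\<lambda>x. norm (grad c x)) \<le> CARD('d) * (sqrt (CARD('d)) + C * h * conformity_const * V) * N"
      by (simp add: algebra_simps)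
  qed
  let ?S = "{x \<in> \<Omega>. infdist x (- \<Omega>) \<le> 4 * \<epsilon>}"
  have Sm[measurable]: "?S \<in> sets borel"
  proof -
    have "?S = \<Omega> \<inter> {x. infdist x (- \<Omega>) \<le> 4 * \<epsilon>}" by auto
    moreover have "closed {x. infdist x (- \<Omega>) \<le> 4 * \<epsilon>}" by (intro closed_Collect_le continuous_intros)
    ultimately show ?thesis using open_domain by simp
  qed
  have cb[measurable]: "c \<in> borel_measurable borel" by (rule tfun_borel[OF ct])
  have sS: "sq_int lborel (\<lambda>x. 1 / \<epsilon> * \<bar>indicator ?S x * c x\<bar>)"
  proof (rule sq_int_cmult, rule sq_int_mono(1)[OF sq_tf[OF ct]])
    show "(\<lambda>x. \<bar>indicator ?S x * c x\<bar>) \<in> borel_measurable lborel" by measurable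
  qed (auto simp: indicator_def)
  have "l2 lborel (pd i w) \<le> l2 lborel (\<lambda>x. norm (grad c x) + 1 / \<epsilon> * \<bar>indicator ?S x * c x\<bar>)"
  proof (rule sq_int_mono(2)[OF sq_int_add[OF sg sS]])
    show "pd i w \<in> borel_measurable lborel"
      using tfun_borel[OF tfun_pd[OF wt]] by simp
    have "\<bar>pd i w x\<bar> \<le> norm (grad c x) + 1 / \<epsilon> * \<bar>indicator ?S x * c x\<bar>" for x
    proof -
      have e: "pd i w x = \<rho> x * pd i c x + pd i \<rho> x * c x"
        unfolding w_def using pd_mult[OF tfun_differentiable[OF \<rho>(1)] tfun_differentiable[OF ct]] by simp
      have "\<bar>\<rho> x * pd i c x\<bar> \<le> 1 * norm (grad c x)"
        unfolding abs_mult using \<rho>(2,3)[of x] component_le_norm_cart[of "grad c x" i]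
        by (intro mult_mono) (auto simp: grad_def)
      \<comment> \<open>The gradient of the cut-off is bounded by 1/\<epsilon> and supported in the
        strip; the strip hypothesis cancels this factor below.\<close>
      moreover have "\<bar>pd i \<rho> x * c x\<bar> \<le> 1 / \<epsilon> * \<bar>indicator ?S x * c x\<bar>"
      proof (cases "grad \<rho> x = 0")
        case True
        then have "pd i \<rho> x = 0" by (simp add: grad_def vec_eq_iff)
        then show ?thesis using \<epsilon> by simp
      next
        case False
        then have "x \<in> ?S" using \<rho>(5) by blast
        moreover have "\<bar>pd i \<rho> x\<bar> \<le> 1 / \<epsilon>"
          using component_le_norm_cart[of "grad \<rho> x" i] \<rho>(4)[of x] by (simp add: grad_def)
        ultimately show ?thesis unfolding abs_mult using \<epsilon>(1) by (intro mult_mono) auto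
      qed
      ultimately show ?thesis unfolding e by linarith
    qed
    then show "AE x in lborel. \<bar>pd i w x\<bar> \<le> \<bar>norm (grad c x) + 1 / \<epsilon> * \<bar>indicator ?S x * c x\<bar>\<bar>"
      by (intro AE_I2) (rule order_trans[OF _ abs_ge_self])
  qed
  also have "\<dots> \<le> l2 lborel (\<lambda>x. norm (grad c x)) + l2 lborel (\<lambda>x. 1 / \<epsilon> * \<bar>indicator ?S x * c x\<bar>)"
    by (rule l2_triangle[OF sg sS])
  also have "l2 lborel (\<lambda>x. 1 / \<epsilon> * \<bar>indicator ?S x * c x\<bar>) = 1 / \<epsilon> * l2 lborel (\<lambda>x. indicator ?S x * c x)"
    unfolding l2_cmult using \<epsilon> by (simp add: l2_def)
  also have "\<dots> \<le> 1 / \<epsilon> * (Cs * \<epsilon> * l2 lborel (\<lambda>x. norm (grad c x)))"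
    by (rule mult_left_mono[OF Cs(2)]) (use \<epsilon> in simp)
  also have "\<dots> = Cs * l2 lborel (\<lambda>x. norm (grad c x))" using \<epsilon> by simp
  finally have "l2 lborel (pd i w) \<le> (1 + Cs) * l2 lborel (\<lambda>x. norm (grad c x))" by (simp add: algebra_simps)
  also have "\<dots> \<le> (1 + Cs) * (CARD('d) * (sqrt (CARD('d)) + C * h * conformity_const * V) * N)"
    using Cs(1) by (intro mult_left_mono lg) simp
  finally show "l2 (leb \<Omega>) (pd i w) \<le>
      (1 + Cs) * (CARD('d) * (sqrt (CARD('d)) + C * h * conformity_const * sqrt (measure lborel ?B))) * dnorm m v v'"
    unfolding l2_tf[OF tfun_pd[OF wt]] V_def N_def by (simp add: mult.assoc)
qed

text \<open>The cut-off is one wherever \<psi> does not vanish, so only the mollification error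
  remains. The integral of the absolute value of \<open>u\<close> is bounded by its norm on the
  domain through the Cauchy-Schwarz inequality.\<close>

lemma reconstruction_defect:
  fixes \<kappa> \<rho> \<psi> :: "real^'d => real" and v :: "(real^'d) set => real"
  defines "u \<equiv> pwc m v"
  assumes k: "tfun UNIV \<kappa>" "\<And>x. \<kappa> x \<ge> 0" "integral\<^sup>L lborel \<kappa> = 1" "\<And>x. \<kappa> x \<noteq> 0 ==> norm x < \<epsilon>" "\<And>x. \<kappa> (- x) = \<kappa> x" "\<epsilon> > 0"
    and \<psi>: "tfun \<Omega> \<psi>" "\<And>x y. \<bar>\<psi> y - \<psi> x\<bar> \<le> L * norm (y - x)" "L \<ge> 0"
    and \<rho>: "\<rho> \<in> borel_measurable borel" "\<And>x. \<psi> x \<noteq> 0 ==> \<rho> x = 1"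
  shows "\<bar>(LINT x|leb \<Omega>. \<psi> x * u x) - (LINT x|leb \<Omega>. \<psi> x * (\<rho> x * conv u \<kappa> x))\<bar> \<le>
    L * \<epsilon> * (sqrt (vol \<Omega>) * l2 (leb \<Omega>) u)"
proof -
  note ui = pwc_integrable[of v, folded u_def] and ub[measurable] = pwc_borel[of v, folded u_def]
  have pb[measurable]: "\<psi> \<in> borel_measurable borel" by (rule tfun_borel[OF \<psi>(1)])
  have cb[measurable]: "conv u \<kappa> \<in> borel_measurable borel"
    by (rule borel_measurable_continuous_onI[OF C_k_continuous[OF C_k_conv[OF ui k(1)]]])
  have out: "\<psi> x = 0" "u x = 0" if "x \<notin> \<Omega>" for x
    using tfun_outside[OF \<psi>(1) that] pwc_outside[OF that] by (simp_all add: u_def)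
  have e1: "(LINT x|leb \<Omega>. \<psi> x * u x) = (LBINT x. \<psi> x * u x)"
    by (rule integral_lebesgue_on_eq(1)[OF open_domain]) (auto simp: out)
  have e: "(\<lambda>x. \<psi> x * (\<rho> x * conv u \<kappa> x)) = (\<lambda>x. \<psi> x * conv u \<kappa> x)"
  proof
    fix x show "\<psi> x * (\<rho> x * conv u \<kappa> x) = \<psi> x * conv u \<kappa> x" using \<rho>(2)[of x] by (cases "\<psi> x = 0") auto
  qed
  have e2: "(LINT x|leb \<Omega>. \<psi> x * (\<rho> x * conv u \<kappa> x)) = (LBINT x. \<psi> x * conv u \<kappa> x)"
    unfolding e by (rule integral_lebesgue_on_eq(1)[OF open_domain]) (auto simp: out)
  have fm: "finite_measure (leb \<Omega>)" using lebesgue_on_finite open_domain bounded_domain by blast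
  have one: "sq_int (leb \<Omega>) (\<lambda>_. 1)" "l2 (leb \<Omega>) (\<lambda>_. 1) = sqrt (vol \<Omega>)"
    using fm open_domain by (auto simp: sq_int_def l2_def vol_def measure_restrict_space finite_measure.integrable_const)
  have su: "sq_int (leb \<Omega>) (\<lambda>x. \<bar>u x\<bar>)" "l2 (leb \<Omega>) (\<lambda>x. \<bar>u x\<bar>) = l2 (leb \<Omega>) u"
    using pwc_l2(1)[of v] unfolding u_def by (auto simp: sq_int_def l2_def)
  have "(LBINT x. \<bar>u x\<bar>) = (LINT x|leb \<Omega>. \<bar>u x\<bar>)"
    by (rule integral_lebesgue_on_eq(1)[OF open_domain, symmetric]) (auto simp: out)
  also have "\<dots> \<le> sqrt (vol \<Omega>) * l2 (leb \<Omega>) u"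
    using l2_Cauchy_Schwarz[OF one(1) su(1)] unfolding one(2) su(2) by simp
  finally have "L * \<epsilon> * (LBINT x. \<bar>u x\<bar>) \<le> L * \<epsilon> * (sqrt (vol \<Omega>) * l2 (leb \<Omega>) u)"
    using \<psi>(3) k(6) by (intro mult_left_mono) auto
  then show ?thesis unfolding e1 e2
    using integral_conv_defect[OF ui ub \<psi>(1) k(1-5) \<psi>(2,3)] by linarith
qed

end

text \<open>The residual of the weak equation with flux \<open>q\<close> when a discrete function
  takes the place of a test function.\<close>

definition conformity_defect ::
    "(real^'d) set => (real^'d) mesh => (real^'d => real) => (real^'d => real^'d) => ((real^'d) set => real) => ((real^'d) set => real) => real" where
  "conformity_defect \<Omega> m f q v v' = \<bar>(LINT x|leb \<Omega>. f x * pwc m v x) -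
       (\<Sum>i\<in>UNIV. LINT x|leb \<Omega>. q x $ i * pwc m (\<lambda>K. dgrad m v v' K $ i) x)\<bar>"

text \<open>\<open>f\<close> and \<open>q\<close> are replaced by test functions. Against these,
  \<open>u\<close> may be exchanged for its reconstruction \<open>w\<close>; the discrete gradient
  is moved onto the approximate flux by \<open>conformity\<close> and then back onto
  \<open>w\<close> by parts. The weak equation holds for \<open>w\<close>. The three kinds of error
  are each allotted one third of \<eta>.\<close>

lemma limit_conformity:
  fixes \<Omega> :: "(real^'d) set" and f :: "real^'d => real" and q :: "real^'d => real^'d"
  assumes o: "open \<Omega>" and b: "bounded \<Omega>" and po: "polytopal_open \<Omega>"
    and R: "R > 0" and \<theta>: "\<theta> > 0"
    and f: "sq_int (leb \<Omega>) f" and q: "\<And>i. sq_int (leb \<Omega>) (\<lambda>x. q x $ i)"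
    and weak: "\<And>w. tfun \<Omega> w ==> (LINT x|leb \<Omega>. f x * w x) =
       (\<Sum>i\<in>UNIV. LINT x|leb \<Omega>. q x $ i * pd i w x)"
    and \<eta>: "\<eta> > 0"
  shows "\<exists>\<delta>>0. \<forall>h m v v'. star_mesh \<Omega> R \<theta> h m --> h \<le> \<delta> -->
      (\<forall>E\<in>all_faces m. E \<subseteq> frontier \<Omega> --> v' E = 0) -->
      conformity_defect \<Omega> m f q v v' \<le> \<eta> * dnorm m v v'"
proof -
  let ?M = "leb \<Omega>" and ?d = "real CARD('d)"
  define Kp where "Kp = 2 * R * sqrt (?d + 1)"
  \<comment> \<open>The value of \<open>conformity_const\<close>, written out because the choices
    precede the mesh.\<close>
  define cc where "cc = sqrt (vol \<Omega>) * (2 * sqrt ?d + (1 + \<theta> * ?d) * Kp)"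
  have Kp: "Kp > 0" using R by (simp add: Kp_def add_pos_pos)
  have cc: "cc \<ge> 0" using Kp \<theta> by (simp add: cc_def vol_def)
  define A0 where "A0 = sqrt (vol \<Omega>)"
  have A0: "A0 \<ge> 0" by (simp add: A0_def vol_def)
  define V where "V = sqrt (measure lborel (cball 0 (R + 1) :: (real^'d) set))"
  have V: "V \<ge> 0" by (simp add: V_def)
  obtain Cs \<epsilon>0 where Cs: "Cs > 0" "\<epsilon>0 > 0" and strip: "\<And>\<epsilon> w. 0 < \<epsilon> ==> \<epsilon> \<le> \<epsilon>0 ==> tfun UNIV w ==>
      (\<And>x. w x \<noteq> 0 ==> \<exists>y\<in>\<Omega>. norm (x - y) < \<epsilon>) ==>
      l2 lborel (\<lambda>x. indicator {x \<in> \<Omega>. infdist x (- \<Omega>) \<le> 4 * \<epsilon>} x * w x) \<le> Cs * \<epsilon> * l2 lborel (\<lambda>x. norm (grad w x))"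
    by (rule boundary_strip[OF po b]) blast
  \<comment> \<open>The gradient bound of \<open>reconstruction\<close> with its kernel term
    replaced by one; the choice of \<delta> justifies this.\<close>
  define C1 where "C1 = (1 + Cs) * (?d * (sqrt ?d + 1))"
  have C1: "C1 \<ge> 0" using Cs by (simp add: C1_def)
  \<comment> \<open>The error of approximating \<open>f\<close> is multiplied by
    \<open>2 * Kp\<close>, once for \<open>u\<close> and once for \<open>w\<close>; each component
    of \<open>q\<close> by \<open>sqrt ?d + C1\<close>, for the discrete gradient and for the
    gradient of \<open>w\<close>.\<close>
  define \<eta>1 where "\<eta>1 = \<eta> / (3 * (2 * Kp + ?d * (sqrt ?d + C1)))"
  have pos1: "2 * Kp + ?d * (sqrt ?d + C1) > 0" using Kp C1 by (intro add_pos_nonneg) auto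
  then have \<eta>1: "\<eta>1 > 0" using \<eta> by (simp add: \<eta>1_def)
  have cancel: "\<eta> / (3 * X) * X = \<eta> / 3" if "X > 0" for X using that by simp
  obtain fs where fs: "tfun \<Omega> fs" "l2 ?M (\<lambda>x. f x - fs x) < \<eta>1"
    by (rule tfun_dense[OF o b f \<eta>1])
  have "\<exists>\<phi>. tfun \<Omega> \<phi> \<and> l2 ?M (\<lambda>x. q x $ i - \<phi> x) < \<eta>1" for i
    by (rule tfun_dense[OF o b q[of i] \<eta>1]) blast
  then obtain qs where qs: "\<And>i. tfun \<Omega> (qs i)" "\<And>i. l2 ?M (\<lambda>x. q x $ i - qs i x) < \<eta>1" by metis
  let ?est = "\<lambda>\<phi> C. C11_bound C \<phi> (grad \<phi>)"
  have est_ex: "\<exists>C. ?est \<phi> C" if "tfun U \<phi>" for U and \<phi> :: "real^'d => real"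
    by (rule tfun_C11[OF that]) blast
  obtain Af where Af: "?est fs Af" using est_ex[OF fs(1)] by blast
  obtain Aq where Aq: "\<And>i. ?est (qs i) (Aq i)" using est_ex[OF qs(1)] by metis
  define A where "A = Af + (\<Sum>i\<in>UNIV. Aq i)"
  have Ap: "Af > 0" "\<And>i. Aq i > 0" using Af Aq by (auto dest: C11_boundD(1))
  then have A: "A > 0" unfolding A_def by (intro add_pos_nonneg sum_nonneg) (auto intro: less_imp_le)
  have "Af \<le> A" using Ap unfolding A_def by (simp add: sum_nonneg less_imp_le)
  then have ef: "?est fs A" using C11_bound_mono[OF Af] by blast
  have "Aq i \<le> A" for i using member_le_sum[of i UNIV Aq] Ap unfolding A_def by (simp add: less_imp_le add_increasing)
  then have eq: "?est (qs i) A" for i using C11_bound_mono[OF Aq] by blast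
  obtain Sf where Sf: "compact Sf" "Sf \<subseteq> \<Omega>" "\<And>x. x \<notin> Sf ==> fs x = 0"
    using tfun_support[OF fs(1)] by blast
  have "\<exists>S. compact S \<and> S \<subseteq> \<Omega> \<and> (\<forall>x. x \<notin> S --> pd i (qs i) x = 0)" for i
    using tfun_support[OF qs(1)[of i]] by blast
  then obtain Sq where Sq: "\<And>i. compact (Sq i)" "\<And>i. Sq i \<subseteq> \<Omega>" "\<And>i x. x \<notin> Sq i ==> pd i (qs i) x = 0" by metis
  \<comment> \<open>A compact set outside of which \<open>fs\<close> and the derivatives
    \<open>pd i (qs i)\<close> vanish; the cut-off has to be one on it.\<close>
  define S where "S = Sf \<union> (\<Union>i. Sq i)"
  have S: "compact S" "S \<subseteq> \<Omega>" unfolding S_def using Sf(1,2) Sq(1,2) by (auto intro!: compact_Un compact_UN dest: subsetD[OF Sq(2)])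
  have ne: "- \<Omega> \<noteq> {}" using b not_bounded_UNIV by (metis Compl_empty_eq double_complement)
  have "\<exists>r>0. \<forall>x\<in>S. \<forall>y\<in>-\<Omega>. r \<le> dist x y"
    using S o by (intro separate_compact_closed) auto
  then obtain r where r: "r > 0" "\<And>x y. x \<in> S ==> y \<in> -\<Omega> ==> r \<le> dist x y" by blast
  have rS: "r \<le> infdist x (- \<Omega>)" if "x \<in> S" for x
    unfolding infdist_notempty[OF ne] using r(2)[OF that] ne by (intro cINF_greatest) auto
  \<comment> \<open>The entries serve the radius \<open>R + 1\<close> of the ball in
    \<open>reconstruction\<close>, the strip estimate, the value one of the cut-off on
    \<open>S\<close>, and the mollification error.\<close>
  define \<epsilon> where "\<epsilon> = Min {1, \<epsilon>0, r / 4, \<eta> / (3 * (A * (A0 + 1) * Kp * (1 + ?d)))}"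
  have pos2: "A * (A0 + 1) * Kp * (1 + ?d) > 0" using A A0 Kp by simp
  have \<epsilon>: "0 < \<epsilon>" "\<epsilon> \<le> 1" "\<epsilon> \<le> \<epsilon>0" "\<epsilon> \<le> r / 4" "\<epsilon> \<le> \<eta> / (3 * (A * (A0 + 1) * Kp * (1 + ?d)))"
    using Cs r \<eta> pos2 unfolding \<epsilon>_def by auto
  obtain \<kappa> :: "real^'d => real" where k: "tfun UNIV \<kappa>" "\<And>x. \<kappa> x \<ge> 0" "integral\<^sup>L lborel \<kappa> = 1" "\<And>x. \<kappa> x \<noteq> 0 ==> norm x < \<epsilon>"
    and ke: "\<And>x. \<kappa> (- x) = \<kappa> x" by (rule mollifier_exists[OF \<epsilon>(1)]) blast
  obtain Ck where Cke: "?est \<kappa> Ck" using est_ex[OF k(1)] by blast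
  note Ck = C11_boundD(1)[OF Cke]
  obtain \<rho> where \<rho>: "tfun \<Omega> \<rho>" "\<And>x. 0 \<le> \<rho> x" "\<And>x. \<rho> x \<le> 1" "\<And>x. norm (grad \<rho> x) \<le> 1 / \<epsilon>"
    and \<rho>1: "\<And>x. infdist x (- \<Omega>) \<ge> 4 * \<epsilon> ==> \<rho> x = 1"
    and \<rho>g: "\<And>x. grad \<rho> x \<noteq> 0 ==> x \<in> \<Omega> \<and> infdist x (- \<Omega>) \<le> 4 * \<epsilon>"
    using cutoff_exists[OF o b \<epsilon>(1) k] by blast
  have \<rho>S: "\<rho> x = 1" if "x \<in> S" for x using rS[OF that] \<epsilon>(4) by (intro \<rho>1) linarith
  \<comment> \<open>The first entry makes the kernel term of \<open>reconstruction\<close> at most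
    one although \<open>Ck\<close> depends on \<epsilon>; the second controls the discrete
    integration by parts.\<close>
  define \<delta> where "\<delta> = min (1 / (Ck * (cc + 1) * (V + 1))) (\<eta> / (3 * (?d * A * (cc + 1))))"
  show ?thesis
  proof (intro exI[of _ \<delta>] conjI allI impI)
    have "1 / (Ck * (cc + 1) * (V + 1)) > 0" using Ck cc V by (intro divide_pos_pos mult_pos_pos) auto
    moreover have "\<eta> / (3 * (?d * A * (cc + 1))) > 0" using \<eta> A cc by (intro divide_pos_pos mult_pos_pos) auto
    ultimately show "\<delta> > 0" unfolding \<delta>_def by simp
    fix h m and v v' :: "(real^'d) set => real"
    assume sm: "star_mesh \<Omega> R \<theta> h m" and h\<delta>: "h \<le> \<delta>" and "\<forall>E\<in>all_faces m. E \<subseteq> frontier \<Omega> --> v' E = 0"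
    then have bz: "\<And>E. E \<in> all_faces m ==> E \<subseteq> frontier \<Omega> ==> v' E = 0" by blast
    interpret star_mesh \<Omega> R \<theta> h m by (rule sm)
    have cce: "conformity_const = cc" unfolding conformity_const_def cc_def Kp_def ..
    define N where "N = dnorm m v v'"
    have N: "N \<ge> 0" unfolding N_def by (rule dnorm_nonneg)
    define u where "u = pwc m v"
    define c where "c = conv u \<kappa>"
    define w where "w = (\<lambda>x. \<rho> x * c x)"
    define g where "g i = pwc m (\<lambda>K. dgrad m v v' K $ i)" for i
    have su: "sq_int ?M u" and sg: "sq_int ?M (g i)" for i
      unfolding u_def g_def by (rule pwc_l2(1))+
    have P: "l2 ?M u \<le> Kp * N" unfolding u_def N_def Kp_def by (rule discrete_Poincare) (rule bz)
    have lg: "l2 ?M (g i) \<le> sqrt ?d * N" for i unfolding g_def N_def by (rule dgrad_l2(3))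
    have ct: "tfun UNIV c" and u\<Omega>: "u x \<noteq> 0 ==> x \<in> \<Omega>" for x
    proof -
      show u\<Omega>: "u x \<noteq> 0 ==> x \<in> \<Omega>" for x using pwc_outside unfolding u_def by blast
      show "tfun UNIV c" unfolding c_def
        by (rule conv_tfun[OF _ _ k(1,4), where R = R])
           (use pwc_integrable radius u\<Omega> in \<open>auto simp: u_def\<close>)
    qed
    have strip_c: "l2 lborel (\<lambda>x. indicator {x \<in> \<Omega>. infdist x (- \<Omega>) \<le> 4 * \<epsilon>} x * c x) \<le> Cs * \<epsilon> * l2 lborel (\<lambda>x. norm (grad c x))"
    proof (rule strip[OF \<epsilon>(1,3) ct])
      fix x assume "c x \<noteq> 0"
      then show "\<exists>y\<in>\<Omega>. norm (x - y) < \<epsilon>" using conv_nonzeroD[OF _ k(4)] u\<Omega> unfolding c_def by blast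
    qed
    note rec = reconstruction[where v = v and v' = v' and \<kappa> = \<kappa> and \<rho> = \<rho>, folded u_def, folded c_def, folded w_def,
      OF bz \<epsilon>(1,2) k Cke \<rho> \<rho>g less_imp_le[OF Cs(1)] strip_c]
    have wt: "tfun \<Omega> w" by (rule rec(1))
    have lw: "l2 ?M w \<le> Kp * N" by (rule order_trans[OF rec(2) P])
    have ldw: "l2 ?M (pd i w) \<le> C1 * N" for i
    proof -
      have "Ck * h * cc * V \<le> Ck * h * (cc + 1) * (V + 1)"
        using Ck size_nonneg cc V by (intro mult_mono) auto
      also have "\<dots> = h * (Ck * (cc + 1) * (V + 1))" by simp
      also have "\<dots> \<le> 1 / (Ck * (cc + 1) * (V + 1)) * (Ck * (cc + 1) * (V + 1))"
        using h\<delta> Ck cc V unfolding \<delta>_def by (intro mult_right_mono) auto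
      also have "\<dots> = 1" using Ck cc V by simp
      finally have "(1 + Cs) * (?d * (sqrt ?d + Ck * h * cc * V)) * N \<le> C1 * N"
        unfolding C1_def using Cs N by (intro mult_right_mono mult_left_mono add_left_mono) auto
      then show ?thesis using rec(3)[of i] unfolding cce V_def N_def by auto
    qed
    have sw: "sq_int ?M w" and sdw: "sq_int ?M (pd i w)" for i
      using tfun_sq_int(1)[OF o b wt] tfun_sq_int(1)[OF o b tfun_pd[OF wt]] by auto
    have sfs: "sq_int ?M fs" and sqs: "sq_int ?M (qs i)" for i
      using tfun_sq_int(1)[OF o b] fs(1) qs(1) by auto
    have defect: "\<bar>(LINT x|?M. \<psi> x * u x) - (LINT x|?M. \<psi> x * w x)\<bar> \<le> A * \<epsilon> * (A0 * (Kp * N))"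
      if "tfun \<Omega> \<psi>" "\<And>x y. \<bar>\<psi> y - \<psi> x\<bar> \<le> A * norm (y - x)" "\<And>x. x \<notin> S ==> \<psi> x = 0" for \<psi>
    proof -
      have "\<bar>(LINT x|?M. \<psi> x * u x) - (LINT x|?M. \<psi> x * w x)\<bar> \<le> A * \<epsilon> * (A0 * l2 ?M u)"
        unfolding w_def c_def u_def A0_def
        by (rule reconstruction_defect[OF k ke \<epsilon>(1) that(1,2)])
           (use A that(3) \<rho>S tfun_borel[OF \<rho>(1)] in auto)
      also have "\<dots> \<le> A * \<epsilon> * (A0 * (Kp * N))" using A \<epsilon> A0 P by (intro mult_left_mono) auto
      finally show ?thesis .
    qed
    have A\<epsilon>: "(1 + ?d) * (A * \<epsilon> * (A0 * (Kp * N))) \<le> \<eta> / 3 * N"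
    proof -
      have "(1 + ?d) * (A * \<epsilon> * (A0 * Kp)) \<le> (1 + ?d) * (A * \<epsilon> * ((A0 + 1) * Kp))"
        using A \<epsilon> Kp by (intro mult_left_mono mult_right_mono) auto
      also have "\<dots> = \<epsilon> * (A * (A0 + 1) * Kp * (1 + ?d))" by simp
      also have "\<dots> \<le> \<eta> / (3 * (A * (A0 + 1) * Kp * (1 + ?d))) * (A * (A0 + 1) * Kp * (1 + ?d))"
        using \<epsilon>(5) pos2 by (intro mult_right_mono) auto
      also have "\<dots> = \<eta> / 3" by (rule cancel[OF pos2])
      finally have "(1 + ?d) * (A * \<epsilon> * (A0 * Kp)) * N \<le> \<eta> / 3 * N" using N by (rule mult_right_mono)
      then show ?thesis by (simp add: mult_ac)
    qed
    have hA: "?d * (A * h * cc * N) \<le> \<eta> / 3 * N"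
    proof -
      have "?d * (A * h * cc) \<le> ?d * (A * h * (cc + 1))" using A size_nonneg by (intro mult_left_mono) auto
      also have "\<dots> = h * (?d * A * (cc + 1))" by simp
      also have "\<dots> \<le> \<eta> / (3 * (?d * A * (cc + 1))) * (?d * A * (cc + 1))"
        using h\<delta> A cc unfolding \<delta>_def by (intro mult_right_mono) auto
      also have "\<dots> = \<eta> / 3" using A cc by simp
      finally have "?d * (A * h * cc) * N \<le> \<eta> / 3 * N" using N by (rule mult_right_mono)
      then show ?thesis by (simp add: mult_ac)
    qed
    have approx: "\<bar>(LINT x|?M. a x * y x) - (LINT x|?M. a' x * y x)\<bar> \<le> \<eta>1 * l2 ?M y"
      if "sq_int ?M a" "sq_int ?M a'" "sq_int ?M y" "l2 ?M (\<lambda>x. a x - a' x) < \<eta>1" for a a' y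
    proof -
      have "(LINT x|?M. a x * y x) - (LINT x|?M. a' x * y x) = (LINT x|?M. (a x - a' x) * y x)"
        unfolding left_diff_distrib
        by (rule Bochner_Integration.integral_diff[symmetric]) (rule sq_int_mult, fact, fact)+
      then have "\<bar>(LINT x|?M. a x * y x) - (LINT x|?M. a' x * y x)\<bar> \<le> l2 ?M (\<lambda>x. a x - a' x) * l2 ?M y"
        using l2_Cauchy_Schwarz[OF sq_int_diff[OF that(1,2)] that(3)] by simp
      also have "\<dots> \<le> \<eta>1 * l2 ?M y" using that(4) by (intro mult_right_mono) auto
      finally show ?thesis .
    qed
    \<comment> \<open>Passage from \<open>f\<close> to \<open>fs\<close>, from \<open>u\<close> to
      \<open>w\<close>, and back to \<open>f\<close>.\<close>
    have F: "\<bar>(LINT x|?M. f x * u x) - (LINT x|?M. f x * w x)\<bar> \<le> \<eta>1 * (2 * Kp) * N + A * \<epsilon> * (A0 * (Kp * N))"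
    proof -
      have "\<bar>(LINT x|?M. f x * u x) - (LINT x|?M. fs x * u x)\<bar> \<le> \<eta>1 * (Kp * N)"
        using approx[OF f sfs su fs(2)] mult_left_mono[OF P less_imp_le[OF \<eta>1]] by linarith
      moreover have "\<bar>(LINT x|?M. f x * w x) - (LINT x|?M. fs x * w x)\<bar> \<le> \<eta>1 * (Kp * N)"
        using approx[OF f sfs sw fs(2)] mult_left_mono[OF lw less_imp_le[OF \<eta>1]] by linarith
      moreover have "\<bar>(LINT x|?M. fs x * u x) - (LINT x|?M. fs x * w x)\<bar> \<le> A * \<epsilon> * (A0 * (Kp * N))"
        by (rule defect[OF fs(1)]) (use C11_boundD(2)[OF ef] Sf(3) in \<open>auto simp: S_def\<close>)
      ultimately show ?thesis by (simp add: algebra_simps)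
    qed
    \<comment> \<open>After replacing the flux by \<open>qs\<close>, fact 3 moves the discrete
      gradient onto \<open>qs\<close>, \<open>defect\<close> exchanges \<open>u\<close> for
      \<open>w\<close>, and fact 4 returns the derivative to \<open>w\<close>.\<close>
    have Q: "\<bar>(LINT x|?M. q x $ i * g i x) - (LINT x|?M. q x $ i * pd i w x)\<bar> \<le>
      \<eta>1 * (sqrt ?d + C1) * N + A * \<epsilon> * (A0 * (Kp * N)) + A * h * cc * N" for i
    proof -
      have 1: "\<bar>(LINT x|?M. q x $ i * g i x) - (LINT x|?M. qs i x * g i x)\<bar> \<le> \<eta>1 * (sqrt ?d * N)"
        using approx[OF q sqs sg qs(2)] mult_left_mono[OF lg less_imp_le[OF \<eta>1]] by (rule order_trans)
      have 2: "\<bar>(LINT x|?M. q x $ i * pd i w x) - (LINT x|?M. qs i x * pd i w x)\<bar> \<le> \<eta>1 * (C1 * N)"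
        using approx[OF q sqs sdw qs(2)] mult_left_mono[OF ldw less_imp_le[OF \<eta>1]] by (rule order_trans)
      have 3: "\<bar>(LINT x|?M. g i x * qs i x) + (LINT x|?M. u x * grad (qs i) x $ i)\<bar> \<le> A * h * conformity_const * N"
        unfolding g_def u_def N_def
      proof (rule conformity)
        show "qs i \<in> borel_measurable borel" by (rule tfun_borel[OF qs(1)])
        show "(\<lambda>x. grad (qs i) x $ i) \<in> borel_measurable borel"
          unfolding grad_def using tfun_borel[OF tfun_pd[OF qs(1)]] by simp
      qed (use bz eq in auto)
      have 4: "(LINT x|?M. qs i x * pd i w x) = - (LINT x|?M. pd i (qs i) x * w x)"
        using weak_gradient_tfun[OF o wt] qs(1)[of i] unfolding weak_gradient_def by (simp add: grad_def mult.commute)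
      have "\<bar>(LINT x|?M. pd i (qs i) x * u x) - (LINT x|?M. pd i (qs i) x * w x)\<bar> \<le> A * \<epsilon> * (A0 * (Kp * N))"
      proof (rule defect[OF tfun_pd[OF qs(1)]])
        fix x y
        show "\<bar>pd i (qs i) y - pd i (qs i) x\<bar> \<le> A * norm (y - x)"
          using order_trans[OF component_le_norm_cart[of "grad (qs i) y - grad (qs i) x" i] C11_boundD(3)[OF eq]] by (simp add: grad_def)
        show "x \<notin> S ==> pd i (qs i) x = 0" using Sq(3) by (auto simp: S_def)
      qed
      moreover have "(LINT x|?M. u x * grad (qs i) x $ i) = (LINT x|?M. pd i (qs i) x * u x)"
        by (simp add: grad_def mult.commute)
      moreover have "(LINT x|?M. g i x * qs i x) = (LINT x|?M. qs i x * g i x)" by (simp add: mult.commute)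
      ultimately show ?thesis using 1 2 3 4 unfolding cce by (simp add: algebra_simps)
    qed
    have "\<bar>(\<Sum>i\<in>UNIV. (LINT x|?M. q x $ i * g i x)) - (\<Sum>i\<in>UNIV. (LINT x|?M. q x $ i * pd i w x))\<bar> \<le>
      ?d * (\<eta>1 * (sqrt ?d + C1) * N + A * \<epsilon> * (A0 * (Kp * N)) + A * h * cc * N)"
      unfolding sum_subtractf[symmetric]
      by (rule order_trans[OF sum_abs order_trans[OF sum_mono[OF Q]]]) simp
    then have "\<bar>(LINT x|?M. f x * u x) - (\<Sum>i\<in>UNIV. LINT x|?M. q x $ i * g i x)\<bar> \<le>
      \<eta>1 * (2 * Kp) * N + A * \<epsilon> * (A0 * (Kp * N)) + ?d * (\<eta>1 * (sqrt ?d + C1) * N + A * \<epsilon> * (A0 * (Kp * N)) + A * h * cc * N)"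
      using F weak[OF wt] by linarith
    also have "\<dots> = \<eta>1 * (2 * Kp + ?d * (sqrt ?d + C1)) * N + (1 + ?d) * (A * \<epsilon> * (A0 * (Kp * N))) + ?d * (A * h * cc * N)"
      by (simp add: algebra_simps)
    also have "\<eta>1 * (2 * Kp + ?d * (sqrt ?d + C1)) = \<eta> / 3" unfolding \<eta>1_def by (rule cancel[OF pos1])
    finally have "\<bar>(LINT x|?M. f x * u x) - (\<Sum>i\<in>UNIV. LINT x|?M. q x $ i * g i x)\<bar> \<le> \<eta> * N" using A\<epsilon> hA by linarith
    then show "conformity_defect \<Omega> m f q v v' \<le> \<eta> * dnorm m v v'"
      unfolding u_def g_def N_def conformity_defect_def .
  qed
qed

section \<open>The scheme on a mesh\<close>

text \<open>Gaussian elimination on abstract forms: the form induced on the functions vanishing at \<open>k\<close> by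
  eliminating the unknown at \<open>k\<close> is the Schur complement.\<close>

lemma bilinear_form_solvable:
  fixes a :: "('i => real) => ('i => real) => real" and l :: "('i => real) => real"
  assumes "finite I"
    and "\<And>U V W c. a (\<lambda>i. U i + c * V i) W = a U W + c * a V W"
    and "\<And>U V W c. a W (\<lambda>i. U i + c * V i) = a W U + c * a W V"
    and "\<And>U V c. l (\<lambda>i. U i + c * V i) = l U + c * l V"
    and "\<And>U. (\<And>i. i \<notin> I ==> U i = 0) ==> \<exists>i. U i \<noteq> 0 ==> a U U > 0"
  shows "\<exists>X. (\<forall>i. i \<notin> I --> X i = 0) \<and> (\<forall>V. (\<forall>i. i \<notin> I --> V i = 0) --> a V X = l V)"
  using assms
proof (induction I arbitrary: a l rule: finite_induct)
  case empty
  have zl: "l (\<lambda>_. 0) = 0" using empty.prems(3)[of "\<lambda>_. 0" "-1" "\<lambda>_. 0"] by simp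
  have za: "a (\<lambda>_. 0) X = 0" for X using empty.prems(1)[of "\<lambda>_. 0" "-1" "\<lambda>_. 0" X] by simp
  show ?case
  proof (intro exI[of _ "\<lambda>_. 0"] conjI allI impI)
    fix V :: "'i => real" assume "\<forall>i. i \<notin> {} --> V i = 0"
    then have V: "V = (\<lambda>_. 0)" by auto
    show "a V (\<lambda>_. 0) = l V" unfolding V za zl ..
  qed simp
next
  case (insert k I)
  note a1 = insert.prems(1) and a2 = insert.prems(2) and l1 = insert.prems(3) and pos = insert.prems(4)
  define e :: "'i => real" where "e i = (if i = k then 1 else 0)" for i
  have ek: "a e e > 0" by (rule pos) (auto simp: e_def)
  define b where "b U V = a U V - a U e * a e V / a e e" for U V
  define j where "j V = l V - a V e * l e / a e e" for V
  have "\<exists>X. (\<forall>i. i \<notin> I --> X i = 0) \<and> (\<forall>V. (\<forall>i. i \<notin> I --> V i = 0) --> b V X = j V)"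
  proof (rule insert.IH)
    show "b (\<lambda>i. U i + c * V i) W = b U W + c * b V W" for U V W c
      unfolding b_def a1 by (simp add: algebra_simps add_divide_distrib)
    show "b W (\<lambda>i. U i + c * V i) = b W U + c * b W V" for U V W c
      unfolding b_def a2 by (simp add: algebra_simps add_divide_distrib)
    show "j (\<lambda>i. U i + c * V i) = j U + c * j V" for U V c
      unfolding j_def a1 l1 by (simp add: algebra_simps add_divide_distrib)
    fix U :: "'i => real" assume U: "\<And>i. i \<notin> I ==> U i = 0" "\<exists>i. U i \<noteq> 0"
    \<comment> \<open>With this coefficient \<open>a e\<close> vanishes at the corrected function,
      so that the form there reduces to \<open>b U U\<close>.\<close>
    let ?t = "- a e U / a e e"
    have "0 < a (\<lambda>i. U i + ?t * e i) (\<lambda>i. U i + ?t * e i)"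
    proof (rule pos)
      show "U i + ?t * e i = 0" if "i \<notin> insert k I" for i using that U(1) by (simp add: e_def)
      obtain i where "U i \<noteq> 0" using U(2) by blast
      then show "\<exists>i. U i + ?t * e i \<noteq> 0" using U(1)[of k] insert.hyps(2) by (intro exI[of _ i]) (auto simp: e_def)
    qed
    also have "\<dots> = b U U" unfolding a1 a2 b_def using ek by (simp add: field_simps)
    finally show "b U U > 0" .
  qed
  then obtain X where X: "\<And>i. i \<notin> I ==> X i = 0" "\<And>V. (\<forall>i. i \<notin> I --> V i = 0) ==> b V X = j V" by blast
  \<comment> \<open>Chosen so that the equation tested with \<open>e\<close> holds for
    \<open>Y\<close>.\<close>
  define s where "s = (l e - a e X) / a e e"
  define Y where "Y = (\<lambda>i. X i + s * e i)"
  have Y: "a V Y = a V X + s * a V e" for V unfolding Y_def a2 ..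
  have "a V Y = l V" if V: "\<forall>i. i \<notin> insert k I --> V i = 0" for V
  proof -
    define V0 where "V0 = (\<lambda>i. V i + (- V k) * e i)"
    have "\<forall>i. i \<notin> I --> V0 i = 0" using V by (simp add: V0_def e_def)
    then have "b V0 X = j V0" by (rule X(2))
    then have "a V0 Y = l V0" unfolding Y b_def j_def s_def using ek by (simp add: field_simps)
    moreover have "a e Y = l e" unfolding Y s_def using ek by simp
    moreover have "a V0 Y = a V Y + (- V k) * a e Y" "l V0 = l V + (- V k) * l e" unfolding V0_def a1 l1 by simp_all
    ultimately show ?thesis by simp
  qed
  moreover have "Y i = 0" if "i \<notin> insert k I" for i using that X(1) by (simp add: Y_def e_def)
  ultimately show ?case by blast
qed

text \<open>The bounds concern \<open>W\<close>, the inverse of the mimetic matrix, because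
  eliminating the fluxes leads to a form in \<open>W\<close>.\<close>

locale hmmf_mesh = star_mesh \<Omega> R \<theta> h m + elliptic_tensor \<Omega> \<Lambda> \<zeta> \<mu>
  for \<Omega> :: "(real^'d) set" and R \<theta> h m \<Lambda> \<zeta> \<mu> +
  fixes MM BH BM W :: "(real^'d) set => (real^'d) set => (real^'d) set => real" and s S :: real
  assumes hmmf: "\<And>K. K \<in> cells m ==> hmmf_cell \<theta> m K \<Lambda> \<zeta> \<mu> (MM K) (BH K) (BM K) (W K)"
    and bounds: "\<And>K. K \<in> cells m ==> elliptic_cell.inverse_bounds m K (W K) s S" and s_pos: "s > 0" and S_pos: "S > 0"
begin

text \<open>For a solution of the scheme this vector is the mimetic matrix times the flux vector of
  the cell.\<close>

definition jump :: "((real^'d) set => real) => ((real^'d) set => real) => (real^'d) set => (real^'d) set => real" where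
  "jump u u' K E = area E * (u K - u' E)"

definition form :: "((real^'d) set => real) => ((real^'d) set => real) => ((real^'d) set => real) => ((real^'d) set => real) => real" where
  "form u u' v v' = (\<Sum>K\<in>cells m. bilin (faces m K) (W K) (jump u u' K) (jump v v' K))"

section \<open>Elimination of the fluxes and solvability of the scheme\<close>

lemma sum_jump_power2:
  "K \<in> cells m ==> (\<Sum>E\<in>faces m K. (jump v v' K E)^2 / (area E * dist_face m K E)) =
    (\<Sum>E\<in>faces m K. area E / dist_face m K E * (v' E - v K)^2)"
proof (intro sum.cong refl)
  fix E assume K: "K \<in> cells m" and s: "E \<in> faces m K"
  show "(jump v v' K E)^2 / (area E * dist_face m K E) = area E / dist_face m K E * (v' E - v K)^2"
    unfolding jump_def power_mult_distrib power2_commute[of "v K"] using face(1)[OF K s] by (simp add: power2_eq_square)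
qed

lemma form_bounds:
  shows "s * (dnorm m v v')^2 \<le> form v v' v v'" and "form v v' v v' \<le> S * (dnorm m v v')^2"
proof -
  have "s * (\<Sum>E\<in>faces m K. area E / dist_face m K E * (v' E - v K)^2) \<le> bilin (faces m K) (W K) (jump v v' K) (jump v v' K) \<and>
    bilin (faces m K) (W K) (jump v v' K) (jump v v' K) \<le> S * (\<Sum>E\<in>faces m K. area E / dist_face m K E * (v' E - v K)^2)"
    if K: "K \<in> cells m" for K
  proof -
    interpret hmmf_cell \<theta> m K \<Lambda> \<zeta> \<mu> "MM K" "BH K" "BM K" "W K" by (rule hmmf[OF K])
    show ?thesis using bounds[OF K] unfolding inverse_bounds_def sum_jump_power2[OF K, symmetric] by blast
  qed
  then show "s * (dnorm m v v')^2 \<le> form v v' v v'" "form v v' v v' \<le> S * (dnorm m v v')^2"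
    unfolding form_def dnorm_power2 sum_distrib_left[of s] sum_distrib_left[of S] by (auto intro!: sum_mono)
qed

lemma dnorm_zero_imp:
  assumes bz: "\<And>E. E \<in> all_faces m ==> E \<subseteq> frontier \<Omega> ==> v' E = 0" and N: "dnorm m v v' = 0"
  shows "\<And>K. K \<in> cells m ==> v K = 0" and "\<And>E. E \<in> all_faces m ==> v' E = 0"
proof -
  have "l2 (leb \<Omega>) (pwc m v) \<le> 2 * R * sqrt (real CARD('d) + 1) * dnorm m v v'"
    by (rule discrete_Poincare) (rule bz)
  then have "l2 (leb \<Omega>) (pwc m v) = 0" using N by (intro antisym) auto
  then have "(\<Sum>K\<in>cells m. vol K * (v K)^2) = 0" using pwc_l2(2)[of v] by simp
  then have "\<forall>K\<in>cells m. vol K * (v K)^2 = 0"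
    by (subst (asm) sum_nonneg_eq_0_iff) (auto simp: finite_cells vol_def)
  then show v: "v K = 0" if "K \<in> cells m" for K using cell(8)[OF that] that by fastforce
  fix E assume "E \<in> all_faces m"
  then obtain K where K: "K \<in> cells m" "E \<in> faces m K" unfolding all_faces_def by blast
  have nn: "0 \<le> area \<tau> / dist_face m L \<tau> * (v' \<tau> - v L)^2" if "L \<in> cells m" "\<tau> \<in> faces m L" for L \<tau>
    using face(1,2)[OF that] by simp
  have "(\<Sum>K\<in>cells m. \<Sum>E\<in>faces m K. area E / dist_face m K E * (v' E - v K)^2) = 0"
    unfolding dnorm_power2[symmetric] N by simp
  then have "(\<Sum>E\<in>faces m K. area E / dist_face m K E * (v' E - v K)^2) = 0"
    by (rule sum_nonneg_0[OF finite_cells _ _ K(1), rotated]) (intro sum_nonneg nn)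
  then have "area E / dist_face m K E * (v' E - v K)^2 = 0"
    by (rule sum_nonneg_0[OF cell(5)[OF K(1)] _ _ K(2), rotated]) (rule nn[OF K(1)])
  then show "v' E = 0" using face(1,2)[OF K] v[OF K(1)] by auto
qed

text \<open>The third equation of the scheme expresses the jumps through the fluxes, so pairing with
  \<open>W\<close> leaves the fluxes alone. Balance in the cells gives the right-hand side; the face
  terms cancel by conservativity and the boundary values.\<close>

lemma scheme_form:
  assumes f: "integrable (leb \<Omega>) f" and sol: "scheme_solution \<Omega> f m MM p p' F"
    and bz: "\<And>E. E \<in> all_faces m ==> E \<subseteq> frontier \<Omega> ==> v' E = 0"
  shows "form v v' p p' = (LINT x|leb \<Omega>. f x * pwc m v x)"
proof -
  have cons: "F K E + F L E = 0" if "E \<in> interior_faces m" "K \<in> cells_at m E" "L \<in> cells_at m E" "K \<noteq> L" for E K L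
    using sol that unfolding scheme_solution_def by blast
  have bal: "(\<Sum>E\<in>faces m K. area E * F K E) = integral\<^sup>L (leb K) f" if K: "K \<in> cells m" for K
    using sol K set_integrable_cell(2)[OF cell(3,2)[OF K], of f] unfolding scheme_solution_def by auto
  have con: "bilin (faces m K) (MM K) G (F K) = (\<Sum>E\<in>faces m K. (p K - p' E) * area E * G E)" if K: "K \<in> cells m" for K G
    using sol K unfolding scheme_solution_def by blast
  have "bilin (faces m K) (W K) (jump v v' K) (jump p p' K) =
     v K * integral\<^sup>L (leb K) f - (\<Sum>E\<in>faces m K. v' E * (area E * F K E))" if K: "K \<in> cells m" for K
  proof -
    interpret hmmf_cell \<theta> m K \<Lambda> \<zeta> \<mu> "MM K" "BH K" "BM K" "W K" by (rule hmmf[OF K])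
    have row: "jump p p' K E = (\<Sum>\<tau>\<in>faces m K. MM K E \<tau> * F K \<tau>)" if s: "E \<in> faces m K" for E
    proof -
      \<comment> \<open>Testing with unit vectors gives the third equation row by row.\<close>
      let ?e = "\<lambda>\<tau>. if \<tau> = E then 1 else 0 :: real"
      have "(\<Sum>\<tau>\<in>faces m K. (p K - p' \<tau>) * area \<tau> * ?e \<tau>) = (\<Sum>\<tau>\<in>faces m K. if \<tau> = E then (p K - p' \<tau>) * area \<tau> else 0)"
        by (intro sum.cong) auto
      also have "\<dots> = jump p p' K E" using s finite_faces by (simp add: jump_def)
      finally have 1: "(\<Sum>\<tau>\<in>faces m K. (p K - p' \<tau>) * area \<tau> * ?e \<tau>) = jump p p' K E" .
      have "bilin (faces m K) (MM K) ?e (F K) = (\<Sum>i\<in>faces m K. if i = E then (\<Sum>j\<in>faces m K. MM K i j * F K j) else 0)"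
        unfolding bilin_def by (intro sum.cong) auto
      also have "\<dots> = (\<Sum>\<tau>\<in>faces m K. MM K E \<tau> * F K \<tau>)" using s finite_faces by simp
      finally show ?thesis using con[OF K, of ?e] 1 by simp
    qed
    have "bilin (faces m K) (W K) (jump v v' K) (jump p p' K) = (\<Sum>E\<in>faces m K. jump v v' K E * F K E)"
      by (rule inverse_matrices_solve[OF finite_faces inverse_matrices_sym[OF inverse] row])
    also have "\<dots> = v K * (\<Sum>E\<in>faces m K. area E * F K E) - (\<Sum>E\<in>faces m K. v' E * (area E * F K E))"
      unfolding jump_def sum_distrib_left sum_subtractf[symmetric] by (intro sum.cong refl) (simp add: algebra_simps)
    finally show ?thesis unfolding bal[OF K] .
  qed
  then have "form v v' p p' = (\<Sum>K\<in>cells m. v K * integral\<^sup>L (leb K) f) -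
      (\<Sum>K\<in>cells m. \<Sum>E\<in>faces m K. v' E * (area E * F K E))"
    unfolding form_def by (simp add: sum_subtractf)
  also have "(\<Sum>K\<in>cells m. \<Sum>E\<in>faces m K. v' E * (area E * F K E)) = 0"
  proof (rule sum_faces_cancel[where X = "\<lambda>K E. area E * F K E"])
    fix E K L assume "E \<in> interior_faces m" "K \<in> cells_at m E" "L \<in> cells_at m E" "K \<noteq> L"
    then have "F K E + F L E = 0" by (rule cons)
    then show "area E * F K E + area E * F L E = 0" by (simp add: distrib_left[symmetric])
  qed (rule bz)
  also have "(\<Sum>K\<in>cells m. v K * integral\<^sup>L (leb K) f) = (LINT x|leb \<Omega>. f x * pwc m v x)"
    unfolding integral_cells(1)[OF f, symmetric] by (simp add: mult.commute)
  finally show ?thesis by simp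
qed

text \<open>The unknowns are the cell values and the interior face values, tagged by
  \<open>Inl\<close> and \<open>Inr\<close>; boundary faces lie outside the index set and so get the
  value zero. Coercivity on these unknowns makes the form uniquely positive enough for
  elimination.\<close>

lemma scheme_solution_exists: "\<exists>p p' F. scheme_solution \<Omega> f m MM p p' F"
proof -
  let ?I = "Inl ` cells m \<union> Inr ` interior_faces m :: ((real^'d) set + (real^'d) set) set"
  define b where "b K = (LINT x:K|lebesgue. f x)" for K
  define a where "a V U = form (V \<circ> Inl) (V \<circ> Inr) (U \<circ> Inl) (U \<circ> Inr)" for U V
  define l where "l V = (\<Sum>K\<in>cells m. V (Inl K) * b K)" for V :: "(real^'d) set + (real^'d) set => real"
  have j: "jump ((\<lambda>i. U i + c * V i) \<circ> Inl) ((\<lambda>i. U i + c * V i) \<circ> Inr) K =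
    (\<lambda>E. jump (U \<circ> Inl) (U \<circ> Inr) K E + c * jump (V \<circ> Inl) (V \<circ> Inr) K E)" for U V c K
    by (rule ext) (simp add: jump_def algebra_simps)
  have not_interior: "E \<notin> interior_faces m" if "E \<in> all_faces m" "E \<subseteq> frontier \<Omega>" for E
    using mesh that unfolding polytopal_mesh_def by blast
  have fa: "finite (all_faces m)" unfolding all_faces_def using finite_cells cell(5) by blast
  have "finite ?I" using finite_cells fa by (simp add: interior_faces_def)
  then have "\<exists>X. (\<forall>i. i \<notin> ?I --> X i = 0) \<and> (\<forall>V. (\<forall>i. i \<notin> ?I --> V i = 0) --> a V X = l V)"
  proof (rule bilinear_form_solvable)
    show "a (\<lambda>i. U i + c * V i) X = a U X + c * a V X" for U V X c
      unfolding a_def form_def j bilin_add_left bilin_scale_left sum.distrib sum_distrib_left ..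
    show "a X (\<lambda>i. U i + c * V i) = a X U + c * a X V" for U V X c
      unfolding a_def form_def j bilin_add_right bilin_scale_right sum.distrib sum_distrib_left ..
    show "l (\<lambda>i. U i + c * V i) = l U + c * l V" for U V c
      unfolding l_def by (simp add: algebra_simps sum.distrib sum_distrib_left)
    fix U :: "(real^'d) set + (real^'d) set => real"
    assume U: "\<And>i. i \<notin> ?I ==> U i = 0" "\<exists>i. U i \<noteq> 0"
    have bz: "(U \<circ> Inr) E = 0" if "E \<in> all_faces m" "E \<subseteq> frontier \<Omega>" for E
    proof -
      have "Inr E \<notin> ?I" using not_interior[OF that] by auto
      then show ?thesis unfolding comp_def by (rule U(1))
    qed
    have "dnorm m (U \<circ> Inl) (U \<circ> Inr) \<noteq> 0"
    proof
      assume "dnorm m (U \<circ> Inl) (U \<circ> Inr) = 0"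
      note z = dnorm_zero_imp[OF _ this]
      have "U (Inl K) = 0" if "K \<in> cells m" for K using z(1) bz that by auto
      moreover have "U (Inr E) = 0" if "E \<in> interior_faces m" for E
        using z(2) bz that by (auto simp: interior_faces_def)
      ultimately have "U i = 0" for i using U(1)[of i] by blast
      then show False using U(2) by blast
    qed
    then have "0 < s * (dnorm m (U \<circ> Inl) (U \<circ> Inr))^2" using s_pos by simp
    then show "0 < a U U" unfolding a_def using form_bounds(1) by (rule less_le_trans)
  qed
  then obtain X where X: "\<And>i. i \<notin> ?I ==> X i = 0" "\<And>V. (\<forall>i. i \<notin> ?I --> V i = 0) ==> a V X = l V" by blast
  define p where "p = X \<circ> Inl"
  define p' where "p' = X \<circ> Inr"
  \<comment> \<open>The fluxes are recovered by applying the inverse mimetic matrix to the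
    jumps.\<close>
  define F where "F K E = (\<Sum>\<tau>\<in>faces m K. W K E \<tau> * jump p p' K \<tau>)" for K E
  have bF: "bilin (faces m K) (W K) G (jump p p' K) = (\<Sum>E\<in>faces m K. G E * F K E)" for K G
    unfolding bilin_def F_def sum_distrib_left by (simp add: mult.assoc)
  have test: "(\<Sum>K\<in>cells m. \<Sum>E\<in>faces m K. area E * (V (Inl K) - V (Inr E)) * F K E) = (\<Sum>K\<in>cells m. V (Inl K) * b K)"
    if "\<And>i. i \<notin> ?I ==> V i = 0" for V
    using X(2)[of V] that unfolding a_def l_def form_def p_def[symmetric] p'_def[symmetric] bF by (simp add: jump_def)
  have "scheme_solution \<Omega> f m MM p p' F"
    unfolding scheme_solution_def
  proof (intro conjI ballI impI allI)
    show "p' E = 0" if "E \<in> all_faces m" "E \<subseteq> frontier \<Omega>" for E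
    proof -
      have "Inr E \<notin> ?I" using not_interior[OF that] by auto
      then show ?thesis unfolding p'_def comp_def by (rule X(1))
    qed
  next
    fix E K L assume s: "E \<in> interior_faces m" "K \<in> cells_at m E" "L \<in> cells_at m E" "K \<noteq> L"
    \<comment> \<open>The unit vector of an interior face yields conservativity of the
      fluxes.\<close>
    let ?V = "\<lambda>i :: (real^'d) set + (real^'d) set. if i = Inr E then 1 else 0 :: real"
    have "card (cells_at m E) = 2" using s(1) unfolding interior_faces_def by blast
    then have ca: "cells_at m E = {K, L}" using s by (auto simp: card_2_iff)
    have "(\<Sum>\<tau>\<in>faces m M. area \<tau> * (?V (Inl M) - ?V (Inr \<tau>)) * F M \<tau>) = (if E \<in> faces m M then - (area E * F M E) else 0)"
      if "M \<in> cells m" for M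
    proof -
      have "(\<Sum>\<tau>\<in>faces m M. area \<tau> * (?V (Inl M) - ?V (Inr \<tau>)) * F M \<tau>) = (\<Sum>\<tau>\<in>faces m M. if \<tau> = E then - (area \<tau> * F M \<tau>) else 0)"
        by (intro sum.cong) auto
      then show ?thesis using cell(5)[OF that] by simp
    qed
    then have "(\<Sum>M\<in>cells m. if E \<in> faces m M then - (area E * F M E) else 0) =
      (\<Sum>M\<in>cells m. \<Sum>\<tau>\<in>faces m M. area \<tau> * (?V (Inl M) - ?V (Inr \<tau>)) * F M \<tau>)"
      by (intro sum.cong refl) (rule sym)
    also have "\<dots> = (\<Sum>M\<in>cells m. ?V (Inl M) * b M)" by (rule test) (use s(1) in auto)
    also have "\<dots> = 0" by simp
    finally have "(\<Sum>M\<in>cells m. if E \<in> faces m M then - (area E * F M E) else 0) = 0" .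
    moreover have "(\<Sum>M\<in>cells m. if E \<in> faces m M then - (area E * F M E) else 0) = (\<Sum>M\<in>cells_at m E. - (area E * F M E))"
      unfolding cells_at_def using finite_cells by (intro sum.mono_neutral_cong_right) auto
    ultimately have "area E * (F K E + F L E) = 0" unfolding ca using s(4) by (simp add: algebra_simps)
    moreover have "area E > 0" using s(2) face(1) unfolding cells_at_def by blast
    ultimately show "F K E + F L E = 0" by simp
  next
    fix K assume K: "K \<in> cells m"
    \<comment> \<open>The unit vector of a cell yields the balance in this cell.\<close>
    let ?V = "\<lambda>i :: (real^'d) set + (real^'d) set. if i = Inl K then 1 else 0 :: real"
    have "(\<Sum>M\<in>cells m. \<Sum>\<tau>\<in>faces m M. area \<tau> * (?V (Inl M) - ?V (Inr \<tau>)) * F M \<tau>) =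
      (\<Sum>M\<in>cells m. if M = K then (\<Sum>\<tau>\<in>faces m M. area \<tau> * F M \<tau>) else 0)"
      by (intro sum.cong refl) auto
    also have "\<dots> = (\<Sum>\<tau>\<in>faces m K. area \<tau> * F K \<tau>)" using K finite_cells by simp
    finally have 1: "(\<Sum>M\<in>cells m. \<Sum>\<tau>\<in>faces m M. area \<tau> * (?V (Inl M) - ?V (Inr \<tau>)) * F M \<tau>) = (\<Sum>\<tau>\<in>faces m K. area \<tau> * F K \<tau>)" .
    have "(\<Sum>M\<in>cells m. ?V (Inl M) * b M) = (\<Sum>M\<in>cells m. if M = K then b M else 0)" by (intro sum.cong) auto
    also have "\<dots> = b K" using K finite_cells by simp
    finally show "(\<Sum>E\<in>faces m K. area E * F K E) = (LINT x:K|lebesgue. f x)"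
      unfolding 1[symmetric] b_def[symmetric] using K by (subst test) auto
  next
    fix K G assume K: "K \<in> cells m"
    interpret hmmf_cell \<theta> m K \<Lambda> \<zeta> \<mu> "MM K" "BH K" "BM K" "W K" by (rule hmmf[OF K])
    have "bilin (faces m K) (MM K) G (F K) = (\<Sum>E\<in>faces m K. G E * jump p p' K E)"
      by (rule inverse_matrices_solve[OF finite_faces inverse]) (simp add: F_def)
    also have "\<dots> = (\<Sum>E\<in>faces m K. (p K - p' E) * area E * G E)" by (intro sum.cong refl) (simp add: jump_def)
    finally show "bilin (faces m K) (MM K) G (F K) = (\<Sum>E\<in>faces m K. (p K - p' E) * area E * G E)" .
  qed
  then show ?thesis by blast
qed

end

context hmmf_mesh
begin

section \<open>Stabilisation, interpolation and the error estimate\<close>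

definition dfield :: "((real^'d) set => real) => ((real^'d) set => real) => real^'d => real^'d" where
  "dfield v v' x = (\<Sum>K\<in>cells m. indicator K x *\<^sub>R dgrad m v v' K)"

lemma dfield_component: "dfield v v' x $ i = pwc m (\<lambda>K. dgrad m v v' K $ i) x"
  by (simp add: dfield_def piecewise_constant_def mult.commute)

lemma dfield_cell: "K \<in> cells m ==> x \<in> K ==> dfield v v' x = dgrad m v v' K"
  by (simp add: vec_eq_iff dfield_component pwc_cell)

lemma dfield_L2:
  shows "L2_on \<Omega> (dfield v v')" and "l2 (leb \<Omega>) (\<lambda>x. norm (dfield v v' x)) \<le> sqrt (CARD('d)) * dnorm m v v'"
proof -
  let ?p = "pwc m (\<lambda>K. norm (dgrad m v v' K))"
  have b: "dfield v v' \<in> borel_measurable borel"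
    unfolding dfield_def using cell(7)
    by (intro borel_measurable_sum borel_measurable_scaleR borel_measurable_const borel_measurable_indicator)
  have m: "dfield v v' \<in> borel_measurable (leb \<Omega>)"
    by (rule measurable_restrict_space1) (use b in \<open>simp add: measurable_completion\<close>)
  have ae: "AE x in leb \<Omega>. \<bar>norm (dfield v v' x)\<bar> \<le> \<bar>?p x\<bar>"
    using AE_cells by eventually_elim (auto simp: dfield_cell pwc_cell)
  note mono = sq_int_mono[OF pwc_l2(1) borel_measurable_norm[THEN measurable_compose[OF m]] ae]
  show "L2_on \<Omega> (dfield v v')" using m mono(1) by (simp add: L2_on_def sq_int_def)
  show "l2 (leb \<Omega>) (\<lambda>x. norm (dfield v v' x)) \<le> sqrt (CARD('d)) * dnorm m v v'"
    using mono(2) dgrad_l2(2)[of v v'] by simp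
qed

lemma D_op_jump: "D_op m K (jump u u' K) = - dgrad m u u' K"
proof -
  have "jump u u' K E *\<^sub>R outward_normal K E = - ((area E * (u' E - u K)) *\<^sub>R outward_normal K E)" for E
    unfolding jump_def by (simp add: algebra_simps)
  then show ?thesis unfolding dgrad_def D_op_def by (simp add: sum_negf)
qed

abbreviation stab :: "((real^'d) set => real) => ((real^'d) set => real) => ((real^'d) set => real) => ((real^'d) set => real) => (real^'d) set => real" where
  "stab u u' v v' K \<equiv> bilin (faces m K) (BH K) (L_op m K (jump u u' K)) (L_op m K (jump v v' K))"

text \<open>The discrete gradients are constant in each cell, so under the integral the mean tensor
  may be replaced by the tensor itself.\<close>

lemma form_split:
  "form u u' v v' = (LINT x|leb \<Omega>. (\<Lambda> x *v dfield u u' x) \<bullet> dfield v v' x) + (\<Sum>K\<in>cells m. stab u u' v v' K)"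
proof -
  have "bilin (faces m K) (W K) (jump u u' K) (jump v v' K) =
     (LINT x|leb K. (\<Lambda> x *v dfield u u' x) \<bullet> dfield v v' x) + stab u u' v v' K" if K: "K \<in> cells m" for K
  proof -
    interpret hmmf_cell \<theta> m K \<Lambda> \<zeta> \<mu> "MM K" "BH K" "BM K" "W K" by (rule hmmf[OF K])
    have "(LINT x|leb K. (\<Lambda> x *v dfield u u' x) \<bullet> dfield v v' x) =
      (LINT x|leb K. (\<Lambda> x *v dgrad m u u' K) \<bullet> dgrad m v v' K)"
      using K by (intro Bochner_Integration.integral_cong) (auto simp: dfield_cell)
    also have "\<dots> = vol K * ((mean_tensor \<Lambda> K *v dgrad m u u' K) \<bullet> dgrad m v v' K)"
      unfolding mean_tensor_inner(1)[OF cell(3,2)[OF K]] using vol_pos by simp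
    also have "\<dots> = vol K * ((mean_tensor \<Lambda> K *v D_op m K (jump u u' K)) \<bullet> D_op m K (jump v v' K))"
      unfolding D_op_jump linear_neg[OF matrix_vector_mul_linear] by simp
    finally show ?thesis unfolding W_eq' by simp
  qed
  then show ?thesis
    unfolding form_def integral_cells(3)[OF tensor_form(1)[OF dfield_L2(1) dfield_L2(1)]] by (simp add: sum.distrib)
qed

lemma stab_bounds:
  assumes K: "K \<in> cells m"
  shows "0 \<le> stab u u' u u' K"
    and "stab u u' u u' K \<le> S * (\<Sum>E\<in>faces m K. area E / dist_face m K E * (L_op m K (jump u u' K) E)^2)"
    and "stab u u' u u' K \<le> S * (\<Sum>E\<in>faces m K. area E / dist_face m K E * (u' E - u K)^2)"
    and "\<bar>stab u u' v v' K\<bar> \<le> sqrt (stab u u' u u' K) * sqrt (stab v v' v v' K)"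
proof -
  interpret hmmf_cell \<theta> m K \<Lambda> \<zeta> \<mu> "MM K" "BH K" "BM K" "W K" by (rule hmmf[OF K])
  note ib = bounds[OF K]
  show 0: "0 \<le> stab u u' u u' K" for u u' by (rule sym_pos_def_bilin(2)[OF BH_spd])
  show "stab u u' u u' K \<le> S * (\<Sum>E\<in>faces m K. area E / dist_face m K E * (L_op m K (jump u u' K) E)^2)"
    using inverse_imp_hybrid[OF ib] unfolding hybrid_bounds_def by blast
  \<comment> \<open>Dropping the nonnegative consistent term leaves the stabilisation below the full
    form.\<close>
  have "0 \<le> \<zeta> * (norm (D_op m K (jump u u' K)))^2" using zeta_pos by simp
  also have "\<dots> \<le> (mean_tensor \<Lambda> K *v D_op m K (jump u u' K)) \<bullet> D_op m K (jump u u' K)" by (rule mean_coercive)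
  finally have "stab u u' u u' K \<le> bilin (faces m K) (W K) (jump u u' K) (jump u u' K)"
    unfolding W_eq' using vol_pos by simp
  also have "\<dots> \<le> S * (\<Sum>E\<in>faces m K. area E / dist_face m K E * (u' E - u K)^2)"
    unfolding sum_jump_power2[OF K, symmetric] using ib unfolding inverse_bounds_def by blast
  finally show "stab u u' u u' K \<le> S * (\<Sum>E\<in>faces m K. area E / dist_face m K E * (u' E - u K)^2)" .
  have "(stab u u' v v' K)^2 \<le> stab u u' u u' K * stab v v' v v' K"
    by (rule bilin_Cauchy_Schwarz) (rule sym_pos_def_bilin[OF BH_spd])+
  also have "\<dots> = (sqrt (stab u u' u u' K) * sqrt (stab v v' v v' K))^2" using 0 by (simp add: power_mult_distrib)
  finally have "\<bar>stab u u' v v' K\<bar>\<^sup>2 \<le> (sqrt (stab u u' u u' K) * sqrt (stab v v' v v' K))^2" by simp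
  then show "\<bar>stab u u' v v' K\<bar> \<le> sqrt (stab u u' u u' K) * sqrt (stab v v' v v' K)"
    by (rule power2_le_imp_le) (use 0 in simp)
qed

lemma sum_stab_le:
  assumes B: "(\<Sum>K\<in>cells m. stab v v' v v' K) \<le> B"
  shows "\<bar>\<Sum>K\<in>cells m. stab u u' v v' K\<bar> \<le> sqrt S * dnorm m u u' * sqrt B"
proof -
  let ?a = "\<lambda>K. sqrt (stab u u' u u' K)" and ?b = "\<lambda>K. sqrt (stab v v' v v' K)"
  have "\<bar>\<Sum>K\<in>cells m. stab u u' v v' K\<bar> \<le> (\<Sum>K\<in>cells m. ?a K * ?b K)"
    by (rule order_trans[OF sum_abs]) (intro sum_mono stab_bounds(4))
  also have "\<dots> \<le> sqrt S * dnorm m u u' * sqrt B"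
  proof (rule power2_le_imp_le)
    have "(\<Sum>K\<in>cells m. ?a K * ?b K)^2 \<le> (\<Sum>K\<in>cells m. (?a K)^2 / 1) * (\<Sum>K\<in>cells m. 1 * (?b K)^2)"
      by (rule weighted_sum_mult_power2_le) simp
    also have "\<dots> = (\<Sum>K\<in>cells m. stab u u' u u' K) * (\<Sum>K\<in>cells m. stab v v' v v' K)"
      using stab_bounds(1) by simp
    also have "\<dots> \<le> (S * (dnorm m u u')^2) * B"
    proof (rule mult_mono)
      show "(\<Sum>K\<in>cells m. stab u u' u u' K) \<le> S * (dnorm m u u')^2"
        unfolding dnorm_power2 sum_distrib_left[of S _ "cells m"] by (rule sum_mono) (rule stab_bounds(3))
      show "0 \<le> (\<Sum>K\<in>cells m. stab v v' v v' K)" by (rule sum_nonneg) (rule stab_bounds(1))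
    qed (use B S_pos in auto)
    also have "\<dots> = (sqrt S * dnorm m u u' * sqrt B)^2"
      using S_pos order_trans[OF sum_nonneg[OF stab_bounds(1)] B] by (simp add: power_mult_distrib)
    finally show "(\<Sum>K\<in>cells m. ?a K * ?b K)^2 \<le> (sqrt S * dnorm m u u' * sqrt B)^2" .
    have "0 \<le> B" by (rule order_trans[OF sum_nonneg[OF stab_bounds(1)] B])
    then show "0 \<le> sqrt S * dnorm m u u' * sqrt B" using S_pos dnorm_nonneg by simp
  qed
  finally show ?thesis .
qed

text \<open>The constants of \<open>L_op_bounds\<close> applied to the Taylor remainder
  \<open>Q\<close> in \<open>interpolation\<close>.\<close>

definition stab_const :: real where "stab_const = 2 * \<theta>^2 * CARD('d) + 2 * \<theta> ^ 4 * CARD('d) ^ 3"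

text \<open>Affine functions have the exact discrete gradient and no stabilisation. Hence only the
  Taylor remainder at the barycentres counts, which is at most \<open>C * h * \<theta>\<close> times
  the distance of the face.\<close>

lemma interpolation:
  fixes \<phi> :: "real^'d => real"
  defines "u \<equiv> (\<lambda>K. \<phi> (point m K))" and "u' \<equiv> (\<lambda>E. \<phi> (barycentre E))"
  assumes C11: "C11_bound C \<phi> (grad \<phi>)" and K: "K \<in> cells m"
  shows "norm (dgrad m u u' K - grad \<phi> (point m K)) \<le> CARD('d) * \<theta> * (C * h)"
    and "stab u u' u u' K \<le> S * (C * h)^2 * stab_const * vol K"
proof -
  interpret hmmf_cell \<theta> m K \<Lambda> \<zeta> \<mu> "MM K" "BH K" "BM K" "W K" by (rule hmmf[OF K])
  note C = C11_boundD(1,4)[OF C11]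
  let ?F = "faces m K" and ?r = "\<lambda>E. barycentre E - point m K" and ?g = "grad \<phi> (point m K)"
  define e where "e E = \<phi> (barycentre E) - \<phi> (point m K) - ?g \<bullet> ?r E" for E
  define Q where "Q E = area E * e E" for E
  have e_le: "\<bar>e E\<bar> \<le> C * h * \<theta> * dist_face m K E" if s: "E \<in> ?F" for E
  proof -
    have "\<bar>e E\<bar> \<le> C * (norm (?r E))^2" unfolding e_def by (rule C(2))
    also have "\<dots> \<le> C * (h * \<theta> * dist_face m K E)" using C(1) face(6)[OF K s] by (intro mult_left_mono) auto
    finally show ?thesis by (simp add: mult_ac)
  qed
  have sE: "(\<Sum>E\<in>?F. (Q E)^2 / (area E * dist_face m K E)) \<le> (C * h * \<theta>)^2 * (CARD('d) * vol K)"
  proof -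
    have "(\<Sum>E\<in>?F. (Q E)^2 / (area E * dist_face m K E)) \<le> (\<Sum>E\<in>?F. (C * h * \<theta>)^2 * (area E * dist_face m K E))"
    proof (rule sum_mono)
      fix E assume s: "E \<in> ?F"
      note f = face(1,2)[OF K s]
      have "\<bar>e E\<bar>\<^sup>2 \<le> (C * h * \<theta> * dist_face m K E)^2" by (rule power_mono[OF e_le[OF s]]) simp
      then have "(e E)^2 * (area E / dist_face m K E) \<le> (C * h * \<theta> * dist_face m K E)^2 * (area E / dist_face m K E)"
        using f by (intro mult_right_mono) auto
      moreover have "(Q E)^2 / (area E * dist_face m K E) = (e E)^2 * (area E / dist_face m K E)"
        unfolding Q_def power_mult_distrib using f by (simp add: power2_eq_square)
      moreover have "(C * h * \<theta> * dist_face m K E)^2 * (area E / dist_face m K E) = (C * h * \<theta>)^2 * (area E * dist_face m K E)"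
        unfolding power_mult_distrib[of _ "dist_face m K E"] using f by (simp add: power2_eq_square)
      ultimately show "(Q E)^2 / (area E * dist_face m K E) \<le> (C * h * \<theta>)^2 * (area E * dist_face m K E)" by simp
    qed
    also have "\<dots> = (C * h * \<theta>)^2 * (CARD('d) * vol K)"
      using regular_cell.sum_area_dist[OF cell(1)[OF K]] by (simp add: sum_distrib_left[symmetric])
    finally show ?thesis .
  qed
  have DE: "(norm (D_op m K Q))^2 \<le> (CARD('d) * \<theta> * (C * h))^2"
  proof -
    have "(norm (D_op m K Q))^2 \<le> CARD('d) / vol K * ((C * h * \<theta>)^2 * (CARD('d) * vol K))"
      using sE vol_pos by (intro order_trans[OF D_op_le] mult_left_mono) auto
    also have "\<dots> = (CARD('d) * \<theta> * (C * h))^2" using vol_pos by (simp add: power_mult_distrib power2_eq_square)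
    finally show ?thesis .
  qed
  have dg: "dgrad m u u' K = ?g + D_op m K Q"
  proof -
    have "(area E * (u' E - u K)) *\<^sub>R outward_normal K E =
      (area E * (?g \<bullet> ?r E)) *\<^sub>R outward_normal K E + Q E *\<^sub>R outward_normal K E" for E
      unfolding scaleR_add_left[symmetric] Q_def e_def u_def u'_def by (simp add: algebra_simps)
    then show ?thesis unfolding dgrad_def D_op_def using sum_area_r_normal[of ?g] vol_pos
      by (simp add: sum.distrib scaleR_add_right)
  qed
  have "norm (D_op m K Q) \<le> CARD('d) * \<theta> * (C * h)"
    by (rule power2_le_imp_le[OF DE]) (use C theta_pos size_nonneg in simp)
  then show "norm (dgrad m u u' K - ?g) \<le> CARD('d) * \<theta> * (C * h)" unfolding dg by simp
  \<comment> \<open>The affine part of the interpolate is annihilated by \<open>L_op\<close>; the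
    sign is lost in the square.\<close>
  have L: "(L_op m K (jump u u' K) E)^2 = (L_op m K Q E)^2" if s: "E \<in> ?F" for E
  proof -
    have "jump u u' K E / area E = - (Q E / area E + ?g \<bullet> ?r E)"
      using face(1)[OF K s] unfolding jump_def Q_def e_def u_def u'_def by simp
    then have "L_op m K (jump u u' K) E = - L_op m K Q E"
      unfolding L_op_def D_op_jump dg by (simp add: inner_add_left inner_diff_left)
    then show ?thesis by simp
  qed
  have "(\<Sum>E\<in>?F. area E / dist_face m K E * (L_op m K (jump u u' K) E)^2) = (\<Sum>E\<in>?F. area E / dist_face m K E * (L_op m K Q E)^2)"
    using L by (intro sum.cong) auto
  also have "\<dots> \<le> 2 * ((C * h * \<theta>)^2 * (CARD('d) * vol K)) + 2 * (\<theta>^2 * CARD('d) * vol K * (CARD('d) * \<theta> * (C * h))^2)"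
    using vol_pos by (intro order_trans[OF L_op_bounds(1)] add_mono mult_left_mono sE DE) auto
  also have "\<dots> = (C * h)^2 * stab_const * vol K"
    unfolding stab_const_def by (simp add: power_mult_distrib algebra_simps power2_eq_square power3_eq_cube power4_eq_xxxx)
  finally have "S * (\<Sum>E\<in>?F. area E / dist_face m K E * (L_op m K (jump u u' K) E)^2) \<le> S * ((C * h)^2 * stab_const * vol K)"
    using S_pos by (intro mult_left_mono) auto
  then show "stab u u' u u' K \<le> S * (C * h)^2 * stab_const * vol K"
    using stab_bounds(2)[OF K, of u u'] by (simp add: mult.assoc)
qed

text \<open>A non-convex face may miss its own barycentre, so the vanishing of a test function there
  has to come from the nearby complement.\<close>

lemma barycentre_boundary:
  assumes E: "E \<in> all_faces m" "E \<subseteq> frontier \<Omega>"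
  shows "\<exists>y. y \<notin> \<Omega> \<and> norm (barycentre E - y) \<le> h"
proof -
  obtain K where K: "K \<in> cells m" "E \<in> faces m K" using E(1) unfolding all_faces_def by blast
  have cf: "cell_face K E" by (rule polytopal_mesh_cell(7)[OF mesh K])
  then obtain y where y: "y \<in> E" unfolding cell_face_def by blast
  have cl: "E \<subseteq> closure K" using cf unfolding cell_face_def frontier_def by blast
  have "norm (barycentre E - y) \<le> diameter K"
  proof (rule mesh_face_data(4)[OF mesh K(1) bounded_domain star[OF K(1)] K(2)])
    fix x assume "x \<in> E"
    then show "norm (x - y) \<le> diameter K" using cl y cell(6)[OF K(1)] by (intro norm_diff_le_diameter) auto
  qed
  moreover have "y \<notin> \<Omega>" using y E(2) open_domain by (auto simp: frontier_def interior_open)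
  ultimately show ?thesis using diameter_le_size[OF K(1)] by fastforce
qed

text \<open>Coercivity is applied to the difference of the solution and the interpolate of \<phi>.
  The scheme turns its form into the residual against the interpolate, which splits into the
  conformity defect, the distance of the interpolated gradient from \<open>g\<close>, and the
  stabilisation of the interpolate. Each is linear in the discrete norm \<open>N\<close> of the
  difference.\<close>

lemma error_estimate:
  fixes \<phi> :: "real^'d => real" and g :: "real^'d => real^'d"
  defines "u \<equiv> (\<lambda>K. \<phi> (point m K))" and "u' \<equiv> (\<lambda>E. \<phi> (barycentre E))"
  assumes f: "integrable (leb \<Omega>) f" and sol: "scheme_solution \<Omega> f m MM p p' F"
    and g: "L2_on \<Omega> g"
    and \<eta>: "\<eta> \<ge> 0" and defect: "\<And>v v'. (\<And>E. E \<in> all_faces m ==> E \<subseteq> frontier \<Omega> ==> v' E = 0) ==>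
      conformity_defect \<Omega> m f (\<lambda>x. \<Lambda> x *v g x) v v' \<le> \<eta> * dnorm m v v'"
    and \<phi>: "tfun \<Omega> \<phi>" and C11: "C11_bound C \<phi> (grad \<phi>)"
    and supp: "\<And>x y. \<phi> x \<noteq> 0 ==> y \<notin> \<Omega> ==> h < norm (x - y)"
    and \<eta>2: "l2 (leb \<Omega>) (\<lambda>x. norm (grad \<phi> x - g x)) \<le> \<eta>2"
  shows "s * dnorm m (\<lambda>K. p K - u K) (\<lambda>E. p' E - u' E) \<le>
      \<eta> + \<mu> * sqrt (CARD('d)) * ((CARD('d) * \<theta> + 1) * (C * h) * sqrt (vol \<Omega>) + \<eta>2) + S * (C * h) * sqrt (stab_const * vol \<Omega>)"
    and "l2 (leb \<Omega>) (\<lambda>x. pwc m p x - \<phi> x) \<le>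
      2 * R * sqrt (real CARD('d) + 1) * dnorm m (\<lambda>K. p K - u K) (\<lambda>E. p' E - u' E) + C * h * sqrt (vol \<Omega>)"
proof -
  let ?M = "leb \<Omega>"
  note C = C11_boundD[OF C11]
  define e where "e = (\<lambda>K. p K - u K)"
  define e' where "e' = (\<lambda>E. p' E - u' E)"
  define N where "N = dnorm m e e'"
  have N0: "N \<ge> 0" unfolding N_def by (rule dnorm_nonneg)
  have Ch: "C * h \<ge> 0" using C(1) size_nonneg by simp
  have fm: "finite_measure ?M" using lebesgue_on_finite open_domain bounded_domain by blast
  have mM: "measure ?M (space ?M) = vol \<Omega>" using open_domain by (simp add: vol_def measure_restrict_space)
  \<comment> \<open>By \<open>supp\<close> the function \<phi> vanishes within distance
    \<open>h\<close> of the complement, and the barycentre of a boundary face lies there.\<close>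
  have bu: "u' E = 0" if "E \<in> all_faces m" "E \<subseteq> frontier \<Omega>" for E
    using barycentre_boundary[OF that] supp unfolding u'_def by (meson not_le)
  have be: "e' E = 0" if "E \<in> all_faces m" "E \<subseteq> frontier \<Omega>" for E
    using sol that bu[OF that] unfolding scheme_solution_def e'_def by auto
  have \<phi>g: "L2_on \<Omega> (grad \<phi>)" by (rule tfun_sq_int(2)[OF open_domain bounded_domain \<phi>])
  have dist_pt: "norm (x - point m K) \<le> h" if "K \<in> cells m" "x \<in> K" for x K
  proof -
    have "norm (x - point m K) \<le> diameter K" using that cell[OF that(1)] closure_subset by (intro norm_diff_le_diameter) auto
    then show ?thesis using diameter_le_size[OF that(1)] by simp
  qed
  have je: "jump e e' K = (\<lambda>E. jump p p' K E + (-1) * jump u u' K E)" for K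
    by (rule ext) (simp add: jump_def e_def e'_def algebra_simps)
  have "form e e' e e' = form e e' p p' - form e e' u u'"
    unfolding form_def je[of _] bilin_add_right bilin_scale_right by (simp add: sum_subtractf sum.distrib sum_negf)
  also have "form e e' p p' = (LINT x|?M. f x * pwc m e x)" by (rule scheme_form[OF f sol be])
  finally have fe: "form e e' e e' = (LINT x|?M. f x * pwc m e x) -
    ((LINT x|?M. (\<Lambda> x *v dfield e e' x) \<bullet> dfield u u' x) + (\<Sum>K\<in>cells m. stab e e' u u' K))"
    unfolding form_split[of e e' u u'] .
  let ?T = "LINT x|?M. (\<Lambda> x *v dfield e e' x) \<bullet> g x"
  let ?s = "\<lambda>x i. (\<Lambda> x *v g x) $ i * pwc m (\<lambda>K. dgrad m e e' K $ i) x"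
  \<comment> \<open>The components recombine to an inner product, and symmetry moves the tensor from
    \<open>g\<close> to the discrete gradient.\<close>
  have T: "(\<Sum>i\<in>UNIV. LINT x|?M. ?s x i) = ?T"
  proof -
    have "(\<Sum>i\<in>UNIV. LINT x|?M. ?s x i) =
      (LINT x|?M. (\<Sum>i\<in>UNIV. ?s x i))"
      by (rule Bochner_Integration.integral_sum[symmetric])
         (intro sq_int_mult L2_on_vec(2) tensor_form(3)[OF g g] pwc_l2(1))
    also have "\<dots> = ?T"
    proof (rule Bochner_Integration.integral_cong[OF refl])
      fix x assume "x \<in> space ?M"
      then have "x \<in> \<Omega>" by simp
      have "(\<Sum>i\<in>UNIV. ?s x i) = (\<Lambda> x *v g x) \<bullet> dfield e e' x"
        unfolding inner_vec_def dfield_component by simp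
      also have "\<dots> = g x \<bullet> (\<Lambda> x *v dfield e e' x)" by (rule tensor_inner_sym[OF \<open>x \<in> \<Omega>\<close>])
      finally show "(\<Sum>i\<in>UNIV. ?s x i) = (\<Lambda> x *v dfield e e' x) \<bullet> g x"
        by (simp only: inner_commute)
    qed
    finally show ?thesis .
  qed
  have d1: "\<bar>(LINT x|?M. f x * pwc m e x) - ?T\<bar> \<le> \<eta> * N"
    unfolding T[symmetric] N_def conformity_defect_def[symmetric] by (rule defect) (rule be)
  define dI where "dI = dfield u u'"
  have LI: "L2_on \<Omega> dI" unfolding dI_def by (rule dfield_L2)
  have LIg: "L2_on \<Omega> (\<lambda>x. dI x - g x)" by (rule L2_on_vec_diff(1)[OF LI g])
  have d2: "l2 ?M (\<lambda>x. norm (dI x - g x)) \<le> (CARD('d) * \<theta> + 1) * (C * h) * sqrt (vol \<Omega>) + \<eta>2"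
  proof -
    note D1 = L2_on_vec_diff(1)[OF LI \<phi>g] and D2 = L2_on_vec_diff(1)[OF g \<phi>g]
    have "AE x in ?M. \<bar>norm (dI x - grad \<phi> x)\<bar> \<le> (CARD('d) * \<theta> + 1) * (C * h)"
      using AE_cells
    proof eventually_elim
      case (elim x)
      then obtain K where K: "K \<in> cells m" "x \<in> K" by blast
      have "norm (dI x - grad \<phi> x) \<le> norm (dgrad m u u' K - grad \<phi> (point m K)) + norm (grad \<phi> (point m K) - grad \<phi> x)"
        unfolding dI_def dfield_cell[OF K] by (rule norm_triangle_sub[of _ "dgrad m u u' K - grad \<phi> (point m K)", simplified, THEN order_trans]) simp
      also have "\<dots> \<le> CARD('d) * \<theta> * (C * h) + C * h"
      proof (rule add_mono)
        show "norm (dgrad m u u' K - grad \<phi> (point m K)) \<le> CARD('d) * \<theta> * (C * h)"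
          unfolding u_def u'_def by (rule interpolation(1)[OF C11 K(1)])
        have "norm (grad \<phi> (point m K) - grad \<phi> x) \<le> C * norm (x - point m K)"
          using C(3)[of "point m K" x] by (simp add: norm_minus_commute)
        also have "\<dots> \<le> C * h" using C(1) dist_pt[OF K] by (intro mult_left_mono) auto
        finally show "norm (grad \<phi> (point m K) - grad \<phi> x) \<le> C * h" .
      qed
      finally show ?case by (simp add: algebra_simps)
    qed
    then have "l2 ?M (\<lambda>x. norm (dI x - grad \<phi> x)) \<le> (CARD('d) * \<theta> + 1) * (C * h) * sqrt (vol \<Omega>)"
      unfolding mM[symmetric] using Ch theta_pos L2_on_vec(1)[OF D1]
      by (intro sq_int_bounded(2)[OF fm]) (auto simp: sq_int_def)
    moreover have "l2 ?M (\<lambda>x. norm (dI x - g x)) \<le> l2 ?M (\<lambda>x. norm (dI x - grad \<phi> x)) + l2 ?M (\<lambda>x. norm (g x - grad \<phi> x))"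
      using L2_on_vec_diff(2)[OF D1 D2] by simp
    ultimately show ?thesis using \<eta>2 by (simp add: norm_minus_commute)
  qed
  have d3: "\<bar>?T - (LINT x|?M. (\<Lambda> x *v dfield e e' x) \<bullet> dI x)\<bar> \<le>
    \<mu> * sqrt (CARD('d)) * ((CARD('d) * \<theta> + 1) * (C * h) * sqrt (vol \<Omega>) + \<eta>2) * N"
  proof -
    have "(LINT x|?M. (\<Lambda> x *v dfield e e' x) \<bullet> dI x) - ?T = (LINT x|?M. (\<Lambda> x *v dfield e e' x) \<bullet> (dI x - g x))"
      unfolding inner_diff_right
      by (rule Bochner_Integration.integral_diff[symmetric]) (intro tensor_form(1) dfield_L2 LI g)+
    then have "\<bar>?T - (LINT x|?M. (\<Lambda> x *v dfield e e' x) \<bullet> dI x)\<bar> \<le>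
      \<mu> * (l2 ?M (\<lambda>x. norm (dfield e e' x)) * l2 ?M (\<lambda>x. norm (dI x - g x)))"
      using tensor_form(2)[OF dfield_L2(1) LIg, of e e'] by (simp add: abs_minus_commute)
    also have "\<dots> \<le> \<mu> * ((sqrt (CARD('d)) * N) * ((CARD('d) * \<theta> + 1) * (C * h) * sqrt (vol \<Omega>) + \<eta>2))"
      using mu_pos N0 dfield_L2(2)[of e e'] d2 unfolding N_def[symmetric] by (intro mult_left_mono mult_mono) auto
    finally show ?thesis by (simp add: mult_ac)
  qed
  have d4: "\<bar>\<Sum>K\<in>cells m. stab e e' u u' K\<bar> \<le> S * (C * h) * sqrt (stab_const * vol \<Omega>) * N"
  proof -
    have "(\<Sum>K\<in>cells m. stab u u' u u' K) \<le> (\<Sum>K\<in>cells m. S * (C * h)^2 * stab_const * vol K)"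
      unfolding u_def u'_def by (intro sum_mono interpolation(2)[OF C11])
    also have "\<dots> = S * (C * h)^2 * (stab_const * vol \<Omega>)" unfolding sum_vol[symmetric] by (simp add: sum_distrib_left mult.assoc)
    finally have "\<bar>\<Sum>K\<in>cells m. stab e e' u u' K\<bar> \<le> sqrt S * N * sqrt (S * (C * h)^2 * (stab_const * vol \<Omega>))"
      unfolding N_def by (rule sum_stab_le)
    also have "\<dots> = S * (C * h) * sqrt (stab_const * vol \<Omega>) * N"
    proof -
      have "sqrt S * sqrt S = S" using S_pos by simp
      moreover have "sqrt ((C * h)^2) = C * h" using Ch by simp
      ultimately show ?thesis unfolding real_sqrt_mult[of _ "stab_const * vol \<Omega>"] real_sqrt_mult[of S] by (metis mult.assoc mult.commute)
    qed
    finally show ?thesis .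
  qed
  define X where "X = \<eta> + \<mu> * sqrt (CARD('d)) * ((CARD('d) * \<theta> + 1) * (C * h) * sqrt (vol \<Omega>) + \<eta>2) + S * (C * h) * sqrt (stab_const * vol \<Omega>)"
  have "form e e' e e' \<le> X * N" unfolding fe X_def using d1 d3 d4 unfolding dI_def
    by (simp add: distrib_right)
  then have sN: "s * N * N \<le> X * N" using form_bounds(1)[of e e'] unfolding N_def[symmetric] by (simp add: power2_eq_square)
  \<comment> \<open>Division by \<open>N\<close>; for \<open>N = 0\<close> the claim is that
    \<open>X\<close> is nonnegative.\<close>
  have "s * N \<le> X"
  proof (cases "N = 0")
    case False
    then show ?thesis using sN N0 by (auto dest: mult_right_le_imp_le)
  next
    case True
    have "dnorm m (\<lambda>_. 0) (\<lambda>_. 0) = 0" by (simp add: dnorm_def)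
    have "0 \<le> \<eta>2" using \<eta>2 by (rule order_trans[OF l2_nonneg])
    moreover have "0 \<le> stab_const * vol \<Omega>" using theta_pos by (simp add: stab_const_def vol_def)
    ultimately show ?thesis unfolding True X_def using \<eta> mu_pos S_pos Ch theta_pos
      by (simp add: vol_def add_nonneg_nonneg)
  qed
  then show "s * dnorm m (\<lambda>K. p K - u K) (\<lambda>E. p' E - u' E) \<le>
      \<eta> + \<mu> * sqrt (CARD('d)) * ((CARD('d) * \<theta> + 1) * (C * h) * sqrt (vol \<Omega>) + \<eta>2) + S * (C * h) * sqrt (stab_const * vol \<Omega>)"
    unfolding X_def N_def e_def e'_def .
  have su: "sq_int ?M (pwc m u)" and sp: "sq_int ?M (pwc m p)"
    by (rule pwc_l2(1))+
  have s\<phi>: "sq_int ?M \<phi>" by (rule tfun_sq_int(1)[OF open_domain bounded_domain \<phi>])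
  have "AE x in ?M. \<bar>pwc m u x - \<phi> x\<bar> \<le> C * h"
    using AE_cells
  proof eventually_elim
    case (elim x)
    then obtain K where K: "K \<in> cells m" "x \<in> K" by blast
    have "\<bar>\<phi> (point m K) - \<phi> x\<bar> \<le> C * norm (x - point m K)" using C(2)[of "point m K" x] by (simp add: norm_minus_commute)
    also have "\<dots> \<le> C * h" using C(1) dist_pt[OF K] by (intro mult_left_mono) auto
    finally show ?case unfolding pwc_cell[OF K] u_def .
  qed
  then have l1: "l2 ?M (\<lambda>x. pwc m u x - \<phi> x) \<le> C * h * sqrt (vol \<Omega>)"
    unfolding mM[symmetric] using Ch sq_int_diff[OF su s\<phi>]
    by (intro sq_int_bounded(2)[OF fm]) (auto simp: sq_int_def)
  have "(\<lambda>x. pwc m p x - pwc m u x) = pwc m e"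
    by (rule ext) (simp add: piecewise_constant_def e_def left_diff_distrib sum_subtractf)
  then have "l2 ?M (\<lambda>x. pwc m p x - pwc m u x) \<le> 2 * R * sqrt (real CARD('d) + 1) * N"
    using discrete_Poincare[of e' e] be unfolding N_def by simp
  then show "l2 ?M (\<lambda>x. pwc m p x - \<phi> x) \<le>
      2 * R * sqrt (real CARD('d) + 1) * dnorm m (\<lambda>K. p K - u K) (\<lambda>E. p' E - u' E) + C * h * sqrt (vol \<Omega>)"
    using l2_triangle_diff[OF sp su s\<phi>] l1 unfolding N_def e_def e'_def by linarith
qed

end

section \<open>Convergence\<close>

context elliptic_tensor
begin

text \<open>The test function \<phi> close to the weak solution is fixed before the mesh. Then every
  term of \<open>error_estimate\<close> is small by the choice of \<phi>, small by limit conformity,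
  or proportional to \<open>h\<close>, and \<delta> depends on the mesh family only through
  \<theta>, \<open>s\<close> and \<open>S\<close>.\<close>

lemma hmmf_convergence:
  assumes po: "polytopal_open \<Omega>" and R: "R > 0" and \<theta>: "\<theta> > 0" and s: "s > 0" and S: "S > 0"
    and f: "L2_on \<Omega> f" and weak: "weak_solution \<Omega> \<Lambda> f pbar" and \<epsilon>: "\<epsilon> > 0"
  shows "\<exists>\<delta>>0. \<forall>h m MM BH BM W p p' F. hmmf_mesh \<Omega> R \<theta> h m \<Lambda> \<zeta> \<mu> MM BH BM W s S --> h < \<delta> -->
      scheme_solution \<Omega> f m MM p p' F --> L2_dist \<Omega> (pwc m p) pbar < \<epsilon>"
proof -
  let ?M = "leb \<Omega>" and ?d = "real CARD('d)"
  note o = open_domain and b = bounded_domain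
  obtain g where g: "H1_0 \<Omega> pbar g" and wk: "\<And>v h. H1_0 \<Omega> v h ==>
      (LINT x|?M. (\<Lambda> x *v g x) \<bullet> h x) = (LINT x|?M. f x * v x)"
    using weak unfolding weak_solution_def by blast
  have sf: "sq_int ?M f" using f by (simp add: L2_on_iff_sq_int)
  have fi: "integrable ?M f"
  proof -
    have "sq_int ?M (\<lambda>_. 1)" using finite_measure_domain by (simp add: sq_int_def finite_measure.integrable_const)
    then show ?thesis using sq_int_mult[OF sf] by fastforce
  qed
  have gL: "L2_on \<Omega> g" by (rule H1_0_sq_int(2)[OF g])
  have q: "sq_int ?M (\<lambda>x. (\<Lambda> x *v g x) $ i)" for i by (rule L2_on_vec(2)[OF tensor_form(3)[OF gL gL]])
  have weak': "(LINT x|?M. f x * w x) = (\<Sum>i\<in>UNIV. LINT x|?M. (\<Lambda> x *v g x) $ i * pd i w x)"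
    if w: "tfun \<Omega> w" for w
  proof -
    have "(LINT x|?M. f x * w x) = (LINT x|?M. (\<Lambda> x *v g x) \<bullet> grad w x)"
      by (rule wk[symmetric]) (rule H1_0_tfun[OF o b w])
    also have "\<dots> = (LINT x|?M. (\<Sum>i\<in>UNIV. (\<Lambda> x *v g x) $ i * pd i w x))"
      by (simp add: inner_vec_def grad_def)
    also have "\<dots> = (\<Sum>i\<in>UNIV. LINT x|?M. (\<Lambda> x *v g x) $ i * pd i w x)"
      by (rule Bochner_Integration.integral_sum)
         (intro sq_int_mult q tfun_sq_int(1)[OF o b tfun_pd[OF w]])
    finally show ?thesis .
  qed
  define Kp where "Kp = 2 * R * sqrt (?d + 1)"
  have Kp: "Kp > 0" using R by (simp add: Kp_def add_pos_pos)
  \<comment> \<open>The coefficient of the gradient error after multiplying the estimate by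
    \<open>Kp / s\<close>.\<close>
  define Q where "Q = Kp / s * (\<mu> * sqrt ?d)"
  have Q: "Q \<ge> 0" using Kp s mu_pos by (simp add: Q_def)
  define \<eta> where "\<eta> = \<epsilon> * s / (4 * Kp)"
  have \<eta>: "\<eta> > 0" "Kp / s * \<eta> = \<epsilon> / 4" using \<epsilon> s Kp by (auto simp: \<eta>_def)
  define \<eta>2 where "\<eta>2 = \<epsilon> / (4 * (Q + 1))"
  have cancel: "x * (\<epsilon> / (4 * x)) = \<epsilon> / 4" if "x > 0" for x using that by simp
  have \<eta>2: "\<eta>2 > 0" "(Q + 1) * \<eta>2 = \<epsilon> / 4" using \<epsilon> Q cancel[of "Q + 1"] by (simp_all add: \<eta>2_def)
  obtain \<delta>1 where \<delta>1: "\<delta>1 > 0" "\<forall>h m v v'. star_mesh \<Omega> R \<theta> h m --> h \<le> \<delta>1 -->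
      (\<forall>E\<in>all_faces m. E \<subseteq> frontier \<Omega> --> v' E = 0) -->
      conformity_defect \<Omega> m f (\<lambda>x. \<Lambda> x *v g x) v v' \<le> \<eta> * dnorm m v v'"
    using limit_conformity[OF o b po R \<theta> sf q weak' \<eta>(1)] by blast
  obtain \<phi> where \<phi>: "tfun \<Omega> \<phi>" "l2 ?M (\<lambda>x. \<phi> x - pbar x) < \<eta>2" "l2 ?M (\<lambda>x. norm (grad \<phi> x - g x)) < \<eta>2"
    by (rule H1_0_approx[OF o b g \<eta>2(1)])
  obtain C where C: "C11_bound C \<phi> (grad \<phi>)"
    by (rule tfun_C11[OF \<phi>(1)])
  obtain T where T: "compact T" "T \<subseteq> \<Omega>" "\<And>x. x \<notin> T ==> \<phi> x = 0" using tfun_support[OF \<phi>(1)] by blast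
  have "\<exists>r>0. \<forall>x\<in>T. \<forall>y\<in>-\<Omega>. r \<le> dist x y" using T o by (intro separate_compact_closed) auto
  then obtain r where r: "r > 0" "\<And>x y. x \<in> T ==> y \<in> -\<Omega> ==> r \<le> dist x y" by blast
  \<comment> \<open>The value of \<open>stab_const\<close>, which is independent of the
    mesh.\<close>
  define sc where "sc = 2 * \<theta>^2 * ?d + 2 * \<theta> ^ 4 * ?d ^ 3"
  define v where "v = sqrt (vol \<Omega>)"
  \<comment> \<open>The total coefficient of \<open>h\<close> in the final estimate.\<close>
  define Z where "Z = C * (Q * ((?d * \<theta> + 1) * v) + Kp / s * (S * sqrt (sc * vol \<Omega>)) + v)"
  have "sc * vol \<Omega> \<ge> 0" using \<theta> by (simp add: sc_def vol_def)
  then have Z: "Z \<ge> 0" unfolding Z_def v_def using C11_boundD(1)[OF C] Q \<theta> Kp s S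
    by (intro mult_nonneg_nonneg add_nonneg_nonneg) (auto simp: vol_def)
  show ?thesis
  \<comment> \<open>The thresholds stand for limit conformity, for the distance of the support of
    \<phi> to the complement, and for \<open>Z * h \<le> \<epsilon> / 4\<close>. The three quarters
    of \<epsilon> so obtained leave a strict inequality.\<close>
  proof (intro exI[of _ "min \<delta>1 (min r (\<epsilon> / (4 * (Z + 1))))"] conjI allI impI)
    have "\<epsilon> / (4 * (Z + 1)) > 0" using \<epsilon> Z by simp
    then show "min \<delta>1 (min r (\<epsilon> / (4 * (Z + 1)))) > 0" using \<delta>1(1) r(1) by simp
    fix h m MM BH BM W p p' F
    assume hm: "hmmf_mesh \<Omega> R \<theta> h m \<Lambda> \<zeta> \<mu> MM BH BM W s S" and "h < min \<delta>1 (min r (\<epsilon> / (4 * (Z + 1))))"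
      and sol: "scheme_solution \<Omega> f m MM p p' F"
    then have h: "h < \<delta>1" "h < r" "h < \<epsilon> / (4 * (Z + 1))" by auto
    interpret H: hmmf_mesh \<Omega> R \<theta> h m \<Lambda> \<zeta> \<mu> MM BH BM W s S by (rule hm)
    define N where "N = dnorm m (\<lambda>K. p K - \<phi> (point m K)) (\<lambda>E. p' E - \<phi> (barycentre E))"
    have supp: "h < norm (x - y)" if "\<phi> x \<noteq> 0" "y \<notin> \<Omega>" for x y
    proof -
      have "x \<in> T" using T(3) that(1) by blast
      then have "r \<le> norm (x - y)" using r(2) that(2) by (simp add: dist_norm)
      then show ?thesis using h(2) by simp
    qed
    have defect: "conformity_defect \<Omega> m f (\<lambda>x. \<Lambda> x *v g x) v v' \<le> \<eta> * dnorm m v v'"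
      if "\<And>E. E \<in> all_faces m ==> E \<subseteq> frontier \<Omega> ==> v' E = 0" for v v'
      using \<delta>1(2)[rule_format, OF H.star_mesh_axioms less_imp_le[OF h(1)]] that by blast
    note ee = H.error_estimate[OF fi sol gL less_imp_le[OF \<eta>(1)] defect \<phi>(1) C supp less_imp_le[OF \<phi>(3)],
      folded N_def, folded v_def]
    have sc: "H.stab_const = sc" unfolding H.stab_const_def sc_def by simp
    have sN: "s * N \<le> \<eta> + \<mu> * sqrt ?d * ((?d * \<theta> + 1) * (C * h) * v + \<eta>2) + S * (C * h) * sqrt (sc * vol \<Omega>)"
      unfolding sc[symmetric] by (rule ee(1)) blast+
    have ee2: "l2 ?M (\<lambda>x. pwc m p x - \<phi> x) \<le> Kp * N + C * h * v"
      unfolding Kp_def by (rule ee(2)) blast+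
    have "Kp * N = Kp / s * (s * N)" using s by simp
    also have "\<dots> \<le> Kp / s * (\<eta> + \<mu> * sqrt ?d * ((?d * \<theta> + 1) * (C * h) * v + \<eta>2) + S * (C * h) * sqrt (sc * vol \<Omega>))"
      using Kp s by (intro mult_left_mono sN) auto
    also have "\<dots> = Kp / s * \<eta> + Q * \<eta>2 + (Q * ((?d * \<theta> + 1) * v) + Kp / s * (S * sqrt (sc * vol \<Omega>))) * (C * h)"
      unfolding Q_def by (simp only: distrib_left distrib_right mult_ac)
    finally have KN: "Kp * N \<le> \<epsilon> / 4 + Q * \<eta>2 + (Q * ((?d * \<theta> + 1) * v) + Kp / s * (S * sqrt (sc * vol \<Omega>))) * (C * h)"
      unfolding \<eta>(2) .
    have "l2 ?M (\<lambda>x. pwc m p x - pbar x) \<le>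
      l2 ?M (\<lambda>x. pwc m p x - \<phi> x) + l2 ?M (\<lambda>x. \<phi> x - pbar x)"
      by (rule l2_triangle_diff[OF H.pwc_l2(1) tfun_sq_int(1)[OF o b \<phi>(1)] H1_0_sq_int(1)[OF g]])
    also have "\<dots> \<le> Kp * N + C * h * v + \<eta>2" using ee2 \<phi>(2) by linarith
    also have "\<dots> \<le> \<epsilon> / 4 + (Q + 1) * \<eta>2 + Z * h" using KN unfolding Z_def by (simp add: algebra_simps)
    also have "Z * h \<le> \<epsilon> / 4"
    proof -
      have "Z * h \<le> (Z + 1) * (\<epsilon> / (4 * (Z + 1)))" using Z h(3) H.size_nonneg by (intro mult_mono) auto
      also have "\<dots> = \<epsilon> / 4" by (rule cancel) (use Z in simp)
      finally show ?thesis .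
    qed
    finally have "l2 ?M (\<lambda>x. pwc m p x - pbar x) < \<epsilon>" unfolding \<eta>2(2) using \<epsilon> by simp
    then show "L2_dist \<Omega> (pwc m p) pbar < \<epsilon>" unfolding L2_dist_def l2_def .
  qed
qed

end

theorem theorem4p1:
  fixes \<Omega> :: "(real^'d) set"
    and \<Lambda> :: "real^'d \<Rightarrow> real^'d^'d"
    and f pbar :: "real^'d \<Rightarrow> real"
    and \<theta> :: real
    and msh :: "'i \<Rightarrow> (real^'d) mesh"
    and M BH BM :: "'i \<Rightarrow> (real^'d) set \<Rightarrow> (real^'d) set \<Rightarrow> (real^'d) set \<Rightarrow> real"
  assumes "open \<Omega>" and "bounded \<Omega>" and "polytopal_open \<Omega>"
    and "bounded (\<Lambda> ` \<Omega>)"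
    and "\<Lambda> \<in> borel_measurable (lebesgue_on \<Omega>)"
    and "\<And>x. x \<in> \<Omega> \<Longrightarrow> transpose (\<Lambda> x) = \<Lambda> x"
    and "\<exists>\<zeta>>0. AE x in lebesgue_on \<Omega>. \<forall>\<xi>. (\<Lambda> x *v \<xi>) \<bullet> \<xi> \<ge> \<zeta> * (norm \<xi>)\<^sup>2"
    and "L2_on \<Omega> f"
    and "weak_solution \<Omega> \<Lambda> f pbar"
    and "\<theta> > 0"
    and "\<And>i. polytopal_mesh \<Omega> (msh i)"
    and "\<And>i K. K \<in> cells (msh i) \<Longrightarrow> star_shaped K (point (msh i) K)"
    and "\<And>i. regular_mesh \<theta> (msh i)"
    and "\<And>i K. K \<in> cells (msh i) \<Longrightarrow> hmmf_matrices \<Lambda> (msh i) K (M i K) (BH i K) (BM i K)"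
  defines "cond1 \<equiv> \<exists>s>0. \<exists>S>0. \<forall>i. \<forall>K\<in>cells (msh i). \<forall>V.
      s * (\<Sum>\<sigma>\<in>faces (msh i) K. area \<sigma> * dist_face (msh i) K \<sigma> * (V \<sigma>)\<^sup>2)
        \<le> bilin (faces (msh i) K) (M i K) V V \<and>
      bilin (faces (msh i) K) (M i K) V V
        \<le> S * (\<Sum>\<sigma>\<in>faces (msh i) K. area \<sigma> * dist_face (msh i) K \<sigma> * (V \<sigma>)\<^sup>2)"
    and "cond2 \<equiv> \<exists>s>0. \<exists>S>0. \<forall>i. \<forall>K\<in>cells (msh i). \<forall>V.
      s * (\<Sum>\<sigma>\<in>faces (msh i) K. area \<sigma> / dist_face (msh i) K \<sigma> * (L_op (msh i) K V \<sigma>)\<^sup>2)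
        \<le> bilin (faces (msh i) K) (BH i K) (L_op (msh i) K V) (L_op (msh i) K V) \<and>
      bilin (faces (msh i) K) (BH i K) (L_op (msh i) K V) (L_op (msh i) K V)
        \<le> S * (\<Sum>\<sigma>\<in>faces (msh i) K. area \<sigma> / dist_face (msh i) K \<sigma> * (L_op (msh i) K V \<sigma>)\<^sup>2)"
    and "cond3 \<equiv> \<exists>s>0. \<exists>S>0. \<forall>i. \<forall>K\<in>cells (msh i). \<forall>V.
      s * (\<Sum>\<sigma>\<in>faces (msh i) K. area \<sigma> * dist_face (msh i) K \<sigma> * (T_op \<Lambda> (msh i) K V \<sigma>)\<^sup>2)
        \<le> bilin (faces (msh i) K) (BM i K) (T_op \<Lambda> (msh i) K V) (T_op \<Lambda> (msh i) K V) \<and>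
      bilin (faces (msh i) K) (BM i K) (T_op \<Lambda> (msh i) K V) (T_op \<Lambda> (msh i) K V)
        \<le> S * (\<Sum>\<sigma>\<in>faces (msh i) K. area \<sigma> * dist_face (msh i) K \<sigma> * (T_op \<Lambda> (msh i) K V \<sigma>)\<^sup>2)"
  shows "(cond1 \<longleftrightarrow> cond2) \<and> (cond2 \<longleftrightarrow> cond3) \<and>
    (cond1 \<or> cond2 \<or> cond3 \<longrightarrow>
      (\<forall>q. weak_solution \<Omega> \<Lambda> f q \<longrightarrow> (AE x in lebesgue_on \<Omega>. q x = pbar x)) \<and>
      (\<forall>i. \<exists>p p' F. scheme_solution \<Omega> f (msh i) (M i) p p' F) \<and>
      (\<forall>\<epsilon>>0. \<exists>\<delta>>0. \<forall>i p p' F.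
         mesh_size (msh i) < \<delta> \<longrightarrow> scheme_solution \<Omega> f (msh i) (M i) p p' F \<longrightarrow>
         L2_dist \<Omega> (piecewise_constant (msh i) p) pbar < \<epsilon>))"
proof -
  obtain \<zeta> where \<zeta>: "\<zeta> > 0" "AE x in leb \<Omega>. \<forall>\<xi>. (\<Lambda> x *v \<xi>) \<bullet> \<xi> \<ge> \<zeta> * (norm \<xi>)^2"
    using assms(7) by blast
  obtain \<mu> where \<mu>: "\<mu> > 0" "\<And>x. x \<in> \<Omega> ==> norm (\<Lambda> x) \<le> \<mu>"
    using assms(4) unfolding bounded_pos by blast
  obtain R where R: "R > 0" "\<And>x. x \<in> \<Omega> ==> norm x \<le> R" using assms(2) unfolding bounded_pos by blast
  interpret elliptic_tensor \<Omega> \<Lambda> \<zeta> \<mu> by unfold_locales (use assms(1,2,5,6) \<zeta> \<mu> in auto)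
  define P where "P i K = hmmf_cell \<theta> (msh i) K \<Lambda> \<zeta> \<mu> (M i K) (BH i K) (BM i K)" for i K
  have "\<exists>W. P i K W" if K: "K \<in> cells (msh i)" for i K unfolding P_def
  proof (rule hmmf_matrices_cell[OF mesh_elliptic_cell assms(14)[OF K]])
    show "regular_cell \<theta> (msh i) K"
      by (rule mesh_regular_cell[OF assms(11) K assms(2) assms(12)[OF K] assms(13,10)])
    show "K \<subseteq> \<Omega>" "open K" using polytopal_mesh_cell[OF assms(11) K] by auto
  qed
  \<comment> \<open>One inverse matrix is chosen for each cell, so that uniform bounds can refer to
    it.\<close>
  moreover define W where "W i K = (SOME V. P i K V)" for i K
  ultimately have W: "hmmf_cell \<theta> (msh i) K \<Lambda> \<zeta> \<mu> (M i K) (BH i K) (BM i K) (W i K)" if "K \<in> cells (msh i)" for i K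
    using someI_ex[of "P i K"] that unfolding W_def P_def[symmetric] by blast
  have ec: "elliptic_cell \<theta> (msh i) K \<Lambda> \<zeta> \<mu>" if "K \<in> cells (msh i)" for i K
    using W[OF that] by (rule hmmf_cell.axioms(1))
  define unif where "unif B \<longleftrightarrow> (\<exists>s>0. \<exists>S>0. \<forall>i. \<forall>K\<in>cells (msh i). B i K s S)" for B :: "'i => _ => real => real => bool"
  let ?mim = "\<lambda>i K. elliptic_cell.mimetic_bounds (msh i) K (M i K)"
    and ?inv = "\<lambda>i K. elliptic_cell.inverse_bounds (msh i) K (W i K)"
    and ?hyb = "\<lambda>i K. elliptic_cell.hybrid_bounds (msh i) K (BH i K)"
    and ?mix = "\<lambda>i K. elliptic_cell.mixed_bounds (msh i) K \<Lambda> (BM i K)"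
  have c: "cond1 = unif ?mim" "cond2 = unif ?hyb" "cond3 = unif ?mix"
    unfolding cond1_def cond2_def cond3_def unif_def
    by (simp_all add: elliptic_cell.mimetic_bounds_def[OF ec] elliptic_cell.hybrid_bounds_def[OF ec]
        elliptic_cell.mixed_bounds_def[OF ec] cong: ball_cong)
  \<comment> \<open>The new constants are functions \<open>g\<close> and \<open>h\<close> of the old
    ones alone, hence common to all meshes and cells.\<close>
  have unif: "unif B'" if "unif B" and "\<And>i K s S. K \<in> cells (msh i) ==> B i K s S ==> s > 0 ==> S > 0 ==> B' i K (g s S) (h s S)"
    "\<And>s S. s > 0 ==> S > 0 ==> g s S > 0 \<and> h s S > 0" for B B' g h
    using that unfolding unif_def by metis
  have pos: "2 / s + 2 * x > 0" if "s > 0" "x \<ge> 0" for s x :: real using that by (simp add: add_pos_nonneg)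
  have im: "unif ?mim" if "unif ?inv" by (rule unif[OF that], rule hmmf_cell.inverse_imp_mimetic[OF W], assumption+) auto
  have mi: "unif ?inv" if "unif ?mim" by (rule unif[OF that], rule hmmf_cell.mimetic_imp_inverse[OF W], assumption+) auto
  have ih: "unif ?hyb" if "unif ?inv" by (rule unif[OF that], rule hmmf_cell.inverse_imp_hybrid[OF W], assumption+) auto
  have hi: "unif ?inv" if "unif ?hyb"
    by (rule unif[OF that], rule hmmf_cell.hybrid_imp_inverse[OF W], assumption+)
       (use \<zeta>(1) \<mu>(1) assms(10) in \<open>auto intro!: pos divide_pos_pos add_pos_nonneg\<close>)
  have mx: "unif ?mix" if "unif ?mim" by (rule unif[OF that], rule hmmf_cell.mimetic_imp_mixed[OF W], assumption+) auto
  have xm: "unif ?mim" if "unif ?mix"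
    by (rule unif[OF that], rule hmmf_cell.mixed_imp_mimetic[OF W], assumption+)
       (use \<zeta>(1) \<mu>(1) assms(10) in \<open>auto intro!: pos divide_pos_pos add_nonneg_pos mult_pos_pos add_pos_nonneg\<close>)
  \<comment> \<open>Inserting zero gives a meaningful nonnegative bound also when there are no
    cells; it stays below \<delta> whenever \<open>mesh_size\<close> does.\<close>
  have hm: "hmmf_mesh \<Omega> R \<theta> h (msh i) \<Lambda> \<zeta> \<mu> (M i) (BH i) (BM i) (W i) s S"
    if "\<And>i K. K \<in> cells (msh i) ==> ?inv i K s S" "s > 0" "S > 0" and h: "h = Max (insert 0 (diameter ` cells (msh i)))" for s S i h
  proof -
    have fin: "finite (cells (msh i))" using assms(11)[of i] unfolding polytopal_mesh_def by blast
    have "star_mesh \<Omega> R \<theta> h (msh i)"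
      using assms(1,10-13) R fin unfolding h by unfold_locales auto
    then show ?thesis
      using that(1-3) W elliptic_tensor_axioms
      by (intro hmmf_mesh.intro hmmf_mesh_axioms.intro) auto
  qed
  have conv: "(\<forall>i. \<exists>p p' F. scheme_solution \<Omega> f (msh i) (M i) p p' F) \<and>
      (\<forall>\<epsilon>>0. \<exists>\<delta>>0. \<forall>i p p' F.
         mesh_size (msh i) < \<delta> --> scheme_solution \<Omega> f (msh i) (M i) p p' F -->
         L2_dist \<Omega> (pwc (msh i) p) pbar < \<epsilon>)"
    if inv: "\<And>i K. K \<in> cells (msh i) ==> ?inv i K s S" "s > 0" "S > 0" for s S
  proof (intro conjI allI impI)
    show "\<exists>p p' F. scheme_solution \<Omega> f (msh i) (M i) p p' F" for i
      by (rule hmmf_mesh.scheme_solution_exists[OF hm[OF inv refl]])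
    fix \<epsilon> :: real assume "\<epsilon> > 0"
    obtain \<delta> where \<delta>: "\<delta> > 0" "\<forall>h m MM BH BM W p p' F. hmmf_mesh \<Omega> R \<theta> h m \<Lambda> \<zeta> \<mu> MM BH BM W s S --> h < \<delta> -->
        scheme_solution \<Omega> f m MM p p' F --> L2_dist \<Omega> (pwc m p) pbar < \<epsilon>"
      using hmmf_convergence[OF assms(3) R(1) assms(10) inv(2,3) assms(8,9) \<open>\<epsilon> > 0\<close>] by blast
    have "Max (insert 0 (diameter ` cells (msh i))) < \<delta>" if "mesh_size (msh i) < \<delta>" for i
    proof -
      have fin: "finite (cells (msh i))" using assms(11)[of i] unfolding polytopal_mesh_def by blast
      have "diameter K < \<delta>" if "K \<in> cells (msh i)" for K
      proof -
        have "diameter K \<le> mesh_size (msh i)" unfolding mesh_size_def by (rule Max_ge) (use fin that in auto)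
        then show ?thesis using \<open>mesh_size (msh i) < \<delta>\<close> by simp
      qed
      then show ?thesis using fin \<delta>(1) by simp
    qed
    then show "\<exists>\<delta>>0. \<forall>i p p' F. mesh_size (msh i) < \<delta> --> scheme_solution \<Omega> f (msh i) (M i) p p' F -->
         L2_dist \<Omega> (pwc (msh i) p) pbar < \<epsilon>"
      using \<delta> hm[OF inv refl] by blast
  qed
  \<comment> \<open>Each condition leads to the bounds for the inverse matrix, the form in which
    convergence and solvability were proved.\<close>
  have "cond1 \<or> cond2 \<or> cond3 --> unif ?inv" unfolding c using mi hi xm by blast
  moreover have "\<forall>q. weak_solution \<Omega> \<Lambda> f q --> (AE x in leb \<Omega>. q x = pbar x)"
    using weak_solution_unique[OF assms(9)] by blast
  moreover have "(cond1 \<longleftrightarrow> cond2) \<and> (cond2 \<longleftrightarrow> cond3)" unfolding c using im mi ih hi mx xm by blast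
  ultimately show ?thesis using conv unfolding unif_def by blast
qed

end
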